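(* Let $G$ be a finitely generated virtually free group. Let $n$ be a product of a finite set of different primes and $k=\mathbb{Z}/n\mathbb{Z}$. Then the left $k[G]$-module $k[[\widehat{G}]]$ is isomorphic to a direct union of projective $k[G]$-modules.
   Context: $\widehat{G}$ is the profinite completion of $G$, and $k[[\widehat{G}]]=\varprojlim_N k[G/N]$ is the completed group ring, where $N$ ranges over the normal subgroups of finite index in $G$; it is a left $k[G]$-module via the natural map $k[G]\to k[[\widehat{G}]]$. Modules are left modules. A direct union of modules is the union of a family of submodules that is directed with respect to inclusion. *)

theory Defs
  imports "HOL-Algebra.Generated_Groups" "HOL-Algebra.IntRing" "HOL-Algebra.Module"
begin

section \<open>Left modules\<close>

text \<open>
  The library locale \<^locale>\<open>module\<close> requires a commutative ring of scalars; group rings are not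
  commutative in general.  The library's \<^locale>\<open>submodule\<close> has no such restriction and is
  used below.  As in the library, the multiplication and unit that a \<^typ>\<open>('r, 'm) module\<close> record
  inherits from the ring record play no role for modules.
\<close>

locale left_module = R?: ring R + M?: abelian_group M
  for R :: "('r, 'a) ring_scheme" (structure) and M :: "('r, 'm, 'b) module_scheme" (structure) +
  assumes smult_closed [simp, intro]:
      "\<lbrakk>a \<in> carrier R; x \<in> carrier M\<rbrakk> \<Longrightarrow> a \<odot>\<^bsub>M\<^esub> x \<in> carrier M"
    and smult_l_distr:
      "\<lbrakk>a \<in> carrier R; b \<in> carrier R; x \<in> carrier M\<rbrakk> \<Longrightarrow>
        (a \<oplus> b) \<odot>\<^bsub>M\<^esub> x = a \<odot>\<^bsub>M\<^esub> x \<oplus>\<^bsub>M\<^esub> b \<odot>\<^bsub>M\<^esub> x"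
    and smult_r_distr:
      "\<lbrakk>a \<in> carrier R; x \<in> carrier M; y \<in> carrier M\<rbrakk> \<Longrightarrow>
        a \<odot>\<^bsub>M\<^esub> (x \<oplus>\<^bsub>M\<^esub> y) = a \<odot>\<^bsub>M\<^esub> x \<oplus>\<^bsub>M\<^esub> a \<odot>\<^bsub>M\<^esub> y"
    and smult_assoc1:
      "\<lbrakk>a \<in> carrier R; b \<in> carrier R; x \<in> carrier M\<rbrakk> \<Longrightarrow>
        (a \<otimes> b) \<odot>\<^bsub>M\<^esub> x = a \<odot>\<^bsub>M\<^esub> (b \<odot>\<^bsub>M\<^esub> x)"
    and smult_one [simp]:
      "x \<in> carrier M \<Longrightarrow> \<one> \<odot>\<^bsub>M\<^esub> x = x"

definition left_module_hom ::
  "('r, 'a) ring_scheme \<Rightarrow> ('r, 'm, 'b) module_scheme \<Rightarrow> ('r, 'n, 'c) module_scheme \<Rightarrow> ('m \<Rightarrow> 'n) set"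
  where "left_module_hom R M N =
    {h \<in> carrier M \<rightarrow> carrier N.
       (\<forall>x\<in>carrier M. \<forall>y\<in>carrier M. h (x \<oplus>\<^bsub>M\<^esub> y) = h x \<oplus>\<^bsub>N\<^esub> h y) \<and>
       (\<forall>a\<in>carrier R. \<forall>x\<in>carrier M. h (a \<odot>\<^bsub>M\<^esub> x) = a \<odot>\<^bsub>N\<^esub> h x)}"

definition left_module_isomorphic ::
  "('r, 'a) ring_scheme \<Rightarrow> ('r, 'm, 'b) module_scheme \<Rightarrow> ('r, 'n, 'c) module_scheme \<Rightarrow> bool"
  where "left_module_isomorphic R M N \<longleftrightarrow>
    (\<exists>h \<in> left_module_hom R M N. bij_betw h (carrier M) (carrier N))"

text \<open>
  Projectivity is the lifting property along surjections \<open>f : M \<rightarrow> N\<close>.  A HOL definition cannot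
  quantify over all carrier types, so the test modules are taken on two types determined by
  the type \<^typ>\<open>'m\<close> of the elements of \<open>P\<close>, namely \<^typ>\<open>'m \<Rightarrow> 'r\<close> for \<open>M\<close> and \<^typ>\<open>'m\<close> for \<open>N\<close>.
  This is no restriction: these types accommodate the canonical surjection onto \<open>P\<close> from the
  free module on the set of elements of \<open>P\<close>, and by lemma \<open>projective_lifting\<close> below the lifting
  property then holds for surjections between modules on arbitrary types.
\<close>

definition projective_left_module ::
  "('r, 'a) ring_scheme \<Rightarrow> ('r, 'm, 'b) module_scheme \<Rightarrow> bool"
  where "projective_left_module R P \<longleftrightarrow> left_module R P \<and>
    (\<forall>(M :: ('r, 'm \<Rightarrow> 'r) module) (N :: ('r, 'm) module) f g.
       left_module R M \<and> left_module R N \<and>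
       f \<in> left_module_hom R M N \<and> f ` carrier M = carrier N \<and> g \<in> left_module_hom R P N \<longrightarrow>
       (\<exists>h \<in> left_module_hom R P M. \<forall>x\<in>carrier P. f (h x) = g x))"

text \<open>\<open>M\<close> is the direct union of the family \<open>\<F>\<close> of its submodules, given by their carriers.\<close>

definition direct_union_of_submodules ::
  "('r, 'a) ring_scheme \<Rightarrow> ('r, 'm, 'b) module_scheme \<Rightarrow> 'm set set \<Rightarrow> bool"
  where "direct_union_of_submodules R M \<F> \<longleftrightarrow>
    (\<forall>H\<in>\<F>. submodule H R M) \<and>
    \<F> \<noteq> {} \<and> (\<forall>H\<in>\<F>. \<forall>H'\<in>\<F>. \<exists>K\<in>\<F>. H \<subseteq> K \<and> H' \<subseteq> K) \<and>
    carrier M = \<Union>\<F>"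

text \<open>The ring \<open>S\<close> as a left module over the source of a ring homomorphism \<open>\<phi>\<close> into \<open>S\<close>.\<close>

definition left_module_via :: "('r \<Rightarrow> 's) \<Rightarrow> ('s, 'a) ring_scheme \<Rightarrow> ('r, 's) module"
  where "left_module_via \<phi> S =
    \<lparr>carrier = carrier S, monoid.mult = monoid.mult S, one = \<one>\<^bsub>S\<^esub>,
     zero = \<zero>\<^bsub>S\<^esub>, add = add S, smult = (\<lambda>a x. \<phi> a \<otimes>\<^bsub>S\<^esub> x)\<rparr>"


section \<open>Finitely supported functions\<close>

definition supp_on :: "('r, 'a) ring_scheme \<Rightarrow> 'x set \<Rightarrow> ('x \<Rightarrow> 'r) \<Rightarrow> 'x set"
  where "supp_on R X f = {x \<in> X. f x \<noteq> \<zero>\<^bsub>R\<^esub>}"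

definition fin_supp_funs :: "('r, 'a) ring_scheme \<Rightarrow> 'x set \<Rightarrow> ('x \<Rightarrow> 'r) set"
  where "fin_supp_funs R X = {f \<in> X \<rightarrow>\<^sub>E carrier R. finite (supp_on R X f)}"


section \<open>Independence of projectivity from the test types\<close>

definition free_left_module :: "('r, 'a) ring_scheme \<Rightarrow> 'x set \<Rightarrow> ('r, 'x \<Rightarrow> 'r) module"
  where "free_left_module R X =
    \<lparr>carrier = fin_supp_funs R X, monoid.mult = undefined, one = undefined,
     zero = (\<lambda>x\<in>X. \<zero>\<^bsub>R\<^esub>), add = (\<lambda>f g. \<lambda>x\<in>X. f x \<oplus>\<^bsub>R\<^esub> g x),
     smult = (\<lambda>a f. \<lambda>x\<in>X. a \<otimes>\<^bsub>R\<^esub> f x)\<rparr>"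

definition lin_comb ::
  "('r, 'a) ring_scheme \<Rightarrow> ('r, 'm, 'b) module_scheme \<Rightarrow> 'x set \<Rightarrow> ('x \<Rightarrow> 'm) \<Rightarrow> ('x \<Rightarrow> 'r) \<Rightarrow> 'm"
  where "lin_comb R M X v f = (\<Oplus>\<^bsub>M\<^esub>x\<in>supp_on R X f. f x \<odot>\<^bsub>M\<^esub> v x)"

lemma fin_supp_funs_add:
  assumes "ring R" "f \<in> fin_supp_funs R X" "g \<in> fin_supp_funs R X"
  shows "(\<lambda>x\<in>X. f x \<oplus>\<^bsub>R\<^esub> g x) \<in> fin_supp_funs R X"
proof -
  interpret ring R by fact
  have "supp_on R X (\<lambda>x\<in>X. f x \<oplus>\<^bsub>R\<^esub> g x) \<subseteq> supp_on R X f \<union> supp_on R X g"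
    by (auto simp: supp_on_def)
  then show ?thesis
    using assms by (auto simp: fin_supp_funs_def PiE_def Pi_def intro: finite_subset)
qed

lemma fin_supp_funs_smult:
  assumes "ring R" "a \<in> carrier R" "f \<in> fin_supp_funs R X"
  shows "(\<lambda>x\<in>X. a \<otimes>\<^bsub>R\<^esub> f x) \<in> fin_supp_funs R X"
proof -
  interpret ring R by fact
  have "supp_on R X (\<lambda>x\<in>X. a \<otimes>\<^bsub>R\<^esub> f x) \<subseteq> supp_on R X f"
    using assms(2) by (auto simp: supp_on_def)
  then show ?thesis
    using assms by (auto simp: fin_supp_funs_def PiE_def Pi_def intro: finite_subset)
qed

lemma fin_supp_funs_zero:
  assumes "ring R"
  shows "(\<lambda>x\<in>X. \<zero>\<^bsub>R\<^esub>) \<in> fin_supp_funs R X"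
proof -
  interpret ring R by fact
  have "supp_on R X (\<lambda>x\<in>X. \<zero>\<^bsub>R\<^esub>) = {}"
    by (auto simp: supp_on_def)
  then show ?thesis
    by (simp add: fin_supp_funs_def)
qed

lemma fin_supp_funsD:
  assumes "f \<in> fin_supp_funs R X"
  shows "x \<in> X \<Longrightarrow> f x \<in> carrier R" "f \<in> extensional X" "finite (supp_on R X f)"
  using assms by (auto simp: fin_supp_funs_def PiE_iff)

lemma fin_supp_funs_abelian_group:
  assumes "ring R" and "carrier A = fin_supp_funs R X" and "zero A = (\<lambda>x\<in>X. \<zero>\<^bsub>R\<^esub>)"
    and "add A = (\<lambda>f g. \<lambda>x\<in>X. f x \<oplus>\<^bsub>R\<^esub> g x)"
  shows "abelian_group A"
proof -
  interpret ring R by fact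
  show ?thesis
  proof (rule abelian_groupI, unfold assms)
    fix f assume f: "f \<in> fin_supp_funs R X"
    have 1: "(\<lambda>x\<in>X. \<ominus>\<^bsub>R\<^esub> \<one>\<^bsub>R\<^esub> \<otimes>\<^bsub>R\<^esub> f x) \<in> fin_supp_funs R X"
      using fin_supp_funs_smult[OF assms(1) _ f] by simp
    have 2: "(\<lambda>x\<in>X. (\<lambda>x\<in>X. \<ominus>\<^bsub>R\<^esub> \<one>\<^bsub>R\<^esub> \<otimes>\<^bsub>R\<^esub> f x) x \<oplus>\<^bsub>R\<^esub> f x) = (\<lambda>x\<in>X. \<zero>\<^bsub>R\<^esub>)"
      using fin_supp_funsD(1)[OF f] by (auto simp: l_minus l_neg intro!: restrict_ext)
    show "\<exists>g\<in>fin_supp_funs R X. (\<lambda>x\<in>X. g x \<oplus>\<^bsub>R\<^esub> f x) = (\<lambda>x\<in>X. \<zero>\<^bsub>R\<^esub>)"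
      using 1 2 by blast
    show "(\<lambda>x\<in>X. (\<lambda>x\<in>X. \<zero>\<^bsub>R\<^esub>) x \<oplus>\<^bsub>R\<^esub> f x) = f"
      using fin_supp_funsD(1)[OF f] fin_supp_funsD(2)[OF f]
      by (auto simp: fun_eq_iff extensional_def restrict_def)
    fix g assume g: "g \<in> fin_supp_funs R X"
    show "(\<lambda>x\<in>X. f x \<oplus>\<^bsub>R\<^esub> g x) \<in> fin_supp_funs R X"
      by (rule fin_supp_funs_add[OF assms(1) f g])
    show "(\<lambda>x\<in>X. f x \<oplus>\<^bsub>R\<^esub> g x) = (\<lambda>x\<in>X. g x \<oplus>\<^bsub>R\<^esub> f x)"
      using fin_supp_funsD(1)[OF f] fin_supp_funsD(1)[OF g] by (intro restrict_ext) (simp add: a_comm)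
    fix h assume h: "h \<in> fin_supp_funs R X"
    show "(\<lambda>x\<in>X. (\<lambda>x\<in>X. f x \<oplus>\<^bsub>R\<^esub> g x) x \<oplus>\<^bsub>R\<^esub> h x) = (\<lambda>x\<in>X. f x \<oplus>\<^bsub>R\<^esub> (\<lambda>x\<in>X. g x \<oplus>\<^bsub>R\<^esub> h x) x)"
      using fin_supp_funsD(1)[OF f] fin_supp_funsD(1)[OF g] fin_supp_funsD(1)[OF h]
      by (intro restrict_ext) (simp add: a_assoc)
  qed (rule fin_supp_funs_zero[OF assms(1)])
qed

lemma free_left_module_is_left_module:
  assumes "ring R"
  shows "left_module R (free_left_module R X)"
proof -
  interpret ring R by fact
  interpret F: abelian_group "free_left_module R X"
    by (rule fin_supp_funs_abelian_group[OF assms]) (simp_all add: free_left_module_def)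
  have F: "carrier (free_left_module R X) = fin_supp_funs R X"
    "\<And>f g. f \<oplus>\<^bsub>free_left_module R X\<^esub> g = (\<lambda>x\<in>X. f x \<oplus>\<^bsub>R\<^esub> g x)"
    "\<And>a f. a \<odot>\<^bsub>free_left_module R X\<^esub> f = (\<lambda>x\<in>X. a \<otimes>\<^bsub>R\<^esub> f x)"
    by (simp_all add: free_left_module_def)
  show ?thesis
  proof (intro left_module.intro left_module_axioms.intro assms F.abelian_group_axioms, unfold F)
    fix f assume f: "f \<in> fin_supp_funs R X"
    note fc = fin_supp_funsD(1)[OF f]
    show "(\<lambda>x\<in>X. \<one>\<^bsub>R\<^esub> \<otimes>\<^bsub>R\<^esub> f x) = f"
      using fc fin_supp_funsD(2)[OF f] by (intro extensionalityI[of _ X]) auto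
    fix a assume a: "a \<in> carrier R"
    show "(\<lambda>x\<in>X. a \<otimes>\<^bsub>R\<^esub> f x) \<in> fin_supp_funs R X"
      by (rule fin_supp_funs_smult[OF assms a f])
    show "(\<lambda>x\<in>X. a \<otimes>\<^bsub>R\<^esub> (\<lambda>x\<in>X. f x \<oplus>\<^bsub>R\<^esub> g x) x) =
        (\<lambda>x\<in>X. (\<lambda>x\<in>X. a \<otimes>\<^bsub>R\<^esub> f x) x \<oplus>\<^bsub>R\<^esub> (\<lambda>x\<in>X. a \<otimes>\<^bsub>R\<^esub> g x) x)"
      if "g \<in> fin_supp_funs R X" for g
      using a fc fin_supp_funsD(1)[OF that] by (intro restrict_ext) (simp add: r_distr)
    fix b assume b: "b \<in> carrier R"
    show "(\<lambda>x\<in>X. (a \<oplus>\<^bsub>R\<^esub> b) \<otimes>\<^bsub>R\<^esub> f x) =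
        (\<lambda>x\<in>X. (\<lambda>x\<in>X. a \<otimes>\<^bsub>R\<^esub> f x) x \<oplus>\<^bsub>R\<^esub> (\<lambda>x\<in>X. b \<otimes>\<^bsub>R\<^esub> f x) x)"
      using a b fc by (intro restrict_ext) (simp add: l_distr)
    show "(\<lambda>x\<in>X. (a \<otimes>\<^bsub>R\<^esub> b) \<otimes>\<^bsub>R\<^esub> f x) = (\<lambda>x\<in>X. a \<otimes>\<^bsub>R\<^esub> (\<lambda>x\<in>X. b \<otimes>\<^bsub>R\<^esub> f x) x)"
      using a b fc by (intro restrict_ext) (simp add: m_assoc)
  qed
qed

context left_module
begin

lemma smult_l_null: "x \<in> carrier M \<Longrightarrow> \<zero> \<odot>\<^bsub>M\<^esub> x = \<zero>\<^bsub>M\<^esub>"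
  using smult_l_distr[of \<zero> \<zero> x] by simp

lemma smult_r_null: "a \<in> carrier R \<Longrightarrow> a \<odot>\<^bsub>M\<^esub> \<zero>\<^bsub>M\<^esub> = \<zero>\<^bsub>M\<^esub>"
  using smult_r_distr[of a "\<zero>\<^bsub>M\<^esub>" "\<zero>\<^bsub>M\<^esub>"] by simp

lemma finsum_smult:
  assumes "finite A" "a \<in> carrier R" "f \<in> A \<rightarrow> carrier M"
  shows "a \<odot>\<^bsub>M\<^esub> (\<Oplus>\<^bsub>M\<^esub>i\<in>A. f i) = (\<Oplus>\<^bsub>M\<^esub>i\<in>A. a \<odot>\<^bsub>M\<^esub> f i)"
  using assms(1,3)
proof induction
  case empty
  then show ?case using assms(2) by (simp add: smult_r_null)
next
  case (insert i A)
  then have "f \<in> A \<rightarrow> carrier M" "f i \<in> carrier M" by auto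
  moreover from this have "(\<lambda>i. a \<odot>\<^bsub>M\<^esub> f i) \<in> A \<rightarrow> carrier M" using assms(2) by auto
  ultimately show ?case
    using insert assms(2) by (simp add: smult_r_distr)
qed

lemma lin_comb_superset:
  assumes "f \<in> fin_supp_funs R X" "v \<in> X \<rightarrow> carrier M"
    and "finite Y" "supp_on R X f \<subseteq> Y" "Y \<subseteq> X"
  shows "lin_comb R M X v f = (\<Oplus>\<^bsub>M\<^esub>x\<in>Y. f x \<odot>\<^bsub>M\<^esub> v x)"
  unfolding lin_comb_def
proof (rule M.add.finprod_mono_neutral_cong_left[OF assms(3,4)])
  show "f i \<odot>\<^bsub>M\<^esub> v i = \<zero>\<^bsub>M\<^esub>" if "i \<in> Y - supp_on R X f" for i
    using that assms by (auto simp: supp_on_def Pi_def intro!: smult_l_null)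
  show "(\<lambda>x. f x \<odot>\<^bsub>M\<^esub> v x) \<in> Y \<rightarrow> carrier M"
    using assms fin_supp_funsD(1)[OF assms(1)] by (auto simp: Pi_def)
qed simp

lemma lin_comb_hom:
  assumes v: "v \<in> X \<rightarrow> carrier M"
  shows "lin_comb R M X v \<in> left_module_hom R (free_left_module R X) M"
proof -
  have ring: "ring R" by (rule R.ring_axioms)
  have cl: "(\<lambda>x. f x \<odot>\<^bsub>M\<^esub> v x) \<in> Y \<rightarrow> carrier M"
    if "f \<in> fin_supp_funs R X" "Y \<subseteq> X" for f Y
    using that v fin_supp_funsD(1)[OF that(1)] by (auto simp: Pi_def)
  have sub: "supp_on R X f \<subseteq> X" for f :: "_ \<Rightarrow> 'r"
    by (auto simp: supp_on_def)
  have 1: "lin_comb R M X v f \<in> carrier M" if "f \<in> fin_supp_funs R X" for f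
    unfolding lin_comb_def using cl[OF that sub] by (rule M.finsum_closed)
  have 2: "lin_comb R M X v (\<lambda>x\<in>X. f x \<oplus> g x) = lin_comb R M X v f \<oplus>\<^bsub>M\<^esub> lin_comb R M X v g"
    if f: "f \<in> fin_supp_funs R X" and g: "g \<in> fin_supp_funs R X" for f g
  proof -
    define Y where "Y = supp_on R X f \<union> supp_on R X g"
    have Y: "finite Y" "Y \<subseteq> X"
      using f g by (auto simp: Y_def fin_supp_funs_def supp_on_def)
    have s: "supp_on R X (\<lambda>x\<in>X. f x \<oplus> g x) \<subseteq> Y"
      using fin_supp_funsD(1)[OF f] fin_supp_funsD(1)[OF g] by (auto simp: Y_def supp_on_def)
    have "lin_comb R M X v (\<lambda>x\<in>X. f x \<oplus> g x) =
        (\<Oplus>\<^bsub>M\<^esub>x\<in>Y. (\<lambda>x\<in>X. f x \<oplus> g x) x \<odot>\<^bsub>M\<^esub> v x)"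
      by (rule lin_comb_superset[OF fin_supp_funs_add[OF ring f g] v Y(1) s Y(2)])
    also have "\<dots> = (\<Oplus>\<^bsub>M\<^esub>x\<in>Y. f x \<odot>\<^bsub>M\<^esub> v x \<oplus>\<^bsub>M\<^esub> g x \<odot>\<^bsub>M\<^esub> v x)"
      using Y v fin_supp_funsD(1)[OF f] fin_supp_funsD(1)[OF g]
      by (intro M.finsum_cong') (auto simp: smult_l_distr Pi_def subset_iff)
    also have "\<dots> = (\<Oplus>\<^bsub>M\<^esub>x\<in>Y. f x \<odot>\<^bsub>M\<^esub> v x) \<oplus>\<^bsub>M\<^esub> (\<Oplus>\<^bsub>M\<^esub>x\<in>Y. g x \<odot>\<^bsub>M\<^esub> v x)"
      by (rule M.finsum_addf[OF cl[OF f Y(2)] cl[OF g Y(2)]])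
    also have "\<dots> = lin_comb R M X v f \<oplus>\<^bsub>M\<^esub> lin_comb R M X v g"
      using lin_comb_superset[OF f v Y(1) _ Y(2)] lin_comb_superset[OF g v Y(1) _ Y(2)]
      by (simp add: Y_def)
    finally show ?thesis .
  qed
  have 3: "lin_comb R M X v (\<lambda>x\<in>X. a \<otimes> f x) = a \<odot>\<^bsub>M\<^esub> lin_comb R M X v f"
    if f: "f \<in> fin_supp_funs R X" and a: "a \<in> carrier R" for f a
  proof -
    define Y where "Y = supp_on R X f"
    have Y: "finite Y" "Y \<subseteq> X"
      using f by (auto simp: Y_def fin_supp_funs_def supp_on_def)
    have s: "supp_on R X (\<lambda>x\<in>X. a \<otimes> f x) \<subseteq> Y"
      using a by (auto simp: Y_def supp_on_def)
    have "lin_comb R M X v (\<lambda>x\<in>X. a \<otimes> f x) = (\<Oplus>\<^bsub>M\<^esub>x\<in>Y. (\<lambda>x\<in>X. a \<otimes> f x) x \<odot>\<^bsub>M\<^esub> v x)"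
      by (rule lin_comb_superset[OF fin_supp_funs_smult[OF ring a f] v Y(1) s Y(2)])
    also have "\<dots> = (\<Oplus>\<^bsub>M\<^esub>x\<in>Y. a \<odot>\<^bsub>M\<^esub> (f x \<odot>\<^bsub>M\<^esub> v x))"
      using Y v a fin_supp_funsD(1)[OF f]
      by (intro M.finsum_cong') (auto simp: smult_assoc1 Pi_def subset_iff)
    also have "\<dots> = a \<odot>\<^bsub>M\<^esub> lin_comb R M X v f"
      unfolding lin_comb_def Y_def[symmetric] by (rule finsum_smult[OF Y(1) a cl[OF f Y(2)], symmetric])
    finally show ?thesis .
  qed
  show ?thesis
    using 1 2 3 by (simp add: left_module_hom_def free_left_module_def)
qed

lemma hom_zero:
  assumes N: "left_module R N" and h: "h \<in> left_module_hom R M N"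
  shows "h \<zero>\<^bsub>M\<^esub> = \<zero>\<^bsub>N\<^esub>"
proof -
  interpret N: left_module R N by fact
  have "h \<zero>\<^bsub>M\<^esub> \<in> carrier N"
    using h by (auto simp: left_module_hom_def)
  moreover have "h (\<zero>\<^bsub>M\<^esub> \<oplus>\<^bsub>M\<^esub> \<zero>\<^bsub>M\<^esub>) = h \<zero>\<^bsub>M\<^esub> \<oplus>\<^bsub>N\<^esub> h \<zero>\<^bsub>M\<^esub>"
    using h unfolding left_module_hom_def by blast
  ultimately show ?thesis by simp
qed

lemma hom_finsum:
  assumes N: "left_module R N" and h: "h \<in> left_module_hom R M N"
    and "finite A" "f \<in> A \<rightarrow> carrier M"
  shows "h (\<Oplus>\<^bsub>M\<^esub>i\<in>A. f i) = (\<Oplus>\<^bsub>N\<^esub>i\<in>A. h (f i))"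
  using assms(3,4)
proof induction
  case empty
  interpret N: left_module R N by fact
  show ?case by (simp add: hom_zero[OF N h])
next
  case (insert i A)
  interpret N: left_module R N by fact
  have f: "f \<in> A \<rightarrow> carrier M" "f i \<in> carrier M" using insert by auto
  then have hf: "(\<lambda>i. h (f i)) \<in> A \<rightarrow> carrier N" "h (f i) \<in> carrier N"
    using h by (auto simp: left_module_hom_def)
  have "h (f i \<oplus>\<^bsub>M\<^esub> (\<Oplus>\<^bsub>M\<^esub>i\<in>A. f i)) = h (f i) \<oplus>\<^bsub>N\<^esub> h (\<Oplus>\<^bsub>M\<^esub>i\<in>A. f i)"
    using h f by (simp add: left_module_hom_def)
  then show ?case
    using insert f hf by simp
qed

lemma hom_lin_comb:
  assumes N: "left_module R N" and h: "h \<in> left_module_hom R M N"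
    and v: "v \<in> X \<rightarrow> carrier M" and f: "f \<in> fin_supp_funs R X"
  shows "h (lin_comb R M X v f) = lin_comb R N X (\<lambda>x. h (v x)) f"
proof -
  interpret N: left_module R N by fact
  have c: "f x \<in> carrier R" "v x \<in> carrier M" "h (v x) \<in> carrier N" if "x \<in> supp_on R X f" for x
    using that v fin_supp_funsD(1)[OF f] h by (auto simp: supp_on_def left_module_hom_def Pi_def)
  have "h (lin_comb R M X v f) = (\<Oplus>\<^bsub>N\<^esub>x\<in>supp_on R X f. h (f x \<odot>\<^bsub>M\<^esub> v x))"
    unfolding lin_comb_def using c by (intro hom_finsum[OF N h fin_supp_funsD(3)[OF f]]) auto
  also have "\<dots> = lin_comb R N X (\<lambda>x. h (v x)) f"
    unfolding lin_comb_def using c h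
    by (intro N.M.finsum_cong') (auto simp: left_module_hom_def)
  finally show ?thesis .
qed

end

lemma left_module_hom_comp:
  assumes "f \<in> left_module_hom R M N" "g \<in> left_module_hom R N L"
  shows "(\<lambda>x. g (f x)) \<in> left_module_hom R M L"
  using assms by (simp add: left_module_hom_def Pi_iff)

text \<open>The lifting property of \<^const>\<open>projective_left_module\<close> along arbitrary surjections.\<close>

theorem projective_lifting:
  fixes P :: "('r, 'p, 'b) module_scheme"
    and M :: "('r, 'm, 'c) module_scheme" and N :: "('r, 'n, 'd) module_scheme"
  assumes P: "projective_left_module R P" and M: "left_module R M" and N: "left_module R N"
    and f: "f \<in> left_module_hom R M N" "f ` carrier M = carrier N"
    and g: "g \<in> left_module_hom R P N"
  shows "\<exists>h \<in> left_module_hom R P M. \<forall>x\<in>carrier P. f (h x) = g x"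
proof -
  interpret P: left_module R P using P by (simp add: projective_left_module_def)
  interpret M: left_module R M by fact
  interpret N: left_module R N by fact
  let ?X = "carrier P"
  let ?F = "free_left_module R ?X"
  define Q :: "('r, 'p) module" where "Q = \<lparr>carrier = carrier P, monoid.mult = monoid.mult P,
    one = one P, zero = zero P, add = add P, smult = smult P\<rparr>"
  have fs: "carrier ?F = fin_supp_funs R ?X" by (simp add: free_left_module_def)
  have Qs: "carrier Q = carrier P" "add Q = add P" "zero Q = zero P" "smult Q = smult P"
    by (simp_all add: Q_def)
  have "abelian_group Q"
  proof (rule abelian_groupI, unfold Qs)
    show "\<exists>y\<in>carrier P. y \<oplus>\<^bsub>P\<^esub> x = \<zero>\<^bsub>P\<^esub>" if "x \<in> carrier P" for x
      using P.M.l_neg[OF that] P.M.a_inv_closed[OF that] by blast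
  qed (simp_all add: P.M.a_ac)
  then have Q: "left_module R Q"
    by (intro left_module.intro P.R.ring_axioms left_module_axioms.intro)
      (auto simp: Qs P.smult_l_distr P.smult_r_distr P.smult_assoc1)
  have F: "left_module R ?F" by (rule free_left_module_is_left_module[OF P.R.ring_axioms])
  let ?\<pi> = "lin_comb R P ?X (\<lambda>x. x)"
  have \<pi>P: "?\<pi> \<in> left_module_hom R ?F P" by (rule P.lin_comb_hom) auto
  then have \<pi>: "?\<pi> \<in> left_module_hom R ?F Q" by (simp add: left_module_hom_def Qs)
  have "\<exists>e\<in>carrier ?F. ?\<pi> e = p" if p: "p \<in> ?X" for p
  proof -
    define e where "e = (\<lambda>x\<in>?X. if x = p then \<one>\<^bsub>R\<^esub> else \<zero>\<^bsub>R\<^esub>)"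
    have s: "supp_on R ?X e \<subseteq> {p}" by (auto simp: supp_on_def e_def)
    then have e: "e \<in> fin_supp_funs R ?X"
      by (auto simp: fin_supp_funs_def e_def intro: finite_subset)
    have "?\<pi> e = (\<Oplus>\<^bsub>P\<^esub>x\<in>{p}. e x \<odot>\<^bsub>P\<^esub> x)"
      using s p by (intro P.lin_comb_superset[OF e]) auto
    also have "\<dots> = p" using p by (simp add: e_def)
    finally show ?thesis using e fs by blast
  qed
  then have "?\<pi> ` carrier ?F = carrier Q"
    using \<pi> by (force simp: Qs left_module_hom_def)
  moreover have "(\<lambda>x. x) \<in> left_module_hom R P Q"
    by (auto simp: left_module_hom_def Qs)
  ultimately obtain s where s: "s \<in> left_module_hom R P ?F" "\<forall>x\<in>?X. ?\<pi> (s x) = x"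
    using P F Q \<pi> unfolding projective_left_module_def by meson
  have "\<forall>x\<in>?X. \<exists>m\<in>carrier M. f m = g x"
  proof
    fix x assume "x \<in> ?X"
    then have "g x \<in> f ` carrier M" using g f(2) by (auto simp: left_module_hom_def)
    then show "\<exists>m\<in>carrier M. f m = g x" by force
  qed
  then obtain m where m: "\<And>x. x \<in> ?X \<Longrightarrow> m x \<in> carrier M" "\<And>x. x \<in> ?X \<Longrightarrow> f (m x) = g x"
    by metis
  have mP: "m \<in> ?X \<rightarrow> carrier M" using m by auto
  let ?h = "\<lambda>x. lin_comb R M ?X m (s x)"
  have h: "?h \<in> left_module_hom R P M"
    by (rule left_module_hom_comp[OF s(1) M.lin_comb_hom[OF mP]])
  have fh: "f (?h x) = g x" if x: "x \<in> ?X" for x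
  proof -
    have sx: "s x \<in> fin_supp_funs R ?X" using s(1) x fs by (auto simp: left_module_hom_def)
    have "f (?h x) = lin_comb R N ?X (\<lambda>x. f (m x)) (s x)"
      by (rule M.hom_lin_comb[OF N f(1) mP sx])
    also have "\<dots> = lin_comb R N ?X g (s x)"
      unfolding lin_comb_def using m g fin_supp_funsD(1)[OF sx]
      by (intro N.M.finsum_cong') (auto simp: supp_on_def left_module_hom_def)
    also have "\<dots> = g (?\<pi> (s x))"
      by (rule P.hom_lin_comb[OF N g _ sx, symmetric]) auto
    finally show ?thesis using s(2) x by simp
  qed
  show ?thesis
    by (rule bexI[of _ ?h]) (simp_all add: h fh)
qed


section \<open>Group rings\<close>

text \<open>
  The formal sum \<open>\<Sum> f(x) x\<close> is represented by its coefficient function \<open>f\<close>; the product is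
  convolution, where summing over the support of \<open>f\<close> keeps \<^const>\<open>finsum\<close> finite.
\<close>

definition group_ring :: "('r, 'a) ring_scheme \<Rightarrow> ('g, 'b) monoid_scheme \<Rightarrow> ('g \<Rightarrow> 'r) ring"
  where "group_ring R G =
    \<lparr>carrier = fin_supp_funs R (carrier G),
     monoid.mult = (\<lambda>f g. \<lambda>x\<in>carrier G.
       \<Oplus>\<^bsub>R\<^esub>y\<in>supp_on R (carrier G) f. f y \<otimes>\<^bsub>R\<^esub> g (inv\<^bsub>G\<^esub> y \<otimes>\<^bsub>G\<^esub> x)),
     one = (\<lambda>x\<in>carrier G. if x = \<one>\<^bsub>G\<^esub> then \<one>\<^bsub>R\<^esub> else \<zero>\<^bsub>R\<^esub>),
     zero = (\<lambda>x\<in>carrier G. \<zero>\<^bsub>R\<^esub>),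
     add = (\<lambda>f g. \<lambda>x\<in>carrier G. f x \<oplus>\<^bsub>R\<^esub> g x)\<rparr>"

text \<open>The map of group rings \<open>\<Sum> f(x) x \<mapsto> \<Sum> f(x) \<phi>(x)\<close> induced by \<open>\<phi> : G \<rightarrow> H\<close>.\<close>

definition group_ring_map ::
  "('r, 'a) ring_scheme \<Rightarrow> ('g, 'b) monoid_scheme \<Rightarrow> ('h, 'c) monoid_scheme \<Rightarrow> ('g \<Rightarrow> 'h) \<Rightarrow>
   ('g \<Rightarrow> 'r) \<Rightarrow> ('h \<Rightarrow> 'r)"
  where "group_ring_map R G H \<phi> f =
    (\<lambda>y\<in>carrier H. \<Oplus>\<^bsub>R\<^esub>x\<in>{x \<in> supp_on R (carrier G) f. \<phi> x = y}. f x)"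


section \<open>The completed group ring\<close>

definition fin_index_normals :: "('g, 'b) monoid_scheme \<Rightarrow> 'g set set"
  where "fin_index_normals G = {N. N \<lhd> G \<and> finite (rcosets\<^bsub>G\<^esub> N)}"

text \<open>
  The inverse limit of the rings \<open>R[G/N]\<close> as the ring of compatible families; for \<open>N \<subseteq> N'\<close> the
  projection \<open>G/N \<rightarrow> G/N'\<close> maps a coset \<open>C\<close> of \<open>N\<close> to the coset \<open>N' C\<close> of \<open>N'\<close>.
\<close>

definition completed_group_ring ::
  "('r, 'a) ring_scheme \<Rightarrow> ('g, 'b) monoid_scheme \<Rightarrow> ('g set \<Rightarrow> 'g set \<Rightarrow> 'r) ring"
  where "completed_group_ring R G =
    \<lparr>carrier = {x \<in> (\<Pi>\<^sub>E N\<in>fin_index_normals G. carrier (group_ring R (G Mod N))).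
       \<forall>N\<in>fin_index_normals G. \<forall>N'\<in>fin_index_normals G. N \<subseteq> N' \<longrightarrow>
         group_ring_map R (G Mod N) (G Mod N') (\<lambda>C. N' <#>\<^bsub>G\<^esub> C) (x N) = x N'},
     monoid.mult = (\<lambda>x y. \<lambda>N\<in>fin_index_normals G. x N \<otimes>\<^bsub>group_ring R (G Mod N)\<^esub> y N),
     one = (\<lambda>N\<in>fin_index_normals G. \<one>\<^bsub>group_ring R (G Mod N)\<^esub>),
     zero = (\<lambda>N\<in>fin_index_normals G. \<zero>\<^bsub>group_ring R (G Mod N)\<^esub>),
     add = (\<lambda>x y. \<lambda>N\<in>fin_index_normals G. x N \<oplus>\<^bsub>group_ring R (G Mod N)\<^esub> y N)\<rparr>"

definition completion_map ::
  "('r, 'a) ring_scheme \<Rightarrow> ('g, 'b) monoid_scheme \<Rightarrow> ('g \<Rightarrow> 'r) \<Rightarrow> ('g set \<Rightarrow> 'g set \<Rightarrow> 'r)"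
  where "completion_map R G a =
    (\<lambda>N\<in>fin_index_normals G. group_ring_map R G (G Mod N) (\<lambda>g. N #>\<^bsub>G\<^esub> g) a)"

definition completed_group_module ::
  "('r, 'a) ring_scheme \<Rightarrow> ('g, 'b) monoid_scheme \<Rightarrow> ('g \<Rightarrow> 'r, 'g set \<Rightarrow> 'g set \<Rightarrow> 'r) module"
  where "completed_group_module R G =
    left_module_via (completion_map R G) (completed_group_ring R G)"


section \<open>Finitely generated and virtually free groups\<close>

definition finitely_generated_group :: "('g, 'b) monoid_scheme \<Rightarrow> bool"
  where "finitely_generated_group G \<longleftrightarrow>
    (\<exists>S. finite S \<and> S \<subseteq> carrier G \<and> generate G S = carrier G)"

text \<open>
  Words are lists of letters \<open>(s, b)\<close>, where \<open>(s, True)\<close> stands for \<open>s\<close> and \<open>(s, False)\<close> for the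
  formal inverse of \<open>s\<close>.
\<close>

definition reduced_words :: "'g set \<Rightarrow> ('g \<times> bool) list set"
  where "reduced_words S =
    {w \<in> lists (S \<times> UNIV). successively (\<lambda>(s, b) (t, c). \<not> (s = t \<and> b \<noteq> c)) w}"

fun word_value :: "('g, 'b) monoid_scheme \<Rightarrow> ('g \<times> bool) list \<Rightarrow> 'g"
  where
    "word_value G [] = \<one>\<^bsub>G\<^esub>"
  | "word_value G ((s, b) # w) = (if b then s else inv\<^bsub>G\<^esub> s) \<otimes>\<^bsub>G\<^esub> word_value G w"

definition free_group_on :: "('g, 'b) monoid_scheme \<Rightarrow> 'g set \<Rightarrow> bool"
  where "free_group_on F S \<longleftrightarrow> S \<subseteq> carrier F \<and>
    (\<forall>x\<in>carrier F. \<exists>!w. w \<in> reduced_words S \<and> word_value F w = x)"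

definition virtually_free_group :: "('g, 'b) monoid_scheme \<Rightarrow> bool"
  where "virtually_free_group G \<longleftrightarrow>
    (\<exists>H. subgroup H G \<and> finite (rcosets\<^bsub>G\<^esub> H) \<and> (\<exists>S. free_group_on (G\<lparr>carrier := H\<rparr>) S))"

end

theory Submission
  imports Defs "HOL-Algebra.Product_Groups" "HOL-Computational_Algebra.Squarefree"
begin

text \<open>
  Let \<open>V\<close> be the completed group ring as a left \<open>k[G]\<close>-module, and let \<open>H\<close> be a subgroup of finite index that is
  free on \<open>S\<close>.  An element of \<open>V\<close> is a finitely additive \<open>k\<close>-valued measure on the unions of cosets of normal
  subgroups of finite index.  The measures supported on \<open>H\<close> form an \<open>H\<close>-module \<open>VH\<close>, and \<open>V\<close> is the direct
  sum of its translates \<open>t VH\<close>, where \<open>t\<close> represents the cosets of \<open>H\<close>.  As \<open>k\<close> is a quotient of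
  the integers, linear maps are additive equivariant maps; as \<open>n\<close> is squarefree, every subgroup of a finite
  additive subgroup of a \<open>k\<close>-module is a direct summand (\<open>squarefree_exponent_retraction\<close>).

  The property of \<open>V\<close> on which everything rests is \<open>no_finite_relations\<close>: if \<open>Y\<close> is a finite set with
  permutations \<open>\<sigma> s\<close>, and if measures \<open>b s y\<close> in \<open>VH\<close>, for \<open>s\<close> in a finite subset of \<open>S\<close>, satisfy
  \<open>\<Sum>\<^sub>s s (b s y) = \<Sum>\<^sub>s b s (\<sigma> s y)\<close> for all \<open>y\<close>, then all of them vanish.  This is dual to the vanishing of
  the first cohomology of \<open>H\<close> with values in the locally constant functions on \<open>Y \<times> H\<close>.  The latter is
  easy: since \<open>H\<close> is free, a cocycle may be prescribed on \<open>S\<close>, and it describes an action of \<open>H\<close> on a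
  finite set of functions; such an action is trivial on a subgroup of finite index, so the primitive of the
  cocycle is locally constant (\<open>coboundary_exists\<close>).

  For a finite subgroup \<open>U\<close> of \<open>VH\<close> let \<open>D s\<close> be the group of all \<open>u\<close> in \<open>U\<close> with \<open>s u\<close> in \<open>U\<close>.  With a
  one-point set \<open>Y\<close>, the key property makes \<open>(d s)\<^sub>s \<mapsto> \<Sum>\<^sub>s (s d s - d s)\<close> injective on the product of the \<open>D s\<close>.
  Hence the order of this product divides that of \<open>U\<close>; let \<open>chi U\<close> be the quotient.  Replacing \<open>U\<close> by
  \<open>U + s U\<close> or \<open>U + s\<^sup>-\<^sup>1 U\<close> does not raise \<open>chi\<close>, and it lowers \<open>chi\<close> if a product arises that is not
  forced by those in \<open>U\<close> (\<open>critical_grow\<close>).  So if \<open>U\<close> minimizes \<open>chi\<close> among the finite subgroups that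
  contain it, then the submodule spanned by \<open>U\<close> has no relations but those visible in \<open>U\<close>: a map on \<open>U\<close>
  that respects the products \<open>s u\<close> with \<open>u\<close> in \<open>D s\<close> extends to a linear map (\<open>compatible_map_extends\<close>).
  Every finite subset of \<open>VH\<close> lies in such a critical \<open>U\<close>.
   Hence the spans of the critical \<open>U\<close> are directed, and by
  the decomposition of \<open>V\<close> into translates of \<open>VH\<close> their union is \<open>V\<close>.

  These spans are projective.  A linear map from the span of \<open>U\<close> to \<open>N\<close> can be lifted additively along a surjection
  of a module \<open>M\<close> onto \<open>N\<close>, at least on \<open>U\<close>.  The failure of the lift to respect products is a family of
  additive maps \<open>e s\<close> from \<open>D s\<close> to the kernel, and it can be corrected if \<open>e s u = c (s u) - s (c u)\<close> for some
  additive \<open>c\<close> on \<open>U\<close>.  Such a \<open>c\<close> always exists (\<open>cocycle_is_coboundary\<close>).  By duality this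
  concerns the group of relations \<open>\<Sum>\<^sub>s s (x s) = \<Sum>\<^sub>s y s\<close> with \<open>x s\<close> and \<open>y s\<close> in \<open>D s\<close>.  A group of relations in
  which, for each \<open>s\<close>, the components \<open>x s\<close> and \<open>y s\<close> take the same values admits, by counting fibres, permutations
  \<open>\<sigma> s\<close> that carry one component to the other; so it is trivial by the key property
  (\<open>balanced_relations_trivial\<close>).  Any other group of relations has a proper subgroup to which the question can be
  reduced (\<open>relation_functionals\<close>).
\<close>

section \<open>Finite abelian groups of squarefree exponent\<close>

lemma nat_inverse_mod_prime:
  fixes p m :: nat
  assumes p: "Factorial_Ring.prime p" and "\<not> p dvd m"
  obtains c l where "m * c = 1 + p * l"
proof -
  have "coprime m p" using assms by (metis coprime_commute prime_imp_coprime)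
  moreover have "m \<noteq> 0" using assms(2) by (auto intro: ccontr)
  ultimately obtain c l where "m * c = p * l + 1" using bezout_nat[of m p] by auto
  then show ?thesis using that[of c l] by simp
qed

lemma (in group) subgroup_nat_pow_closed:
  assumes "subgroup H G" "x \<in> H"
  shows "x [^] (i::nat) \<in> H"
  using assms by (induction i) (auto simp: subgroup.one_closed subgroup.m_closed)

context comm_group
begin

text \<open>
  If \<open>p\<close> does not divide \<open>i\<close>, then \<open>a\<close> is a power of \<open>a\<^sup>i\<close>; so a nontrivial relation between \<open>A\<close>,
  \<open>B\<close> and the powers of \<open>a\<close> would put \<open>a\<close> itself into \<open>A <#> B\<close>.
\<close>

lemma adjoin_prime_order:
  assumes A: "subgroup A G" and B: "subgroup B G" and AB: "A \<inter> B = {\<one>}"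
    and p: "Factorial_Ring.prime (p::nat)" and a: "a \<in> carrier G" "a [^] p = \<one>" "a \<notin> A <#> B"
  obtains B' where "subgroup B' G" "B \<subset> B'" "A \<inter> B' = {\<one>}"
proof -
  note Ac = subgroup.mem_carrier[OF A] and Bc = subgroup.mem_carrier[OF B]
  have C: "subgroup (A <#> B) G" by (rule mult_subgroups[OF A B]) 
  define B' where "B' = (\<Union>b\<in>B. range (\<lambda>i::nat. b \<otimes> a [^] i))"
  have in_B': "b \<otimes> a [^] (i::nat) \<in> B'" if "b \<in> B" for b i using that by (auto simp: B'_def)
  have pow: "a [^] (p * i) = \<one>" for i :: nat
    using a by (simp flip: nat_pow_pow)
  have "subgroup B' G"
  proof (rule subgroupI)
    show "B' \<subseteq> carrier G" using Bc a by (auto simp: B'_def)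
    show "B' \<noteq> {}" using subgroup.one_closed[OF B] by (auto simp: B'_def)
    fix x assume "x \<in> B'"
    then obtain b i where x: "x = b \<otimes> a [^] (i::nat)" and b: "b \<in> B" by (auto simp: B'_def)
    have "p \<ge> 1" using prime_ge_1_nat[OF p] .
    then have "(p - 1) * i + i = p * i" by (simp add: algebra_simps)
    then have "a [^] ((p - 1) * i) \<otimes> a [^] i = \<one>" using a pow by (simp add: nat_pow_mult)
    then have "inv (a [^] i) = a [^] ((p - 1) * i)" using a by (intro inv_equality) auto
    then have "inv x = inv b \<otimes> a [^] ((p - 1) * i)" using x b Bc a by (simp add: inv_mult)
    then show "inv x \<in> B'" using in_B' subgroup.m_inv_closed[OF B b] by simp
    fix y assume "y \<in> B'"
    then obtain c j where y: "y = c \<otimes> a [^] (j::nat)" and c: "c \<in> B" by (auto simp: B'_def)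
    have "x \<otimes> y = (b \<otimes> c) \<otimes> (a [^] i \<otimes> a [^] j)" using x y b c Bc a by (simp add: m_ac)
    also have "\<dots> = (b \<otimes> c) \<otimes> a [^] (i + j)" using a by (simp add: nat_pow_mult)
    finally show "x \<otimes> y \<in> B'" using in_B' subgroup.m_closed[OF B b c] by simp
  qed
  moreover have "B \<subseteq> B'"
  proof
    fix b assume "b \<in> B"
    then show "b \<in> B'" using in_B'[of b 0] Bc by simp
  qed
  moreover have "a \<in> B'" using in_B'[OF subgroup.one_closed[OF B], of 1] a by simp
  moreover have "a \<notin> B"
  proof
    assume "a \<in> B"
    then have "\<one> \<otimes> a \<in> A <#> B" using subgroup.one_closed[OF A] unfolding set_mult_def by blast
    then show False using a by simp
  qed
  moreover have "x = \<one>" if x: "x \<in> A" "x \<in> B'" for x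
  proof -
    from x obtain b i where xb: "x = b \<otimes> a [^] (i::nat)" and b: "b \<in> B" by (auto simp: B'_def)
    show ?thesis
    proof (cases "p dvd i")
      case True
      then have "x = b" using xb pow Bc b a by (auto elim!: dvdE)
      then show ?thesis using AB x b by auto
    next
      case False
      obtain j l where j: "i * j = 1 + p * l" using nat_inverse_mod_prime[OF p False] .
      have "x [^] j = b [^] j \<otimes> a [^] (i * j)"
        using xb Bc b a by (simp add: pow_mult_distrib m_comm nat_pow_pow)
      also have "a [^] (i * j) = a" using a pow by (simp add: j flip: nat_pow_mult)
      finally have "a = x [^] j \<otimes> inv (b [^] j)"
        using a Bc b by (simp add: m_ac)
      moreover have "x [^] j \<in> A" "inv (b [^] j) \<in> B"
        using x b A B by (simp_all add: subgroup.m_inv_closed subgroup_nat_pow_closed)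
      ultimately have "a \<in> A <#> B" unfolding set_mult_def by blast
      then show ?thesis using a by simp
    qed
  qed
  ultimately show ?thesis
    using that[of B'] subgroup.one_closed[OF A] subgroup.one_closed[of B' G] by blast
qed

text \<open>
  A suitable power of \<open>u\<close> has prime order \<open>p\<close> modulo \<open>C\<close>.  Since \<open>n\<close> is squarefree, some multiple of
  \<open>n div p\<close> is \<open>1\<close> modulo \<open>p\<close>; raising to that multiple stays in the same coset of \<open>C\<close> and gives an
  element of order \<open>p\<close> in the group itself.
\<close>

lemma outside_prime_order:
  assumes n: "squarefree (n::nat)" and exp: "\<And>x. x \<in> carrier G \<Longrightarrow> x [^] n = \<one>"
    and C: "subgroup C G" and u: "u \<in> carrier G" "u \<notin> C"
  obtains p a where "Factorial_Ring.prime (p::nat)" "a \<in> carrier G" "a [^] p = \<one>" "a \<notin> C"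
proof -
  have n0: "n > 0" using n by (auto intro: Nat.gr0I)
  define m :: nat where "m = (LEAST m. m > 0 \<and> u [^] m \<in> C)"
  have m: "m > 0" "u [^] m \<in> C"
    using LeastI[of "\<lambda>m::nat. m > 0 \<and> u [^] m \<in> C" n] n0 exp[OF u(1)] subgroup.one_closed[OF C]
    unfolding m_def by simp_all
  have least: "m \<le> k" if "k > 0" "u [^] k \<in> C" for k
    unfolding m_def using that by (intro Least_le) auto
  have "m \<noteq> 1" using m u by auto
  then obtain p where p: "Factorial_Ring.prime p" "p dvd m" using prime_factor_nat by blast
  define a where "a = u [^] (m div p)"
  have a: "a \<in> carrier G" using u by (simp add: a_def)
  have ap: "a [^] p \<in> C" using m p u by (simp add: a_def nat_pow_pow)
  have aC: "a \<notin> C"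
  proof
    assume "a \<in> C"
    moreover have "m div p > 0" "m div p < m"
      using p m prime_gt_1_nat[OF p(1)] by (auto elim!: dvdE)
    ultimately show False using least[of "m div p"] by (auto simp: a_def)
  qed
  have key: "a \<in> C" if "a [^] (1 + p * l) \<in> C" for l
  proof -
    have "a [^] (1 + p * l) = a \<otimes> (a [^] p) [^] l"
      using a by (simp add: nat_pow_pow m_comm flip: nat_pow_mult)
    moreover have "(a [^] p) [^] l \<in> C" using ap C by (simp add: subgroup_nat_pow_closed)
    ultimately have "a [^] (1 + p * l) \<otimes> inv ((a [^] p) [^] l) = a"
      using a by (simp add: m_assoc)
    then show ?thesis
      using subgroup.m_closed[OF C that subgroup.m_inv_closed[OF C \<open>(a [^] p) [^] l \<in> C\<close>]] by simp
  qed
  have "p dvd n"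
  proof (rule ccontr)
    assume "\<not> p dvd n"
    then obtain c l where c: "n * c = 1 + p * l" using nat_inverse_mod_prime[OF p(1)] by blast
    have "a [^] (n * c) = \<one>" using exp[OF a] a by (simp flip: nat_pow_pow)
    then show False using key[of l] c aC subgroup.one_closed[OF C] by simp
  qed
  have "\<not> p dvd n div p"
  proof
    assume "p dvd n div p"
    then have "p ^ 2 dvd n" using \<open>p dvd n\<close> by (metis dvd_div_mult_self dvd_refl mult_dvd_mono power2_eq_square)
    then show False using n p(1) unfolding squarefree_def by (metis not_prime_unit)
  qed
  then obtain c l where c: "n div p * c = 1 + p * l" using nat_inverse_mod_prime[OF p(1)] by blast
  \<comment> \<open>the \<open>p\<close>-component of \<open>a\<close>\<close>
  define b where "b = a [^] (n div p * c)"
  have b: "b \<in> carrier G" using a by (simp add: b_def)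
  have "(n div p * c) * p = n * c"
    using \<open>p dvd n\<close> by (metis dvd_div_mult_self mult.assoc mult.commute)
  then have "b [^] p = (a [^] n) [^] c" using a by (simp only: b_def nat_pow_pow)
  then have bp: "b [^] p = \<one>" using exp[OF a] by simp
  have "b \<notin> C" using key[of l] aC c by (auto simp: b_def)
  then show ?thesis using that p(1) b bp by blast
qed

text \<open>
  Such groups are semisimple: a subgroup \<open>B\<close> that is maximal among those meeting \<open>A\<close> trivially is a
  complement of \<open>A\<close>, because otherwise it could be enlarged by an element of prime order.  The
  retraction is the projection along \<open>B\<close>.
\<close>

lemma squarefree_exponent_retraction:
  assumes fin: "finite (carrier G)" and n: "squarefree (n::nat)"
    and exp: "\<And>x. x \<in> carrier G \<Longrightarrow> x [^] n = \<one>" and A: "subgroup A G"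
  obtains r where "r \<in> carrier G \<rightarrow> A" "\<And>x y. x \<in> carrier G \<Longrightarrow> y \<in> carrier G \<Longrightarrow> r (x \<otimes> y) = r x \<otimes> r y"
    "\<And>a. a \<in> A \<Longrightarrow> r a = a"
proof -
  note Ac = subgroup.mem_carrier[OF A]
  define \<B> where "\<B> = {B. subgroup B G \<and> A \<inter> B = {\<one>}}"
  have finB: "finite \<B>"
    by (rule finite_subset[of _ "Pow (carrier G)"]) (auto simp: \<B>_def fin dest: subgroup.subset)
  have "{\<one>} \<in> \<B>" using subgroup.one_closed[OF A] triv_subgroup by (auto simp: \<B>_def)
  then have "\<exists>B\<in>\<B>. \<forall>B'\<in>\<B>. B \<subseteq> B' \<longrightarrow> B' = B" using finite_has_maximal[OF finB] by blast
  then obtain B where B: "subgroup B G" "A \<inter> B = {\<one>}" and max: "\<And>B'. B' \<in> \<B> \<Longrightarrow> B \<subseteq> B' \<Longrightarrow> B' = B"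
    by (auto simp: \<B>_def)
  note Bc = subgroup.mem_carrier[OF B(1)]
  have C: "subgroup (A <#> B) G" by (rule mult_subgroups[OF A B(1)])
  have "A <#> B = carrier G"
  proof (rule ccontr)
    assume "A <#> B \<noteq> carrier G"
    then obtain u where "u \<in> carrier G" "u \<notin> A <#> B" using subgroup.subset[OF C] by auto
    then obtain p a where "Factorial_Ring.prime (p::nat)" "a \<in> carrier G" "a [^] p = \<one>" "a \<notin> A <#> B"
      using outside_prime_order[OF n exp C] by blast
    then obtain B' where "subgroup B' G" "B \<subset> B'" "A \<inter> B' = {\<one>}"
      using adjoin_prime_order[OF A B] by blast
    then show False using max[of B'] by (auto simp: \<B>_def)
  qed
  then have dec: "\<exists>a\<in>A. \<exists>b\<in>B. x = a \<otimes> b" if "x \<in> carrier G" for x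
    using that unfolding set_mult_def by blast
  define r where "r x = (SOME a. a \<in> A \<and> (\<exists>b\<in>B. x = a \<otimes> b))" for x
  have r: "r x \<in> A \<and> (\<exists>b\<in>B. x = r x \<otimes> b)" if "x \<in> carrier G" for x
    unfolding r_def by (rule someI_ex) (use dec[OF that] in blast)
  have uniq: "r (a \<otimes> b) = a" if ab: "a \<in> A" "b \<in> B" for a b
  proof -
    have c: "a \<in> carrier G" "b \<in> carrier G" using ab Ac Bc by auto
    obtain b' where b': "b' \<in> B" "a \<otimes> b = r (a \<otimes> b) \<otimes> b'" and ra: "r (a \<otimes> b) \<in> A"
      using r[of "a \<otimes> b"] c by auto
    have "r (a \<otimes> b) \<in> carrier G" "b' \<in> carrier G" using ra b' Ac Bc by auto
    then have "inv (r (a \<otimes> b)) \<otimes> a = b' \<otimes> inv b"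
      using b'(2) c by (metis inv_closed inv_solve_left inv_solve_right m_assoc m_closed)
    moreover have "inv (r (a \<otimes> b)) \<otimes> a \<in> A" "b' \<otimes> inv b \<in> B"
      using ra ab b' A B(1) by (simp_all add: subgroup.m_inv_closed subgroup.m_closed)
    ultimately have "inv (r (a \<otimes> b)) \<otimes> a = \<one>" using B(2) by (metis IntI singletonD)
    then show ?thesis using c \<open>r (a \<otimes> b) \<in> carrier G\<close> by (metis inv_equality inv_inv inv_closed)
  qed
  show ?thesis
  proof (rule that[of r])
    show "r \<in> carrier G \<rightarrow> A" using r by blast
    show "r a = a" if "a \<in> A" for a using uniq[OF that subgroup.one_closed[OF B(1)]] Ac that by simp
    fix x y assume "x \<in> carrier G" "y \<in> carrier G"
    then obtain b c where bc: "b \<in> B" "x = r x \<otimes> b" "c \<in> B" "y = r y \<otimes> c"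
      and rA: "r x \<in> A" "r y \<in> A" using r by blast
    then have "r x \<in> carrier G" "r y \<in> carrier G" "b \<in> carrier G" "c \<in> carrier G" using Ac Bc by auto
    then have "(r x \<otimes> b) \<otimes> (r y \<otimes> c) = (r x \<otimes> r y) \<otimes> (b \<otimes> c)" by (simp add: m_ac)
    then have "x \<otimes> y = (r x \<otimes> r y) \<otimes> (b \<otimes> c)" using bc by simp
    then show "r (x \<otimes> y) = r x \<otimes> r y"
      using uniq subgroup.m_closed[OF A rA] subgroup.m_closed[OF B(1) bc(1,3)] by simp
  qed
qed

lemma finite_exponent_finite_subgroup:
  assumes n: "n > (0::nat)" and exp: "\<And>x. x \<in> carrier G \<Longrightarrow> x [^] n = \<one>"
    and "finite X" "X \<subseteq> carrier G"
  obtains U where "subgroup U G" "finite U" "X \<subseteq> U"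
  using assms(3,4)
proof (induction arbitrary: thesis rule: finite_induct)
  case empty
  show ?case using empty.prems(1)[of "{\<one>}"] triv_subgroup by simp
next
  case (insert x X)
  obtain U where U: "subgroup U G" "finite U" "X \<subseteq> U" using insert by auto
  have x: "x \<in> carrier G" using insert by auto
  define Z where "Z = (\<lambda>i. x [^] i) ` {..<n}"
  have mod: "x [^] i = x [^] (i mod n)" for i
  proof -
    have "x [^] i = x [^] (n * (i div n) + i mod n)" by simp
    also have "\<dots> = x [^] (n * (i div n)) \<otimes> x [^] (i mod n)" using x by (simp only: nat_pow_mult)
    also have "x [^] (n * (i div n)) = \<one>" using exp[OF x] x by (simp flip: nat_pow_pow)
    finally show ?thesis using x by simp
  qed
  have inZ: "x [^] i \<in> Z" for i :: nat
    using n mod[of i] unfolding Z_def by auto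
  have Z: "subgroup Z G"
  proof (rule subgroupI)
    show "Z \<subseteq> carrier G" "Z \<noteq> {}" using x n by (auto simp: Z_def)
    fix y assume "y \<in> Z"
    then obtain i where i: "y = x [^] i" "i < n" by (auto simp: Z_def)
    have "x [^] (n - i) \<otimes> x [^] i = \<one>" using i x exp by (simp add: nat_pow_mult)
    then have "inv y = x [^] (n - i)" using i x by (intro inv_equality) auto
    then show "inv y \<in> Z" using inZ by simp
    fix z assume "z \<in> Z"
    then obtain j :: nat where "z = x [^] j" by (auto simp: Z_def)
    then show "y \<otimes> z \<in> Z" using i x inZ by (simp add: nat_pow_mult)
  qed
  have "U \<subseteq> U <#> Z" "x \<in> U <#> Z"
  proof -
    show "U \<subseteq> U <#> Z"
    proof
      fix u assume u: "u \<in> U"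
      then have "u \<otimes> \<one> \<in> U <#> Z" using subgroup.one_closed[OF Z] unfolding set_mult_def by blast
      then show "u \<in> U <#> Z" using subgroup.mem_carrier[OF U(1) u] by simp
    qed
    have "\<one> \<otimes> x [^] (1::nat) \<in> U <#> Z"
      using subgroup.one_closed[OF U(1)] inZ[of 1] unfolding set_mult_def by blast
    then show "x \<in> U <#> Z" using x by simp
  qed
  moreover have "finite (U <#> Z)" unfolding set_mult_def using U by (simp add: Z_def)
  moreover have "subgroup (U <#> Z) G" by (rule mult_subgroups[OF U(1) Z])
  ultimately show ?case using insert.prems(1)[of "U <#> Z"] U by auto
qed

end

section \<open>Group rings and convolution\<close>

context abelian_monoid
begin

lemma finsum_restrict_cond:
  assumes "finite A" "f \<in> A \<rightarrow> carrier G"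
  shows "(\<Oplus>a\<in>{a \<in> A. P a}. f a) = (\<Oplus>a\<in>A. if P a then f a else \<zero>)"
  using assms by (intro add.finprod_mono_neutral_cong_left) auto

lemma finsum_swap:
  assumes "finite A" "finite B" "\<And>a b. a \<in> A \<Longrightarrow> b \<in> B \<Longrightarrow> f a b \<in> carrier G"
  shows "(\<Oplus>a\<in>A. \<Oplus>b\<in>B. f a b) = (\<Oplus>b\<in>B. \<Oplus>a\<in>A. f a b)"
  using assms(1,3)
proof (induction rule: finite_induct)
  case empty
  then show ?case by simp
next
  case (insert x A)
  have c: "(\<lambda>b. f x b) \<in> B \<rightarrow> carrier G" "(\<lambda>b. \<Oplus>a\<in>A. f a b) \<in> B \<rightarrow> carrier G"
    "(\<lambda>a. \<Oplus>b\<in>B. f a b) \<in> A \<rightarrow> carrier G" "(\<Oplus>b\<in>B. f x b) \<in> carrier G"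
    using insert by (auto intro!: finsum_closed)
  have "(\<Oplus>b\<in>B. \<Oplus>a\<in>insert x A. f a b) = (\<Oplus>b\<in>B. f x b \<oplus> (\<Oplus>a\<in>A. f a b))"
    using insert by (intro finsum_cong') (auto intro!: finsum_insert finsum_closed)
  also have "\<dots> = (\<Oplus>b\<in>B. f x b) \<oplus> (\<Oplus>b\<in>B. \<Oplus>a\<in>A. f a b)" using c by (rule_tac finsum_addf)
  finally show ?case using insert c by simp
qed

lemma finsum_fibers:
  assumes "finite A" "finite B" "\<phi> \<in> A \<rightarrow> B" "f \<in> A \<rightarrow> carrier G"
  shows "(\<Oplus>b\<in>B. \<Oplus>a\<in>{a \<in> A. \<phi> a = b}. f a) = (\<Oplus>a\<in>A. f a)"
proof -
  have "(\<Oplus>b\<in>B. \<Oplus>a\<in>{a \<in> A. \<phi> a = b}. f a) = (\<Oplus>b\<in>B. \<Oplus>a\<in>A. if \<phi> a = b then f a else \<zero>)"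
    using assms finsum_restrict_cond[OF assms(1,4)]
    by (rule_tac finsum_cong') (auto intro!: finsum_closed)
  also have "\<dots> = (\<Oplus>a\<in>A. \<Oplus>b\<in>B. if \<phi> a = b then f a else \<zero>)"
    using assms by (intro finsum_swap) auto
  also have "\<dots> = (\<Oplus>a\<in>A. f a)"
    using assms by (rule_tac finsum_cong') (auto intro!: finsum_singleton)
  finally show ?thesis .
qed

end

locale group_algebra = G: group G + k: cring k
  for G :: "('g, 'b) monoid_scheme" (structure) and k :: "('r, 'c) ring_scheme"
begin

abbreviation kG where "kG \<equiv> group_ring k G"

abbreviation supp where "supp \<equiv> supp_on k (carrier G)"

definition single :: "'g \<Rightarrow> 'g \<Rightarrow> 'r"
  where "single g = (\<lambda>x\<in>carrier G. if x = g then \<one>\<^bsub>k\<^esub> else \<zero>\<^bsub>k\<^esub>)"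

text \<open>
  Coefficient functions on \<open>G\<close> act by convolution on functions on any \<open>G\<close>-set \<open>\<Omega>\<close>.  Both the product of
  the group ring (\<open>\<Omega> = G\<close>) and its action on the layers of the completed group ring (\<open>\<Omega> = G/N\<close>) are of
  this form, so that associativity has to be checked only once.
\<close>

definition conv :: "('g \<Rightarrow> 'w \<Rightarrow> 'w) \<Rightarrow> ('g \<Rightarrow> 'r) \<Rightarrow> ('w \<Rightarrow> 'r) \<Rightarrow> 'w \<Rightarrow> 'r"
  where "conv act f F \<omega> = (\<Oplus>\<^bsub>k\<^esub>y\<in>supp f. f y \<otimes>\<^bsub>k\<^esub> F (act (inv y) \<omega>))"

definition action_on :: "'w set \<Rightarrow> ('g \<Rightarrow> 'w \<Rightarrow> 'w) \<Rightarrow> bool"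
  where "action_on \<Omega> act \<longleftrightarrow> (\<forall>g\<in>carrier G. \<forall>\<omega>\<in>\<Omega>. act g \<omega> \<in> \<Omega>) \<and>
    (\<forall>g\<in>carrier G. \<forall>h\<in>carrier G. \<forall>\<omega>\<in>\<Omega>. act (g \<otimes> h) \<omega> = act g (act h \<omega>)) \<and>
    (\<forall>\<omega>\<in>\<Omega>. act \<one> \<omega> = \<omega>)"

lemma supp_sub: "supp f \<subseteq> carrier G"
  by (auto simp: supp_on_def)

lemma action_closed: "action_on \<Omega> act \<Longrightarrow> g \<in> carrier G \<Longrightarrow> \<omega> \<in> \<Omega> \<Longrightarrow> act g \<omega> \<in> \<Omega>"
  by (auto simp: action_on_def)

lemma action_mult:
  "action_on \<Omega> act \<Longrightarrow> g \<in> carrier G \<Longrightarrow> h \<in> carrier G \<Longrightarrow> \<omega> \<in> \<Omega> \<Longrightarrow> act (g \<otimes> h) \<omega> = act g (act h \<omega>)"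
  by (auto simp: action_on_def)

lemma action_value:
  "action_on \<Omega> act \<Longrightarrow> F \<in> \<Omega> \<rightarrow> carrier k \<Longrightarrow> y \<in> carrier G \<Longrightarrow> \<omega> \<in> \<Omega> \<Longrightarrow>
    F (act (inv y) \<omega>) \<in> carrier k"
  using action_closed[of \<Omega> act "inv y" \<omega>] by auto

lemma conv_superset:
  assumes act: "action_on \<Omega> act" and f: "f \<in> fin_supp_funs k (carrier G)"
    and F: "F \<in> \<Omega> \<rightarrow> carrier k" and w: "\<omega> \<in> \<Omega>"
    and T: "finite T" "supp f \<subseteq> T" "T \<subseteq> carrier G"
  shows "conv act f F \<omega> = (\<Oplus>\<^bsub>k\<^esub>y\<in>T. f y \<otimes>\<^bsub>k\<^esub> F (act (inv y) \<omega>))"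
  unfolding conv_def
proof (rule k.add.finprod_mono_neutral_cong_left[OF T(1,2)])
  have F': "F (act (inv y) \<omega>) \<in> carrier k" if "y \<in> T" for y
    using that T by (intro action_value[OF act F _ w]) auto
  show "f i \<otimes>\<^bsub>k\<^esub> F (act (inv i) \<omega>) = \<zero>\<^bsub>k\<^esub>" if "i \<in> T - supp f" for i
    using that T F'[of i] by (auto simp: supp_on_def)
  show "(\<lambda>y. f y \<otimes>\<^bsub>k\<^esub> F (act (inv y) \<omega>)) \<in> T \<rightarrow> carrier k"
    using T F' fin_supp_funsD(1)[OF f] by auto
qed simp

lemma action_regular: "action_on (carrier G) (\<otimes>)"
  by (auto simp: action_on_def G.m_assoc)

lemma conv_closed:
  assumes act: "action_on \<Omega> act" and f: "f \<in> fin_supp_funs k (carrier G)"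
    and F: "F \<in> \<Omega> \<rightarrow> carrier k" and w: "\<omega> \<in> \<Omega>"
  shows "conv act f F \<omega> \<in> carrier k"
  unfolding conv_def using fin_supp_funsD(1)[OF f] F w supp_sub[of f] action_closed[OF act]
  by (intro k.finsum_closed) (auto simp: Pi_def subset_iff)

lemma conv_add_left:
  assumes act: "action_on \<Omega> act" and f: "f \<in> fin_supp_funs k (carrier G)" "f' \<in> fin_supp_funs k (carrier G)"
    and F: "F \<in> \<Omega> \<rightarrow> carrier k" and w: "\<omega> \<in> \<Omega>"
  shows "conv act (\<lambda>x\<in>carrier G. f x \<oplus>\<^bsub>k\<^esub> f' x) F \<omega> = conv act f F \<omega> \<oplus>\<^bsub>k\<^esub> conv act f' F \<omega>"
proof -
  let ?T = "supp f \<union> supp f'" and ?s = "\<lambda>x\<in>carrier G. f x \<oplus>\<^bsub>k\<^esub> f' x"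
  note fc = fin_supp_funsD(1)[OF f(1)] fin_supp_funsD(1)[OF f(2)]
  have T: "finite ?T" "?T \<subseteq> carrier G" "supp ?s \<subseteq> ?T"
    using fin_supp_funsD(3)[OF f(1)] fin_supp_funsD(3)[OF f(2)] supp_sub fc
    by (auto simp: supp_on_def)
  have Fc: "F (act (inv y) \<omega>) \<in> carrier k" if "y \<in> ?T" for y
    using that T by (intro action_value[OF act F _ w]) auto
  have s: "?s \<in> fin_supp_funs k (carrier G)" using fin_supp_funs_add[OF k.ring_axioms f] .
  have "conv act ?s F \<omega> = (\<Oplus>\<^bsub>k\<^esub>y\<in>?T. ?s y \<otimes>\<^bsub>k\<^esub> F (act (inv y) \<omega>))"
    by (rule conv_superset[OF act s F w T(1,3,2)])
  also have "\<dots> = (\<Oplus>\<^bsub>k\<^esub>y\<in>?T. f y \<otimes>\<^bsub>k\<^esub> F (act (inv y) \<omega>) \<oplus>\<^bsub>k\<^esub> f' y \<otimes>\<^bsub>k\<^esub> F (act (inv y) \<omega>))"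
    using T fc Fc by (intro k.finsum_cong') (auto simp: k.l_distr subset_iff)
  also have "\<dots> = (\<Oplus>\<^bsub>k\<^esub>y\<in>?T. f y \<otimes>\<^bsub>k\<^esub> F (act (inv y) \<omega>)) \<oplus>\<^bsub>k\<^esub>
      (\<Oplus>\<^bsub>k\<^esub>y\<in>?T. f' y \<otimes>\<^bsub>k\<^esub> F (act (inv y) \<omega>))"
    using T fc Fc by (intro k.finsum_addf) (auto simp: subset_iff)
  also have "\<dots> = conv act f F \<omega> \<oplus>\<^bsub>k\<^esub> conv act f' F \<omega>"
    using conv_superset[OF act f(1) F w T(1) _ T(2)] conv_superset[OF act f(2) F w T(1) _ T(2)] by auto
  finally show ?thesis .
qed

lemma conv_add_right:
  assumes act: "action_on \<Omega> act" and f: "f \<in> fin_supp_funs k (carrier G)"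
    and F: "F \<in> \<Omega> \<rightarrow> carrier k" "F' \<in> \<Omega> \<rightarrow> carrier k" and w: "\<omega> \<in> \<Omega>"
  shows "conv act f (\<lambda>w\<in>\<Omega>. F w \<oplus>\<^bsub>k\<^esub> F' w) \<omega> = conv act f F \<omega> \<oplus>\<^bsub>k\<^esub> conv act f F' \<omega>"
proof -
  have c: "f y \<in> carrier k" "act (inv y) \<omega> \<in> \<Omega>"
    "F (act (inv y) \<omega>) \<in> carrier k" "F' (act (inv y) \<omega>) \<in> carrier k" if "y \<in> supp f" for y
    using that supp_sub[of f] fin_supp_funsD(1)[OF f] F w action_closed[OF act]
    by (auto simp: subset_iff Pi_def)
  have "conv act f (\<lambda>w\<in>\<Omega>. F w \<oplus>\<^bsub>k\<^esub> F' w) \<omega> = (\<Oplus>\<^bsub>k\<^esub>y\<in>supp f.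
      f y \<otimes>\<^bsub>k\<^esub> F (act (inv y) \<omega>) \<oplus>\<^bsub>k\<^esub> f y \<otimes>\<^bsub>k\<^esub> F' (act (inv y) \<omega>))"
    unfolding conv_def using c by (intro k.finsum_cong') (auto simp: k.r_distr)
  also have "\<dots> = conv act f F \<omega> \<oplus>\<^bsub>k\<^esub> conv act f F' \<omega>"
    unfolding conv_def using c by (intro k.finsum_addf) auto
  finally show ?thesis .
qed

lemma single_fin_supp: "single g \<in> fin_supp_funs k (carrier G)"
proof -
  have "supp (single g) \<subseteq> {g}" by (auto simp: supp_on_def single_def)
  then show ?thesis by (auto simp: fin_supp_funs_def single_def intro: finite_subset)
qed

lemma conv_single:
  assumes act: "action_on \<Omega> act" and g: "g \<in> carrier G" and F: "F \<in> \<Omega> \<rightarrow> carrier k" and w: "\<omega> \<in> \<Omega>"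
  shows "conv act (single g) F \<omega> = F (act (inv g) \<omega>)"
proof -
  have "F (act (inv g) \<omega>) \<in> carrier k" using F w g action_closed[OF act] by (auto simp: Pi_def)
  moreover have "conv act (single g) F \<omega> = (\<Oplus>\<^bsub>k\<^esub>y\<in>{g}. single g y \<otimes>\<^bsub>k\<^esub> F (act (inv y) \<omega>))"
    using g by (intro conv_superset[OF act single_fin_supp F w]) (auto simp: supp_on_def single_def)
  ultimately show ?thesis using g by (simp add: single_def)
qed

lemma mult_kG: "f \<otimes>\<^bsub>kG\<^esub> g = (\<lambda>x\<in>carrier G. conv (\<otimes>) f g x)"
  by (simp add: group_ring_def conv_def)

lemma carrier_kG: "carrier kG = fin_supp_funs k (carrier G)"
  by (simp add: group_ring_def)

lemma add_kG: "f \<oplus>\<^bsub>kG\<^esub> g = (\<lambda>x\<in>carrier G. f x \<oplus>\<^bsub>k\<^esub> g x)"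
  by (simp add: group_ring_def)

lemma zero_kG: "\<zero>\<^bsub>kG\<^esub> = (\<lambda>x\<in>carrier G. \<zero>\<^bsub>k\<^esub>)"
  by (simp add: group_ring_def)

lemma one_kG: "\<one>\<^bsub>kG\<^esub> = single \<one>"
  by (simp add: group_ring_def single_def)

lemma fin_supp_Pi: "f \<in> fin_supp_funs k X \<Longrightarrow> f \<in> X \<rightarrow> carrier k"
  by (auto simp: fin_supp_funs_def)

lemma supp_mult:
  assumes f: "f \<in> fin_supp_funs k (carrier G)" "g \<in> fin_supp_funs k (carrier G)"
  shows "supp (f \<otimes>\<^bsub>kG\<^esub> g) \<subseteq> (\<lambda>(y, z). y \<otimes> z) ` (supp f \<times> supp g)"
proof
  fix x assume x: "x \<in> supp (f \<otimes>\<^bsub>kG\<^esub> g)"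
  then have xc: "x \<in> carrier G" by (simp add: supp_on_def)
  have "\<exists>y\<in>supp f. f y \<otimes>\<^bsub>k\<^esub> g (inv y \<otimes> x) \<noteq> \<zero>\<^bsub>k\<^esub>"
  proof (rule ccontr)
    assume "\<not> ?thesis"
    then have "conv (\<otimes>) f g x = \<zero>\<^bsub>k\<^esub>" unfolding conv_def by (auto intro!: k.add.finprod_one_eqI)
    then show False using x by (auto simp: supp_on_def mult_kG)
  qed
  then obtain y where y: "y \<in> supp f" "f y \<otimes>\<^bsub>k\<^esub> g (inv y \<otimes> x) \<noteq> \<zero>\<^bsub>k\<^esub>" by blast
  have yc: "y \<in> carrier G" "f y \<in> carrier k" using y fin_supp_funsD(1)[OF f(1)] by (auto simp: supp_on_def)
  have "inv y \<otimes> x \<in> supp g" using y xc yc by (auto simp: supp_on_def)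
  moreover have "x = y \<otimes> (inv y \<otimes> x)" using xc yc by (simp flip: G.m_assoc)
  ultimately show "x \<in> (\<lambda>(y, z). y \<otimes> z) ` (supp f \<times> supp g)" using y(1) by force
qed

lemma mult_fin_supp:
  assumes f: "f \<in> fin_supp_funs k (carrier G)" "g \<in> fin_supp_funs k (carrier G)"
  shows "f \<otimes>\<^bsub>kG\<^esub> g \<in> fin_supp_funs k (carrier G)"
proof -
  have "finite (supp (f \<otimes>\<^bsub>kG\<^esub> g))"
    by (rule finite_subset[OF supp_mult[OF f]]) (simp add: fin_supp_funsD(3) f)
  moreover have "conv (\<otimes>) f g x \<in> carrier k" if "x \<in> carrier G" for x
    using conv_closed[OF action_regular f(1) fin_supp_Pi[OF f(2)] that] .
  ultimately show ?thesis by (auto simp: fin_supp_funs_def mult_kG)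
qed

lemma conv_assoc:
  assumes act: "action_on \<Omega> act" and f: "f \<in> fin_supp_funs k (carrier G)" "g \<in> fin_supp_funs k (carrier G)"
    and F: "F \<in> \<Omega> \<rightarrow> carrier k" and w: "\<omega> \<in> \<Omega>"
  shows "conv act (f \<otimes>\<^bsub>kG\<^esub> g) F \<omega> = conv act f (\<lambda>w\<in>\<Omega>. conv act g F w) \<omega>"
proof -
  define A where "A = supp f"
  define T where "T = (\<lambda>(y, z). y \<otimes> z) ` (A \<times> supp g)"
  have A: "finite A" "A \<subseteq> carrier G" unfolding A_def using f supp_sub by (auto dest: fin_supp_funsD)
  have T: "finite T" "T \<subseteq> carrier G" "supp (f \<otimes>\<^bsub>kG\<^esub> g) \<subseteq> T"
    using A f(2) supp_sub[of g] supp_mult[OF f] fin_supp_funsD(3)[OF f(2)] by (auto simp: T_def A_def)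
  have fc: "f y \<in> carrier k" "g y \<in> carrier k" if "y \<in> carrier G" for y
    using that f by (auto dest: fin_supp_funsD)
  have Fc: "F (act y \<omega>) \<in> carrier k" if "y \<in> carrier G" for y
    using that F w action_closed[OF act] by (auto simp: Pi_def)
  have Ac: "y \<in> carrier G" if "y \<in> A" for y using that A by auto
  have Tc: "y \<in> carrier G" if "y \<in> T" for y using that T by auto
  have inner: "(\<Oplus>\<^bsub>k\<^esub>h\<in>T. g (inv y \<otimes> h) \<otimes>\<^bsub>k\<^esub> F (act (inv h) \<omega>)) = conv act g F (act (inv y) \<omega>)"
    if y: "y \<in> A" for y
  proof -
    let ?R = "(\<lambda>h. inv y \<otimes> h) ` T"
    have yc: "y \<in> carrier G" using y Ac by auto
    have R: "finite ?R" "?R \<subseteq> carrier G" using T yc by auto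
    have "supp g \<subseteq> ?R"
    proof
      fix z assume z: "z \<in> supp g"
      then have "z = inv y \<otimes> (y \<otimes> z)" using yc by (simp add: supp_on_def flip: G.m_assoc)
      moreover have "y \<otimes> z \<in> T" using y z by (auto simp: T_def)
      ultimately show "z \<in> ?R" by blast
    qed
    then have "conv act g F (act (inv y) \<omega>) =
        (\<Oplus>\<^bsub>k\<^esub>z\<in>?R. g z \<otimes>\<^bsub>k\<^esub> F (act (inv z) (act (inv y) \<omega>)))"
      using R by (intro conv_superset[OF act f(2) F]) (auto intro!: action_closed[OF act] yc w)
    also have "\<dots> = (\<Oplus>\<^bsub>k\<^esub>h\<in>T. g (inv y \<otimes> h) \<otimes>\<^bsub>k\<^esub>
        F (act (inv (inv y \<otimes> h)) (act (inv y) \<omega>)))"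
      using T yc w F fc action_closed[OF act]
      by (intro k.finsum_reindex) (auto simp: inj_on_def Pi_def subset_iff)
    also have "\<dots> = (\<Oplus>\<^bsub>k\<^esub>h\<in>T. g (inv y \<otimes> h) \<otimes>\<^bsub>k\<^esub> F (act (inv h) \<omega>))"
    proof (rule k.finsum_cong')
      fix h assume "h \<in> T"
      then have h: "h \<in> carrier G" using Tc by auto
      have "act (inv (inv y \<otimes> h)) (act (inv y) \<omega>) = act (inv (inv y \<otimes> h) \<otimes> inv y) \<omega>"
        using h yc w by (intro action_mult[OF act, symmetric]) auto
      also have "inv (inv y \<otimes> h) \<otimes> inv y = inv h"
        using h yc by (simp add: G.inv_mult_group G.m_assoc)
      finally show "g (inv y \<otimes> h) \<otimes>\<^bsub>k\<^esub> F (act (inv (inv y \<otimes> h)) (act (inv y) \<omega>)) =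
        g (inv y \<otimes> h) \<otimes>\<^bsub>k\<^esub> F (act (inv h) \<omega>)" by simp
    qed (use yc fc Fc Tc in auto)
    finally show ?thesis by simp
  qed
  have "conv act (f \<otimes>\<^bsub>kG\<^esub> g) F \<omega> =
      (\<Oplus>\<^bsub>k\<^esub>h\<in>T. (f \<otimes>\<^bsub>kG\<^esub> g) h \<otimes>\<^bsub>k\<^esub> F (act (inv h) \<omega>))"
    by (rule conv_superset[OF act mult_fin_supp[OF f] F w T(1,3,2)])
  also have "\<dots> = (\<Oplus>\<^bsub>k\<^esub>h\<in>T. \<Oplus>\<^bsub>k\<^esub>y\<in>A. f y \<otimes>\<^bsub>k\<^esub> (g (inv y \<otimes> h) \<otimes>\<^bsub>k\<^esub> F (act (inv h) \<omega>)))"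
  proof (rule k.finsum_cong')
    fix h assume "h \<in> T"
    then have h: "h \<in> carrier G" using Tc by auto
    have "(f \<otimes>\<^bsub>kG\<^esub> g) h \<otimes>\<^bsub>k\<^esub> F (act (inv h) \<omega>) =
      (\<Oplus>\<^bsub>k\<^esub>y\<in>A. (f y \<otimes>\<^bsub>k\<^esub> g (inv y \<otimes> h)) \<otimes>\<^bsub>k\<^esub> F (act (inv h) \<omega>))"
      using h A Ac fc Fc by (simp add: mult_kG conv_def A_def[symmetric]) (intro k.finsum_ldistr, auto)
    also have "\<dots> = (\<Oplus>\<^bsub>k\<^esub>y\<in>A. f y \<otimes>\<^bsub>k\<^esub> (g (inv y \<otimes> h) \<otimes>\<^bsub>k\<^esub> F (act (inv h) \<omega>)))"
      using h Ac fc Fc by (intro k.finsum_cong') (auto intro!: k.m_assoc)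
    finally show "(f \<otimes>\<^bsub>kG\<^esub> g) h \<otimes>\<^bsub>k\<^esub> F (act (inv h) \<omega>) =
      (\<Oplus>\<^bsub>k\<^esub>y\<in>A. f y \<otimes>\<^bsub>k\<^esub> (g (inv y \<otimes> h) \<otimes>\<^bsub>k\<^esub> F (act (inv h) \<omega>)))" .
  qed (use Ac Tc fc Fc in \<open>auto intro!: k.finsum_closed\<close>)
  also have "\<dots> = (\<Oplus>\<^bsub>k\<^esub>y\<in>A. \<Oplus>\<^bsub>k\<^esub>h\<in>T. f y \<otimes>\<^bsub>k\<^esub> (g (inv y \<otimes> h) \<otimes>\<^bsub>k\<^esub> F (act (inv h) \<omega>)))"
    using A T Ac Tc fc Fc by (intro k.finsum_swap) auto
  also have "\<dots> = (\<Oplus>\<^bsub>k\<^esub>y\<in>A. f y \<otimes>\<^bsub>k\<^esub> (\<lambda>w\<in>\<Omega>. conv act g F w) (act (inv y) \<omega>))"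
  proof (rule k.finsum_cong')
    fix y assume y: "y \<in> A"
    have "(\<Oplus>\<^bsub>k\<^esub>h\<in>T. f y \<otimes>\<^bsub>k\<^esub> (g (inv y \<otimes> h) \<otimes>\<^bsub>k\<^esub> F (act (inv h) \<omega>))) =
       f y \<otimes>\<^bsub>k\<^esub> (\<Oplus>\<^bsub>k\<^esub>h\<in>T. g (inv y \<otimes> h) \<otimes>\<^bsub>k\<^esub> F (act (inv h) \<omega>))"
      using y T Ac Tc fc Fc by (intro k.finsum_rdistr[symmetric]) auto
    then show "(\<Oplus>\<^bsub>k\<^esub>h\<in>T. f y \<otimes>\<^bsub>k\<^esub> (g (inv y \<otimes> h) \<otimes>\<^bsub>k\<^esub> F (act (inv h) \<omega>))) =
        f y \<otimes>\<^bsub>k\<^esub> (\<lambda>w\<in>\<Omega>. conv act g F w) (act (inv y) \<omega>)"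
      using inner[OF y] Ac[OF y] w action_closed[OF act] by simp
  next
    show "(\<lambda>y. f y \<otimes>\<^bsub>k\<^esub> (\<lambda>w\<in>\<Omega>. conv act g F w) (act (inv y) \<omega>)) \<in> A \<rightarrow> carrier k"
      using Ac fc w action_closed[OF act] conv_closed[OF act f(2) F] by auto
  qed simp
  finally show ?thesis by (simp add: conv_def A_def)
qed

lemma ring_kG: "ring kG"
proof (rule ringI)
  show ab: "abelian_group kG"
    by (rule fin_supp_funs_abelian_group[OF k.ring_axioms]) (simp_all add: group_ring_def)
  have one_r: "f \<otimes>\<^bsub>kG\<^esub> \<one>\<^bsub>kG\<^esub> = f" if f: "f \<in> carrier kG" for f
  proof -
    have fs: "f \<in> fin_supp_funs k (carrier G)" using f by (simp add: carrier_kG)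
    note fc = fin_supp_funsD[OF fs]
    have "conv (\<otimes>) f (single \<one>) x = f x" if x: "x \<in> carrier G" for x
    proof -
      have "conv (\<otimes>) f (single \<one>) x =
        (\<Oplus>\<^bsub>k\<^esub>y\<in>insert x (supp f). f y \<otimes>\<^bsub>k\<^esub> single \<one> (inv y \<otimes> x))"
        using x supp_sub fc
        by (intro conv_superset[OF action_regular fs fin_supp_Pi[OF single_fin_supp]]) auto
      also have "\<dots> = (\<Oplus>\<^bsub>k\<^esub>y\<in>insert x (supp f). if x = y then f y else \<zero>\<^bsub>k\<^esub>)"
      proof (rule k.finsum_cong')
        fix y assume "y \<in> insert x (supp f)"
        then have y: "y \<in> carrier G" using x supp_sub by auto
        have "inv y \<otimes> x = \<one> \<longleftrightarrow> x = y" using x y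
          by (metis G.inv_closed G.inv_equality G.inv_inv G.l_inv)
        then show "f y \<otimes>\<^bsub>k\<^esub> single \<one> (inv y \<otimes> x) = (if x = y then f y else \<zero>\<^bsub>k\<^esub>)"
          using x y fc by (simp add: single_def)
      qed (use fc x supp_sub[of f] in \<open>auto simp: supp_on_def\<close>)
      also have "\<dots> = f x" using fc x supp_sub[of f] by (intro k.finsum_singleton) (auto simp: supp_on_def)
      finally show ?thesis .
    qed
    then show ?thesis using fc by (auto simp: one_kG mult_kG extensional_def fun_eq_iff)
  qed
  have one_l: "\<one>\<^bsub>kG\<^esub> \<otimes>\<^bsub>kG\<^esub> f = f" if f: "f \<in> carrier kG" for f
  proof -
    have fs: "f \<in> fin_supp_funs k (carrier G)" using f by (simp add: carrier_kG)
    have "conv (\<otimes>) (single \<one>) f x = f x" if "x \<in> carrier G" for x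
      using conv_single[OF action_regular G.one_closed fin_supp_Pi[OF fs] that] that by simp
    then show ?thesis using fin_supp_funsD[OF fs] by (auto simp: one_kG mult_kG extensional_def fun_eq_iff)
  qed
  show "monoid kG"
  proof (rule monoidI)
    show "f \<otimes>\<^bsub>kG\<^esub> g \<in> carrier kG" if "f \<in> carrier kG" "g \<in> carrier kG" for f g
      using that mult_fin_supp by (simp add: carrier_kG)
    show "\<one>\<^bsub>kG\<^esub> \<in> carrier kG" by (simp add: one_kG carrier_kG single_fin_supp)
    fix f g h assume "f \<in> carrier kG" "g \<in> carrier kG" "h \<in> carrier kG"
    then have fs: "f \<in> fin_supp_funs k (carrier G)" "g \<in> fin_supp_funs k (carrier G)"
      "h \<in> fin_supp_funs k (carrier G)" by (auto simp: carrier_kG)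
    show "f \<otimes>\<^bsub>kG\<^esub> g \<otimes>\<^bsub>kG\<^esub> h = f \<otimes>\<^bsub>kG\<^esub> (g \<otimes>\<^bsub>kG\<^esub> h)"
      using conv_assoc[OF action_regular fs(1,2) fin_supp_Pi[OF fs(3)]]
      by (subst (1 3 4) mult_kG) (auto intro!: restrict_ext)
  qed (use one_l one_r in auto)
  fix f g h assume "f \<in> carrier kG" "g \<in> carrier kG" "h \<in> carrier kG"
  then have fs: "f \<in> fin_supp_funs k (carrier G)" "g \<in> fin_supp_funs k (carrier G)"
    "h \<in> fin_supp_funs k (carrier G)" by (auto simp: carrier_kG)
  show "(f \<oplus>\<^bsub>kG\<^esub> g) \<otimes>\<^bsub>kG\<^esub> h = f \<otimes>\<^bsub>kG\<^esub> h \<oplus>\<^bsub>kG\<^esub> g \<otimes>\<^bsub>kG\<^esub> h"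
    using conv_add_left[OF action_regular fs(1,2) fin_supp_Pi[OF fs(3)]]
    by (auto simp: mult_kG add_kG intro!: restrict_ext)
  show "h \<otimes>\<^bsub>kG\<^esub> (f \<oplus>\<^bsub>kG\<^esub> g) = h \<otimes>\<^bsub>kG\<^esub> f \<oplus>\<^bsub>kG\<^esub> h \<otimes>\<^bsub>kG\<^esub> g"
    using conv_add_right[OF action_regular fs(3) fin_supp_Pi[OF fs(1)] fin_supp_Pi[OF fs(2)]]
    by (auto simp: mult_kG add_kG intro!: restrict_ext)
qed

lemma single_mult:
  assumes "g \<in> carrier G" "h \<in> carrier G"
  shows "single g \<otimes>\<^bsub>kG\<^esub> single h = single (g \<otimes> h)"
proof -
  have "conv (\<otimes>) (single g) (single h) x = (if x = g \<otimes> h then \<one>\<^bsub>k\<^esub> else \<zero>\<^bsub>k\<^esub>)" if x: "x \<in> carrier G" for x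
  proof -
    have "inv g \<otimes> x = h \<longleftrightarrow> x = g \<otimes> h"
      using assms x by (metis G.inv_closed G.inv_solve_left)
    then show ?thesis
      using conv_single[OF action_regular assms(1) fin_supp_Pi[OF single_fin_supp[of h]] x] assms x
      by (simp add: single_def)
  qed
  then show ?thesis by (auto simp: mult_kG single_def intro!: restrict_ext)
qed

lemma single_closed: "single g \<in> carrier kG"
  by (simp add: carrier_kG single_fin_supp)

end

section \<open>Modules over the group ring\<close>

text \<open>
  The coefficient ring \<open>k\<close> is a quotient of the integers, so every additive map is \<open>k\<close>-linear: a
  \<open>k[G]\<close>-linear map is an additive map that commutes with the elements of \<open>G\<close>, and a submodule is an
  additive subgroup that is stable under them.
\<close>

locale cyclic_group_algebra = group_algebra G k
  for G :: "('g, 'b) monoid_scheme" (structure) and k :: "('r, 'c) ring_scheme" +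
  fixes n :: nat
  assumes sqfree: "squarefree n"
    and char: "[n] \<cdot>\<^bsub>k\<^esub> \<one>\<^bsub>k\<^esub> = \<zero>\<^bsub>k\<^esub>"
    and cyclic: "c \<in> carrier k \<Longrightarrow> \<exists>m::nat. c = [m] \<cdot>\<^bsub>k\<^esub> \<one>\<^bsub>k\<^esub>"
begin

lemma n_pos: "n > 0"
  using sqfree by (auto intro: Nat.gr0I)

lemma finite_k: "finite (carrier k)"
proof -
  have "c \<in> (\<lambda>m. [m] \<cdot>\<^bsub>k\<^esub> \<one>\<^bsub>k\<^esub>) ` {..<n}" if "c \<in> carrier k" for c
  proof -
    obtain m :: nat where m: "c = [m] \<cdot>\<^bsub>k\<^esub> \<one>\<^bsub>k\<^esub>" using cyclic[OF \<open>c \<in> carrier k\<close>] by blast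
    have "[m] \<cdot>\<^bsub>k\<^esub> \<one>\<^bsub>k\<^esub> = [(n * (m div n) + m mod n)] \<cdot>\<^bsub>k\<^esub> \<one>\<^bsub>k\<^esub>" by simp
    also have "\<dots> = [(n * (m div n))] \<cdot>\<^bsub>k\<^esub> \<one>\<^bsub>k\<^esub> \<oplus>\<^bsub>k\<^esub> [(m mod n)] \<cdot>\<^bsub>k\<^esub> \<one>\<^bsub>k\<^esub>"
      by (simp only: k.add.nat_pow_mult[OF k.one_closed])
    also have "[(n * (m div n))] \<cdot>\<^bsub>k\<^esub> \<one>\<^bsub>k\<^esub> = \<zero>\<^bsub>k\<^esub>"
      using k.add.nat_pow_pow[OF k.one_closed, of "m div n" n] char by simp
    finally have "c = [(m mod n)] \<cdot>\<^bsub>k\<^esub> \<one>\<^bsub>k\<^esub>" using m by simp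
    then show ?thesis using n_pos by auto
  qed
  then show ?thesis by (meson finite_imageI finite_lessThan finite_subset subsetI)
qed

text \<open>
  Every coefficient is a sum of ones, so the group elements generate \<open>k[G]\<close> as an additive monoid.
\<close>

lemma kG_induct [consumes 1, case_names zero single_add]:
  assumes a: "a \<in> carrier kG" and zero: "P \<zero>\<^bsub>kG\<^esub>"
    and step: "\<And>g a. g \<in> carrier G \<Longrightarrow> a \<in> carrier kG \<Longrightarrow> P a \<Longrightarrow> P (single g \<oplus>\<^bsub>kG\<^esub> a)"
  shows "P a"
proof -
  have "\<forall>a\<in>carrier kG. supp a \<subseteq> X \<longrightarrow> P a" if "finite X" for X
    using that
  proof (induction X rule: finite_induct)
    case empty
    have "a = \<zero>\<^bsub>kG\<^esub>" if "a \<in> carrier kG" "supp a \<subseteq> {}" for a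
      using that by (auto simp: supp_on_def zero_kG carrier_kG fin_supp_funs_def PiE_iff extensional_def fun_eq_iff)
    then show ?case using zero by blast
  next
    case (insert x X)
    have "P a" if "a \<in> carrier kG" "supp a \<subseteq> insert x X" "a x = [m] \<cdot>\<^bsub>k\<^esub> \<one>\<^bsub>k\<^esub>" for m :: nat and a
      using that
    proof (induction m arbitrary: a)
      case 0
      then have "supp a \<subseteq> X" by (auto simp: supp_on_def)
      then show ?case using insert 0 by blast
    next
      case (Suc m)
      show ?case
      proof (cases "x \<in> carrier G")
        case False
        then have "supp a \<subseteq> X" using Suc.prems(2) by (auto simp: supp_on_def)
        then show ?thesis using insert Suc.prems by blast
      next
        case True
        define b where "b = (\<lambda>y\<in>carrier G. if y = x then [m] \<cdot>\<^bsub>k\<^esub> \<one>\<^bsub>k\<^esub> else a y)"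
        have s: "supp b \<subseteq> insert x X" using Suc.prems(2) by (auto simp: supp_on_def b_def)
        have ac: "a \<in> fin_supp_funs k (carrier G)" using Suc.prems by (simp add: carrier_kG)
        have b: "b \<in> carrier kG"
          using s insert(1) fin_supp_funsD(1)[OF ac]
          by (auto simp: carrier_kG fin_supp_funs_def b_def intro: finite_subset)
        have "b x = [m] \<cdot>\<^bsub>k\<^esub> \<one>\<^bsub>k\<^esub>" using True by (simp add: b_def)
        then have "P b" using Suc.IH[OF b s] by blast
        moreover have "a = single x \<oplus>\<^bsub>kG\<^esub> b"
        proof -
          have "single x y \<oplus>\<^bsub>k\<^esub> b y = a y" if "y \<in> carrier G" for y
            using that Suc.prems(3) fin_supp_funsD(1)[OF ac] by (auto simp: single_def b_def k.a_comm)
          then show ?thesis using fin_supp_funsD(2)[OF ac]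
            by (auto simp: add_kG extensional_def fun_eq_iff)
        qed
        ultimately show ?thesis using step[OF True b] by simp
      qed
    qed
    moreover have "\<exists>m::nat. a x = [m] \<cdot>\<^bsub>k\<^esub> \<one>\<^bsub>k\<^esub>" if "a \<in> carrier kG" "x \<in> carrier G" for a
      using that by (intro cyclic) (auto simp: carrier_kG dest: fin_supp_funsD)
    moreover have "supp a \<subseteq> X" if "supp a \<subseteq> insert x X" "x \<notin> carrier G" for a
      using that by (auto simp: supp_on_def)
    ultimately show ?case using insert by metis
  qed
  moreover have "finite (supp a)" using a by (auto simp: carrier_kG dest: fin_supp_funsD)
  ultimately show ?thesis using a by blast
qed

abbreviation gact :: "('g \<Rightarrow> 'r, 'm, 'd) module_scheme \<Rightarrow> 'g \<Rightarrow> 'm \<Rightarrow> 'm" ("(_ \<bullet>\<index>/ _)" [76,75] 75)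
  where "gact M g x \<equiv> single g \<odot>\<^bsub>M\<^esub> x"

end

definition additive_on :: "('m, 'd) ring_scheme \<Rightarrow> ('n, 'e) ring_scheme \<Rightarrow> 'm set \<Rightarrow> ('m \<Rightarrow> 'n) \<Rightarrow> bool"
  where "additive_on M N U h \<longleftrightarrow>
    h \<in> U \<rightarrow> carrier N \<and> (\<forall>x\<in>U. \<forall>y\<in>U. h (x \<oplus>\<^bsub>M\<^esub> y) = h x \<oplus>\<^bsub>N\<^esub> h y)"

lemma additive_onD:
  assumes "additive_on M N U h"
  shows "x \<in> U \<Longrightarrow> h x \<in> carrier N" "x \<in> U \<Longrightarrow> y \<in> U \<Longrightarrow> h (x \<oplus>\<^bsub>M\<^esub> y) = h x \<oplus>\<^bsub>N\<^esub> h y"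
  using assms by (auto simp: additive_on_def)

locale kG_module = cyclic_group_algebra G k n + left_module "group_ring k G" M
  for G :: "('g, 'b) monoid_scheme" and k :: "('r, 'c) ring_scheme" and n
    and M :: "('g \<Rightarrow> 'r, 'm, 'd) module_scheme" (structure)
begin

abbreviation asub :: "'m set \<Rightarrow> bool" where "asub U \<equiv> subgroup U (add_monoid M)"

lemma gact_closed [simp]: "x \<in> carrier M \<Longrightarrow> g \<bullet> x \<in> carrier M"
  by (intro smult_closed single_closed)

lemma gact_add: "x \<in> carrier M \<Longrightarrow> y \<in> carrier M \<Longrightarrow> g \<bullet> (x \<oplus> y) = g \<bullet> x \<oplus> g \<bullet> y"
  by (intro smult_r_distr single_closed)

lemma gact_mult:
  "g \<in> carrier G \<Longrightarrow> h \<in> carrier G \<Longrightarrow> x \<in> carrier M \<Longrightarrow> (g \<otimes>\<^bsub>G\<^esub> h) \<bullet> x = g \<bullet> (h \<bullet> x)"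
  using smult_assoc1[OF single_closed single_closed, of x g h] by (simp add: single_mult)

lemma gact_one [simp]: "x \<in> carrier M \<Longrightarrow> \<one>\<^bsub>G\<^esub> \<bullet> x = x"
  using smult_one by (simp add: one_kG)

lemma gact_inv [simp]:
  assumes "g \<in> carrier G" "x \<in> carrier M"
  shows "inv\<^bsub>G\<^esub> g \<bullet> (g \<bullet> x) = x" "g \<bullet> (inv\<^bsub>G\<^esub> g \<bullet> x) = x"
  using assms gact_mult[of "inv\<^bsub>G\<^esub> g" g x] gact_mult[of g "inv\<^bsub>G\<^esub> g" x] by simp_all

lemma gact_zero [simp]: "g \<bullet> \<zero> = \<zero>"
  by (intro smult_r_null single_closed)

lemma gact_neg: 
  assumes x: "x \<in> carrier M" shows "g \<bullet> (\<ominus> x) = \<ominus> (g \<bullet> x)"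
proof -
  have "g \<bullet> (\<ominus> x) \<oplus> g \<bullet> x = \<zero>" using x by (simp add: M.l_neg flip: gact_add)
  then show ?thesis using x by (intro M.minus_equality[symmetric]) auto
qed

lemma nat_mult_kG: "([m] \<cdot>\<^bsub>kG\<^esub> \<one>\<^bsub>kG\<^esub>) = (\<lambda>x\<in>carrier G. if x = \<one>\<^bsub>G\<^esub> then [m] \<cdot>\<^bsub>k\<^esub> \<one>\<^bsub>k\<^esub> else \<zero>\<^bsub>k\<^esub>)" for m :: nat
  by (induction m) (auto simp: zero_kG add_kG one_kG single_def intro!: restrict_ext)

lemma nat_mult_smult: "x \<in> carrier M \<Longrightarrow> ([m] \<cdot>\<^bsub>kG\<^esub> \<one>\<^bsub>kG\<^esub>) \<odot> x = [m] \<cdot> x" for m :: nat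
  by (induction m) (simp_all add: smult_l_null smult_l_distr)

lemma exponent: 
  assumes x: "x \<in> carrier M" shows "[n] \<cdot> x = \<zero>"
proof -
  have "[n] \<cdot>\<^bsub>kG\<^esub> \<one>\<^bsub>kG\<^esub> = \<zero>\<^bsub>kG\<^esub>" by (auto simp: nat_mult_kG char zero_kG intro!: restrict_ext)
  then show ?thesis using nat_mult_smult[OF x, of n] x by (simp add: smult_l_null)
qed

lemma neg_eq_multiple:
  assumes x: "x \<in> carrier M" shows "\<ominus> x = [(n - 1)] \<cdot> x"
proof -
  have "[(n - 1)] \<cdot> x \<oplus> x = [(n - 1 + 1)] \<cdot> x" using x by simp
  also have "\<dots> = \<zero>" using n_pos exponent[OF x] by simp
  finally show ?thesis using x by (intro M.minus_equality) auto
qed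

text \<open>
  Closure under negation is automatic, since \<open>\<ominus> x\<close> is the multiple \<open>n - 1\<close> of \<open>x\<close>.
\<close>

lemma asubI:
  assumes "U \<subseteq> carrier M" "\<zero> \<in> U" "\<And>x y. x \<in> U \<Longrightarrow> y \<in> U \<Longrightarrow> x \<oplus> y \<in> U"
  shows "asub U"
proof -
  have "[m] \<cdot> x \<in> U" if "x \<in> U" for x and m :: nat
    using assms that by (induction m) auto
  then show ?thesis
    using assms neg_eq_multiple by (intro M.add.subgroupI) (auto simp: subset_iff a_inv_def[symmetric])
qed

lemma asubD:
  assumes "asub U"
  shows "U \<subseteq> carrier M" "x \<in> U \<Longrightarrow> x \<in> carrier M" "\<zero> \<in> U" "x \<in> U \<Longrightarrow> y \<in> U \<Longrightarrow> x \<oplus> y \<in> U"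
    "x \<in> U \<Longrightarrow> \<ominus> x \<in> U" "x \<in> U \<Longrightarrow> y \<in> U \<Longrightarrow> x \<ominus> y \<in> U"
  using subgroup.subset[OF assms] subgroup.one_closed[OF assms] subgroup.m_closed[OF assms]
    subgroup.m_inv_closed[OF assms]
  by (auto simp: a_inv_def[symmetric] a_minus_def)

lemma asub_finsum:
  assumes "asub U" "finite A" "f \<in> A \<rightarrow> U"
  shows "(\<Oplus>i\<in>A. f i) \<in> U"
  using assms(2,3)
proof (induction A rule: finite_induct)
  case empty
  then show ?case using asubD(3)[OF assms(1)] by simp
next
  case (insert a A)
  then have "(\<Oplus>i\<in>insert a A. f i) = f a \<oplus> (\<Oplus>i\<in>A. f i)"
    using asubD(1)[OF assms(1)] by (intro M.finsum_insert) auto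
  then show ?case using insert asubD(4)[OF assms(1)] by auto
qed

lemma asub_retraction:
  assumes U: "asub U" "finite U" and A: "asub A" "A \<subseteq> U"
  obtains r where "r \<in> U \<rightarrow> A" "additive_on M M U r" "\<And>a. a \<in> A \<Longrightarrow> r a = a"
proof -
  let ?U = "(add_monoid M)\<lparr>carrier := U\<rparr>"
  interpret U: comm_group ?U
    using group.group_comm_groupI[OF M.add.subgroup_imp_group[OF U(1)]] asubD(2)[OF U(1)]
    by (simp add: M.a_comm)
  have pow: "x [^]\<^bsub>?U\<^esub> m = [m] \<cdot> x" for x and m :: nat
    by (simp add: add_pow_def nat_pow_def)
  have "subgroup A ?U" using M.add.subgroup_incl[OF A(1) U(1) A(2)] .
  moreover have "x [^]\<^bsub>?U\<^esub> n = \<one>\<^bsub>?U\<^esub>" if "x \<in> carrier ?U" for x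
    unfolding pow using that exponent asubD(2)[OF U(1)] by simp
  moreover have "finite (carrier ?U)" using U by simp
  ultimately obtain r where r: "r \<in> carrier ?U \<rightarrow> A"
    "\<And>x y. x \<in> carrier ?U \<Longrightarrow> y \<in> carrier ?U \<Longrightarrow> r (x \<otimes>\<^bsub>?U\<^esub> y) = r x \<otimes>\<^bsub>?U\<^esub> r y" "\<And>a. a \<in> A \<Longrightarrow> r a = a"
    using U.squarefree_exponent_retraction[OF _ sqfree] by metis
  then have "r \<in> U \<rightarrow> A" "additive_on M M U r"
    using A(2) asubD(1)[OF U(1)] by (auto simp: additive_on_def Pi_def subset_iff)
  then show ?thesis using that[of r] r(3) by blast
qed

lemma finite_asub_containing:
  assumes "finite X" "X \<subseteq> carrier M"
  obtains U where "asub U" "finite U" "X \<subseteq> U"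
  using M.add.finite_exponent_finite_subgroup[OF n_pos] assms exponent by auto

lemma submoduleI:
  assumes U: "U \<subseteq> carrier M" "\<zero> \<in> U" "\<And>x y. x \<in> U \<Longrightarrow> y \<in> U \<Longrightarrow> x \<oplus> y \<in> U"
    and act: "\<And>g x. g \<in> carrier G \<Longrightarrow> x \<in> U \<Longrightarrow> g \<bullet> x \<in> U"
  shows "submodule U kG M"
proof -
  have "a \<odot> x \<in> U" if "a \<in> carrier kG" "x \<in> U" for a x
    using that(1)
  proof (induction rule: kG_induct)
    case zero
    then show ?case using U that(2) smult_l_null by auto
  next
    case (single_add g a)
    have "(single g \<oplus>\<^bsub>kG\<^esub> a) \<odot> x = g \<bullet> x \<oplus> a \<odot> x"
      using single_add U(1) that(2) by (intro smult_l_distr single_closed) auto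
    then show ?case using single_add U act that(2) by auto
  qed
  then show ?thesis using asubI[OF U] by (intro submodule.intro submodule_axioms.intro) auto
qed

lemma submodule_left_module:
  assumes "submodule U kG M"
  shows "left_module kG (M\<lparr>carrier := U\<rparr>)"
proof -
  have U: "asub U" using assms by (rule submodule.axioms)
  note D = asubD[OF U]
  have "abelian_group (M\<lparr>carrier := U\<rparr>)"
  proof (rule abelian_groupI)
    show "\<exists>y\<in>carrier (M\<lparr>carrier := U\<rparr>). y \<oplus>\<^bsub>M\<lparr>carrier := U\<rparr>\<^esub> x = \<zero>\<^bsub>M\<lparr>carrier := U\<rparr>\<^esub>"
      if "x \<in> carrier (M\<lparr>carrier := U\<rparr>)" for x
      using that D by (auto intro!: bexI[of _ "\<ominus> x"] simp: M.l_neg)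
  qed (use D in \<open>auto simp: M.a_ac\<close>)
  then show ?thesis
    using D submodule.smult_closed[OF assms]
    by (intro left_module.intro left_module_axioms.intro R.ring_axioms)
      (auto simp: smult_l_distr smult_r_distr smult_assoc1)
qed

end

context cyclic_group_algebra
begin

lemma kG_moduleI: "left_module kG M \<Longrightarrow> kG_module G k n M"
  by (intro kG_module.intro cyclic_group_algebra_axioms)

lemma left_module_homI:
  assumes M: "left_module kG M" and N: "left_module kG N" and h: "additive_on M N (carrier M) h"
    and act: "\<And>g x. g \<in> carrier G \<Longrightarrow> x \<in> carrier M \<Longrightarrow> h (g \<bullet>\<^bsub>M\<^esub> x) = g \<bullet>\<^bsub>N\<^esub> h x"
  shows "h \<in> left_module_hom kG M N"
proof -
  interpret M: kG_module G k n M by (rule kG_moduleI[OF M])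
  interpret N: kG_module G k n N by (rule kG_moduleI[OF N])
  note hD = additive_onD[OF h]
  have h0: "h \<zero>\<^bsub>M\<^esub> = \<zero>\<^bsub>N\<^esub>" using hD(2)[of "\<zero>\<^bsub>M\<^esub>" "\<zero>\<^bsub>M\<^esub>"] hD(1)[of "\<zero>\<^bsub>M\<^esub>"] by simp
  have "h (a \<odot>\<^bsub>M\<^esub> x) = a \<odot>\<^bsub>N\<^esub> h x" if "a \<in> carrier kG" "x \<in> carrier M" for a x
    using that(1)
  proof (induction rule: kG_induct)
    case zero
    then show ?case using that(2) hD h0 by (simp add: M.smult_l_null N.smult_l_null)
  next
    case (single_add g a)
    then show ?case using that(2) hD single_closed[of g] act
      by (simp add: M.smult_l_distr N.smult_l_distr)
  qed
  then show ?thesis using h by (auto simp: left_module_hom_def additive_on_def)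
qed

lemma additive_on_zero:
  assumes "left_module kG M" "left_module kG N" "additive_on M N U h" "subgroup U (add_monoid M)"
  shows "h \<zero>\<^bsub>M\<^esub> = \<zero>\<^bsub>N\<^esub>"
proof -
  interpret M: kG_module G k n M by (rule kG_moduleI[OF assms(1)])
  interpret N: kG_module G k n N by (rule kG_moduleI[OF assms(2)])
  note hD = additive_onD[OF assms(3)]
  have "\<zero>\<^bsub>M\<^esub> \<in> U" using M.asubD(3)[OF assms(4)] .
  then show ?thesis using hD(2)[of "\<zero>\<^bsub>M\<^esub>" "\<zero>\<^bsub>M\<^esub>"] hD(1)[of "\<zero>\<^bsub>M\<^esub>"] by simp
qed

lemma additive_on_neg:
  assumes "left_module kG M" "left_module kG N" "additive_on M N U h" "subgroup U (add_monoid M)"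
    and x: "x \<in> U"
  shows "h (\<ominus>\<^bsub>M\<^esub> x) = \<ominus>\<^bsub>N\<^esub> h x"
proof -
  interpret M: kG_module G k n M by (rule kG_moduleI[OF assms(1)])
  interpret N: kG_module G k n N by (rule kG_moduleI[OF assms(2)])
  note hD = additive_onD[OF assms(3)]
  have m: "\<ominus>\<^bsub>M\<^esub> x \<in> U" "x \<in> carrier M" using M.asubD[OF assms(4)] x by auto
  have "h (\<ominus>\<^bsub>M\<^esub> x) \<oplus>\<^bsub>N\<^esub> h x = h (\<ominus>\<^bsub>M\<^esub> x \<oplus>\<^bsub>M\<^esub> x)" using hD m x by simp
  also have "\<dots> = \<zero>\<^bsub>N\<^esub>" using m additive_on_zero[OF assms(1-4)] by (simp add: M.M.l_neg)
  finally show ?thesis using hD m x by (intro N.M.minus_equality[symmetric]) auto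
qed

end

section \<open>Normal subgroups of finite index\<close>

context group
begin

lemma rcoset_eq_iff:
  assumes L: "subgroup L G" and x: "x \<in> carrier G" "y \<in> carrier G"
  shows "L #> x = L #> y \<longleftrightarrow> x \<otimes> inv y \<in> L"
proof
  assume "L #> x = L #> y"
  then have "x \<in> L #> y" using rcos_self[OF x(1) L] by simp
  then obtain h where "h \<in> L" "x = h \<otimes> y" by (auto simp: r_coset_def)
  then show "x \<otimes> inv y \<in> L" using subgroup.mem_carrier[OF L] x by (simp add: m_assoc)
next
  assume "x \<otimes> inv y \<in> L"
  moreover have "x = (x \<otimes> inv y) \<otimes> y" using x by (simp add: m_assoc)
  ultimately have "x \<in> L #> y" unfolding r_coset_def by blast
  then show "L #> x = L #> y" using repr_independence[OF _ x(2) L] by simp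
qed

lemma finite_index_by_map:
  assumes L: "subgroup L G" and fin: "finite (\<phi> ` carrier G)"
    and sep: "\<And>x y. x \<in> carrier G \<Longrightarrow> y \<in> carrier G \<Longrightarrow> \<phi> x = \<phi> y \<Longrightarrow> x \<otimes> inv y \<in> L"
  shows "finite (rcosets L)"
proof (rule finite_subset)
  show "rcosets L \<subseteq> (\<lambda>v. L #> (SOME x. x \<in> carrier G \<and> \<phi> x = v)) ` \<phi> ` carrier G"
  proof
    fix C assume "C \<in> rcosets L"
    then obtain x where x: "x \<in> carrier G" "C = L #> x" by (auto simp: RCOSETS_def)
    define y where "y = (SOME y. y \<in> carrier G \<and> \<phi> y = \<phi> x)"
    have y: "y \<in> carrier G \<and> \<phi> y = \<phi> x" unfolding y_def by (rule someI_ex) (use x in blast)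
    then have "C = L #> y" using sep[of x y] x rcoset_eq_iff[OF L] by auto
    then show "C \<in> (\<lambda>v. L #> (SOME x. x \<in> carrier G \<and> \<phi> x = v)) ` \<phi> ` carrier G"
      using x(1) unfolding y_def by (auto intro!: image_eqI)
  qed
qed (use fin in simp)

lemma fin_index_normalsD:
  assumes "N \<in> fin_index_normals G"
  shows "N \<lhd> G" "subgroup N G" "finite (rcosets N)" "N \<subseteq> carrier G"
  using assms by (auto simp: fin_index_normals_def dest: normal_imp_subgroup subgroup.subset)

text \<open>
  \<open>N\<close> is the kernel of the action of the group on the finitely many cosets of \<open>L\<close>.
\<close>

lemma normal_core_exists:
  assumes L: "subgroup L G" and fin: "finite (rcosets L)"
  obtains N where "N \<in> fin_index_normals G" "N \<subseteq> L"
proof -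
  note Lc = subgroup.subset[OF L]
  define N where "N = {g \<in> carrier G. \<forall>C\<in>rcosets L. C #> g = C}"
  have Cc: "C \<subseteq> carrier G" if "C \<in> rcosets L" for C
    using that Lc by (auto simp: RCOSETS_def r_coset_def)
  have Cx: "C #> x \<in> rcosets L" if "C \<in> rcosets L" "x \<in> carrier G" for C x
    using that Lc by (auto simp: RCOSETS_def coset_mult_assoc)
  have NL: "N \<subseteq> L"
  proof
    fix g assume g: "g \<in> N"
    have "L #> \<one> \<in> rcosets L" using Lc by (intro rcosetsI) auto
    then have "L \<in> rcosets L" using coset_mult_one[OF Lc] by simp
    then have "L #> g = L" "g \<in> carrier G" using g by (auto simp: N_def)
    then show "g \<in> L" using rcos_self[of g L] L by simp
  qed
  have Nsub: "subgroup N G"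
  proof (rule subgroupI)
    show "N \<subseteq> carrier G" by (auto simp: N_def)
    have "\<one> \<in> N" using Cc by (simp add: N_def)
    then show "N \<noteq> {}" by blast
    show "inv a \<in> N" if a: "a \<in> N" for a
    proof -
      have "C #> inv a = C" if "C \<in> rcosets L" for C
      proof -
        have "C #> inv a = C #> a #> inv a" using a that by (simp add: N_def)
        also have "\<dots> = C" using a Cc[OF that] by (simp add: N_def coset_mult_assoc)
        finally show ?thesis .
      qed
      then show ?thesis using a by (simp add: N_def)
    qed
    show "a \<otimes> b \<in> N" if "a \<in> N" "b \<in> N" for a b
    proof -
      have "C #> (a \<otimes> b) = C" if "C \<in> rcosets L" for C
        using \<open>a \<in> N\<close> \<open>b \<in> N\<close> that coset_mult_assoc[OF Cc[OF that], of a b] by (simp add: N_def)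
      then show ?thesis using that by (simp add: N_def)
    qed
  qed
  have "N \<lhd> G"
  proof (rule normal_invI[OF Nsub])
    fix x h assume x: "x \<in> carrier G" and h: "h \<in> N"
    have hc: "h \<in> carrier G" using h by (simp add: N_def)
    have "C #> (x \<otimes> h \<otimes> inv x) = C" if C: "C \<in> rcosets L" for C
    proof -
      have "C #> (x \<otimes> h \<otimes> inv x) = C #> x #> h #> inv x"
        using x hc Cc[OF C] r_coset_subset_G[OF Cc[OF C] x] by (simp add: coset_mult_assoc)
      also have "C #> x #> h = C #> x" using h Cx[OF C x] by (simp add: N_def)
      also have "C #> x #> inv x = C" using x Cc[OF C] by (simp add: coset_mult_assoc)
      finally show ?thesis .
    qed
    then show "x \<otimes> h \<otimes> inv x \<in> N" using x hc by (simp add: N_def)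
  qed
  moreover have "finite (rcosets N)"
  proof (rule finite_index_by_map[OF Nsub])
    let ?\<phi> = "\<lambda>g. \<lambda>C\<in>rcosets L. C #> g"
    have "?\<phi> ` carrier G \<subseteq> (\<Pi>\<^sub>E C\<in>rcosets L. rcosets L)" using Cx by auto
    then show "finite (?\<phi> ` carrier G)" by (rule finite_subset) (intro finite_PiE fin)
    fix x y assume xy: "x \<in> carrier G" "y \<in> carrier G" and eq: "?\<phi> x = ?\<phi> y"
    have "C #> (x \<otimes> inv y) = C" if C: "C \<in> rcosets L" for C
    proof -
      have "C #> (x \<otimes> inv y) = C #> x #> inv y" using xy Cc[OF C] by (simp add: coset_mult_assoc)
      also have "C #> x = C #> y" using fun_cong[OF eq, of C] C by simp
      also have "C #> y #> inv y = C" using xy Cc[OF C] by (simp add: coset_mult_assoc)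
      finally show ?thesis .
    qed
    then show "x \<otimes> inv y \<in> N" using xy by (simp add: N_def)
  qed
  ultimately show ?thesis using that NL by (auto simp: fin_index_normals_def)
qed

lemma fin_index_normals_Int:
  assumes N: "N \<in> fin_index_normals G" "N' \<in> fin_index_normals G"
  shows "N \<inter> N' \<in> fin_index_normals G"
proof -
  note D = fin_index_normalsD[OF N(1)] and D' = fin_index_normalsD[OF N(2)]
  have I: "N \<inter> N' \<lhd> G" using normal_subgroup_intersect[OF D(1) D'(1)] .
  moreover have "finite (rcosets (N \<inter> N'))"
  proof (rule finite_index_by_map[OF normal_imp_subgroup[OF I], of "\<lambda>x. (N #> x, N' #> x)"])
    have "(\<lambda>x. (N #> x, N' #> x)) ` carrier G \<subseteq> (rcosets N) \<times> (rcosets N')" by (auto simp: RCOSETS_def)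
    then show "finite ((\<lambda>x. (N #> x, N' #> x)) ` carrier G)"
      using D(3) D'(3) by (meson finite_SigmaI finite_subset)
  qed (use rcoset_eq_iff D(2) D'(2) in auto)
  ultimately show ?thesis by (simp add: fin_index_normals_def)
qed

lemma rcosets_normalE:
  assumes "C \<in> rcosets N"
  obtains z where "z \<in> carrier G" "C = N #> z"
  using assms by (auto simp: RCOSETS_def)

lemma rcosets_memb:
  assumes "subgroup N G" "C \<in> rcosets N" "z \<in> C"
  shows "C = N #> z" "z \<in> carrier G"
proof -
  obtain y where y: "y \<in> carrier G" "C = N #> y" using assms(2) by (auto simp: RCOSETS_def)
  show "z \<in> carrier G" using assms(3) y subgroup.subset[OF assms(1)] by (auto simp: r_coset_def)
  show "C = N #> z" using repr_independence[OF _ y(1) assms(1), of z] assms(3) y(2) by simp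
qed

lemma rcosets_nonempty:
  assumes "subgroup N G" "C \<in> rcosets N" obtains z where "z \<in> C"
  using assms rcos_self by (auto simp: RCOSETS_def)

lemma rcosets_sub: "subgroup N G \<Longrightarrow> C \<in> rcosets N \<Longrightarrow> C \<subseteq> carrier G"
  using rcosets_memb(2) by blast

lemma l_coset_rcoset:
  assumes N: "N \<lhd> G" and g: "g \<in> carrier G" "z \<in> carrier G"
  shows "g <# (N #> z) = N #> (g \<otimes> z)"
proof -
  note Nc = subgroup.subset[OF normal_imp_subgroup[OF N]]
  have "g <# (N #> z) = (g <# N) #> z"
    using Nc g by (force simp: l_coset_def r_coset_def m_assoc)
  also have "\<dots> = (N #> g) #> z" using normal.coset_eq[OF N] g by simp
  also have "\<dots> = N #> (g \<otimes> z)" using Nc g by (simp add: coset_mult_assoc)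
  finally show ?thesis .
qed

lemma l_coset_rcosets:
  assumes "N \<lhd> G" "g \<in> carrier G" "C \<in> rcosets N"
  shows "g <# C \<in> rcosets N"
  using assms l_coset_rcoset[OF assms(1,2)] by (auto simp: RCOSETS_def)

lemma l_coset_one: "C \<subseteq> carrier G \<Longrightarrow> \<one> <# C = C"
  by (force simp: l_coset_def)

lemma l_coset_inv_cancel:
  assumes "g \<in> carrier G" "C \<subseteq> carrier G"
  shows "inv g <# (g <# C) = C" "g <# (inv g <# C) = C"
  using assms by (simp_all add: lcos_m_assoc l_coset_one)

lemma l_coset_mono: "C \<subseteq> D \<Longrightarrow> g <# C \<subseteq> g <# D"
  by (auto simp: l_coset_def)

lemma rcoset_subset_iff:
  assumes N: "subgroup N G" "subgroup N' G" "N \<subseteq> N'" and C: "C \<in> rcosets N" "C' \<in> rcosets N'"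
  shows "N' <#> C = C' \<longleftrightarrow> C \<subseteq> C'"
proof -
  obtain z where z: "z \<in> carrier G" "C = N #> z" using C(1) by (auto simp: RCOSETS_def)
  have zC: "z \<in> C" using z rcos_self N(1) by simp
  have "N' <#> C = N' #> z"
  proof
    show "N' <#> C \<subseteq> N' #> z"
    proof
      fix w assume "w \<in> N' <#> C"
      then obtain a b where ab: "a \<in> N'" "b \<in> N" "w = a \<otimes> (b \<otimes> z)"
        using z by (auto simp: set_mult_def r_coset_def)
      then have "w = (a \<otimes> b) \<otimes> z" using subgroup.mem_carrier[OF N(1)] subgroup.mem_carrier[OF N(2)] z
        by (simp add: m_assoc)
      moreover have "a \<otimes> b \<in> N'" using ab N(3) subgroup.m_closed[OF N(2)] by auto
      ultimately show "w \<in> N' #> z" unfolding r_coset_def by blast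
    qed
    show "N' #> z \<subseteq> N' <#> C" using zC by (auto simp: set_mult_def r_coset_def)
  qed
  moreover have "N' #> z = C' \<longleftrightarrow> C \<subseteq> C'"
  proof
    assume "N' #> z = C'"
    then show "C \<subseteq> C'" using z N(3) by (auto simp: r_coset_def)
  next
    assume "C \<subseteq> C'"
    then show "N' #> z = C'" using rcosets_memb(1)[OF N(2) C(2)] zC by auto
  qed
  ultimately show ?thesis by simp
qed

end

section \<open>The completed group ring as a module of measures\<close>

context group_algebra
begin

abbreviation Nor where "Nor \<equiv> fin_index_normals G"
abbreviation V where "V \<equiv> completed_group_module k G"

text \<open>
  A compatible family \<open>x\<close> is a finitely additive measure with values in \<open>k\<close>, defined on the unions of
  cosets of normal subgroups of finite index; this is the measure of \<open>E\<close> computed with cosets of \<open>N\<close>.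
\<close>

definition meas :: "('g set \<Rightarrow> 'g set \<Rightarrow> 'r) \<Rightarrow> 'g set \<Rightarrow> 'g set \<Rightarrow> 'r"
  where "meas x N E = (\<Oplus>\<^bsub>k\<^esub>C\<in>{C \<in> rcosets N. C \<subseteq> E}. x N C)"

lemma action_cosets: "N \<lhd> G \<Longrightarrow> action_on (rcosets N) (\<lambda>g C. g <# C)"
  using G.rcosets_sub[OF normal_imp_subgroup[of N]]
  by (auto simp: action_on_def G.l_coset_rcosets G.lcos_m_assoc G.l_coset_one)

lemma carrier_quotient_ring:
  assumes "N \<in> Nor"
  shows "carrier (group_ring k (G Mod N)) = (rcosets N \<rightarrow>\<^sub>E carrier k)"
  using G.fin_index_normalsD(3)[OF assms]
  by (auto simp: group_ring_def fin_supp_funs_def supp_on_def FactGroup_def)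

lemma group_ring_map_quotient:
  assumes N: "N \<in> Nor" "N' \<in> Nor" "N \<subseteq> N'" and F: "F \<in> rcosets N \<rightarrow>\<^sub>E carrier k"
  shows "group_ring_map k (G Mod N) (G Mod N') (\<lambda>C. N' <#> C) F =
    (\<lambda>C'\<in>rcosets N'. \<Oplus>\<^bsub>k\<^esub>C\<in>{C \<in> rcosets N. C \<subseteq> C'}. F C)"
proof -
  note D = G.fin_index_normalsD[OF N(1)] and D' = G.fin_index_normalsD[OF N(2)]
  have "(\<Oplus>\<^bsub>k\<^esub>C\<in>{C \<in> supp_on k (rcosets N) F. N' <#> C = C'}. F C) =
      (\<Oplus>\<^bsub>k\<^esub>C\<in>{C \<in> rcosets N. C \<subseteq> C'}. F C)" if "C' \<in> rcosets N'" for C'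
    using G.rcoset_subset_iff[OF D(2) D'(2) N(3) _ that] F D(3)
    by (intro k.add.finprod_mono_neutral_cong_left) (auto simp: supp_on_def)
  then show ?thesis by (auto simp: group_ring_map_def FactGroup_def intro!: restrict_ext)
qed

lemma carrier_V_iff:
  "x \<in> carrier V \<longleftrightarrow> x \<in> (\<Pi>\<^sub>E N\<in>Nor. rcosets N \<rightarrow>\<^sub>E carrier k) \<and>
    (\<forall>N\<in>Nor. \<forall>N'\<in>Nor. N \<subseteq> N' \<longrightarrow> (\<forall>C'\<in>rcosets N'. meas x N C' = x N' C'))"
proof -
  have 1: "(\<Pi>\<^sub>E N\<in>Nor. carrier (group_ring k (G Mod N))) = (\<Pi>\<^sub>E N\<in>Nor. rcosets N \<rightarrow>\<^sub>E carrier k)"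
    by (intro PiE_cong carrier_quotient_ring)
  have 2: "group_ring_map k (G Mod N) (G Mod N') (\<lambda>C. N' <#> C) (x N) = x N' \<longleftrightarrow>
      (\<forall>C'\<in>rcosets N'. meas x N C' = x N' C')"
    if x: "x \<in> (\<Pi>\<^sub>E N\<in>Nor. rcosets N \<rightarrow>\<^sub>E carrier k)" and N: "N \<in> Nor" "N' \<in> Nor" "N \<subseteq> N'" for N N'
  proof -
    have xN: "x N \<in> rcosets N \<rightarrow>\<^sub>E carrier k" "x N' \<in> rcosets N' \<rightarrow>\<^sub>E carrier k" using x N by auto
    then have ext: "x N' \<in> extensional (rcosets N')" by (simp add: PiE_iff)
    have "(\<lambda>C'\<in>A. u C') = v \<longleftrightarrow> (\<forall>C'\<in>A. u C' = v C')" if "v \<in> extensional A" for A u and v :: "'g set \<Rightarrow> 'r"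
      using that by (auto simp: fun_eq_iff restrict_def extensional_def)
    from this[OF ext] show ?thesis
      unfolding group_ring_map_quotient[OF N xN(1)] meas_def .
  qed
  show ?thesis
    unfolding completed_group_module_def left_module_via_def completed_group_ring_def
    using 1 2 by auto
qed

lemma V_D:
  assumes "x \<in> carrier V"
  shows "N \<in> Nor \<Longrightarrow> x N \<in> rcosets N \<rightarrow>\<^sub>E carrier k" "x \<in> extensional Nor"
    "N \<in> Nor \<Longrightarrow> C \<in> rcosets N \<Longrightarrow> x N C \<in> carrier k"
    "N \<in> Nor \<Longrightarrow> x N \<in> extensional (rcosets N)"
    "N \<in> Nor \<Longrightarrow> N' \<in> Nor \<Longrightarrow> N \<subseteq> N' \<Longrightarrow> C' \<in> rcosets N' \<Longrightarrow> meas x N C' = x N' C'"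
proof -
  have x: "x \<in> (\<Pi>\<^sub>E N\<in>Nor. rcosets N \<rightarrow>\<^sub>E carrier k)" using assms carrier_V_iff by blast
  show 1: "N \<in> Nor \<Longrightarrow> x N \<in> rcosets N \<rightarrow>\<^sub>E carrier k" "x \<in> extensional Nor" using x by (auto simp: PiE_iff)
  show "N \<in> Nor \<Longrightarrow> C \<in> rcosets N \<Longrightarrow> x N C \<in> carrier k"
    "N \<in> Nor \<Longrightarrow> x N \<in> extensional (rcosets N)" using 1 by (auto simp: PiE_iff)
  show "N \<in> Nor \<Longrightarrow> N' \<in> Nor \<Longrightarrow> N \<subseteq> N' \<Longrightarrow> C' \<in> rcosets N' \<Longrightarrow> meas x N C' = x N' C'"
    using assms carrier_V_iff by blast
qed

lemma V_I:
  assumes "\<And>N C. N \<in> Nor \<Longrightarrow> C \<in> rcosets N \<Longrightarrow> f N C \<in> carrier k"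
    "\<And>N N' C'. N \<in> Nor \<Longrightarrow> N' \<in> Nor \<Longrightarrow> N \<subseteq> N' \<Longrightarrow> C' \<in> rcosets N' \<Longrightarrow>
      (\<Oplus>\<^bsub>k\<^esub>C\<in>{C \<in> rcosets N. C \<subseteq> C'}. f N C) = f N' C'"
  shows "(\<lambda>N\<in>Nor. \<lambda>C\<in>rcosets N. f N C) \<in> carrier V"
proof -
  let ?x = "\<lambda>N\<in>Nor. \<lambda>C\<in>rcosets N. f N C"
  have "meas ?x N C' = ?x N' C'" if N: "N \<in> Nor" "N' \<in> Nor" "N \<subseteq> N'" "C' \<in> rcosets N'" for N N' C'
  proof -
    have "meas ?x N C' = (\<Oplus>\<^bsub>k\<^esub>C\<in>{C \<in> rcosets N. C \<subseteq> C'}. f N C)"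
      unfolding meas_def using N assms(1)[OF N(1)] by (intro k.finsum_cong') auto
    then show ?thesis using assms(2)[OF N] N by simp
  qed
  then show ?thesis using assms(1) unfolding carrier_V_iff by auto
qed

lemma V_eqI:
  assumes "x \<in> carrier V" "y \<in> carrier V" "\<And>N C. N \<in> Nor \<Longrightarrow> C \<in> rcosets N \<Longrightarrow> x N C = y N C"
  shows "x = y"
proof (rule extensionalityI[OF V_D(2)[OF assms(1)] V_D(2)[OF assms(2)]])
  fix N assume N: "N \<in> Nor"
  show "x N = y N"
    by (rule extensionalityI[OF V_D(4)[OF assms(1) N] V_D(4)[OF assms(2) N]]) (rule assms(3)[OF N])
qed

lemma add_V:
  "x \<oplus>\<^bsub>V\<^esub> y = (\<lambda>N\<in>Nor. \<lambda>C\<in>rcosets N. x N C \<oplus>\<^bsub>k\<^esub> y N C)"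
  by (simp add: completed_group_module_def left_module_via_def completed_group_ring_def group_ring_def FactGroup_def)

lemma zero_V: "\<zero>\<^bsub>V\<^esub> = (\<lambda>N\<in>Nor. \<lambda>C\<in>rcosets N. \<zero>\<^bsub>k\<^esub>)"
  by (simp add: completed_group_module_def left_module_via_def completed_group_ring_def group_ring_def FactGroup_def)

text \<open>
  The quotient map pushes \<open>a\<close> forward to \<open>G/N\<close>; sorting the support of \<open>a\<close> by cosets of \<open>N\<close> expresses the
  product in \<open>k[G/N]\<close> through the action of \<open>G\<close> on the cosets.
\<close>

lemma quotient_ring_conv:
  assumes N: "N \<in> Nor" and a: "a \<in> carrier kG" and F: "F \<in> rcosets N \<rightarrow>\<^sub>E carrier k"
  shows "group_ring_map k G (G Mod N) (\<lambda>g. N #> g) a \<otimes>\<^bsub>group_ring k (G Mod N)\<^esub> F =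
    (\<lambda>C\<in>rcosets N. conv (\<lambda>g C. g <# C) a F C)"
proof -
  note D = G.fin_index_normalsD[OF N]
  interpret N: normal N G by (rule D(1))
  define b where "b = group_ring_map k G (G Mod N) (\<lambda>g. N #> g) a"
  have afs: "a \<in> fin_supp_funs k (carrier G)" using a by (simp add: carrier_kG)
  note ac = fin_supp_funsD[OF afs]
  have suppc: "y \<in> carrier G" if "y \<in> supp a" for y using that by (simp add: supp_on_def)
  have b: "b D = (\<Oplus>\<^bsub>k\<^esub>y\<in>{y \<in> supp a. N #> y = D}. a y)" if "D \<in> rcosets N" for D
    using that by (simp add: b_def group_ring_map_def FactGroup_def)
  have bc: "b D \<in> carrier k" if "D \<in> rcosets N" for D
    unfolding b[OF that] using ac suppc by (intro k.finsum_closed) auto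
  have invD: "inv\<^bsub>G Mod N\<^esub> (N #> y) <#> C = inv y <# C" if y: "y \<in> carrier G" and C: "C \<in> rcosets N" for y C
  proof -
    obtain z where z: "z \<in> carrier G" "C = N #> z" using C by (rule G.rcosets_normalE)
    have "N #> y \<in> carrier (G Mod N)" using y G.rcosetsI[OF D(4)] by (simp add: FactGroup_def)
    then have "inv\<^bsub>G Mod N\<^esub> (N #> y) = N #> inv y" using N.inv_FactGroup N.rcos_inv[OF y] by simp
    then show ?thesis using z y G.l_coset_rcoset[OF D(1)] N.rcos_sum by simp
  qed
  have Fc: "F (inv y <# C) \<in> carrier k" if "y \<in> carrier G" "C \<in> rcosets N" for y C
    using F G.l_coset_rcosets[OF D(1) _ that(2)] that(1) by auto
  have "(\<Oplus>\<^bsub>k\<^esub>D\<in>supp_on k (rcosets N) b. b D \<otimes>\<^bsub>k\<^esub> F (inv\<^bsub>G Mod N\<^esub> D <#> C)) =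
      conv (\<lambda>g C. g <# C) a F C" if C: "C \<in> rcosets N" for C
  proof -
    have FD: "F (inv\<^bsub>G Mod N\<^esub> D <#> C) \<in> carrier k" if D: "D \<in> rcosets N" for D
    proof -
      obtain y where "y \<in> carrier G" "D = N #> y" using D by (rule G.rcosets_normalE)
      then show ?thesis using invD[OF _ C] Fc[OF _ C] by simp
    qed
    have "(\<Oplus>\<^bsub>k\<^esub>D\<in>supp_on k (rcosets N) b. b D \<otimes>\<^bsub>k\<^esub> F (inv\<^bsub>G Mod N\<^esub> D <#> C)) =
        (\<Oplus>\<^bsub>k\<^esub>D\<in>rcosets N. b D \<otimes>\<^bsub>k\<^esub> F (inv\<^bsub>G Mod N\<^esub> D <#> C))"
      using bc FD D(3) by (intro k.add.finprod_mono_neutral_cong_left) (auto simp: supp_on_def)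
    also have "\<dots> = (\<Oplus>\<^bsub>k\<^esub>D\<in>rcosets N. \<Oplus>\<^bsub>k\<^esub>y\<in>{y \<in> supp a. N #> y = D}. a y \<otimes>\<^bsub>k\<^esub> F (inv y <# C))"
    proof (rule k.finsum_cong')
      fix D assume D: "D \<in> rcosets N"
      have "b D \<otimes>\<^bsub>k\<^esub> F (inv\<^bsub>G Mod N\<^esub> D <#> C) =
          (\<Oplus>\<^bsub>k\<^esub>y\<in>{y \<in> supp a. N #> y = D}. a y \<otimes>\<^bsub>k\<^esub> F (inv\<^bsub>G Mod N\<^esub> D <#> C))"
        unfolding b[OF D] using ac suppc FD[OF D] by (intro k.finsum_ldistr) auto
      also have "\<dots> = (\<Oplus>\<^bsub>k\<^esub>y\<in>{y \<in> supp a. N #> y = D}. a y \<otimes>\<^bsub>k\<^esub> F (inv y <# C))"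
        using invD[OF _ C] suppc ac Fc[OF _ C] by (intro k.finsum_cong') auto
      finally show "b D \<otimes>\<^bsub>k\<^esub> F (inv\<^bsub>G Mod N\<^esub> D <#> C) =
          (\<Oplus>\<^bsub>k\<^esub>y\<in>{y \<in> supp a. N #> y = D}. a y \<otimes>\<^bsub>k\<^esub> F (inv y <# C))" .
    qed (use ac suppc Fc[OF _ C] in \<open>auto intro!: k.finsum_closed\<close>)
    also have "\<dots> = (\<Oplus>\<^bsub>k\<^esub>y\<in>supp a. a y \<otimes>\<^bsub>k\<^esub> F (inv y <# C))"
      using ac suppc Fc[OF _ C] D(3) G.rcosetsI[OF D(4)] by (intro k.finsum_fibers) auto
    finally show ?thesis by (simp add: conv_def)
  qed
  then show ?thesis
    unfolding b_def[symmetric] by (auto simp: group_ring_def FactGroup_def intro!: restrict_ext)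
qed

lemma smult_V:
  assumes a: "a \<in> carrier kG" and x: "x \<in> carrier V"
  shows "a \<odot>\<^bsub>V\<^esub> x = (\<lambda>N\<in>Nor. \<lambda>C\<in>rcosets N. conv (\<lambda>g C. g <# C) a (x N) C)"
  using quotient_ring_conv[OF _ a V_D(1)[OF x]]
  by (auto simp: completed_group_module_def left_module_via_def completed_group_ring_def completion_map_def
      intro!: restrict_ext)

end

context cyclic_group_algebra
begin

lemma add_V_closed:
  assumes x: "x \<in> carrier V" "y \<in> carrier V"
  shows "x \<oplus>\<^bsub>V\<^esub> y \<in> carrier V"
  unfolding add_V
proof (rule V_I)
  fix N N' C' assume N: "N \<in> Nor" "N' \<in> Nor" "N \<subseteq> N'" "C' \<in> rcosets N'"
  show "(\<Oplus>\<^bsub>k\<^esub>C\<in>{C \<in> rcosets N. C \<subseteq> C'}. x N C \<oplus>\<^bsub>k\<^esub> y N C) = x N' C' \<oplus>\<^bsub>k\<^esub> y N' C'"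
    using V_D(5)[OF x(1) N] V_D(5)[OF x(2) N] V_D(3)[OF x(1) N(1)] V_D(3)[OF x(2) N(1)]
    unfolding meas_def by (subst k.finsum_addf) auto
qed (use V_D(3) x in auto)

lemma zero_V_closed: "\<zero>\<^bsub>V\<^esub> \<in> carrier V"
  unfolding zero_V by (rule V_I) (auto intro!: k.add.finprod_one_eqI)

lemma abelian_group_V: "abelian_group V"
proof (rule abelian_groupI)
  fix x assume x: "x \<in> carrier V"
  let ?y = "\<lambda>N\<in>Nor. \<lambda>C\<in>rcosets N. \<ominus>\<^bsub>k\<^esub> \<one>\<^bsub>k\<^esub> \<otimes>\<^bsub>k\<^esub> x N C"
  have y: "?y \<in> carrier V"
  proof (rule V_I)
    fix N N' C' assume N: "N \<in> Nor" "N' \<in> Nor" "N \<subseteq> N'" "C' \<in> rcosets N'"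
    show "(\<Oplus>\<^bsub>k\<^esub>C\<in>{C \<in> rcosets N. C \<subseteq> C'}. \<ominus>\<^bsub>k\<^esub> \<one>\<^bsub>k\<^esub> \<otimes>\<^bsub>k\<^esub> x N C) = \<ominus>\<^bsub>k\<^esub> \<one>\<^bsub>k\<^esub> \<otimes>\<^bsub>k\<^esub> x N' C'"
      using V_D(5)[OF x N] V_D(3)[OF x N(1)] G.fin_index_normalsD(3)[OF N(1)]
      unfolding meas_def by (subst k.finsum_rdistr[symmetric]) auto
  qed (use V_D(3)[OF x] in auto)
  show "\<exists>y\<in>carrier V. y \<oplus>\<^bsub>V\<^esub> x = \<zero>\<^bsub>V\<^esub>"
  proof (rule bexI[OF _ y])
    have "\<ominus>\<^bsub>k\<^esub> \<one>\<^bsub>k\<^esub> \<otimes>\<^bsub>k\<^esub> x N C \<oplus>\<^bsub>k\<^esub> x N C = \<zero>\<^bsub>k\<^esub>" if "N \<in> Nor" "C \<in> rcosets N" for N C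
      using V_D(3)[OF x that] by (simp add: k.l_minus k.l_neg)
    then show "?y \<oplus>\<^bsub>V\<^esub> x = \<zero>\<^bsub>V\<^esub>" by (auto simp: add_V zero_V intro!: restrict_ext)
  qed
  show "\<zero>\<^bsub>V\<^esub> \<oplus>\<^bsub>V\<^esub> x = x"
    using add_V_closed[OF zero_V_closed x] x V_D(3)[OF x]
    by (intro V_eqI) (auto simp: add_V zero_V)
  fix y assume y: "y \<in> carrier V"
  show "x \<oplus>\<^bsub>V\<^esub> y \<in> carrier V" by (rule add_V_closed[OF x y])
  show "x \<oplus>\<^bsub>V\<^esub> y = y \<oplus>\<^bsub>V\<^esub> x"
    using V_D(3)[OF x] V_D(3)[OF y] by (auto simp: add_V k.a_comm intro!: restrict_ext)
  fix z assume z: "z \<in> carrier V"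
  show "x \<oplus>\<^bsub>V\<^esub> y \<oplus>\<^bsub>V\<^esub> z = x \<oplus>\<^bsub>V\<^esub> (y \<oplus>\<^bsub>V\<^esub> z)"
    using V_D(3)[OF x] V_D(3)[OF y] V_D(3)[OF z] by (auto simp: add_V k.a_assoc intro!: restrict_ext)
qed (rule zero_V_closed)

lemma conv_V_add_left:
  assumes "a \<in> carrier kG" "b \<in> carrier kG" "x \<in> carrier V"
  shows "(a \<oplus>\<^bsub>kG\<^esub> b) \<odot>\<^bsub>V\<^esub> x = a \<odot>\<^bsub>V\<^esub> x \<oplus>\<^bsub>V\<^esub> b \<odot>\<^bsub>V\<^esub> x"
proof -
  have s: "a \<oplus>\<^bsub>kG\<^esub> b \<in> carrier kG"
    using assms fin_supp_funs_add[OF k.ring_axioms] by (simp add: add_kG carrier_kG)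
  have fs: "a \<in> fin_supp_funs k (carrier G)" "b \<in> fin_supp_funs k (carrier G)" using assms by (auto simp: carrier_kG)
  have "conv (\<lambda>g C. g <# C) (a \<oplus>\<^bsub>kG\<^esub> b) (x N) C =
      conv (\<lambda>g C. g <# C) a (x N) C \<oplus>\<^bsub>k\<^esub> conv (\<lambda>g C. g <# C) b (x N) C"
    if "N \<in> Nor" "C \<in> rcosets N" for N C
    unfolding add_kG using V_D(1)[OF assms(3) that(1)]
    by (intro conv_add_left[OF action_cosets[OF G.fin_index_normalsD(1)[OF that(1)]] fs _ that(2)]) auto
  then show ?thesis
    using assms s by (auto simp: smult_V add_V intro!: restrict_ext)
qed

lemma single_smult_V:
  assumes "g \<in> carrier G" "x \<in> carrier V"
  shows "single g \<odot>\<^bsub>V\<^esub> x = (\<lambda>N\<in>Nor. \<lambda>C\<in>rcosets N. x N (inv g <# C))"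
proof -
  have "conv (\<lambda>g C. g <# C) (single g) (x N) C = x N (inv g <# C)"
    if "N \<in> Nor" "C \<in> rcosets N" for N C
    using V_D(1)[OF assms(2) that(1)]
    by (intro conv_single[OF action_cosets[OF G.fin_index_normalsD(1)[OF that(1)]] assms(1) _ that(2)]) auto
  then show ?thesis using assms by (auto simp: smult_V single_closed intro!: restrict_ext)
qed

lemma single_smult_V_closed:
  assumes g: "g \<in> carrier G" and x: "x \<in> carrier V"
  shows "single g \<odot>\<^bsub>V\<^esub> x \<in> carrier V"
  unfolding single_smult_V[OF assms]
proof (rule V_I)
  fix N C assume "N \<in> Nor" "C \<in> rcosets N"
  then show "x N (inv g <# C) \<in> carrier k"
    using V_D(3)[OF x] G.l_coset_rcosets[OF G.fin_index_normalsD(1)] g by auto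
next
  fix N N' C' assume N: "N \<in> Nor" "N' \<in> Nor" "N \<subseteq> N'" "C' \<in> rcosets N'"
  note D = G.fin_index_normalsD[OF N(1)] and D' = G.fin_index_normalsD[OF N(2)]
  let ?A = "{C \<in> rcosets N. C \<subseteq> C'}" and ?B = "{C \<in> rcosets N. C \<subseteq> inv g <# C'}"
  let ?m = "\<lambda>C. inv g <# C"
  have sub: "C \<subseteq> carrier G" if "C \<in> rcosets N" for C using G.rcosets_sub[OF D(2) that] .
  have sub': "C' \<subseteq> carrier G" using G.rcosets_sub[OF D'(2) N(4)] .
  have im: "?m ` ?A = ?B"
  proof (intro equalityI subsetI)
    fix C assume "C \<in> ?m ` ?A"
    then obtain D where "D \<in> ?A" "C = ?m D" by blast
    then show "C \<in> ?B" using G.l_coset_rcosets[OF D(1)] G.l_coset_mono[of D C'] g by blast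
  next
    fix C assume C: "C \<in> ?B"
    then have "g <# C \<subseteq> g <# (inv g <# C')" using G.l_coset_mono by blast
    then have "g <# C \<in> ?A" using C g G.l_coset_rcosets[OF D(1) g] G.l_coset_inv_cancel(2)[OF g sub'] by auto
    moreover have "C = ?m (g <# C)" using G.l_coset_inv_cancel(1)[OF g] C sub by auto
    ultimately show "C \<in> ?m ` ?A" by blast
  qed
  have inj: "inj_on ?m ?A"
    by (rule inj_on_inverseI[of _ "\<lambda>C. g <# C"]) (use G.l_coset_inv_cancel(2)[OF g] sub in auto)
  have "(\<Oplus>\<^bsub>k\<^esub>C\<in>?A. x N (?m C)) = (\<Oplus>\<^bsub>k\<^esub>C\<in>?B. x N C)"
    unfolding im[symmetric] using V_D(3)[OF x N(1)] G.l_coset_rcosets[OF D(1)] g inj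
    by (intro k.finsum_reindex[symmetric]) auto
  also have "\<dots> = x N' (inv g <# C')"
    using V_D(5)[OF x N(1,2,3) G.l_coset_rcosets[OF D'(1) _ N(4)]] g by (simp add: meas_def)
  finally show "(\<Oplus>\<^bsub>k\<^esub>C\<in>?A. x N (?m C)) = x N' (inv g <# C')" .
qed

lemma left_module_V: "left_module kG V"
proof (intro left_module.intro left_module_axioms.intro ring_kG abelian_group_V)
  interpret kG: ring kG by (rule ring_kG)
  interpret V: abelian_group V by (rule abelian_group_V)
  show closed: "a \<odot>\<^bsub>V\<^esub> x \<in> carrier V" if "a \<in> carrier kG" "x \<in> carrier V" for a x
    using that(1)
  proof (induction rule: kG_induct)
    case zero
    have "supp \<zero>\<^bsub>kG\<^esub> = {}" by (auto simp: supp_on_def zero_kG)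
    then have "\<zero>\<^bsub>kG\<^esub> \<odot>\<^bsub>V\<^esub> x = \<zero>\<^bsub>V\<^esub>"
      using that(2) by (simp add: smult_V zero_V conv_def)
    then show ?case by (simp only: V.zero_closed)
  next
    case (single_add g a)
    then show ?case
      using conv_V_add_left[OF single_closed _ that(2)] single_smult_V_closed[OF _ that(2)] by simp
  qed
  show "(a \<oplus>\<^bsub>kG\<^esub> b) \<odot>\<^bsub>V\<^esub> x = a \<odot>\<^bsub>V\<^esub> x \<oplus>\<^bsub>V\<^esub> b \<odot>\<^bsub>V\<^esub> x"
    if "a \<in> carrier kG" "b \<in> carrier kG" "x \<in> carrier V" for a b x
    using conv_V_add_left that .
  show "\<one>\<^bsub>kG\<^esub> \<odot>\<^bsub>V\<^esub> x = x" if x: "x \<in> carrier V" for x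
  proof (rule V_eqI[OF closed[OF kG.one_closed x] x])
    fix N C assume N: "N \<in> Nor" "C \<in> rcosets N"
    then show "(\<one>\<^bsub>kG\<^esub> \<odot>\<^bsub>V\<^esub> x) N C = x N C"
      using G.rcosets_sub[OF G.fin_index_normalsD(2)]
      by (simp add: one_kG single_smult_V[OF G.one_closed x] G.l_coset_one)
  qed
  fix a x assume a: "a \<in> carrier kG" and x: "x \<in> carrier V"
  have fs: "a \<in> fin_supp_funs k (carrier G)" using a by (simp add: carrier_kG)
  have xN: "x N \<in> rcosets N \<rightarrow> carrier k" if "N \<in> Nor" for N using V_D(1)[OF x that] by auto
  show "a \<odot>\<^bsub>V\<^esub> (x \<oplus>\<^bsub>V\<^esub> y) = a \<odot>\<^bsub>V\<^esub> x \<oplus>\<^bsub>V\<^esub> a \<odot>\<^bsub>V\<^esub> y" if y: "y \<in> carrier V" for y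
  proof -
    have yN: "y N \<in> rcosets N \<rightarrow> carrier k" if "N \<in> Nor" for N using V_D(1)[OF y that] by auto
    have "conv (\<lambda>g C. g <# C) a ((x \<oplus>\<^bsub>V\<^esub> y) N) C =
        conv (\<lambda>g C. g <# C) a (x N) C \<oplus>\<^bsub>k\<^esub> conv (\<lambda>g C. g <# C) a (y N) C"
      if N: "N \<in> Nor" "C \<in> rcosets N" for N C
      using conv_add_right[OF action_cosets[OF G.fin_index_normalsD(1)[OF N(1)]] fs xN[OF N(1)] yN[OF N(1)] N(2)] N
      by (simp add: add_V)
    then have "a \<odot>\<^bsub>V\<^esub> (x \<oplus>\<^bsub>V\<^esub> y) = (\<lambda>N\<in>Nor. \<lambda>C\<in>rcosets N.
        conv (\<lambda>g C. g <# C) a (x N) C \<oplus>\<^bsub>k\<^esub> conv (\<lambda>g C. g <# C) a (y N) C)"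
      unfolding smult_V[OF a V.a_closed[OF x y]] by (intro restrict_ext) auto
    then show ?thesis unfolding smult_V[OF a x] smult_V[OF a y]
      by (subst add_V) (auto intro!: restrict_ext)
  qed
  show "a \<otimes>\<^bsub>kG\<^esub> b \<odot>\<^bsub>V\<^esub> x = a \<odot>\<^bsub>V\<^esub> (b \<odot>\<^bsub>V\<^esub> x)" if b: "b \<in> carrier kG" for b
  proof -
    have fsb: "b \<in> fin_supp_funs k (carrier G)" using b by (simp add: carrier_kG)
    have "conv (\<lambda>g C. g <# C) (a \<otimes>\<^bsub>kG\<^esub> b) (x N) C = conv (\<lambda>g C. g <# C) a ((b \<odot>\<^bsub>V\<^esub> x) N) C"
      if N: "N \<in> Nor" "C \<in> rcosets N" for N C
      using conv_assoc[OF action_cosets[OF G.fin_index_normalsD(1)[OF N(1)]] fs fsb xN[OF N(1)] N(2)] N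
      by (simp add: smult_V[OF b x])
    then show ?thesis
      unfolding smult_V[OF kG.m_closed[OF a b] x] smult_V[OF a closed[OF b x]] by (intro restrict_ext) auto
  qed
qed

end

sublocale cyclic_group_algebra \<subseteq> V: kG_module G k n "completed_group_module k G"
  by (rule kG_moduleI[OF left_module_V])

context cyclic_group_algebra
begin

lemma gact_V:
  assumes "g \<in> carrier G" "x \<in> carrier V" "N \<in> Nor" "C \<in> rcosets N"
  shows "(g \<bullet>\<^bsub>V\<^esub> x) N C = x N (inv g <# C)"
  using single_smult_V[OF assms(1,2)] assms(3,4) by simp

lemma add_V_app:
  "N \<in> Nor \<Longrightarrow> C \<in> rcosets N \<Longrightarrow> (x \<oplus>\<^bsub>V\<^esub> y) N C = x N C \<oplus>\<^bsub>k\<^esub> y N C"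
  by (simp add: add_V)

lemma zero_V_app: "N \<in> Nor \<Longrightarrow> C \<in> rcosets N \<Longrightarrow> \<zero>\<^bsub>V\<^esub> N C = \<zero>\<^bsub>k\<^esub>"
  by (simp add: zero_V)

lemma finsum_V_app:
  assumes "finite A" "f \<in> A \<rightarrow> carrier V" and N: "N \<in> Nor" "C \<in> rcosets N"
  shows "(\<Oplus>\<^bsub>V\<^esub>i\<in>A. f i) N C = (\<Oplus>\<^bsub>k\<^esub>i\<in>A. f i N C)"
  using assms(1,2)
proof (induction A rule: finite_induct)
  case empty
  then show ?case using zero_V_app[OF N] by simp
next
  case (insert a A)
  then have "(\<lambda>i. f i N C) \<in> A \<rightarrow> carrier k" "f a N C \<in> carrier k" using V_D(3)[OF _ N] by (auto simp: Pi_def)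
  moreover have "(\<Oplus>\<^bsub>V\<^esub>i\<in>insert a A. f i) = f a \<oplus>\<^bsub>V\<^esub> (\<Oplus>\<^bsub>V\<^esub>i\<in>A. f i)"
    using insert by (intro V.M.finsum_insert) auto
  ultimately show ?case using insert by (simp add: add_V_app[OF N])
qed

definition saturated :: "'g set \<Rightarrow> 'g set \<Rightarrow> bool"
  where "saturated N E \<longleftrightarrow> (\<forall>C\<in>rcosets N. C \<subseteq> E \<or> C \<inter> E = {})"

lemma coset_coarsen:
  assumes N: "N \<in> Nor" "N' \<in> Nor" "N \<subseteq> N'" and C: "C \<in> rcosets N"
  obtains C' where "C' \<in> rcosets N'" "C \<subseteq> C'"
proof -
  obtain z where z: "z \<in> carrier G" "C = N #> z" using C by (rule G.rcosets_normalE)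
  have "N' #> z \<in> rcosets N'" using z G.fin_index_normalsD[OF N(2)] by (intro G.rcosetsI)
  moreover have "C \<subseteq> N' #> z" using z N(3) by (auto simp: r_coset_def)
  ultimately show ?thesis using that by blast
qed

lemma saturated_coset:
  assumes "N \<in> Nor" "C \<in> rcosets N" shows "saturated N C"
  unfolding saturated_def using G.rcosets_memb(1)[OF G.fin_index_normalsD(2)[OF assms(1)]] assms(2) by blast

lemma saturated_mono:
  assumes N: "N \<in> Nor" "N' \<in> Nor" "N \<subseteq> N'" and "saturated N' E" shows "saturated N E"
  unfolding saturated_def
proof
  fix C assume "C \<in> rcosets N"
  then obtain C' where "C' \<in> rcosets N'" "C \<subseteq> C'" using coset_coarsen[OF N] by blast
  then show "C \<subseteq> E \<or> C \<inter> E = {}" using assms(4) unfolding saturated_def by blast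
qed

lemma saturated_Int: "saturated N E \<Longrightarrow> saturated N F \<Longrightarrow> saturated N (E \<inter> F)"
  unfolding saturated_def by blast

lemma meas_partition:
  assumes x: "x \<in> carrier V" and N: "N \<in> Nor" and I: "finite I" and sub: "\<And>i. i \<in> I \<Longrightarrow> E i \<subseteq> F"
    and ex: "\<And>D. D \<in> rcosets N \<Longrightarrow> D \<subseteq> F \<Longrightarrow> \<exists>!i. i \<in> I \<and> D \<subseteq> E i"
  shows "(\<Oplus>\<^bsub>k\<^esub>i\<in>I. meas x N (E i)) = meas x N F"
proof -
  let ?A = "{D \<in> rcosets N. D \<subseteq> F}"
  define \<phi> where "\<phi> D = (THE i. i \<in> I \<and> D \<subseteq> E i)" for D
  have \<phi>: "\<phi> D \<in> I \<and> D \<subseteq> E (\<phi> D)" if "D \<in> ?A" for D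
    unfolding \<phi>_def by (rule theI') (use ex that in auto)
  have eq: "{D \<in> ?A. \<phi> D = i} = {D \<in> rcosets N. D \<subseteq> E i}" if i: "i \<in> I" for i
  proof (intro equalityI subsetI)
    fix D assume "D \<in> {D \<in> ?A. \<phi> D = i}"
    then show "D \<in> {D \<in> rcosets N. D \<subseteq> E i}" using \<phi>[of D] by auto
  next
    fix D assume D: "D \<in> {D \<in> rcosets N. D \<subseteq> E i}"
    then have DA: "D \<in> ?A" using sub[OF i] by auto
    then have "\<phi> D = i" using ex[of D] \<phi>[OF DA] D i by auto
    then show "D \<in> {D \<in> ?A. \<phi> D = i}" using DA by simp
  qed
  have "(\<Oplus>\<^bsub>k\<^esub>i\<in>I. meas x N (E i)) = (\<Oplus>\<^bsub>k\<^esub>i\<in>I. \<Oplus>\<^bsub>k\<^esub>D\<in>{D \<in> ?A. \<phi> D = i}. x N D)"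
  proof (rule k.finsum_cong')
    show "meas x N (E i) = (\<Oplus>\<^bsub>k\<^esub>D\<in>{D \<in> ?A. \<phi> D = i}. x N D)" if "i \<in> I" for i
      unfolding meas_def eq[OF that] ..
  qed (use V_D(3)[OF x N] in \<open>auto intro!: k.finsum_closed\<close>)
  also have "\<dots> = (\<Oplus>\<^bsub>k\<^esub>D\<in>?A. x N D)"
    using \<phi> V_D(3)[OF x N] G.fin_index_normalsD(3)[OF N] I by (intro k.finsum_fibers) auto
  finally show ?thesis unfolding meas_def .
qed

lemma meas_closed: "x \<in> carrier V \<Longrightarrow> N \<in> Nor \<Longrightarrow> meas x N E \<in> carrier k"
  unfolding meas_def using V_D(3) by (intro k.finsum_closed) auto

lemma coset_in_unique:
  assumes N: "N \<in> Nor" "N' \<in> Nor" "N \<subseteq> N'" and D: "D \<in> rcosets N" "D \<subseteq> F" and saturated: "saturated N' F"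
  shows "\<exists>!C. C \<in> {C \<in> rcosets N'. C \<subseteq> F} \<and> D \<subseteq> C"
proof -
  obtain C where C: "C \<in> rcosets N'" "D \<subseteq> C" using coset_coarsen[OF N D(1)] .
  obtain z where z: "z \<in> D" using G.rcosets_nonempty[OF G.fin_index_normalsD(2)[OF N(1)] D(1)] .
  have "C \<subseteq> F" using saturated C D z unfolding saturated_def by blast
  moreover have "C'' = C" if "C'' \<in> rcosets N'" "D \<subseteq> C''" for C''
    using G.rcosets_memb(1)[OF G.fin_index_normalsD(2)[OF N(2)]] C that z by (metis subsetD)
  ultimately show ?thesis using C by blast
qed

lemma meas_refine:
  assumes x: "x \<in> carrier V" and N: "N \<in> Nor" "N' \<in> Nor" "N \<subseteq> N'" and saturated: "saturated N' E"
  shows "meas x N E = meas x N' E"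
proof -
  have "meas x N' E = (\<Oplus>\<^bsub>k\<^esub>C\<in>{C \<in> rcosets N'. C \<subseteq> E}. meas x N C)"
    unfolding meas_def[of x N' E] using V_D(3)[OF x N(2)] V_D(5)[OF x N]
    by (intro k.finsum_cong') (auto simp: meas_closed[OF x N(1)])
  also have "\<dots> = meas x N E"
    using coset_in_unique[OF N _ _ saturated] G.fin_index_normalsD(3)[OF N(2)]
    by (intro meas_partition[OF x N(1)]) auto
  finally show ?thesis by simp
qed

text \<open>
  The measure of a coset of a large subgroup is the sum over the cosets of a smaller one, so only small
  subgroups matter.
\<close>

lemma V_zeroI:
  assumes x: "x \<in> carrier V" and N0: "N0 \<in> Nor"
    and z: "\<And>N C. N \<in> Nor \<Longrightarrow> N \<subseteq> N0 \<Longrightarrow> C \<in> rcosets N \<Longrightarrow> x N C = \<zero>\<^bsub>k\<^esub>"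
  shows "x = \<zero>\<^bsub>V\<^esub>"
proof (rule V_eqI[OF x zero_V_closed])
  fix N C assume N: "N \<in> Nor" "C \<in> rcosets N"
  have I: "N \<inter> N0 \<in> Nor" using G.fin_index_normals_Int[OF N(1) N0] .
  have "x N C = meas x (N \<inter> N0) C" using V_D(5)[OF x I N(1) _ N(2)] by simp
  also have "\<dots> = \<zero>\<^bsub>k\<^esub>" unfolding meas_def using z[OF I] by (auto intro!: k.add.finprod_one_eqI)
  finally show "x N C = \<zero>\<^bsub>V\<^esub> N C" using N by (simp add: zero_V)
qed

definition supported :: "'g set \<Rightarrow> ('g set \<Rightarrow> 'g set \<Rightarrow> 'r) set"
  where "supported E = {x \<in> carrier V. \<forall>N\<in>Nor. \<forall>C\<in>rcosets N. C \<inter> E = {} \<longrightarrow> x N C = \<zero>\<^bsub>k\<^esub>}"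

text \<open>
  The restriction of the measure \<open>x\<close> to a union \<open>E\<close> of cosets of \<open>N0\<close>.  Passing from \<open>N\<close> to \<open>N \<inter> N0\<close>
  makes the sets \<open>E \<inter> C\<close> measurable.
\<close>

definition restr :: "'g set \<Rightarrow> 'g set \<Rightarrow> ('g set \<Rightarrow> 'g set \<Rightarrow> 'r) \<Rightarrow> ('g set \<Rightarrow> 'g set \<Rightarrow> 'r)"
  where "restr N0 E x = (\<lambda>N\<in>Nor. \<lambda>C\<in>rcosets N. meas x (N \<inter> N0) (E \<inter> C))"

lemma restr_closed:
  assumes x: "x \<in> carrier V" and N0: "N0 \<in> Nor" and E: "saturated N0 E"
  shows "restr N0 E x \<in> carrier V"
  unfolding restr_def
proof (rule V_I)
  fix N C assume "N \<in> Nor"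
  then show "meas x (N \<inter> N0) (E \<inter> C) \<in> carrier k"
    by (intro meas_closed[OF x] G.fin_index_normals_Int N0)
next
  fix N N' C' assume N: "N \<in> Nor" "N' \<in> Nor" "N \<subseteq> N'" "C' \<in> rcosets N'"
  have I: "N \<inter> N0 \<in> Nor" "N' \<inter> N0 \<in> Nor" using N N0 by (auto intro: G.fin_index_normals_Int)
  have satC: "saturated N C'" using saturated_mono[OF N(1-3) saturated_coset[OF N(2,4)]] .
  have "(\<Oplus>\<^bsub>k\<^esub>C\<in>{C \<in> rcosets N. C \<subseteq> C'}. meas x (N \<inter> N0) (E \<inter> C)) = meas x (N \<inter> N0) (E \<inter> C')"
  proof (rule meas_partition[OF x I(1)])
    show "finite {C \<in> rcosets N. C \<subseteq> C'}" using G.fin_index_normalsD(3)[OF N(1)] by simp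
    fix D assume "D \<in> rcosets (N \<inter> N0)" "D \<subseteq> E \<inter> C'"
    then show "\<exists>!C. C \<in> {C \<in> rcosets N. C \<subseteq> C'} \<and> D \<subseteq> E \<inter> C"
      using coset_in_unique[OF I(1) N(1) _ _ _ satC, of D] by simp
  qed auto
  also have "\<dots> = meas x (N' \<inter> N0) (E \<inter> C')"
  proof (rule meas_refine[OF x I])
    show "saturated (N' \<inter> N0) (E \<inter> C')"
      by (intro saturated_Int saturated_mono[OF I(2) N0 _ E] saturated_mono[OF I(2) N(2) _ saturated_coset[OF N(2,4)]]) auto
  qed (use N in auto)
  finally show "(\<Oplus>\<^bsub>k\<^esub>C\<in>{C \<in> rcosets N. C \<subseteq> C'}. meas x (N \<inter> N0) (E \<inter> C)) = meas x (N' \<inter> N0) (E \<inter> C')" .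
qed

lemma restr_supported:
  assumes x: "x \<in> carrier V" and N0: "N0 \<in> Nor" and E: "saturated N0 E"
  shows "restr N0 E x \<in> supported E"
proof -
  have "meas x (N \<inter> N0) (E \<inter> C) = \<zero>\<^bsub>k\<^esub>" if "N \<in> Nor" "C \<inter> E = {}" for N C
  proof -
    have s: "subgroup (N \<inter> N0) G" using G.fin_index_normalsD(2)[OF G.fin_index_normals_Int[OF that(1) N0]] .
    have "{D \<in> rcosets (N \<inter> N0). D \<subseteq> E \<inter> C} = {}"
      using G.rcosets_nonempty[OF s] that by blast
    then show ?thesis by (simp only: meas_def k.finsum_empty)
  qed
  then show ?thesis using restr_closed[OF assms] by (auto simp: supported_def restr_def)
qed

lemma restr_sum:
  assumes x: "x \<in> carrier V" and N0: "N0 \<in> Nor" and T: "finite T"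
    and E: "\<And>t. t \<in> T \<Longrightarrow> saturated N0 (E t)" and part: "\<And>g. g \<in> carrier G \<Longrightarrow> \<exists>!t. t \<in> T \<and> g \<in> E t"
  shows "x = (\<Oplus>\<^bsub>V\<^esub>t\<in>T. restr N0 (E t) x)"
proof (rule V_eqI[OF x])
  have rc: "(\<lambda>t. restr N0 (E t) x) \<in> T \<rightarrow> carrier V" using restr_closed[OF x N0 E] by auto
  show "(\<Oplus>\<^bsub>V\<^esub>t\<in>T. restr N0 (E t) x) \<in> carrier V" using rc by (rule V.M.finsum_closed)
  fix N C assume N: "N \<in> Nor" "C \<in> rcosets N"
  have I: "N \<inter> N0 \<in> Nor" using N N0 by (auto intro: G.fin_index_normals_Int)
  have "(\<Oplus>\<^bsub>V\<^esub>t\<in>T. restr N0 (E t) x) N C = (\<Oplus>\<^bsub>k\<^esub>t\<in>T. meas x (N \<inter> N0) (E t \<inter> C))"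
    using finsum_V_app[OF T rc N] N by (simp add: restr_def)
  also have "\<dots> = meas x (N \<inter> N0) C"
  proof (rule meas_partition[OF x I T])
    fix D assume D: "D \<in> rcosets (N \<inter> N0)" "D \<subseteq> C"
    obtain z where z: "z \<in> D" using G.rcosets_nonempty[OF G.fin_index_normalsD(2)[OF I] D(1)] .
    have "z \<in> carrier G" using G.rcosets_memb(2)[OF G.fin_index_normalsD(2)[OF I] D(1) z] .
    then obtain t where t: "t \<in> T" "z \<in> E t" "\<And>t'. t' \<in> T \<Longrightarrow> z \<in> E t' \<Longrightarrow> t' = t" using part[of z] by (metis (no_types))
    have "saturated (N \<inter> N0) (E t)" by (rule saturated_mono[OF I N0 _ E[OF t(1)]]) auto
    then have "D \<subseteq> E t" using D z t(2) unfolding saturated_def by blast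
    then show "\<exists>!t. t \<in> T \<and> D \<subseteq> E t \<inter> C"
    proof (intro ex1I[of _ t] conjI)
      show "t' = t" if "t' \<in> T \<and> D \<subseteq> E t' \<inter> C" for t' using t(3)[of t'] that z by blast
    qed (use t(1) D in auto)
  qed auto
  also have "\<dots> = x N C" using V_D(5)[OF x I N(1) _ N(2)] by simp
  finally show "x N C = (\<Oplus>\<^bsub>V\<^esub>t\<in>T. restr N0 (E t) x) N C" by simp
qed

end

section \<open>Actions of a free subgroup on finite sets\<close>

lemma (in abelian_monoid) finsum_bij:
  assumes "bij_betw \<theta> I J" "f \<in> J \<rightarrow> carrier G"
  shows "(\<Oplus>i\<in>I. f (\<theta> i)) = (\<Oplus>j\<in>J. f j)"
  using assms finsum_reindex[of f \<theta> I] by (auto simp: bij_betw_def)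

fun word_action :: "'x set \<Rightarrow> ('s \<Rightarrow> 'x \<Rightarrow> 'x) \<Rightarrow> ('s \<times> bool) list \<Rightarrow> 'x \<Rightarrow> 'x"
  where
    "word_action X \<tau> [] x = x"
  | "word_action X \<tau> ((s, b) # w) x = (if b then \<tau> s else inv_into X (\<tau> s)) (word_action X \<tau> w x)"

lemma word_action_append: "word_action X \<tau> (u @ w) x = word_action X \<tau> u (word_action X \<tau> w x)"
  by (induction u) auto

locale finite_index_free = cyclic_group_algebra G k n
  for G :: "('g, 'b) monoid_scheme" (structure) and k :: "('r, 'c) ring_scheme" and n +
  fixes H S :: "'g set"
  assumes H: "subgroup H G" and finH: "finite (rcosets H)"
    and free: "free_group_on (G\<lparr>carrier := H\<rparr>) S"
begin

abbreviation "words \<equiv> lists (S \<times> (UNIV :: bool set))"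
abbreviation "wv \<equiv> word_value (G\<lparr>carrier := H\<rparr>)"

lemma S_H: "s \<in> S \<Longrightarrow> s \<in> H"
  using free by (auto simp: free_group_on_def)

lemma H_G: "h \<in> H \<Longrightarrow> h \<in> carrier G"
  using subgroup.mem_carrier[OF H] .

lemma inv_H: "h \<in> H \<Longrightarrow> inv\<^bsub>G\<lparr>carrier := H\<rparr>\<^esub> h = inv h"
  using G.m_inv_consistent[OF H] .

lemma H_closed: "h \<in> H \<Longrightarrow> h' \<in> H \<Longrightarrow> h \<otimes> h' \<in> H" "h \<in> H \<Longrightarrow> inv h \<in> H" "\<one> \<in> H"
  using subgroup.m_closed[OF H] subgroup.m_inv_closed[OF H] subgroup.one_closed[OF H] by auto

lemma wv_simps [simp]:
  "wv [] = \<one>" "s \<in> S \<Longrightarrow> wv ((s, b) # w) = (if b then s else inv s) \<otimes> wv w"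
  using inv_H[OF S_H] by simp_all

declare word_value.simps [simp del]

lemma wv_H: "w \<in> words \<Longrightarrow> wv w \<in> H"
proof (induction w)
  case (Cons l w)
  obtain s b where "l = (s, b)" "s \<in> S" using Cons.prems by (cases l) auto
  then show ?case using Cons H_closed S_H by simp
qed (simp add: H_closed)

lemma wv_append: "u \<in> words \<Longrightarrow> w \<in> words \<Longrightarrow> wv (u @ w) = wv u \<otimes> wv w"
proof (induction u)
  case Nil
  then show ?case using H_G[OF wv_H] by simp
next
  case (Cons l u)
  obtain s b where l: "l = (s, b)" "s \<in> S" using Cons.prems by (cases l) auto
  then show ?case
    using Cons H_G[OF wv_H] H_G[OF S_H] by (simp add: G.m_assoc)
qed

text \<open>
  Cancelling a letter against its inverse changes neither the value of a word nor its action, so an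
  arbitrary word can be replaced by a reduced one.
\<close>

lemma reduce_word:
  assumes \<tau>: "\<And>s. s \<in> S \<Longrightarrow> bij_betw (\<tau> s) X X" and "w \<in> words"
  shows "\<exists>w'\<in>reduced_words S. wv w' = wv w \<and> (\<forall>x\<in>X. word_action X \<tau> w' x = word_action X \<tau> w x \<and> word_action X \<tau> w x \<in> X)"
  using assms(2)
proof (induction w rule: list.induct)
  case Nil
  have "[] \<in> reduced_words S" by (simp add: reduced_words_def)
  then show ?case by (intro bexI[of _ "[]"]) auto
next
  case (Cons l w)
  obtain s b where l: "l = (s, b)" "s \<in> S" using Cons.prems by (cases l) auto
  obtain w' where w': "w' \<in> reduced_words S" "wv w' = wv w"
    "\<And>x. x \<in> X \<Longrightarrow> word_action X \<tau> w' x = word_action X \<tau> w x" "\<And>x. x \<in> X \<Longrightarrow> word_action X \<tau> w x \<in> X"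
    using Cons by auto
  have inX: "word_action X \<tau> (l # w) x \<in> X" if "x \<in> X" for x
    using \<tau>[OF l(2)] w'(4)[OF that] bij_betwE[OF \<tau>[OF l(2)]] bij_betwE[OF bij_betw_inv_into[OF \<tau>[OF l(2)]]]
    by (auto simp: l)
  show ?case
  proof (cases "\<exists>w''. w' = (s, \<not> b) # w''")
    case True
    then obtain w'' where w'': "w' = (s, \<not> b) # w''" by blast
    have red: "w'' \<in> reduced_words S" and ww: "w'' \<in> words"
      using w'(1) by (auto simp: w'' reduced_words_def successively_Cons)
    have "wv (l # w) = (if b then s else inv s) \<otimes> ((if \<not> b then s else inv s) \<otimes> wv w'')"
      using w'(2) l by (simp add: w'')
    also have "\<dots> = wv w''"
      using H_G[OF wv_H[OF ww]] H_G[OF S_H[OF l(2)]] by (simp flip: G.m_assoc)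
    finally have "wv w'' = wv (l # w)" by simp
    moreover have "word_action X \<tau> w'' x = word_action X \<tau> (l # w) x" if "x \<in> X" for x
    proof -
      have wx: "word_action X \<tau> w x = (if \<not> b then \<tau> s else inv_into X (\<tau> s)) (word_action X \<tau> w'' x)"
        using w'(3)[OF that] by (simp add: w'')
      have "word_action X \<tau> u x \<in> X" if u: "u \<in> words" for u
        using u
      proof (induction u rule: list.induct)
        case Nil
        then show ?case using \<open>x \<in> X\<close> by simp
      next
        case (Cons l' u)
        obtain t c where t: "l' = (t, c)" "t \<in> S" using Cons.prems by (cases l') auto
        then show ?case using Cons bij_betwE[OF \<tau>[OF t(2)]] bij_betwE[OF bij_betw_inv_into[OF \<tau>[OF t(2)]]] by auto
      qed
      from this[OF ww] have wX: "word_action X \<tau> w'' x \<in> X" .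
      have inj: "inj_on (\<tau> s) X" "\<tau> s ` X = X" using \<tau>[OF l(2)] by (auto simp: bij_betw_def)
      show ?thesis
        using wx wX inv_into_f_f[OF inj(1) wX] f_inv_into_f[of "word_action X \<tau> w'' x" "\<tau> s" X] inj
        by (cases b) (auto simp: l)
    qed
    ultimately show ?thesis using red inX by blast
  next
    case False
    have "l # w' \<in> reduced_words S"
      using w'(1) False l by (cases w') (auto simp: reduced_words_def successively_Cons)
    moreover have "wv (l # w') = wv (l # w)" using w'(2) l by simp
    moreover have "word_action X \<tau> (l # w') x = word_action X \<tau> (l # w) x" if "x \<in> X" for x
      using w'(3)[OF that] l by simp
    ultimately show ?thesis using inX by blast
  qed
qed

lemma reduced_unique:
  assumes "w \<in> reduced_words S" "w' \<in> reduced_words S" "wv w = wv w'"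
  shows "w = w'"
proof -
  have "wv w \<in> H" using assms by (intro wv_H) (auto simp: reduced_words_def)
  then have "\<exists>!u. u \<in> reduced_words S \<and> wv u = wv w" using free by (simp add: free_group_on_def)
  then show ?thesis using assms by metis
qed

lemma word_exists:
  assumes "h \<in> H" obtains w where "w \<in> words" "wv w = h"
proof -
  have "\<exists>w. w \<in> reduced_words S \<and> wv w = h" using free assms by (auto simp: free_group_on_def)
  then show ?thesis using that by (auto simp: reduced_words_def)
qed

text \<open>
  The universal property of a free group: permutations of \<open>X\<close>, chosen arbitrarily for the elements of the
  basis, extend to an action of \<open>H\<close>.  An element acts through its reduced word, which is unique.
\<close>

lemma free_action_exists:
  assumes \<tau>: "\<And>s. s \<in> S \<Longrightarrow> bij_betw (\<tau> s) X X"
  obtains \<rho> where "\<And>h x. h \<in> H \<Longrightarrow> x \<in> X \<Longrightarrow> \<rho> h x \<in> X"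
    "\<And>g h x. g \<in> H \<Longrightarrow> h \<in> H \<Longrightarrow> x \<in> X \<Longrightarrow> \<rho> (g \<otimes> h) x = \<rho> g (\<rho> h x)"
    "\<And>s x. s \<in> S \<Longrightarrow> x \<in> X \<Longrightarrow> \<rho> s x = \<tau> s x" "\<And>x. x \<in> X \<Longrightarrow> \<rho> \<one> x = x"
proof -
  define wd where "wd h = (SOME w. w \<in> reduced_words S \<and> wv w = h)" for h
  have wd: "wd h \<in> reduced_words S \<and> wv (wd h) = h" if "h \<in> H" for h
    unfolding wd_def by (rule someI_ex) (use free that in \<open>auto simp: free_group_on_def\<close>)
  then have wdw: "wd h \<in> words" if "h \<in> H" for h using that by (auto simp: reduced_words_def)
  define \<rho> where "\<rho> h x = word_action X \<tau> (wd h) x" for h x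
  have \<rho>: "\<rho> (wv w) x = word_action X \<tau> w x \<and> word_action X \<tau> w x \<in> X" if w: "w \<in> words" and x: "x \<in> X" for w x
  proof -
    obtain w' where w': "w' \<in> reduced_words S" "wv w' = wv w"
      and act: "\<forall>x\<in>X. word_action X \<tau> w' x = word_action X \<tau> w x \<and> word_action X \<tau> w x \<in> X"
      using reduce_word[of \<tau> X w] \<tau> w by blast
    have "wd (wv w) = w'"
      using reduced_unique w' wd[OF wv_H[OF w]] by metis
    then show ?thesis using act x by (simp add: \<rho>_def)
  qed
  show ?thesis
  proof (rule that[of \<rho>])
    fix g h x assume *: "g \<in> H" "h \<in> H" "x \<in> X"
    have "\<rho> (g \<otimes> h) x = \<rho> (wv (wd g @ wd h)) x" using wv_append wdw wd * by simp
    also have "\<dots> = word_action X \<tau> (wd g @ wd h) x" using \<rho>[of "wd g @ wd h" x] wdw * by simp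
    finally show "\<rho> (g \<otimes> h) x = \<rho> g (\<rho> h x)" by (simp add: \<rho>_def word_action_append)
  next
    fix s x assume *: "s \<in> S" "x \<in> X"
    have "wv [(s, True)] = s" using *(1) H_G[OF S_H] by simp
    then show "\<rho> s x = \<tau> s x" using \<rho>[of "[(s, True)]" x] * by simp
  next
    fix x assume "x \<in> X"
    then show "\<rho> \<one> x = x" using \<rho>[of "[]" x] by simp
  next
    fix h x assume "h \<in> H" "x \<in> X"
    then show "\<rho> h x \<in> X" using \<rho>[OF wdw, of h x] wd by simp
  qed
qed

lemma coset_sub_H:
  assumes N: "N \<in> Nor" "N \<subseteq> H" and C: "C \<in> rcosets N" "C \<inter> H \<noteq> {}"
  shows "C \<subseteq> H"
proof -
  obtain z where "z \<in> C" "z \<in> H" using C by blast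
  then have "C = N #> z" using G.rcosets_memb(1)[OF G.fin_index_normalsD(2)[OF N(1)] C(1)] by simp
  then show ?thesis using N(2) H_closed \<open>z \<in> H\<close> by (auto simp: r_coset_def)
qed

lemma l_coset_sub_H: "h \<in> H \<Longrightarrow> C \<subseteq> H \<Longrightarrow> h <# C \<subseteq> H"
  using H_closed by (auto simp: l_coset_def)

text \<open>
  The elements of \<open>N1\<close> in the stabilizer of \<open>z\<close> form a subgroup of finite index in \<open>G\<close>: modulo this
  subgroup an element is determined by its cosets of \<open>H\<close> and of \<open>N1\<close> and by a point of the finite set
  \<open>X\<close>.  The group \<open>N\<close> is its normal core.
\<close>

lemma stabilizer_finite_index:
  assumes N1: "N1 \<in> Nor" and X: "finite X" "z \<in> X"
    and \<rho>: "\<And>h x. h \<in> H \<Longrightarrow> x \<in> X \<Longrightarrow> \<rho> h x \<in> X"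
      "\<And>g h x. g \<in> H \<Longrightarrow> h \<in> H \<Longrightarrow> x \<in> X \<Longrightarrow> \<rho> (g \<otimes> h) x = \<rho> g (\<rho> h x)"
      "\<And>x. x \<in> X \<Longrightarrow> \<rho> \<one> x = x"
  obtains N where "N \<in> Nor" "N \<subseteq> N1" "\<And>h. h \<in> N \<Longrightarrow> h \<in> H \<and> \<rho> h z = z"
proof -
  note D = G.fin_index_normalsD[OF N1]
  \<comment> \<open>the stabilizer of \<open>z\<close> in \<open>H \<inter> N1\<close>\<close>
  define L where "L = {h \<in> H \<inter> N1. \<rho> h z = z}"
  have inv: "\<rho> (inv h) (\<rho> h x) = x" if "h \<in> H" "x \<in> X" for h x
    using \<rho>(2)[of "inv h" h x] \<rho>(3) that H_closed H_G by simp
  have L: "subgroup L G"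
  proof (rule G.subgroupI)
    show "L \<subseteq> carrier G" using H_G by (auto simp: L_def)
    have "\<one> \<in> L" using \<rho>(3) X H_closed subgroup.one_closed[OF D(2)] by (simp add: L_def)
    then show "L \<noteq> {}" by blast
    show "inv a \<in> L" if "a \<in> L" for a
      using that inv[of a z] X H_closed subgroup.m_inv_closed[OF D(2)] by (auto simp: L_def)
    show "a \<otimes> b \<in> L" if "a \<in> L" "b \<in> L" for a b
      using that \<rho>(2)[of a b z] X H_closed subgroup.m_closed[OF D(2)] by (auto simp: L_def)
  qed
  define r where "r C = (SOME x. x \<in> C)" for C :: "'g set"
  have r: "r (H #> g) \<otimes> inv g \<in> H \<and> r (H #> g) \<in> carrier G" if g: "g \<in> carrier G" for g
  proof -
    have "g \<in> H #> g" using G.rcos_self[OF g H] .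
    then have "r (H #> g) \<in> H #> g" unfolding r_def by (rule someI)
    then obtain h where "h \<in> H" "r (H #> g) = h \<otimes> g" by (auto simp: r_coset_def)
    then show ?thesis using g H_G by (simp add: G.m_assoc)
  qed
  define \<phi> where "\<phi> g = (H #> g, N1 #> g, \<rho> (r (H #> g) \<otimes> inv g) z)" for g
  have "finite (rcosets L)"
  proof (rule G.finite_index_by_map[OF L, of \<phi>])
    have "\<phi> ` carrier G \<subseteq> (rcosets H) \<times> (rcosets N1) \<times> X"
      using r \<rho>(1) X by (auto simp: \<phi>_def RCOSETS_def)
    then show "finite (\<phi> ` carrier G)" using finH D(3) X(1) by (meson finite_SigmaI finite_subset)
    fix x y assume xy: "x \<in> carrier G" "y \<in> carrier G" and eq: "\<phi> x = \<phi> y"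
    define a where "a = r (H #> x) \<otimes> inv x"
    define b where "b = r (H #> x) \<otimes> inv y"
    have Hx: "H #> x = H #> y" "N1 #> x = N1 #> y" "\<rho> a z = \<rho> b z"
      using eq by (auto simp: \<phi>_def a_def b_def)
    have ab: "a \<in> H" "b \<in> H" using r[OF xy(1)] r[OF xy(2)] Hx(1) by (auto simp: a_def b_def)
    have "x \<otimes> inv y = inv a \<otimes> b"
    proof -
      have "inv a \<otimes> b = x \<otimes> (inv r (H #> x) \<otimes> (r (H #> x) \<otimes> inv y))"
        using r[OF xy(1)] xy by (simp add: a_def b_def G.inv_mult_group G.m_assoc)
      also have "inv r (H #> x) \<otimes> (r (H #> x) \<otimes> inv y) = inv y"
        using r[OF xy(1)] xy by (simp flip: G.m_assoc)
      finally show ?thesis by simp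
    qed
    moreover have "\<rho> (inv a \<otimes> b) z = z"
      using \<rho>(2)[of "inv a" b z] inv[OF ab(1) X(2)] Hx(3) ab X H_closed by simp
    moreover have "x \<otimes> inv y \<in> H" "x \<otimes> inv y \<in> N1"
      using G.rcoset_eq_iff[OF H xy] G.rcoset_eq_iff[OF D(2) xy] Hx by auto
    ultimately show "x \<otimes> inv y \<in> L" by (simp add: L_def)
  qed
  then obtain N where "N \<in> Nor" "N \<subseteq> L" using G.normal_core_exists[OF L] by blast
  then show ?thesis using that[of N] by (auto simp: L_def)
qed

text \<open>
  Let \<open>H\<close> act on locally constant functions on \<open>Y \<times> H\<close> through \<open>\<sigma>\<close> and left translation.  The cocycle
  that sends \<open>s0\<close> to an indicator function, given by \<open>y0\<close> and \<open>C0\<close>, and the rest of the basis to \<open>0\<close> exists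
  because \<open>H\<close> is free, and the lemma asserts that it is a coboundary.  The primitive \<open>c\<close> is obtained by letting \<open>H\<close> act on the
  finite set \<open>X\<close> of functions on \<open>Y \<times> H/N1\<close> by affine maps \<open>\<tau> s\<close> whose translation part is the
  prescribed value: \<open>c y x\<close> is the value at \<open>(y, N1 x)\<close> of the function to which \<open>x\<close> moves the zero
  function.  As \<open>X\<close> is finite, \<open>c\<close> is constant on the cosets of some \<open>N\<close>.
\<close>

lemma coboundary_exists:
  fixes Y :: "'y set"
  assumes N1: "N1 \<in> Nor" "N1 \<subseteq> H" and Y: "finite Y" and \<sigma>: "\<And>s. s \<in> S \<Longrightarrow> bij_betw (\<sigma> s) Y Y"
  obtains N c where "N \<in> Nor" "N \<subseteq> N1"
    "\<And>y C. y \<in> Y \<Longrightarrow> C \<in> rcosets N \<Longrightarrow> C \<subseteq> H \<Longrightarrow> c y C \<in> carrier k"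
    "\<And>s y C. s \<in> S \<Longrightarrow> y \<in> Y \<Longrightarrow> C \<in> rcosets N \<Longrightarrow> C \<subseteq> H \<Longrightarrow>
      c (\<sigma> s y) (s <# C) = c y C \<oplus>\<^bsub>k\<^esub> (if s = s0 \<and> \<sigma> s y = y0 \<and> N1 <#> C = C0 then \<one>\<^bsub>k\<^esub> else \<zero>\<^bsub>k\<^esub>)"
proof -
  note D1 = G.fin_index_normalsD[OF N1(1)]
  define Q where "Q = {C \<in> rcosets N1. C \<subseteq> H}"
  define X where "X = (Y \<times> Q \<rightarrow>\<^sub>E carrier k)"
  have finX: "finite X" unfolding X_def using Y D1(3) finite_k by (intro finite_PiE) (auto simp: Q_def)
  define jump where "jump s y C = (if s = s0 \<and> y = y0 \<and> C = C0 then \<one>\<^bsub>k\<^esub> else \<zero>\<^bsub>k\<^esub>)" for s and y :: 'y and C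
  define \<tau> where "\<tau> s f = (\<lambda>(y, C)\<in>Y \<times> Q. f (inv_into Y (\<sigma> s) y, inv s <# C) \<oplus>\<^bsub>k\<^esub> jump s y (inv s <# C))"
    for s and f :: "'y \<times> 'g set \<Rightarrow> 'r"
  have Qact: "h <# C \<in> Q" if "h \<in> H" "C \<in> Q" for h C
    using that G.l_coset_rcosets[OF D1(1) H_G] l_coset_sub_H by (auto simp: Q_def)
  have Qsub: "C \<subseteq> carrier G" if "C \<in> Q" for C using that G.rcosets_sub[OF D1(2)] by (auto simp: Q_def)
  have \<tau>X: "\<tau> s f \<in> X" if s: "s \<in> S" and f: "f \<in> X" for s f
  proof -
    have "inv_into Y (\<sigma> s) y \<in> Y" if "y \<in> Y" for y
      using bij_betwE[OF bij_betw_inv_into[OF \<sigma>[OF s]]] that by auto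
    moreover have "inv s <# C \<in> Q" if "C \<in> Q" for C using Qact H_closed S_H s that by auto
    ultimately show ?thesis using f by (auto simp: X_def \<tau>_def jump_def PiE_iff Pi_def)
  qed
  have \<tau>app: "\<tau> s f (\<sigma> s y, s <# C) = f (y, C) \<oplus>\<^bsub>k\<^esub> jump s (\<sigma> s y) C"
    if s: "s \<in> S" and y: "y \<in> Y" and C: "C \<in> Q" for s f y C
    using bij_betwE[OF \<sigma>[OF s]] y Qact[OF S_H[OF s] C] G.l_coset_inv_cancel(1)[OF H_G[OF S_H[OF s]] Qsub[OF C]]
      inv_into_f_f[OF bij_betw_imp_inj_on[OF \<sigma>[OF s]] y]
    by (simp add: \<tau>_def)
  have "bij_betw (\<tau> s) X X" if s: "s \<in> S" for s
  proof -
    have "inj_on (\<tau> s) X"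
    proof (rule inj_onI)
      fix f f' assume f: "f \<in> X" "f' \<in> X" and eq: "\<tau> s f = \<tau> s f'"
      have "f (y, C) = f' (y, C)" if "y \<in> Y" "C \<in> Q" for y C
      proof -
        have "f (y, C) \<oplus>\<^bsub>k\<^esub> jump s (\<sigma> s y) C = f' (y, C) \<oplus>\<^bsub>k\<^esub> jump s (\<sigma> s y) C"
          using \<tau>app[OF s that, of f] \<tau>app[OF s that, of f'] eq by simp
        moreover have "f (y, C) \<in> carrier k" "f' (y, C) \<in> carrier k" using f that by (auto simp: X_def)
        ultimately show ?thesis by (simp add: jump_def split: if_splits)
      qed
      then show "f = f'" using f by (intro extensionalityI[of f "Y \<times> Q" f']) (auto simp: X_def PiE_iff)
    qed
    moreover from this have "\<tau> s ` X = X" using finX \<tau>X s by (intro endo_inj_surj) auto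
    ultimately show ?thesis by (simp add: bij_betw_def)
  qed
  then obtain \<rho> where \<rho>: "\<And>h x. h \<in> H \<Longrightarrow> x \<in> X \<Longrightarrow> \<rho> h x \<in> X"
    "\<And>g h x. g \<in> H \<Longrightarrow> h \<in> H \<Longrightarrow> x \<in> X \<Longrightarrow> \<rho> (g \<otimes> h) x = \<rho> g (\<rho> h x)"
    "\<And>s x. s \<in> S \<Longrightarrow> x \<in> X \<Longrightarrow> \<rho> s x = \<tau> s x" "\<And>x. x \<in> X \<Longrightarrow> \<rho> \<one> x = x"
    using free_action_exists[of \<tau> X] by blast
  define z where "z = (\<lambda>_\<in>Y \<times> Q. \<zero>\<^bsub>k\<^esub>)"
  have z: "z \<in> X" by (auto simp: z_def X_def)
  obtain N where N: "N \<in> Nor" "N \<subseteq> N1" "\<And>h. h \<in> N \<Longrightarrow> h \<in> H \<and> \<rho> h z = z"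
    using stabilizer_finite_index[OF N1(1) finX z \<rho>(1,2,4)] by blast
  note D = G.fin_index_normalsD[OF N(1)]
  define c' where "c' y x = \<rho> x z (y, N1 #> x)" for y x
  define c where "c y C = c' y (SOME x. x \<in> C)" for y and C :: "'g set"
  have inQ: "N1 #> x \<in> Q" if "x \<in> H" for x
    using that D1(4) N1(2) H_G H_closed by (auto simp: Q_def r_coset_def intro!: G.rcosetsI[unfolded r_coset_def])
  have c_eq: "c y C = c' y x" if C: "C \<in> rcosets N" "C \<subseteq> H" and x: "x \<in> C" for y C x
  proof -
    define x' where "x' = (SOME x. x \<in> C)"
    have x': "x' \<in> C" unfolding x'_def using x by (rule someI)
    have xH: "x \<in> H" "x' \<in> H" "x \<in> carrier G" "x' \<in> carrier G" using C x x' H_G by auto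
    have e: "N #> x' = N #> x" using G.rcosets_memb(1)[OF D(2) C(1)] x x' by metis
    then have m: "x' \<otimes> inv x \<in> N" using G.rcoset_eq_iff[OF D(2)] xH by simp
    \<comment> \<open>right cosets are used, but \<open>\<rho>\<close> is a left action: normality moves the factor to the right\<close>
    define m' where "m' = inv x \<otimes> (x' \<otimes> inv x) \<otimes> x"
    have "m' \<in> N" using normal.inv_op_closed1[OF D(1) xH(3) m] by (simp add: m'_def)
    have "x' = x \<otimes> m'"
      unfolding m'_def using xH by (simp add: G.m_assoc) (simp flip: G.m_assoc)
    then have "\<rho> x' z = \<rho> x z" using \<rho>(2)[of x m' z] N(3)[OF \<open>m' \<in> N\<close>] xH z by simp
    moreover have "N1 #> x' = N1 #> x" using G.rcoset_eq_iff[OF D1(2)] m N(2) xH by auto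
    ultimately show ?thesis by (simp add: c_def c'_def x'_def)
  qed
  show ?thesis
  proof (rule that[OF N(1,2), of c])
    fix y C assume y: "y \<in> Y" and C: "C \<in> rcosets N" "C \<subseteq> H"
    obtain x where x: "x \<in> C" using G.rcosets_nonempty[OF D(2) C(1)] .
    then have "\<rho> x z \<in> X" using \<rho>(1) z C by auto
    then show "c y C \<in> carrier k" using c_eq[OF C x] inQ[of x] x C y by (auto simp: c'_def X_def)
    fix s assume s: "s \<in> S"
    have xH: "x \<in> H" "s \<in> H" "x \<in> carrier G" "s \<in> carrier G" using x C s S_H H_G by auto
    have sC: "s <# C \<in> rcosets N" "s <# C \<subseteq> H" "s \<otimes> x \<in> s <# C"
      using G.l_coset_rcosets[OF D(1) xH(4) C(1)] l_coset_sub_H[OF xH(2) C(2)] x by (auto simp: l_coset_def)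
    have "c (\<sigma> s y) (s <# C) = \<rho> (s \<otimes> x) z (\<sigma> s y, N1 #> (s \<otimes> x))"
      using c_eq[OF sC] by (simp add: c'_def)
    also have "\<dots> = \<tau> s (\<rho> x z) (\<sigma> s y, s <# (N1 #> x))"
      using \<rho>(2)[OF xH(2,1) z] \<rho>(3)[OF s \<rho>(1)[OF xH(1) z]] G.l_coset_rcoset[OF D1(1) xH(4,3)] by simp
    also have "\<dots> = c y C \<oplus>\<^bsub>k\<^esub> jump s (\<sigma> s y) (N1 #> x)"
      using \<tau>app[OF s y inQ[OF xH(1)]] c_eq[OF C x] by (simp add: c'_def)
    also have "N1 #> x = N1 <#> C"
    proof -
      have "N1 #> x \<in> rcosets N1" using xH D1(4) by (intro G.rcosetsI)
      moreover have "C \<subseteq> N1 #> x"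
        using G.rcosets_memb(1)[OF D(2) C(1) x] N(2) by (auto simp: r_coset_def)
      ultimately show ?thesis using G.rcoset_subset_iff[OF D(2) D1(2) N(2) C(1), of "N1 #> x"] by metis
    qed
    finally show "c (\<sigma> s y) (s <# C) = c y C \<oplus>\<^bsub>k\<^esub> (if s = s0 \<and> \<sigma> s y = y0 \<and> N1 <#> C = C0 then \<one>\<^bsub>k\<^esub> else \<zero>\<^bsub>k\<^esub>)"
      by (simp add: jump_def)
  qed
qed

section \<open>Periodic relations between measures are trivial\<close>

text \<open>
  Relations between measures that are periodic, in the sense of being indexed by a finite set on which \<open>H\<close>
  acts, are trivial.  Read at level \<open>N\<close> and integrated against the function \<open>c\<close> of \<open>coboundary_exists\<close>,
  the sum of all relations becomes the integral of the measures \<open>b s y\<close> against the coboundary of \<open>c\<close>.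
  Only the measure of \<open>C0\<close> under \<open>b s0 y0\<close> survives, so it vanishes.
\<close>

theorem no_finite_relations:
  fixes Y :: "'y set"
  assumes Y: "finite Y" and \<sigma>: "\<And>s. s \<in> S \<Longrightarrow> bij_betw (\<sigma> s) Y Y"
    and S': "finite S'" "S' \<subseteq> S"
    and b: "\<And>s y. s \<in> S' \<Longrightarrow> y \<in> Y \<Longrightarrow> b s y \<in> supported H"
    and rel: "\<And>y. y \<in> Y \<Longrightarrow> (\<Oplus>\<^bsub>V\<^esub>s\<in>S'. s \<bullet>\<^bsub>V\<^esub> b s y) = (\<Oplus>\<^bsub>V\<^esub>s\<in>S'. b s (\<sigma> s y))"
    and s0: "s0 \<in> S'" and y0: "y0 \<in> Y"
  shows "b s0 y0 = \<zero>\<^bsub>V\<^esub>"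
proof -
  have bV: "b s y \<in> carrier V" if "s \<in> S'" "y \<in> Y" for s y using b[OF that] by (simp add: supported_def)
  have \<sigma>Y: "\<sigma> s y \<in> Y" if "s \<in> S'" "y \<in> Y" for s y using bij_betwE[OF \<sigma>] that S' by blast
  have S'G: "s \<in> carrier G" "s \<in> H" "s \<in> S" if "s \<in> S'" for s using that S' S_H H_G by auto
  obtain N0 where N0: "N0 \<in> Nor" "N0 \<subseteq> H" using G.normal_core_exists[OF H finH] .
  show ?thesis
  proof (rule V_zeroI[OF bV[OF s0 y0] N0(1)])
    fix N1 C0 assume N1: "N1 \<in> Nor" "N1 \<subseteq> N0" and C0: "C0 \<in> rcosets N1"
    have N1H: "N1 \<subseteq> H" using N1 N0 by auto
    note D1 = G.fin_index_normalsD[OF N1(1)]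
    show "b s0 y0 N1 C0 = \<zero>\<^bsub>k\<^esub>"
    proof (cases "C0 \<inter> H = {}")
      case True
      then show ?thesis using b[OF s0 y0] N1 C0 by (auto simp: supported_def)
    next
      case False
      then have C0H: "C0 \<subseteq> H" using coset_sub_H[OF N1(1) N1H C0] by simp
      define jump where "jump s y C = (if s = s0 \<and> y = y0 \<and> N1 <#> C = C0 then \<one>\<^bsub>k\<^esub> else \<zero>\<^bsub>k\<^esub>)" for s y C
      obtain N c where N: "N \<in> Nor" "N \<subseteq> N1"
        and cc: "\<And>y C. y \<in> Y \<Longrightarrow> C \<in> rcosets N \<Longrightarrow> C \<subseteq> H \<Longrightarrow> c y C \<in> carrier k"
        and c: "\<And>s y C. s \<in> S \<Longrightarrow> y \<in> Y \<Longrightarrow> C \<in> rcosets N \<Longrightarrow> C \<subseteq> H \<Longrightarrow>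
          c (\<sigma> s y) (s <# C) = c y C \<oplus>\<^bsub>k\<^esub> jump s (\<sigma> s y) C"
        by (rule coboundary_exists[where Y = Y and \<sigma> = \<sigma> and ?s0.0 = s0 and ?y0.0 = y0 and ?C0.0 = C0,
          OF N1(1) N1H Y \<sigma>, folded jump_def]) (assumption, rule that, assumption+)
      note D = G.fin_index_normalsD[OF N(1)]
      define I where "I = Y \<times> {C \<in> rcosets N. C \<subseteq> H}"
      have finI: "finite I" using Y D(3) by (simp add: I_def)
      have Csub: "C \<subseteq> carrier G" if "C \<in> rcosets N" for C using G.rcosets_sub[OF D(2) that] .
      have act: "s <# C \<in> rcosets N \<and> s <# C \<subseteq> H" if "s \<in> H" "C \<in> rcosets N" "C \<subseteq> H" for s C
        using that G.l_coset_rcosets[OF D(1) H_G] l_coset_sub_H by auto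
      have bk: "b s y N C \<in> carrier k" if "s \<in> S'" "y \<in> Y" "C \<in> rcosets N" for s y C
        using V_D(3)[OF bV N(1)] that by auto
      have jk: "jump s y C \<in> carrier k" for s y C by (simp add: jump_def)
      have bij: "bij_betw (\<lambda>(y, C). (\<sigma> s y, s <# C)) I I" if s: "s \<in> S'" for s
      proof -
        let ?Q = "{C \<in> rcosets N. C \<subseteq> H}"
        have sH: "s \<in> H" "inv s \<in> H" using S'G(2)[OF s] H_closed(2) by auto
        have Q: "s <# C \<in> ?Q" "inv s <# C \<in> ?Q" if "C \<in> ?Q" for C
          using act[OF sH(1), of C] act[OF sH(2), of C] that by simp_all
        have "bij_betw (\<lambda>C. s <# C) ?Q ?Q"
        proof (rule bij_betw_byWitness[where f' = "\<lambda>C. inv s <# C"])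
          show "\<forall>C\<in>?Q. inv s <# (s <# C) = C" "\<forall>C\<in>?Q. s <# (inv s <# C) = C"
            using G.l_coset_inv_cancel[OF S'G(1)[OF s] Csub] by simp_all
          show "(\<lambda>C. s <# C) ` ?Q \<subseteq> ?Q" "(\<lambda>C. inv s <# C) ` ?Q \<subseteq> ?Q"
            by (rule image_subsetI, erule Q)+
        qed
        then have "bij_betw (map_prod (\<sigma> s) (\<lambda>C. s <# C)) I I"
          using \<sigma>[OF S'G(3)[OF s]] unfolding I_def by (rule_tac bij_betw_map_prod) auto
        then show ?thesis by (simp add: map_prod_def)
      qed
      \<comment> \<open>both sides of \<open>rel\<close> at level \<open>N\<close>, weighted by \<open>c\<close>, and the weights \<open>jump\<close> by which they differ\<close>
      define f where "f s = (\<lambda>(y, C). b s y N (inv s <# C) \<otimes>\<^bsub>k\<^esub> c y C)" for s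
      define g where "g s = (\<lambda>(y, C). b s (\<sigma> s y) N C \<otimes>\<^bsub>k\<^esub> c y C)" for s
      define e where "e s = (\<lambda>(y, C). b s (\<sigma> s y) N C \<otimes>\<^bsub>k\<^esub> jump s (\<sigma> s y) C)" for s
      have fk: "f s i \<in> carrier k" if "s \<in> S'" "i \<in> I" for s i
        using that bk cc act[of "inv s"] H_closed S'G by (auto simp: f_def I_def)
      have gk: "g s i \<in> carrier k" if "s \<in> S'" "i \<in> I" for s i
        using that bk cc \<sigma>Y by (auto simp: g_def I_def)
      have ek: "e s i \<in> carrier k" if "s \<in> S'" "i \<in> I" for s i
        using that bk jk \<sigma>Y by (auto simp: e_def I_def)
      have level: "(\<Oplus>\<^bsub>k\<^esub>s\<in>S'. f s i) = (\<Oplus>\<^bsub>k\<^esub>s\<in>S'. g s i)" if i: "i \<in> I" for i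
      proof -
        obtain y C where yC: "i = (y, C)" "y \<in> Y" "C \<in> rcosets N" "C \<subseteq> H" using i by (auto simp: I_def)
        have "(\<Oplus>\<^bsub>V\<^esub>s\<in>S'. s \<bullet>\<^bsub>V\<^esub> b s y) N C = (\<Oplus>\<^bsub>k\<^esub>s\<in>S'. b s y N (inv s <# C))"
        proof -
          have "(\<Oplus>\<^bsub>V\<^esub>s\<in>S'. s \<bullet>\<^bsub>V\<^esub> b s y) N C = (\<Oplus>\<^bsub>k\<^esub>s\<in>S'. (s \<bullet>\<^bsub>V\<^esub> b s y) N C)"
            using finsum_V_app[OF S'(1) _ N(1) yC(3)] bV[OF _ yC(2)] by simp
          also have "\<dots> = (\<Oplus>\<^bsub>k\<^esub>s\<in>S'. b s y N (inv s <# C))"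
            using gact_V[OF S'G(1) bV N(1) yC(3)] yC(2,3,4) bk act H_closed S'G
            by (intro k.finsum_cong') auto
          finally show ?thesis .
        qed
        moreover have "(\<Oplus>\<^bsub>V\<^esub>s\<in>S'. b s (\<sigma> s y)) N C = (\<Oplus>\<^bsub>k\<^esub>s\<in>S'. b s (\<sigma> s y) N C)"
          using finsum_V_app[OF S'(1) _ N(1) yC(3)] bV \<sigma>Y[OF _ yC(2)] by simp
        ultimately have eq: "(\<Oplus>\<^bsub>k\<^esub>s\<in>S'. b s y N (inv s <# C)) = (\<Oplus>\<^bsub>k\<^esub>s\<in>S'. b s (\<sigma> s y) N C)"
          using rel[OF yC(2)] by simp
        have "(\<Oplus>\<^bsub>k\<^esub>s\<in>S'. f s i) = (\<Oplus>\<^bsub>k\<^esub>s\<in>S'. b s y N (inv s <# C)) \<otimes>\<^bsub>k\<^esub> c y C"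
          unfolding f_def yC(1) prod.case using cc[OF yC(2-4)] bk yC act H_closed S'G S'(1)
          by (intro k.finsum_ldistr[symmetric]) auto
        also have "\<dots> = (\<Oplus>\<^bsub>k\<^esub>s\<in>S'. g s i)"
          unfolding g_def yC(1) prod.case eq using cc[OF yC(2-4)] bk yC \<sigma>Y S'(1)
          by (intro k.finsum_ldistr) auto
        finally show ?thesis .
      qed
      \<comment> \<open>substituting \<open>(\<sigma> s y, s C)\<close> for \<open>(y, C)\<close> turns the left-hand side into the right-hand side, up to \<open>jump\<close>\<close>
      have shift: "(\<Oplus>\<^bsub>k\<^esub>i\<in>I. f s i) = (\<Oplus>\<^bsub>k\<^esub>i\<in>I. g s i) \<oplus>\<^bsub>k\<^esub> (\<Oplus>\<^bsub>k\<^esub>i\<in>I. e s i)" if s: "s \<in> S'" for s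
      proof -
        have "(\<Oplus>\<^bsub>k\<^esub>i\<in>I. f s i) = (\<Oplus>\<^bsub>k\<^esub>i\<in>I. f s ((\<lambda>(y, C). (\<sigma> s y, s <# C)) i))"
          using k.finsum_bij[OF bij[OF s], of "f s"] fk[OF s] by simp
        also have "\<dots> = (\<Oplus>\<^bsub>k\<^esub>i\<in>I. g s i \<oplus>\<^bsub>k\<^esub> e s i)"
        proof (rule k.finsum_cong')
          fix i assume "i \<in> I"
          then obtain y C where yC: "i = (y, C)" "y \<in> Y" "C \<in> rcosets N" "C \<subseteq> H" by (auto simp: I_def)
          have "f s ((\<lambda>(y, C). (\<sigma> s y, s <# C)) i) = b s (\<sigma> s y) N C \<otimes>\<^bsub>k\<^esub> (c y C \<oplus>\<^bsub>k\<^esub> jump s (\<sigma> s y) C)"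
            using c[OF S'G(3)[OF s] yC(2-4)] G.l_coset_inv_cancel(1)[OF S'G(1)[OF s] Csub[OF yC(3)]]
            by (simp add: f_def yC(1))
          then show "f s ((\<lambda>(y, C). (\<sigma> s y, s <# C)) i) = g s i \<oplus>\<^bsub>k\<^esub> e s i"
            using bk[OF s \<sigma>Y[OF s yC(2)] yC(3)] cc[OF yC(2-4)] jk by (simp add: g_def e_def yC(1) k.r_distr)
        qed (use gk[OF s] ek[OF s] in auto)
        also have "\<dots> = (\<Oplus>\<^bsub>k\<^esub>i\<in>I. g s i) \<oplus>\<^bsub>k\<^esub> (\<Oplus>\<^bsub>k\<^esub>i\<in>I. e s i)"
          using gk[OF s] ek[OF s] by (intro k.finsum_addf) auto
        finally show ?thesis .
      qed
      have "(\<Oplus>\<^bsub>k\<^esub>s\<in>S'. \<Oplus>\<^bsub>k\<^esub>i\<in>I. f s i) = (\<Oplus>\<^bsub>k\<^esub>i\<in>I. \<Oplus>\<^bsub>k\<^esub>s\<in>S'. f s i)"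
        using S'(1) finI fk by (intro k.finsum_swap) auto
      also have "\<dots> = (\<Oplus>\<^bsub>k\<^esub>i\<in>I. \<Oplus>\<^bsub>k\<^esub>s\<in>S'. g s i)"
        using level gk by (rule_tac k.finsum_cong'[OF refl]) (auto intro!: k.finsum_closed)
      also have "\<dots> = (\<Oplus>\<^bsub>k\<^esub>s\<in>S'. \<Oplus>\<^bsub>k\<^esub>i\<in>I. g s i)"
        using S'(1) finI gk by (intro k.finsum_swap) auto
      finally have fg: "(\<Oplus>\<^bsub>k\<^esub>s\<in>S'. \<Oplus>\<^bsub>k\<^esub>i\<in>I. f s i) = (\<Oplus>\<^bsub>k\<^esub>s\<in>S'. \<Oplus>\<^bsub>k\<^esub>i\<in>I. g s i)" .
      have "(\<Oplus>\<^bsub>k\<^esub>s\<in>S'. \<Oplus>\<^bsub>k\<^esub>i\<in>I. f s i) =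
          (\<Oplus>\<^bsub>k\<^esub>s\<in>S'. (\<Oplus>\<^bsub>k\<^esub>i\<in>I. g s i) \<oplus>\<^bsub>k\<^esub> (\<Oplus>\<^bsub>k\<^esub>i\<in>I. e s i))"
        using shift gk ek by (intro k.finsum_cong'[OF refl]) (auto intro!: k.finsum_closed)
      also have "\<dots> = (\<Oplus>\<^bsub>k\<^esub>s\<in>S'. \<Oplus>\<^bsub>k\<^esub>i\<in>I. g s i) \<oplus>\<^bsub>k\<^esub> (\<Oplus>\<^bsub>k\<^esub>s\<in>S'. \<Oplus>\<^bsub>k\<^esub>i\<in>I. e s i)"
        using gk ek by (intro k.finsum_addf) (auto intro!: k.finsum_closed)
      finally have source_sum: "(\<Oplus>\<^bsub>k\<^esub>s\<in>S'. \<Oplus>\<^bsub>k\<^esub>i\<in>I. e s i) = \<zero>\<^bsub>k\<^esub>"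
      proof -
        assume h: "(\<Oplus>\<^bsub>k\<^esub>s\<in>S'. \<Oplus>\<^bsub>k\<^esub>i\<in>I. f s i) =
          (\<Oplus>\<^bsub>k\<^esub>s\<in>S'. \<Oplus>\<^bsub>k\<^esub>i\<in>I. g s i) \<oplus>\<^bsub>k\<^esub> (\<Oplus>\<^bsub>k\<^esub>s\<in>S'. \<Oplus>\<^bsub>k\<^esub>i\<in>I. e s i)"
        have "(\<Oplus>\<^bsub>k\<^esub>s\<in>S'. \<Oplus>\<^bsub>k\<^esub>i\<in>I. g s i) \<in> carrier k" "(\<Oplus>\<^bsub>k\<^esub>s\<in>S'. \<Oplus>\<^bsub>k\<^esub>i\<in>I. e s i) \<in> carrier k"
          using gk ek by (auto intro!: k.finsum_closed)
        then show ?thesis using h fg by simp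
      qed
      have "y0 \<in> \<sigma> s0 ` Y" using \<sigma>[OF S'G(3)[OF s0]] y0 by (simp add: bij_betw_def)
      then obtain y1 where y1: "y1 \<in> Y" "\<sigma> s0 y1 = y0" by blast
      have uy1: "y = y1" if "y \<in> Y" "\<sigma> s0 y = y0" for y
        using \<sigma>[OF S'G(3)[OF s0]] y1 that by (auto simp: bij_betw_def dest: inj_onD)
      let ?J = "{C \<in> rcosets N. C \<subseteq> C0}"
      have es0: "(\<Oplus>\<^bsub>k\<^esub>i\<in>I. e s0 i) = b s0 y0 N1 C0"
      proof -
        have iff: "N1 <#> C = C0 \<longleftrightarrow> C \<subseteq> C0" if "C \<in> rcosets N" for C
          using G.rcoset_subset_iff[OF D(2) D1(2) N(2) that C0] .
        have "(\<Oplus>\<^bsub>k\<^esub>i\<in>I. e s0 i) = (\<Oplus>\<^bsub>k\<^esub>i\<in>Pair y1 ` ?J. e s0 i)"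
        proof (rule k.add.finprod_mono_neutral_cong_right[OF finI])
          show "Pair y1 ` ?J \<subseteq> I" using y1 C0H by (auto simp: I_def)
          show "e s0 i = \<zero>\<^bsub>k\<^esub>" if i: "i \<in> I - Pair y1 ` ?J" for i
          proof -
            obtain y C where yC: "i = (y, C)" "y \<in> Y" "C \<in> rcosets N" using i by (auto simp: I_def)
            have "\<not> (\<sigma> s0 y = y0 \<and> C \<subseteq> C0)" using uy1[OF yC(2)] i yC by blast
            then have "jump s0 (\<sigma> s0 y) C = \<zero>\<^bsub>k\<^esub>" using iff[OF yC(3)] by (auto simp: jump_def)
            then show ?thesis using bk[OF s0 \<sigma>Y[OF s0 yC(2)] yC(3)] by (simp add: e_def yC(1))
          qed
        qed (use ek[OF s0] in auto)
        also have "\<dots> = (\<Oplus>\<^bsub>k\<^esub>C\<in>?J. e s0 (y1, C))"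
          using ek[OF s0] y1 C0H by (intro k.finsum_reindex) (auto simp: I_def inj_on_def)
        also have "\<dots> = (\<Oplus>\<^bsub>k\<^esub>C\<in>?J. b s0 y0 N C)"
          using bk[OF s0 y0] iff y1 by (intro k.finsum_cong') (auto simp: e_def jump_def)
        also have "\<dots> = b s0 y0 N1 C0"
          using V_D(5)[OF bV[OF s0 y0] N(1) N1(1) N(2) C0] by (simp add: meas_def)
        finally show ?thesis .
      qed
      have "(\<Oplus>\<^bsub>k\<^esub>i\<in>I. e s i) = \<zero>\<^bsub>k\<^esub>" if "s \<in> S'" "s \<noteq> s0" for s
        using that bk \<sigma>Y by (auto intro!: k.add.finprod_one_eqI simp: e_def jump_def I_def)
      then have "(\<Oplus>\<^bsub>k\<^esub>s\<in>S'. \<Oplus>\<^bsub>k\<^esub>i\<in>I. e s i) = (\<Oplus>\<^bsub>k\<^esub>s\<in>S'. if s0 = s then b s0 y0 N1 C0 else \<zero>\<^bsub>k\<^esub>)"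
        using es0 V_D(3)[OF bV[OF s0 y0] N1(1) C0] by (intro k.finsum_cong'[OF refl]) auto
      also have "\<dots> = b s0 y0 N1 C0"
        using k.finsum_singleton[OF s0 S'(1), of "\<lambda>_. b s0 y0 N1 C0"] V_D(3)[OF bV[OF s0 y0] N1(1) C0] by simp
      finally show ?thesis using source_sum by simp
    qed
  qed
qed

end

section \<open>Critical subgroups\<close>

lemma card_fibers:
  assumes "finite A" "\<And>x. x \<in> A \<Longrightarrow> card {y \<in> A. f y = f x} = m"
  shows "card A = m * card (f ` A)"
proof -
  have "card A = (\<Sum>y\<in>f ` A. \<Sum>x\<in>{x \<in> A. f x = y}. 1)"
    using sum.image_gen[OF assms(1), of "\<lambda>_. 1::nat" f] by simp
  also have "\<dots> = (\<Sum>y\<in>f ` A. m)" using assms(2) by (intro sum.cong) auto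
  finally show ?thesis by simp
qed

context finite_index_free
begin

abbreviation VH where "VH \<equiv> supported H"

lemma VH_V: "x \<in> VH \<Longrightarrow> x \<in> carrier V"
  by (simp add: supported_def)

lemma VH_asub: "V.asub VH"
proof (rule V.asubI)
  show "VH \<subseteq> carrier V" using VH_V by blast
  show "\<zero>\<^bsub>V\<^esub> \<in> VH" using zero_V_closed by (auto simp: supported_def zero_V_app)
  show "x \<oplus>\<^bsub>V\<^esub> y \<in> VH" if "x \<in> VH" "y \<in> VH" for x y
    using that add_V_closed by (auto simp: supported_def add_V_app)
qed

lemma VH_gact:
  assumes h: "h \<in> H" and x: "x \<in> VH" shows "h \<bullet>\<^bsub>V\<^esub> x \<in> VH"
proof -
  have "x N (inv h <# C) = \<zero>\<^bsub>k\<^esub>" if N: "N \<in> Nor" "C \<in> rcosets N" "C \<inter> H = {}" for N C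
  proof -
    note D = G.fin_index_normalsD[OF N(1)]
    have Cc: "C \<subseteq> carrier G" using G.rcosets_sub[OF D(2) N(2)] .
    have "(inv h <# C) \<inter> H = {}"
    proof (rule ccontr)
      assume "(inv h <# C) \<inter> H \<noteq> {}"
      then obtain c where c: "c \<in> C" "inv h \<otimes> c \<in> H" by (auto simp: l_coset_def)
      then have "h \<otimes> (inv h \<otimes> c) \<in> H" using h H_closed by blast
      moreover have "h \<otimes> (inv h \<otimes> c) = c" using c Cc H_G[OF h] by (auto simp flip: G.m_assoc)
      ultimately show False using c N(3) by auto
    qed
    moreover have "inv h <# C \<in> rcosets N"
      using G.l_coset_rcosets[OF D(1) _ N(2)] H_G[OF h] by simp
    ultimately show ?thesis using x N(1) by (auto simp: supported_def)
  qed
  then show ?thesis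
    using VH_V[OF x] H_G[OF h] gact_V by (auto simp: supported_def)
qed

text \<open>
  The case of a one-point set \<open>Y\<close>: the maps \<open>s - 1\<close> on \<open>VH\<close> are injective, and their images are
  independent.
\<close>

lemma independent_shifts:
  assumes S': "finite S'" "S' \<subseteq> S" and d: "\<And>s. s \<in> S' \<Longrightarrow> d s \<in> VH"
    and sum: "(\<Oplus>\<^bsub>V\<^esub>s\<in>S'. s \<bullet>\<^bsub>V\<^esub> d s \<oplus>\<^bsub>V\<^esub> (\<ominus>\<^bsub>V\<^esub> d s)) = \<zero>\<^bsub>V\<^esub>" and s: "s \<in> S'"
  shows "d s = \<zero>\<^bsub>V\<^esub>"
proof -
  have dV: "d s \<in> carrier V" if "s \<in> S'" for s using d that VH_V by blast
  have c: "(\<Oplus>\<^bsub>V\<^esub>s\<in>S'. d s) \<in> carrier V" "(\<Oplus>\<^bsub>V\<^esub>s\<in>S'. s \<bullet>\<^bsub>V\<^esub> d s) \<in> carrier V"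
    using dV by (auto intro!: V.M.finsum_closed)
  have "(\<Oplus>\<^bsub>V\<^esub>s\<in>S'. s \<bullet>\<^bsub>V\<^esub> d s) = (\<Oplus>\<^bsub>V\<^esub>s\<in>S'. (s \<bullet>\<^bsub>V\<^esub> d s \<oplus>\<^bsub>V\<^esub> (\<ominus>\<^bsub>V\<^esub> d s)) \<oplus>\<^bsub>V\<^esub> d s)"
    using dV by (intro V.M.finsum_cong') (auto simp: V.M.a_assoc V.M.l_neg)
  also have "\<dots> = (\<Oplus>\<^bsub>V\<^esub>s\<in>S'. s \<bullet>\<^bsub>V\<^esub> d s \<oplus>\<^bsub>V\<^esub> (\<ominus>\<^bsub>V\<^esub> d s)) \<oplus>\<^bsub>V\<^esub> (\<Oplus>\<^bsub>V\<^esub>s\<in>S'. d s)"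
    using dV by (intro V.M.finsum_addf) auto
  finally have "(\<Oplus>\<^bsub>V\<^esub>s\<in>S'. s \<bullet>\<^bsub>V\<^esub> d s) = (\<Oplus>\<^bsub>V\<^esub>s\<in>S'. d s)" using sum c by simp
  then show ?thesis
    using no_finite_relations[of "{()}" "\<lambda>_. id" S' "\<lambda>s _. d s" s "()"] S' d s by auto
qed

definition shift_dom :: "('g set \<Rightarrow> 'g set \<Rightarrow> 'r) set \<Rightarrow> 'g \<Rightarrow> ('g set \<Rightarrow> 'g set \<Rightarrow> 'r) set"
  where "shift_dom U s = {u \<in> U. s \<bullet>\<^bsub>V\<^esub> u \<in> U}"

definition fsub :: "('g set \<Rightarrow> 'g set \<Rightarrow> 'r) set \<Rightarrow> bool"
  where "fsub U \<longleftrightarrow> V.asub U \<and> finite U \<and> U \<subseteq> VH"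

text \<open>
  These are the finitely many basis elements that contribute a nontrivial factor to the product of the
  orders of the groups \<open>shift_dom U s\<close>.
\<close>

definition active :: "('g set \<Rightarrow> 'g set \<Rightarrow> 'r) set \<Rightarrow> 'g set"
  where "active U = {s \<in> S. shift_dom U s \<noteq> {\<zero>\<^bsub>V\<^esub>}}"

lemma fsubD:
  assumes "fsub U"
  shows "V.asub U" "finite U" "x \<in> U \<Longrightarrow> x \<in> VH" "x \<in> U \<Longrightarrow> x \<in> carrier V" "\<zero>\<^bsub>V\<^esub> \<in> U"
    "x \<in> U \<Longrightarrow> y \<in> U \<Longrightarrow> x \<oplus>\<^bsub>V\<^esub> y \<in> U" "x \<in> U \<Longrightarrow> \<ominus>\<^bsub>V\<^esub> x \<in> U"
  using assms V.asubD[of U] VH_V by (auto simp: fsub_def)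

lemma shift_dom_asub:
  assumes U: "V.asub U" shows "V.asub (shift_dom U s)"
  using V.asubD[OF U] by (intro V.asubI) (auto simp: shift_dom_def V.gact_add)

lemma shift_dom_fsub: "fsub U \<Longrightarrow> fsub (shift_dom U s)"
  using shift_dom_asub by (auto simp: fsub_def shift_dom_def)

lemma active_sub: "active U \<subseteq> S"
  by (auto simp: active_def)

text \<open>
  Nonzero elements \<open>d s\<close> of \<open>shift_dom U s\<close> give elements \<open>s d s - d s\<close> of the finite group \<open>U\<close>, which are
  pairwise different by \<open>independent_shifts\<close>.
\<close>

lemma finite_active:
  assumes U: "fsub U" shows "finite (active U)"
proof -
  have "\<exists>d. d \<in> shift_dom U s \<and> d \<noteq> \<zero>\<^bsub>V\<^esub>" if "s \<in> active U" for s
    using that V.asubD(3)[OF shift_dom_asub[OF fsubD(1)[OF U]], of s] by (auto simp: active_def)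
  then obtain d where d: "\<And>s. s \<in> active U \<Longrightarrow> d s \<in> shift_dom U s" "\<And>s. s \<in> active U \<Longrightarrow> d s \<noteq> \<zero>\<^bsub>V\<^esub>" by metis
  let ?m = "\<lambda>s. s \<bullet>\<^bsub>V\<^esub> d s \<oplus>\<^bsub>V\<^esub> (\<ominus>\<^bsub>V\<^esub> d s)"
  have dV: "d s \<in> carrier V" "d s \<in> VH" "d s \<in> U" "s \<bullet>\<^bsub>V\<^esub> d s \<in> U" if "s \<in> active U" for s
    using d(1)[OF that] fsubD(3,4)[OF U] by (auto simp: shift_dom_def)
  have "inj_on ?m (active U)"
  proof (rule inj_onI, rule ccontr)
    fix s s' assume s: "s \<in> active U" "s' \<in> active U" "?m s = ?m s'" "s \<noteq> s'"
    \<comment> \<open>equal values for two letters would be a relation between the two shifts\<close>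
    define e where "e r = (if r = s then d s else \<ominus>\<^bsub>V\<^esub> d s')" for r
    have "(\<Oplus>\<^bsub>V\<^esub>r\<in>{s, s'}. r \<bullet>\<^bsub>V\<^esub> e r \<oplus>\<^bsub>V\<^esub> (\<ominus>\<^bsub>V\<^esub> e r)) = ?m s \<oplus>\<^bsub>V\<^esub> (s' \<bullet>\<^bsub>V\<^esub> (\<ominus>\<^bsub>V\<^esub> d s') \<oplus>\<^bsub>V\<^esub> (\<ominus>\<^bsub>V\<^esub> (\<ominus>\<^bsub>V\<^esub> d s')))"
      using s(1,2,4) dV by (simp add: e_def V.M.a_ac)
    also have "\<dots> = ?m s \<oplus>\<^bsub>V\<^esub> (\<ominus>\<^bsub>V\<^esub> ?m s')"
      using s(1,2,4) dV by (simp add: V.gact_neg V.M.minus_add)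
    also have "\<dots> = \<zero>\<^bsub>V\<^esub>" using s dV by (simp add: V.M.r_neg)
    finally have sum: "(\<Oplus>\<^bsub>V\<^esub>r\<in>{s, s'}. r \<bullet>\<^bsub>V\<^esub> e r \<oplus>\<^bsub>V\<^esub> (\<ominus>\<^bsub>V\<^esub> e r)) = \<zero>\<^bsub>V\<^esub>" .
    have "{s, s'} \<subseteq> S" using s(1,2) active_sub by blast
    moreover have "e r \<in> VH" if "r \<in> {s, s'}" for r
      using dV(2)[OF s(1)] V.asubD(5)[OF VH_asub dV(2)[OF s(2)]] by (simp add: e_def)
    ultimately have "e s = \<zero>\<^bsub>V\<^esub>" by (intro independent_shifts[OF _ _ _ sum]) auto
    then show False using d(2)[OF s(1)] by (simp add: e_def)
  qed
  moreover have "?m ` active U \<subseteq> U" using dV fsubD(6,7)[OF U] by auto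
  ultimately show ?thesis using fsubD(2)[OF U] by (meson finite_imageD finite_subset)
qed

lemma prod_dom_superset:
  assumes U: "fsub U" and T: "finite T" "active U \<subseteq> T" "T \<subseteq> S"
  shows "(\<Prod>s\<in>T. card (shift_dom U s)) = (\<Prod>s\<in>active U. card (shift_dom U s))"
proof (rule prod.mono_neutral_right[OF T(1,2)])
  show "\<forall>s\<in>T - active U. card (shift_dom U s) = 1" using T(3) by (auto simp: active_def)
qed

text \<open>
  By \<open>independent_shifts\<close> the product of the groups \<open>shift_dom U s\<close> embeds into \<open>U\<close> through
  \<open>d \<mapsto> \<Sum>\<^sub>s (s d s - d s)\<close>, and Lagrange's theorem applies to the image.
\<close>

lemma prod_dom_dvd:
  assumes U: "fsub U"
  shows "(\<Prod>s\<in>active U. card (shift_dom U s)) dvd card U"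
proof -
  let ?T = "active U"
  define \<phi> where "\<phi> d = (\<Oplus>\<^bsub>V\<^esub>s\<in>?T. s \<bullet>\<^bsub>V\<^esub> d s \<oplus>\<^bsub>V\<^esub> (\<ominus>\<^bsub>V\<^esub> d s))" for d
  define A where "A = (\<Pi>\<^sub>E s\<in>?T. shift_dom U s)"
  have T: "finite ?T" using finite_active[OF U] .
  have dU: "d s \<in> carrier V" "d s \<in> VH" "d s \<in> U" "s \<bullet>\<^bsub>V\<^esub> d s \<in> U" if "d \<in> A" "s \<in> ?T" for d s
    using that fsubD(3,4)[OF U] by (auto simp: shift_dom_def A_def PiE_iff)
  have \<phi>U: "\<phi> d \<in> U" if "d \<in> A" for d
    unfolding \<phi>_def using dU[OF that] fsubD(6,7)[OF U] by (intro V.asub_finsum[OF fsubD(1)[OF U] T]) auto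
  have \<phi>_add: "\<phi> (\<lambda>s\<in>?T. d s \<oplus>\<^bsub>V\<^esub> e s) = \<phi> d \<oplus>\<^bsub>V\<^esub> \<phi> e" if "d \<in> A" "e \<in> A" for d e
  proof -
    have "\<phi> (\<lambda>s\<in>?T. d s \<oplus>\<^bsub>V\<^esub> e s) = (\<Oplus>\<^bsub>V\<^esub>s\<in>?T. (s \<bullet>\<^bsub>V\<^esub> d s \<oplus>\<^bsub>V\<^esub> (\<ominus>\<^bsub>V\<^esub> d s)) \<oplus>\<^bsub>V\<^esub> (s \<bullet>\<^bsub>V\<^esub> e s \<oplus>\<^bsub>V\<^esub> (\<ominus>\<^bsub>V\<^esub> e s)))"
      unfolding \<phi>_def using dU[OF that(1)] dU[OF that(2)]
      by (intro V.M.finsum_cong') (auto simp: V.gact_add V.M.minus_add V.M.a_ac)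
    also have "\<dots> = \<phi> d \<oplus>\<^bsub>V\<^esub> \<phi> e"
      unfolding \<phi>_def using dU(1)[OF that(1)] dU(1)[OF that(2)] by (rule_tac V.M.finsum_addf) auto
    finally show ?thesis .
  qed
  have A_add: "(\<lambda>s\<in>?T. d s \<oplus>\<^bsub>V\<^esub> e s) \<in> A" if "d \<in> A" "e \<in> A" for d e
    using that fsubD(6)[OF shift_dom_fsub[OF U]] by (auto simp: A_def PiE_iff)
  have A_neg: "(\<lambda>s\<in>?T. \<ominus>\<^bsub>V\<^esub> d s) \<in> A" if "d \<in> A" for d
    using that fsubD(7)[OF shift_dom_fsub[OF U]] by (auto simp: A_def PiE_iff)
  have A_zero: "(\<lambda>s\<in>?T. \<zero>\<^bsub>V\<^esub>) \<in> A" using fsubD(5)[OF shift_dom_fsub[OF U]] by (auto simp: A_def)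
  have \<phi>_zero: "\<phi> (\<lambda>s\<in>?T. \<zero>\<^bsub>V\<^esub>) = \<zero>\<^bsub>V\<^esub>"
    unfolding \<phi>_def by (intro V.M.add.finprod_one_eqI) simp
  have ker: "d = (\<lambda>s\<in>?T. \<zero>\<^bsub>V\<^esub>)" if d: "d \<in> A" "\<phi> d = \<zero>\<^bsub>V\<^esub>" for d
  proof -
    have "d s = \<zero>\<^bsub>V\<^esub>" if "s \<in> ?T" for s
      using independent_shifts[OF T active_sub dU(2)[OF d(1)] d(2)[unfolded \<phi>_def] that] .
    then show ?thesis using d(1) by (auto simp: A_def PiE_iff extensional_def)
  qed
  have inj: "inj_on \<phi> A"
  proof (rule inj_onI)
    fix d e assume de: "d \<in> A" "e \<in> A" "\<phi> d = \<phi> e"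
    let ?n = "\<lambda>s\<in>?T. \<ominus>\<^bsub>V\<^esub> e s"
    have Vc: "\<phi> d \<in> carrier V" "\<phi> e \<in> carrier V" "\<phi> ?n \<in> carrier V"
      using \<phi>U fsubD(4)[OF U] de(1,2) A_neg[OF de(2)] by blast+
    have "(\<lambda>s\<in>?T. e s \<oplus>\<^bsub>V\<^esub> ?n s) = (\<lambda>s\<in>?T. \<zero>\<^bsub>V\<^esub>)"
      using dU[OF de(2)] by (intro restrict_ext) (auto simp: V.M.r_neg)
    then have "\<phi> e \<oplus>\<^bsub>V\<^esub> \<phi> ?n = \<zero>\<^bsub>V\<^esub>" using \<phi>_add[OF de(2) A_neg[OF de(2)]] \<phi>_zero by simp
    then have "\<phi> (\<lambda>s\<in>?T. d s \<oplus>\<^bsub>V\<^esub> ?n s) = \<zero>\<^bsub>V\<^esub>" using \<phi>_add[OF de(1) A_neg[OF de(2)]] de(3) by simp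
    from ker[OF A_add[OF de(1) A_neg[OF de(2)]] this]
    have "(\<lambda>s\<in>?T. d s \<oplus>\<^bsub>V\<^esub> ?n s) = (\<lambda>s\<in>?T. \<zero>\<^bsub>V\<^esub>)" .
    have eq: "d s \<oplus>\<^bsub>V\<^esub> (\<ominus>\<^bsub>V\<^esub> e s) = \<zero>\<^bsub>V\<^esub>" if "s \<in> ?T" for s using fun_cong[OF \<open>(\<lambda>s\<in>?T. d s \<oplus>\<^bsub>V\<^esub> ?n s) = (\<lambda>s\<in>?T. \<zero>\<^bsub>V\<^esub>)\<close>, of s] that by simp
    have "d s = e s" if "s \<in> ?T" for s
      using V.M.minus_equality[OF eq[OF that]] dU(1)[OF de(1) that] dU(1)[OF de(2) that] by simp
    then show "d = e" using de by (intro extensionalityI[of d ?T e]) (auto simp: A_def PiE_iff)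
  qed
  have I: "V.asub (\<phi> ` A)"
  proof (rule V.asubI)
    show "\<phi> ` A \<subseteq> carrier V" using \<phi>U fsubD(4)[OF U] by blast
    show "\<zero>\<^bsub>V\<^esub> \<in> \<phi> ` A" using \<phi>_zero A_zero by (metis image_eqI)
    fix x y assume "x \<in> \<phi> ` A" "y \<in> \<phi> ` A"
    then obtain d e where de: "d \<in> A" "e \<in> A" "x = \<phi> d" "y = \<phi> e" by blast
    show "x \<oplus>\<^bsub>V\<^esub> y \<in> \<phi> ` A"
      using imageI[OF A_add[OF de(1,2)], of \<phi>] \<phi>_add[OF de(1,2)] de(3,4) by simp
  qed
  let ?U = "(add_monoid V)\<lparr>carrier := U\<rparr>"
  interpret U: group ?U using V.M.add.subgroup_imp_group[OF fsubD(1)[OF U]] .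
  have "subgroup (\<phi> ` A) ?U" using V.M.add.subgroup_incl[OF I fsubD(1)[OF U]] \<phi>U by blast
  from U.lagrange[OF this] have "card (\<phi> ` A) dvd order ?U" by (metis dvd_triv_right)
  then have "card (\<phi> ` A) dvd card U" by (simp add: order_def)
  moreover have "card (\<phi> ` A) = (\<Prod>s\<in>?T. card (shift_dom U s))"
    using card_image[OF inj] card_PiE[OF T] by (simp add: A_def)
  ultimately show ?thesis by simp
qed

text \<open>
  A multiplicative Euler characteristic: that of the \<open>k[H]\<close>-module with generators \<open>U\<close> in which the product
  of \<open>s\<close> and \<open>u\<close> is prescribed for all \<open>u\<close> in \<open>shift_dom U s\<close>.
\<close>

definition chi :: "('g set \<Rightarrow> 'g set \<Rightarrow> 'r) set \<Rightarrow> nat"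
  where "chi U = card U div (\<Prod>s\<in>active U. card (shift_dom U s))"

lemma card_eq_chi:
  assumes U: "fsub U" and T: "finite T" "active U \<subseteq> T" "T \<subseteq> S"
  shows "card U = chi U * (\<Prod>s\<in>T. card (shift_dom U s))"
  using prod_dom_dvd[OF U] prod_dom_superset[OF assms] by (simp add: chi_def)

text \<open>
  Passing from \<open>U\<close> to \<open>U + s U\<close> or \<open>U + s\<^sup>-\<^sup>1 U\<close> never raises \<open>chi\<close>, and it lowers \<open>chi\<close> when a product arises
  that those in \<open>U\<close> do not force.  Minimality of \<open>chi\<close> among the finite subgroups above \<open>U\<close> excludes the second case.
\<close>

definition critical :: "('g set \<Rightarrow> 'g set \<Rightarrow> 'r) set \<Rightarrow> bool"
  where "critical U \<longleftrightarrow> fsub U \<and> (\<forall>U'. fsub U' \<and> U \<subseteq> U' \<longrightarrow> chi U \<le> chi U')"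

lemma critical_exists:
  assumes "finite X" "X \<subseteq> VH"
  obtains U where "critical U" "X \<subseteq> U"
proof -
  obtain U0 where U0: "V.asub U0" "finite U0" "X \<subseteq> U0"
    using V.finite_asub_containing[OF assms(1)] assms(2) VH_V by blast
  have "V.asub (U0 \<inter> VH)" using V.asubD[OF U0(1)] V.asubD[OF VH_asub] by (intro V.asubI) auto
  then have "fsub (U0 \<inter> VH) \<and> X \<subseteq> U0 \<inter> VH" using U0 assms by (auto simp: fsub_def)
  then obtain U where U: "fsub U \<and> X \<subseteq> U" "\<And>U'. fsub U' \<and> X \<subseteq> U' \<Longrightarrow> chi U \<le> chi U'"
    using ex_has_least_nat[of "\<lambda>U. fsub U \<and> X \<subseteq> U" "U0 \<inter> VH" chi] by blast
  then have "critical U" by (auto simp: critical_def)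
  then show ?thesis using that U by blast
qed

definition letter :: "'g \<Rightarrow> 'g \<Rightarrow> bool"
  where "letter s t \<longleftrightarrow> s \<in> S \<and> (t = s \<or> t = inv s)"

lemma letterD: "letter s t \<Longrightarrow> s \<in> S" "letter s t \<Longrightarrow> t \<in> H" "letter s t \<Longrightarrow> t \<in> carrier G" "letter s t \<Longrightarrow> s \<in> carrier G"
  using S_H H_closed H_G by (auto simp: letter_def)

definition grow :: "('g set \<Rightarrow> 'g set \<Rightarrow> 'r) set \<Rightarrow> 'g \<Rightarrow> ('g set \<Rightarrow> 'g set \<Rightarrow> 'r) set"
  where "grow U t = (\<lambda>(u, v). u \<oplus>\<^bsub>V\<^esub> t \<bullet>\<^bsub>V\<^esub> v) ` (U \<times> U)"

text \<open>
  The elements of \<open>grow U t\<close> of which it is clear without further relations that \<open>r\<close> moves them into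
  \<open>grow U t\<close>, for a letter \<open>t\<close> belonging to \<open>s\<close>.
\<close>

definition formal_dom :: "('g set \<Rightarrow> 'g set \<Rightarrow> 'r) set \<Rightarrow> 'g \<Rightarrow> 'g \<Rightarrow> 'g \<Rightarrow> ('g set \<Rightarrow> 'g set \<Rightarrow> 'r) set"
  where "formal_dom U s t r = (if r \<noteq> s then shift_dom U r else if t = s then U else (\<lambda>u. t \<bullet>\<^bsub>V\<^esub> u) ` U)"

lemma growI: "u \<in> U \<Longrightarrow> v \<in> U \<Longrightarrow> u \<oplus>\<^bsub>V\<^esub> t \<bullet>\<^bsub>V\<^esub> v \<in> grow U t"
  by (auto simp: grow_def)

lemma grow_incl:
  assumes U: "fsub U" and u: "u \<in> U"
  shows "u \<in> grow U t" "t \<bullet>\<^bsub>V\<^esub> u \<in> grow U t"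
  using growI[OF u fsubD(5)[OF U], of t] growI[OF fsubD(5)[OF U] u, of t] fsubD(4)[OF U u] by simp_all

lemma grow_fsub:
  assumes U: "fsub U" and t: "t \<in> H"
  shows "fsub (grow U t)"
proof -
  note D = fsubD[OF U]
  have sub: "grow U t \<subseteq> VH"
    using D(3) VH_gact[OF t] V.asubD(4)[OF VH_asub] by (auto simp: grow_def)
  have "V.asub (grow U t)"
  proof (rule V.asubI)
    show "grow U t \<subseteq> carrier V" using sub VH_V by blast
    show "\<zero>\<^bsub>V\<^esub> \<in> grow U t" using grow_incl(1)[OF U D(5)] .
    fix x y assume "x \<in> grow U t" "y \<in> grow U t"
    then obtain u v u' v' where uv: "u \<in> U" "v \<in> U" "u' \<in> U" "v' \<in> U"
      and xy: "x = u \<oplus>\<^bsub>V\<^esub> t \<bullet>\<^bsub>V\<^esub> v" "y = u' \<oplus>\<^bsub>V\<^esub> t \<bullet>\<^bsub>V\<^esub> v'" by (auto simp: grow_def)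
    have "x \<oplus>\<^bsub>V\<^esub> y = (u \<oplus>\<^bsub>V\<^esub> u') \<oplus>\<^bsub>V\<^esub> t \<bullet>\<^bsub>V\<^esub> (v \<oplus>\<^bsub>V\<^esub> v')"
      using uv D(4) by (simp add: xy V.gact_add V.M.a_ac)
    then show "x \<oplus>\<^bsub>V\<^esub> y \<in> grow U t" using growI uv D(6) by simp
  qed
  then show ?thesis using sub D(2) by (auto simp: fsub_def grow_def)
qed

lemma formal_dom_sub:
  assumes U: "fsub U" and st: "letter s t" and r: "r \<in> S"
  shows "formal_dom U s t r \<subseteq> shift_dom (grow U t) r"
proof
  note D = fsubD[OF U]
  fix x assume x: "x \<in> formal_dom U s t r"
  consider "r \<noteq> s" "x \<in> U" "r \<bullet>\<^bsub>V\<^esub> x \<in> U" | "r = s" "t = s" "x \<in> U"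
    | u where "r = s" "t = inv s" "u \<in> U" "x = t \<bullet>\<^bsub>V\<^esub> u"
    using x st by (auto simp: formal_dom_def shift_dom_def letter_def split: if_splits)
  then show "x \<in> shift_dom (grow U t) r"
  proof cases
    case 1
    then show ?thesis using grow_incl(1)[OF U] by (simp add: shift_dom_def)
  next
    case 2
    then show ?thesis using grow_incl[OF U] by (simp add: shift_dom_def)
  next
    case 3
    then show ?thesis using grow_incl[OF U] letterD(4)[OF st] D(4) by (simp add: shift_dom_def)
  qed
qed

lemma card_gact_image:
  assumes "U \<subseteq> carrier V" "t \<in> carrier G"
  shows "card ((\<lambda>u. t \<bullet>\<^bsub>V\<^esub> u) ` U) = card U"
  using assms by (intro card_image inj_on_inverseI[of _ "\<lambda>u. inv t \<bullet>\<^bsub>V\<^esub> u"]) auto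

text \<open>
  The map \<open>(u, v) \<mapsto> u + t v\<close> from \<open>U \<times> U\<close> onto \<open>grow U t\<close> has fibres of the size of \<open>shift_dom U t\<close>,
  which \<open>t\<close> matches with \<open>shift_dom U s\<close> if it is the inverse of \<open>s\<close>.
\<close>

lemma card_grow:
  assumes U: "fsub U" and st: "letter s t"
  shows "card (grow U t) * card (shift_dom U s) = card U * card U"
proof -
  note D = fsubD[OF U] and tG = letterD(3)[OF st]
  let ?f = "\<lambda>(u, v). u \<oplus>\<^bsub>V\<^esub> t \<bullet>\<^bsub>V\<^esub> v"
  have ct: "card (shift_dom U t) = card (shift_dom U s)"
  proof (cases "t = s")
    case False
    then have t: "t = inv s" using st by (simp add: letter_def)
    have "shift_dom U s = (\<lambda>u. t \<bullet>\<^bsub>V\<^esub> u) ` shift_dom U t"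
    proof (intro equalityI subsetI)
      fix x assume x: "x \<in> shift_dom U s"
      have "s \<bullet>\<^bsub>V\<^esub> x \<in> shift_dom U t" "x = t \<bullet>\<^bsub>V\<^esub> (s \<bullet>\<^bsub>V\<^esub> x)" using x D(4) letterD(4)[OF st] by (auto simp: shift_dom_def t)
      then show "x \<in> (\<lambda>u. t \<bullet>\<^bsub>V\<^esub> u) ` shift_dom U t" by blast
    next
      fix x assume "x \<in> (\<lambda>u. t \<bullet>\<^bsub>V\<^esub> u) ` shift_dom U t"
      then show "x \<in> shift_dom U s" using D(4) letterD(4)[OF st] by (auto simp: shift_dom_def t)
    qed
    moreover have "shift_dom U t \<subseteq> carrier V" using D(4) by (auto simp: shift_dom_def)
    ultimately show ?thesis using card_gact_image tG by simp
  qed simp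
  have "card (U \<times> U) = card (shift_dom U t) * card (?f ` (U \<times> U))"
  proof (rule card_fibers)
    show "finite (U \<times> U)" using D(2) by simp
    fix p assume "p \<in> U \<times> U"
    then obtain u v where p: "p = (u, v)" "u \<in> U" "v \<in> U" by auto
    let ?g = "\<lambda>w. (u \<oplus>\<^bsub>V\<^esub> (\<ominus>\<^bsub>V\<^esub> (t \<bullet>\<^bsub>V\<^esub> w)), v \<oplus>\<^bsub>V\<^esub> w)"
    have "{q \<in> U \<times> U. ?f q = ?f p} = ?g ` shift_dom U t"
    proof (intro equalityI subsetI)
      fix q assume q: "q \<in> {q \<in> U \<times> U. ?f q = ?f p}"
      then obtain u' v' where q': "q = (u', v')" "u' \<in> U" "v' \<in> U" "u' \<oplus>\<^bsub>V\<^esub> t \<bullet>\<^bsub>V\<^esub> v' = u \<oplus>\<^bsub>V\<^esub> t \<bullet>\<^bsub>V\<^esub> v"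
        using p by auto
      let ?w = "v' \<oplus>\<^bsub>V\<^esub> (\<ominus>\<^bsub>V\<^esub> v)"
      note c = D(4)[OF p(2)] D(4)[OF p(3)] D(4)[OF q'(2)] D(4)[OF q'(3)]
      have tw: "t \<bullet>\<^bsub>V\<^esub> ?w = u \<oplus>\<^bsub>V\<^esub> (\<ominus>\<^bsub>V\<^esub> u')"
      proof -
        have "t \<bullet>\<^bsub>V\<^esub> ?w = (u' \<oplus>\<^bsub>V\<^esub> t \<bullet>\<^bsub>V\<^esub> v') \<oplus>\<^bsub>V\<^esub> (\<ominus>\<^bsub>V\<^esub> u') \<oplus>\<^bsub>V\<^esub> (\<ominus>\<^bsub>V\<^esub> (t \<bullet>\<^bsub>V\<^esub> v))"
          using c by (simp add: V.gact_add V.gact_neg V.M.a_ac V.M.r_neg2 V.M.r_neg1)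
        also have "\<dots> = u \<oplus>\<^bsub>V\<^esub> (\<ominus>\<^bsub>V\<^esub> u')"
          unfolding q'(4) using c by (simp add: V.M.a_ac V.M.r_neg)
        finally show ?thesis .
      qed
      have "?w \<in> shift_dom U t" using tw p q' D(6,7) by (simp add: shift_dom_def)
      moreover have "q = ?g ?w" unfolding tw using c q'(1)
        by (simp add: V.M.minus_add V.M.a_ac V.M.r_neg2 V.M.r_neg1 V.M.r_neg)
      ultimately show "q \<in> ?g ` shift_dom U t" by blast
    next
      fix q assume "q \<in> ?g ` shift_dom U t"
      then obtain w where w: "w \<in> U" "t \<bullet>\<^bsub>V\<^esub> w \<in> U" "q = ?g w" by (auto simp: shift_dom_def)
      note c = D(4)[OF p(2)] D(4)[OF p(3)] D(4)[OF w(1)] D(4)[OF w(2)]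
      have "?f q = ?f p" using c by (simp add: w(3) p(1) V.gact_add V.M.a_ac V.M.r_neg V.M.r_neg1 V.M.r_neg2)
      moreover have "q \<in> U \<times> U" using w p D(6,7) by auto
      ultimately show "q \<in> {q \<in> U \<times> U. ?f q = ?f p}" by simp
    qed
    moreover have "inj_on ?g (shift_dom U t)" using D(4) p by (auto simp: inj_on_def shift_dom_def)
    ultimately show "card {q \<in> U \<times> U. ?f q = ?f p} = card (shift_dom U t)" by (simp add: card_image)
  qed
  then show ?thesis using ct by (simp add: grow_def card_cartesian_product mult.commute)
qed

lemma card_dom_pos: "fsub U \<Longrightarrow> card (shift_dom U s) > 0"
  using fsubD(2,5)[OF shift_dom_fsub] by (metis card_gt_0_iff empty_iff)

text \<open>
  If every \<open>shift_dom (grow U t) r\<close> were just \<open>formal_dom U s t r\<close>, then \<open>card_grow\<close> would give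
  \<open>chi (grow U t) = chi U\<close>.  In general these groups can only be larger and \<open>chi\<close> only smaller, which
  criticality of \<open>U\<close> forbids.
\<close>

lemma critical_grow:
  assumes U: "critical U" and st: "letter s t"
  shows "critical (grow U t)" "\<And>r. r \<in> S \<Longrightarrow> shift_dom (grow U t) r = formal_dom U s t r"
proof -
  let ?U' = "grow U t"
  have fU: "fsub U" using U by (simp add: critical_def)
  note D = fsubD[OF fU]
  have fU': "fsub ?U'" using grow_fsub[OF fU letterD(2)[OF st]] .
  have sS: "s \<in> S" using letterD(1)[OF st] .
  have sub: "U \<subseteq> ?U'" using grow_incl(1)[OF fU] by blast
  have le: "chi U \<le> chi ?U'" using U fU' sub by (simp add: critical_def)
  define T where "T = insert s (active U \<union> active ?U')"
  have T: "finite T" "active U \<subseteq> T" "active ?U' \<subseteq> T" "T \<subseteq> S" "s \<in> T"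
    using finite_active[OF fU] finite_active[OF fU'] active_sub sS by (auto simp: T_def)
  let ?p = "\<lambda>X. (\<Prod>r\<in>T. card (X r))"
  have cg: "card (formal_dom U s t s) = card U"
    using card_gact_image[of U t] D(4) letterD(3)[OF st] by (auto simp: formal_dom_def)
  have "?p (formal_dom U s t) = card U * (\<Prod>r\<in>T - {s}. card (shift_dom U r))"
    using T by (simp add: prod.remove[OF T(1,5)] cg) (simp add: formal_dom_def)
  then have pg: "?p (formal_dom U s t) * card (shift_dom U s) = card U * ?p (shift_dom U)"
    using prod.remove[OF T(1,5), of "\<lambda>r. card (shift_dom U r)"] by simp
  have "chi ?U' * ?p (shift_dom ?U') * card (shift_dom U s) = card U * (chi U * ?p (shift_dom U))"
    using card_grow[OF fU st] card_eq_chi[OF fU' T(1,3,4)] card_eq_chi[OF fU T(1,2,4)] by simp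
  also have "\<dots> = chi U * ?p (formal_dom U s t) * card (shift_dom U s)" using pg by simp
  finally have eq: "chi ?U' * ?p (shift_dom ?U') = chi U * ?p (formal_dom U s t)" using card_dom_pos[OF fU, of s] by simp
  have cp: "card U > 0" using D(2,5) by (metis card_gt_0_iff empty_iff)
  then have chi_pos: "chi U > 0" using card_eq_chi[OF fU T(1,2,4)] by (metis mult_0 neq0_conv)
  have gd: "formal_dom U s t r \<subseteq> shift_dom ?U' r" "finite (shift_dom ?U' r)" "0 < card (shift_dom ?U' r)" if "r \<in> T" for r
    using formal_dom_sub[OF fU st] T(4) that fsubD(2)[OF shift_dom_fsub[OF fU']] card_dom_pos[OF fU'] by auto
  have gpos: "0 < card (formal_dom U s t r)" if "r \<in> T" for r
  proof (cases "r = s")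
    case True
    then show ?thesis using cg cp by simp
  next
    case False
    then show ?thesis using card_dom_pos[OF fU] by (simp add: formal_dom_def)
  qed
  have ple: "?p (formal_dom U s t) \<le> ?p (shift_dom ?U')" using gd by (intro prod_mono) (auto intro: card_mono)
  have ppos: "?p (shift_dom ?U') > 0" using gd(3) by (intro prod_pos) auto
  have le2: "?p (shift_dom ?U') \<le> ?p (formal_dom U s t)"
  proof -
    have "chi U * ?p (shift_dom ?U') \<le> chi U * ?p (formal_dom U s t)"
      unfolding eq[symmetric] using le by (rule mult_right_mono) simp
    then show ?thesis using chi_pos by simp
  qed
  then have peq: "?p (shift_dom ?U') = ?p (formal_dom U s t)" using ple by simp
  then have chi_eq: "chi ?U' = chi U" using eq ppos by simp
  show "critical ?U'" using fU' U sub chi_eq by (auto simp: critical_def)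
  fix r assume r: "r \<in> S"
  show "shift_dom ?U' r = formal_dom U s t r"
  proof (cases "r \<in> T")
    case False
    then have "shift_dom U r = {\<zero>\<^bsub>V\<^esub>}" "shift_dom ?U' r = {\<zero>\<^bsub>V\<^esub>}" "r \<noteq> s" using r by (auto simp: T_def active_def)
    then show ?thesis by (simp add: formal_dom_def)
  next
    case True
    have "card (shift_dom ?U' r) = card (formal_dom U s t r)"
    proof (rule ccontr)
      assume "card (shift_dom ?U' r) \<noteq> card (formal_dom U s t r)"
      then have lt: "card (formal_dom U s t r) < card (shift_dom ?U' r)" using card_mono[OF gd(2,1)[OF True]] by simp
      have "(\<Prod>i\<in>T - {r}. card (formal_dom U s t i)) \<le> (\<Prod>i\<in>T - {r}. card (shift_dom ?U' i))"
        using gd by (intro prod_mono) (auto intro: card_mono)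
      moreover have "(\<Prod>i\<in>T - {r}. card (formal_dom U s t i)) > 0" using gpos by (intro prod_pos) auto
      ultimately have "card (formal_dom U s t r) * (\<Prod>i\<in>T - {r}. card (formal_dom U s t i)) <
          card (shift_dom ?U' r) * (\<Prod>i\<in>T - {r}. card (shift_dom ?U' i))"
        using lt by (intro mult_less_le_imp_less) auto
      then show False using peq by (simp add: prod.remove[OF T(1) True])
    qed
    then show ?thesis using card_subset_eq[OF gd(2,1)[OF True]] by simp
  qed
qed

end

section \<open>Extending compatible maps\<close>

lemma (in abelian_group) swap_cancel:
  assumes "x \<in> carrier G" "y \<in> carrier G" "z \<in> carrier G"
  shows "x \<oplus> (y \<oplus> (\<ominus> x \<oplus> z)) = y \<oplus> z" "\<ominus> x \<oplus> (y \<oplus> (x \<oplus> z)) = y \<oplus> z"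
    "x \<oplus> (y \<oplus> \<ominus> x) = y" "\<ominus> x \<oplus> (y \<oplus> x) = y"
  using assms a_lcomm[of x y "\<ominus> x \<oplus> z"] a_lcomm[of "\<ominus> x" y "x \<oplus> z"] a_lcomm[of x y "\<ominus> x"] a_lcomm[of "\<ominus> x" y x]
  by (simp_all add: r_neg1 r_neg2 r_neg l_neg)

context finite_index_free
begin

text \<open>
  Compatible maps are the candidates for restrictions of equivariant maps: they respect every product
  \<open>s u\<close> that lies in \<open>U\<close>.
\<close>

definition compat :: "('g \<Rightarrow> 'r, 'm, 'd) module_scheme \<Rightarrow> ('g set \<Rightarrow> 'g set \<Rightarrow> 'r) set \<Rightarrow> (('g set \<Rightarrow> 'g set \<Rightarrow> 'r) \<Rightarrow> 'm) \<Rightarrow> bool"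
  where "compat M U h \<longleftrightarrow> additive_on V M U h \<and> (\<forall>s\<in>S. \<forall>u\<in>shift_dom U s. h (s \<bullet>\<^bsub>V\<^esub> u) = s \<bullet>\<^bsub>M\<^esub> h u)"

definition extends :: "('g \<Rightarrow> 'r, 'm, 'd) module_scheme \<Rightarrow> ('g set \<Rightarrow> 'g set \<Rightarrow> 'r) set \<Rightarrow> (('g set \<Rightarrow> 'g set \<Rightarrow> 'r) \<Rightarrow> 'm) \<Rightarrow>
    ('g set \<Rightarrow> 'g set \<Rightarrow> 'r) set \<Rightarrow> (('g set \<Rightarrow> 'g set \<Rightarrow> 'r) \<Rightarrow> 'm) \<Rightarrow> bool"
  where "extends M U h U' h' \<longleftrightarrow> critical U' \<and> compat M U' h' \<and> U \<subseteq> U' \<and> (\<forall>u\<in>U. h' u = h u)"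

lemma critical_fsub: "critical U \<Longrightarrow> fsub U"
  by (simp add: critical_def)

text \<open>
  The extension sends \<open>u + t v\<close> to \<open>h u + t h v\<close>.  It is well defined because \<open>h\<close> respects products that
  lie in \<open>U\<close>, and it is again compatible because \<open>grow U t\<close> acquires no products except the formal ones.
\<close>

lemma extend_step:
  assumes M: "left_module kG M" and U: "critical U" and h: "compat M U h" and st: "letter s t"
  shows "\<exists>h'. extends M U h (grow U t) h' \<and> (\<forall>u\<in>U. h' (t \<bullet>\<^bsub>V\<^esub> u) = t \<bullet>\<^bsub>M\<^esub> h u)"
proof -
  interpret M: kG_module G k n M by (rule kG_moduleI[OF M])
  have fU: "fsub U" using U by (rule critical_fsub)
  note D = fsubD[OF fU] and tG = letterD(3)[OF st] and sG = letterD(4)[OF st] and sS = letterD(1)[OF st]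
  have add: "additive_on V M U h" and eqv: "\<And>r u. r \<in> S \<Longrightarrow> u \<in> U \<Longrightarrow> r \<bullet>\<^bsub>V\<^esub> u \<in> U \<Longrightarrow> h (r \<bullet>\<^bsub>V\<^esub> u) = r \<bullet>\<^bsub>M\<^esub> h u"
    using h by (auto simp: compat_def shift_dom_def)
  note hD = additive_onD[OF add]
  have h0: "h \<zero>\<^bsub>V\<^esub> = \<zero>\<^bsub>M\<^esub>" using additive_on_zero[OF left_module_V M add D(1)] .
  have hneg: "h (\<ominus>\<^bsub>V\<^esub> u) = \<ominus>\<^bsub>M\<^esub> h u" if "u \<in> U" for u
    using additive_on_neg[OF left_module_V M add D(1) that] .
  have key: "h (t \<bullet>\<^bsub>V\<^esub> w) = t \<bullet>\<^bsub>M\<^esub> h w" if w: "w \<in> U" "t \<bullet>\<^bsub>V\<^esub> w \<in> U" for w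
  proof (cases "t = s")
    case True
    then show ?thesis using eqv[OF sS] w by simp
  next
    case False
    then have t: "t = inv s" using st by (simp add: letter_def)
    have "h (s \<bullet>\<^bsub>V\<^esub> (t \<bullet>\<^bsub>V\<^esub> w)) = s \<bullet>\<^bsub>M\<^esub> h (t \<bullet>\<^bsub>V\<^esub> w)"
      using eqv[OF sS w(2)] w D(4)[OF w(1)] sG by (simp add: t)
    then have "h w = s \<bullet>\<^bsub>M\<^esub> h (t \<bullet>\<^bsub>V\<^esub> w)" using D(4)[OF w(1)] sG by (simp add: t)
    then show ?thesis using hD(1)[OF w(2)] sG by (simp add: t)
  qed
  have wd: "h u \<oplus>\<^bsub>M\<^esub> t \<bullet>\<^bsub>M\<^esub> h v = h u' \<oplus>\<^bsub>M\<^esub> t \<bullet>\<^bsub>M\<^esub> h v'"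
    if uv: "u \<in> U" "v \<in> U" "u' \<in> U" "v' \<in> U" and eq: "u \<oplus>\<^bsub>V\<^esub> t \<bullet>\<^bsub>V\<^esub> v = u' \<oplus>\<^bsub>V\<^esub> t \<bullet>\<^bsub>V\<^esub> v'" for u v u' v'
  proof -
    note c = D(4)[OF uv(1)] D(4)[OF uv(2)] D(4)[OF uv(3)] D(4)[OF uv(4)]
    note hc = hD(1)[OF uv(1)] hD(1)[OF uv(2)] hD(1)[OF uv(3)] hD(1)[OF uv(4)]
    let ?w = "v' \<oplus>\<^bsub>V\<^esub> (\<ominus>\<^bsub>V\<^esub> v)"
    have wU: "?w \<in> U" using uv D(6,7) by simp
    have "t \<bullet>\<^bsub>V\<^esub> ?w = (u' \<oplus>\<^bsub>V\<^esub> t \<bullet>\<^bsub>V\<^esub> v') \<oplus>\<^bsub>V\<^esub> (\<ominus>\<^bsub>V\<^esub> u') \<oplus>\<^bsub>V\<^esub> (\<ominus>\<^bsub>V\<^esub> (t \<bullet>\<^bsub>V\<^esub> v))"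
      using c by (simp add: V.gact_add V.gact_neg V.M.a_ac V.M.r_neg2 V.M.r_neg1)
    also have "\<dots> = u \<oplus>\<^bsub>V\<^esub> (\<ominus>\<^bsub>V\<^esub> u')"
      unfolding eq[symmetric] using c by (simp add: V.M.a_ac V.M.r_neg)
    finally have tw: "t \<bullet>\<^bsub>V\<^esub> ?w = u \<oplus>\<^bsub>V\<^esub> (\<ominus>\<^bsub>V\<^esub> u')" .
    then have "t \<bullet>\<^bsub>V\<^esub> ?w \<in> U" using uv D(6,7) by simp
    from key[OF wU this] have "h (u \<oplus>\<^bsub>V\<^esub> (\<ominus>\<^bsub>V\<^esub> u')) = t \<bullet>\<^bsub>M\<^esub> h ?w" unfolding tw .
    then have e: "h u \<oplus>\<^bsub>M\<^esub> (\<ominus>\<^bsub>M\<^esub> h u') = t \<bullet>\<^bsub>M\<^esub> h v' \<oplus>\<^bsub>M\<^esub> (\<ominus>\<^bsub>M\<^esub> (t \<bullet>\<^bsub>M\<^esub> h v))"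
      using uv D(7) hD(2) hneg hc by (simp add: M.gact_add M.gact_neg)
    have "h u \<oplus>\<^bsub>M\<^esub> t \<bullet>\<^bsub>M\<^esub> h v = (h u \<oplus>\<^bsub>M\<^esub> (\<ominus>\<^bsub>M\<^esub> h u')) \<oplus>\<^bsub>M\<^esub> h u' \<oplus>\<^bsub>M\<^esub> t \<bullet>\<^bsub>M\<^esub> h v"
      using hc by (simp add: M.M.a_assoc M.M.l_neg)
    also have "\<dots> = h u' \<oplus>\<^bsub>M\<^esub> t \<bullet>\<^bsub>M\<^esub> h v'"
      unfolding e using hc by (simp add: M.M.a_ac M.M.r_neg M.M.r_neg1 M.M.r_neg2 M.M.swap_cancel)
    finally show ?thesis .
  qed
  define h' where "h' x = (SOME m. \<exists>u\<in>U. \<exists>v\<in>U. x = u \<oplus>\<^bsub>V\<^esub> t \<bullet>\<^bsub>V\<^esub> v \<and> m = h u \<oplus>\<^bsub>M\<^esub> t \<bullet>\<^bsub>M\<^esub> h v)" for x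
  have h': "h' (u \<oplus>\<^bsub>V\<^esub> t \<bullet>\<^bsub>V\<^esub> v) = h u \<oplus>\<^bsub>M\<^esub> t \<bullet>\<^bsub>M\<^esub> h v" if "u \<in> U" "v \<in> U" for u v
  proof -
    have "\<exists>u'\<in>U. \<exists>v'\<in>U. u \<oplus>\<^bsub>V\<^esub> t \<bullet>\<^bsub>V\<^esub> v = u' \<oplus>\<^bsub>V\<^esub> t \<bullet>\<^bsub>V\<^esub> v' \<and> h' (u \<oplus>\<^bsub>V\<^esub> t \<bullet>\<^bsub>V\<^esub> v) = h u' \<oplus>\<^bsub>M\<^esub> t \<bullet>\<^bsub>M\<^esub> h v'"
      unfolding h'_def by (rule someI_ex) (use that in blast)
    then show ?thesis using wd that by metis
  qed
  have h'U: "h' u = h u" if "u \<in> U" for u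
    using h'[OF that D(5)] D(4)[OF that] hD(1)[OF that] h0 by simp
  have h't: "h' (t \<bullet>\<^bsub>V\<^esub> u) = t \<bullet>\<^bsub>M\<^esub> h u" if "u \<in> U" for u
    using h'[OF D(5) that] D(4)[OF that] hD(1)[OF that] h0 by simp
  have "additive_on V M (grow U t) h'"
    unfolding additive_on_def
  proof (intro conjI ballI)
    show "h' \<in> grow U t \<rightarrow> carrier M" using h' hD(1) by (auto simp: grow_def)
    fix x y assume "x \<in> grow U t" "y \<in> grow U t"
    then obtain u v u' v' where uv: "u \<in> U" "v \<in> U" "u' \<in> U" "v' \<in> U"
      and xy: "x = u \<oplus>\<^bsub>V\<^esub> t \<bullet>\<^bsub>V\<^esub> v" "y = u' \<oplus>\<^bsub>V\<^esub> t \<bullet>\<^bsub>V\<^esub> v'" by (auto simp: grow_def)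
    note c = D(4)[OF uv(1)] D(4)[OF uv(2)] D(4)[OF uv(3)] D(4)[OF uv(4)]
    note hc = hD(1)[OF uv(1)] hD(1)[OF uv(2)] hD(1)[OF uv(3)] hD(1)[OF uv(4)]
    have "x \<oplus>\<^bsub>V\<^esub> y = (u \<oplus>\<^bsub>V\<^esub> u') \<oplus>\<^bsub>V\<^esub> t \<bullet>\<^bsub>V\<^esub> (v \<oplus>\<^bsub>V\<^esub> v')"
      using c by (simp add: xy V.gact_add V.M.a_ac)
    then have "h' (x \<oplus>\<^bsub>V\<^esub> y) = (h u \<oplus>\<^bsub>M\<^esub> h u') \<oplus>\<^bsub>M\<^esub> t \<bullet>\<^bsub>M\<^esub> (h v \<oplus>\<^bsub>M\<^esub> h v')"
      using h' uv D(6) hD(2) by simp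
    then show "h' (x \<oplus>\<^bsub>V\<^esub> y) = h' x \<oplus>\<^bsub>M\<^esub> h' y"
      using h' uv hc by (simp add: xy M.gact_add M.M.a_ac)
  qed
  moreover have "h' (r \<bullet>\<^bsub>V\<^esub> x) = r \<bullet>\<^bsub>M\<^esub> h' x" if r: "r \<in> S" and "x \<in> shift_dom (grow U t) r" for r x
  proof -
    have x: "x \<in> formal_dom U s t r" using that critical_grow(2)[OF U st] by simp
    consider "x \<in> U" "r \<bullet>\<^bsub>V\<^esub> x \<in> U" | "r = s" "t = s" "x \<in> U"
      | u where "r = s" "t = inv s" "u \<in> U" "x = t \<bullet>\<^bsub>V\<^esub> u"
      using x st by (auto simp: formal_dom_def shift_dom_def letter_def split: if_splits)
    then show ?thesis
    proof cases
      case 1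
      then show ?thesis using eqv[OF r] h'U by simp
    next
      case 2
      then show ?thesis using h'U h't by simp
    next
      case 3
      then show ?thesis using h'U[OF 3(3)] h't[OF 3(3)] D(4)[OF 3(3)] hD(1)[OF 3(3)] sG by simp
    qed
  qed
  ultimately have "compat M (grow U t) h'" by (auto simp: compat_def)
  then have "extends M U h (grow U t) h'"
    using critical_grow(1)[OF U st] grow_incl(1)[OF fU] h'U by (auto simp: extends_def)
  then show ?thesis using h't by blast
qed

lemma extend_word:
  assumes M: "left_module kG M" and U: "critical U" and h: "compat M U h" and w: "w \<in> words"
  shows "\<exists>U' h'. extends M U h U' h' \<and> (\<forall>u\<in>U. wv w \<bullet>\<^bsub>V\<^esub> u \<in> U' \<and> h' (wv w \<bullet>\<^bsub>V\<^esub> u) = wv w \<bullet>\<^bsub>M\<^esub> h u)"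
  using w
proof (induction w rule: list.induct)
  interpret M: kG_module G k n M by (rule kG_moduleI[OF M])
  note UD = fsubD[OF critical_fsub[OF U]]
  have hc: "h u \<in> carrier M" if "u \<in> U" for u using h that by (auto simp: compat_def dest: additive_onD)
  {
    case Nil
    have "extends M U h U h" using U h by (simp add: extends_def)
    then show ?case using UD(4) hc by (intro exI[of _ U] exI[of _ h]) simp
  next
    case (Cons l w)
    obtain s b where l: "l = (s, b)" "s \<in> S" using Cons.prems by (cases l) auto
    have ww: "w \<in> words" using Cons.prems by simp
    define t where "t = (if b then s else inv s)"
    have st: "letter s t" using l by (auto simp: t_def letter_def)
    obtain U1 h1 where 1: "extends M U h U1 h1"
      "\<And>u. u \<in> U \<Longrightarrow> wv w \<bullet>\<^bsub>V\<^esub> u \<in> U1 \<and> h1 (wv w \<bullet>\<^bsub>V\<^esub> u) = wv w \<bullet>\<^bsub>M\<^esub> h u"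
      using Cons.IH[OF ww] by blast
    have U1: "critical U1" "compat M U1 h1" using 1(1) by (auto simp: extends_def)
    obtain h2 where h2: "extends M U1 h1 (grow U1 t) h2" "\<forall>u\<in>U1. h2 (t \<bullet>\<^bsub>V\<^esub> u) = t \<bullet>\<^bsub>M\<^esub> h1 u"
      using extend_step[OF M U1 st] by blast
    have "extends M U h (grow U1 t) h2" using 1(1) h2(1) unfolding extends_def by (metis subset_trans subsetD)
    moreover have "wv (l # w) \<bullet>\<^bsub>V\<^esub> u \<in> grow U1 t \<and> h2 (wv (l # w) \<bullet>\<^bsub>V\<^esub> u) = wv (l # w) \<bullet>\<^bsub>M\<^esub> h u" if u: "u \<in> U" for u
    proof -
      have e: "wv (l # w) = t \<otimes> wv w" using l by (simp add: t_def)
      have wG: "wv w \<in> carrier G" using H_G[OF wv_H[OF ww]] .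
      have "wv (l # w) \<bullet>\<^bsub>V\<^esub> u = t \<bullet>\<^bsub>V\<^esub> (wv w \<bullet>\<^bsub>V\<^esub> u)" "wv (l # w) \<bullet>\<^bsub>M\<^esub> h u = t \<bullet>\<^bsub>M\<^esub> (wv w \<bullet>\<^bsub>M\<^esub> h u)"
        unfolding e using V.gact_mult[OF letterD(3)[OF st] wG UD(4)[OF u]] M.gact_mult[OF letterD(3)[OF st] wG hc[OF u]]
        by auto
      then show ?thesis using 1(2)[OF u] h2(2) grow_incl(2)[OF critical_fsub[OF U1(1)]] by simp
    qed
    ultimately show ?case by blast
  }
qed

definition left_transversal :: "'g set \<Rightarrow> bool"
  where "left_transversal T \<longleftrightarrow> finite T \<and> T \<subseteq> carrier G \<and> (\<forall>g\<in>carrier G. \<exists>!t. t \<in> T \<and> g \<in> t <# H)"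

lemma left_transversal_exists: obtains T where "left_transversal T"
proof -
  define r where "r C = (SOME x. x \<in> C)" for C :: "'g set"
  have r: "r C \<in> C" "C = H #> r C" "r C \<in> carrier G" if C: "C \<in> rcosets H" for C
  proof -
    obtain z where "z \<in> C" using G.rcosets_nonempty[OF H C] .
    then show "r C \<in> C" unfolding r_def by (rule someI)
    then show "C = H #> r C" "r C \<in> carrier G" using G.rcosets_memb[OF H C] by auto
  qed
  define T where "T = (\<lambda>C. inv r C) ` (rcosets H)"
  have mem: "g \<in> inv r C <# H \<longleftrightarrow> inv g \<in> C" if C: "C \<in> rcosets H" and g: "g \<in> carrier G" for C g
  proof
    assume "g \<in> inv r C <# H"
    then obtain h where h: "h \<in> H" "g = inv r C \<otimes> h" by (auto simp: l_coset_def)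
    then have "inv g = inv h \<otimes> r C" using r[OF C] H_G by (simp add: G.inv_mult_group)
    then have "inv g \<in> H #> r C" using H_closed(2)[OF h(1)] unfolding r_coset_def by blast
    then show "inv g \<in> C" using r(2)[OF C] by simp
  next
    assume "inv g \<in> C"
    then have "inv g \<in> H #> r C" using r(2)[OF C] by simp
    then obtain h where h: "h \<in> H" "inv g = h \<otimes> r C" by (auto simp: r_coset_def)
    then have "g = inv r C \<otimes> inv h"
      using r(3)[OF C] H_G g by (metis G.inv_inv G.inv_mult_group)
    then show "g \<in> inv r C <# H" using H_closed(2)[OF h(1)] unfolding l_coset_def by blast
  qed
  have "\<exists>!t. t \<in> T \<and> g \<in> t <# H" if g: "g \<in> carrier G" for g
  proof -
    let ?C = "H #> inv g"
    have C: "?C \<in> rcosets H" using g subgroup.subset[OF H] by (intro G.rcosetsI) auto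
    have in_C: "inv g \<in> ?C" using g G.rcos_self[OF _ H] by simp
    show ?thesis
    proof (rule ex1I[of _ "inv r ?C"])
      show "inv r ?C \<in> T \<and> g \<in> inv r ?C <# H" using mem[OF C g] in_C C by (simp add: T_def)
      fix t assume t: "t \<in> T \<and> g \<in> t <# H"
      then obtain C' where C': "C' \<in> rcosets H" "t = inv r C'" by (auto simp: T_def)
      then have "inv g \<in> C'" using mem[OF C'(1) g] t by simp
      then have "C' = ?C" using G.rcosets_memb(1)[OF H C'(1)] by simp
      then show "t = inv r ?C" using C' by simp
    qed
  qed
  moreover have "finite T" "T \<subseteq> carrier G" using finH r(3) by (auto simp: T_def)
  ultimately have "left_transversal T" unfolding left_transversal_def by blast
  then show ?thesis by (rule that)
qed

lemma saturated_l_coset: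
  assumes N0: "N0 \<in> Nor" "N0 \<subseteq> H" and t: "t \<in> carrier G"
  shows "saturated N0 (t <# H)"
  unfolding saturated_def
proof (intro ballI)
  note D = G.fin_index_normalsD[OF N0(1)]
  fix C assume C: "C \<in> rcosets N0"
  show "C \<subseteq> t <# H \<or> C \<inter> (t <# H) = {}"
  proof (rule disjCI)
    assume "C \<inter> (t <# H) \<noteq> {}"
    then obtain h where h: "h \<in> H" "t \<otimes> h \<in> C" by (auto simp: l_coset_def)
    have "C = N0 #> (t \<otimes> h)" using G.rcosets_memb(1)[OF D(2) C h(2)] .
    also have "\<dots> = (t \<otimes> h) <# N0" using D(1) t H_G[OF h(1)] by (simp add: normal.coset_eq)
    also have "\<dots> \<subseteq> t <# H"
    proof
      fix x assume "x \<in> (t \<otimes> h) <# N0"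
      then obtain m where m: "m \<in> N0" "x = t \<otimes> h \<otimes> m" by (auto simp: l_coset_def)
      then have "x = t \<otimes> (h \<otimes> m)" using t H_G[OF h(1)] D(4) by (auto simp: G.m_assoc)
      moreover have "h \<otimes> m \<in> H" using h(1) m(1) N0(2) H_closed by blast
      ultimately show "x \<in> t <# H" unfolding l_coset_def by blast
    qed
    finally show "C \<subseteq> t <# H" .
  qed
qed

text \<open>
  \<open>x t\<close> is the restriction of \<open>v\<close> to the coset \<open>t H\<close>, moved into \<open>H\<close>.
\<close>

lemma coset_decomposition:
  assumes T: "left_transversal T" and v: "v \<in> carrier V"
  obtains x where "\<And>t. t \<in> T \<Longrightarrow> x t \<in> VH" "v = (\<Oplus>\<^bsub>V\<^esub>t\<in>T. t \<bullet>\<^bsub>V\<^esub> x t)"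
proof -
  obtain N0 where N0: "N0 \<in> Nor" "N0 \<subseteq> H" using G.normal_core_exists[OF H finH] .
  have TG: "t \<in> carrier G" if "t \<in> T" for t using T that by (auto simp: left_transversal_def)
  let ?E = "\<lambda>t. t <# H"
  define x where "x t = inv t \<bullet>\<^bsub>V\<^esub> restr N0 (?E t) v" for t
  have rs: "restr N0 (?E t) v \<in> supported (?E t)" if "t \<in> T" for t
    using restr_supported[OF v N0(1) saturated_l_coset[OF N0 TG[OF that]]] .
  then have rV: "restr N0 (?E t) v \<in> carrier V" if "t \<in> T" for t using that by (auto simp: supported_def)
  have "x t \<in> VH" if t: "t \<in> T" for t
  proof -
    note tG = TG[OF t]
    have "x t N C = \<zero>\<^bsub>k\<^esub>" if N: "N \<in> Nor" "C \<in> rcosets N" "C \<inter> H = {}" for N C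
    proof -
      note D = G.fin_index_normalsD[OF N(1)]
      have Cc: "C \<subseteq> carrier G" using G.rcosets_sub[OF D(2) N(2)] .
      have "(t <# C) \<inter> ?E t = {}"
      proof (rule ccontr)
        assume "(t <# C) \<inter> ?E t \<noteq> {}"
        then obtain c h where "c \<in> C" "h \<in> H" "t \<otimes> c = t \<otimes> h" by (auto simp: l_coset_def)
        then have "inv t \<otimes> (t \<otimes> c) = inv t \<otimes> (t \<otimes> h)" by simp
        then have "c = h" using tG Cc H_G \<open>c \<in> C\<close> \<open>h \<in> H\<close> by (auto simp flip: G.m_assoc)
        then show False using N(3) \<open>c \<in> C\<close> \<open>h \<in> H\<close> by auto
      qed
      moreover have "t <# C \<in> rcosets N" using G.l_coset_rcosets[OF D(1) tG N(2)] .
      ultimately have "restr N0 (?E t) v N (t <# C) = \<zero>\<^bsub>k\<^esub>"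
        using rs[OF t] N(1) by (auto simp: supported_def)
      then show ?thesis using gact_V[OF _ rV[OF t] N(1,2), of "inv t"] tG by (simp add: x_def)
    qed
    moreover have "x t \<in> carrier V" using rV[OF t] by (simp add: x_def)
    ultimately show ?thesis by (auto simp: supported_def)
  qed
  moreover have "v = (\<Oplus>\<^bsub>V\<^esub>t\<in>T. restr N0 (?E t) v)"
    using T saturated_l_coset[OF N0] TG by (intro restr_sum[OF v N0(1)]) (auto simp: left_transversal_def)
  moreover have "(\<Oplus>\<^bsub>V\<^esub>t\<in>T. restr N0 (?E t) v) = (\<Oplus>\<^bsub>V\<^esub>t\<in>T. t \<bullet>\<^bsub>V\<^esub> x t)"
    using rV TG by (intro V.M.finsum_cong') (auto simp: x_def)
  ultimately show ?thesis using that[of x] by metis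
qed

text \<open>
  The summands are measures supported on different cosets of \<open>H\<close>.
\<close>

lemma coset_independent:
  assumes T: "left_transversal T" and x: "\<And>t. t \<in> T \<Longrightarrow> x t \<in> VH"
    and sum: "(\<Oplus>\<^bsub>V\<^esub>t\<in>T. t \<bullet>\<^bsub>V\<^esub> x t) = \<zero>\<^bsub>V\<^esub>" and t0: "t0 \<in> T"
  shows "x t0 = \<zero>\<^bsub>V\<^esub>"
proof -
  obtain N0 where N0: "N0 \<in> Nor" "N0 \<subseteq> H" using G.normal_core_exists[OF H finH] .
  have TG: "t \<in> carrier G" if "t \<in> T" for t using T that by (auto simp: left_transversal_def)
  have xV: "x t \<in> carrier V" if "t \<in> T" for t using VH_V x that by blast
  show ?thesis
  proof (rule V_zeroI[OF xV[OF t0] N0(1)])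
    fix N C assume N: "N \<in> Nor" "N \<subseteq> N0" "C \<in> rcosets N"
    note D = G.fin_index_normalsD[OF N(1)]
    have Cc: "C \<subseteq> carrier G" using G.rcosets_sub[OF D(2) N(3)] .
    show "x t0 N C = \<zero>\<^bsub>k\<^esub>"
    proof (cases "C \<inter> H = {}")
      case True
      then show ?thesis using x[OF t0] N by (auto simp: supported_def)
    next
      case False
      then have CH: "C \<subseteq> H" using coset_sub_H[OF N(1) _ N(3)] N(2) N0(2) by auto
      let ?C = "t0 <# C"
      have tC: "?C \<in> rcosets N" using G.l_coset_rcosets[OF D(1) TG[OF t0] N(3)] .
      have other: "x t N (inv t <# ?C) = \<zero>\<^bsub>k\<^esub>" if t: "t \<in> T" "t \<noteq> t0" for t
      proof -
        have "(inv t <# ?C) \<inter> H = {}"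
        proof (rule ccontr)
          assume "(inv t <# ?C) \<inter> H \<noteq> {}"
          then obtain c where c: "c \<in> C" "inv t \<otimes> (t0 \<otimes> c) \<in> H" by (auto simp: l_coset_def)
          have cG: "c \<in> carrier G" "t0 \<otimes> c \<in> carrier G" using c Cc TG[OF t0] by auto
          have "t0 \<otimes> c = t \<otimes> (inv t \<otimes> (t0 \<otimes> c))"
            using cG TG[OF t(1)] by (simp flip: G.m_assoc)
          then have "t0 \<otimes> c \<in> t <# H" using c(2) unfolding l_coset_def by blast
          moreover have "t0 \<otimes> c \<in> t0 <# H" using c(1) CH unfolding l_coset_def by blast
          ultimately show False using T cG(2) t t0 unfolding left_transversal_def by metis
        qed
        then show ?thesis
          using x[OF t(1)] N(1) G.l_coset_rcosets[OF D(1) _ tC] TG[OF t(1)] by (auto simp: supported_def)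
      qed
      have "(\<Oplus>\<^bsub>V\<^esub>t\<in>T. t \<bullet>\<^bsub>V\<^esub> x t) N ?C = (\<Oplus>\<^bsub>k\<^esub>t\<in>T. (t \<bullet>\<^bsub>V\<^esub> x t) N ?C)"
        using T xV by (intro finsum_V_app[OF _ _ N(1) tC]) (auto simp: left_transversal_def)
      also have "\<dots> = (\<Oplus>\<^bsub>k\<^esub>t\<in>T. if t0 = t then x t0 N C else \<zero>\<^bsub>k\<^esub>)"
      proof (rule k.finsum_cong')
        fix t assume t: "t \<in> T"
        have "(t \<bullet>\<^bsub>V\<^esub> x t) N ?C = x t N (inv t <# ?C)" using gact_V[OF TG[OF t] xV[OF t] N(1) tC] .
        then show "(t \<bullet>\<^bsub>V\<^esub> x t) N ?C = (if t0 = t then x t0 N C else \<zero>\<^bsub>k\<^esub>)"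
          using other[OF t] G.l_coset_inv_cancel(1)[OF TG[OF t0] Cc] by auto
      qed (use V_D(3)[OF xV[OF t0] N(1,3)] in auto)
      also have "\<dots> = x t0 N C"
        using T V_D(3)[OF xV[OF t0] N(1,3)] by (intro k.finsum_singleton[OF t0]) (auto simp: left_transversal_def)
      finally show ?thesis using sum zero_V_app[OF N(1) tC] by simp
    qed
  qed
qed

text \<open>
  The closure of the graph of \<open>h\<close> under addition and under the action of \<open>G\<close>.  It is the graph of the
  equivariant extension of \<open>h\<close> once it is known to be single-valued.
\<close>

inductive_set graph_closure :: "('g \<Rightarrow> 'r, 'm, 'd) module_scheme \<Rightarrow> ('g set \<Rightarrow> 'g set \<Rightarrow> 'r) set \<Rightarrow> (('g set \<Rightarrow> 'g set \<Rightarrow> 'r) \<Rightarrow> 'm) \<Rightarrow>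
    (('g set \<Rightarrow> 'g set \<Rightarrow> 'r) \<times> 'm) set"
  for M :: "('g \<Rightarrow> 'r, 'm, 'd) module_scheme" and U h where
  zero: "(\<zero>\<^bsub>V\<^esub>, \<zero>\<^bsub>M\<^esub>) \<in> graph_closure M U h"
| add: "(x, m) \<in> graph_closure M U h \<Longrightarrow> g \<in> carrier G \<Longrightarrow> u \<in> U \<Longrightarrow> (g \<bullet>\<^bsub>V\<^esub> u \<oplus>\<^bsub>V\<^esub> x, g \<bullet>\<^bsub>M\<^esub> h u \<oplus>\<^bsub>M\<^esub> m) \<in> graph_closure M U h"

inductive_set span :: "('g set \<Rightarrow> 'g set \<Rightarrow> 'r) set \<Rightarrow> ('g set \<Rightarrow> 'g set \<Rightarrow> 'r) set" for U where
  zero: "\<zero>\<^bsub>V\<^esub> \<in> span U"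
| add: "x \<in> span U \<Longrightarrow> g \<in> carrier G \<Longrightarrow> u \<in> U \<Longrightarrow> g \<bullet>\<^bsub>V\<^esub> u \<oplus>\<^bsub>V\<^esub> x \<in> span U"

lemma span_V: 
  assumes U: "U \<subseteq> carrier V" and x: "x \<in> span U" shows "x \<in> carrier V"
  using x by (induction rule: span.induct) (use U in auto)

lemma span_add:
  assumes U: "U \<subseteq> carrier V" and x: "x \<in> span U" and y: "y \<in> span U"
  shows "x \<oplus>\<^bsub>V\<^esub> y \<in> span U"
  using x
proof (induction rule: span.induct)
  case zero
  then show ?case using y span_V[OF U y] by simp
next
  case (add x g u)
  then have "g \<bullet>\<^bsub>V\<^esub> u \<oplus>\<^bsub>V\<^esub> (x \<oplus>\<^bsub>V\<^esub> y) \<in> span U" by (intro span.add)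
  moreover have "u \<in> carrier V" "x \<in> carrier V" "y \<in> carrier V" using add U span_V[OF U] y by auto
  ultimately show ?case by (simp add: V.M.a_assoc)
qed

lemma span_gact:
  assumes U: "U \<subseteq> carrier V" and x: "x \<in> span U" and g: "g \<in> carrier G"
  shows "g \<bullet>\<^bsub>V\<^esub> x \<in> span U"
  using x
proof (induction rule: span.induct)
  case zero
  then show ?case using span.zero by simp
next
  case (add x g' u)
  then have "(g \<otimes> g') \<bullet>\<^bsub>V\<^esub> u \<oplus>\<^bsub>V\<^esub> (g \<bullet>\<^bsub>V\<^esub> x) \<in> span U" using g by (intro span.add) auto
  moreover have "u \<in> carrier V" "x \<in> carrier V" using add U span_V[OF U] by auto
  ultimately show ?case using g add by (simp add: V.gact_add V.gact_mult)
qed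

lemma span_submodule:
  assumes U: "U \<subseteq> carrier V" shows "submodule (span U) kG V"
  using span_V[OF U] span_add[OF U] span_gact[OF U] span.zero by (intro V.submoduleI) auto

lemma span_incl:
  assumes U: "U \<subseteq> carrier V" and u: "u \<in> U" and g: "g \<in> carrier G" shows "g \<bullet>\<^bsub>V\<^esub> u \<in> span U"
proof -
  have "g \<bullet>\<^bsub>V\<^esub> u \<oplus>\<^bsub>V\<^esub> \<zero>\<^bsub>V\<^esub> \<in> span U" by (intro span.intros g u)
  moreover have "u \<in> carrier V" using U u by blast
  ultimately show ?thesis by simp
qed

lemma span_self:
  assumes U: "U \<subseteq> carrier V" and u: "u \<in> U" shows "u \<in> span U"
  using span_incl[OF U u G.one_closed] U u by auto

lemma graph_closure_total: "x \<in> span U \<Longrightarrow> \<exists>m. (x, m) \<in> graph_closure M U h"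
  by (induction rule: span.induct) (auto intro: graph_closure.intros)

lemma finsum_modify:
  assumes "left_module kG M" "finite T" "t0 \<in> T" "f \<in> T \<rightarrow> carrier M" "c \<in> carrier M"
  shows "(\<Oplus>\<^bsub>M\<^esub>t\<in>T. if t = t0 then c \<oplus>\<^bsub>M\<^esub> f t else f t) = c \<oplus>\<^bsub>M\<^esub> (\<Oplus>\<^bsub>M\<^esub>t\<in>T. f t)"
proof -
  interpret M: kG_module G k n M by (rule kG_moduleI[OF assms(1)])
  have "(\<Oplus>\<^bsub>M\<^esub>t\<in>T. if t = t0 then c \<oplus>\<^bsub>M\<^esub> f t else f t) = (\<Oplus>\<^bsub>M\<^esub>t\<in>T. (if t0 = t then c else \<zero>\<^bsub>M\<^esub>) \<oplus>\<^bsub>M\<^esub> f t)"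
    using assms funcset_mem[OF assms(4)] by (intro M.M.finsum_cong') auto
  also have "\<dots> = (\<Oplus>\<^bsub>M\<^esub>t\<in>T. if t0 = t then c else \<zero>\<^bsub>M\<^esub>) \<oplus>\<^bsub>M\<^esub> (\<Oplus>\<^bsub>M\<^esub>t\<in>T. f t)"
    using assms by (intro M.M.finsum_addf) auto
  also have "(\<Oplus>\<^bsub>M\<^esub>t\<in>T. if t0 = t then c else \<zero>\<^bsub>M\<^esub>) = c"
    using assms by (intro M.M.finsum_singleton) auto
  finally show ?thesis .
qed

text \<open>
  A pair in the closure involves finitely many group elements, each of which is \<open>t \<eta>\<close> with \<open>t \<in> T\<close> and
  \<open>\<eta> \<in> H\<close>.  Extending \<open>h\<close> along words for all the \<open>\<eta>\<close> collects the pair, coset by coset, in the graph of a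
  single compatible map.
\<close>

lemma graph_invariant:
  assumes M: "left_module kG M" and U: "critical U" and h: "compat M U h" and T: "left_transversal T"
    and xm: "(x, m) \<in> graph_closure M U h"
  shows "\<exists>U' h' y. extends M U h U' h' \<and> (\<forall>t\<in>T. y t \<in> U') \<and>
    x = (\<Oplus>\<^bsub>V\<^esub>t\<in>T. t \<bullet>\<^bsub>V\<^esub> y t) \<and> m = (\<Oplus>\<^bsub>M\<^esub>t\<in>T. t \<bullet>\<^bsub>M\<^esub> h' (y t))"
  using xm
proof (induction rule: graph_closure.induct)
  interpret M: kG_module G k n M by (rule kG_moduleI[OF M])
  {
    case zero
    have "extends M U h U h" using U h by (simp add: extends_def)
    moreover have "h \<zero>\<^bsub>V\<^esub> = \<zero>\<^bsub>M\<^esub>"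
      using additive_on_zero[OF left_module_V M _ fsubD(1)[OF critical_fsub[OF U]]] h by (simp add: compat_def)
    ultimately show ?case
      using fsubD(5)[OF critical_fsub[OF U]] by (intro exI[of _ U] exI[of _ h] exI[of _ "\<lambda>_. \<zero>\<^bsub>V\<^esub>"]) simp
  next
    case (add x m g u)
    obtain U1 h1 y where 1: "extends M U h U1 h1" "\<And>t. t \<in> T \<Longrightarrow> y t \<in> U1"
      "x = (\<Oplus>\<^bsub>V\<^esub>t\<in>T. t \<bullet>\<^bsub>V\<^esub> y t)" "m = (\<Oplus>\<^bsub>M\<^esub>t\<in>T. t \<bullet>\<^bsub>M\<^esub> h1 (y t))" using add.IH by blast
    have U1: "critical U1" "compat M U1 h1" "U \<subseteq> U1" "\<And>u. u \<in> U \<Longrightarrow> h1 u = h u" using 1(1) by (auto simp: extends_def)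
    obtain t0 \<eta> where t0: "t0 \<in> T" "\<eta> \<in> H" "g = t0 \<otimes> \<eta>"
    proof -
      obtain t where "t \<in> T" "g \<in> t <# H" using T add.hyps(2) unfolding left_transversal_def by metis
      then show ?thesis using that unfolding l_coset_def by blast
    qed
    have finT: "finite T" and TG: "\<And>t. t \<in> T \<Longrightarrow> t \<in> carrier G" using T by (auto simp: left_transversal_def)
    obtain w where w: "w \<in> words" "wv w = \<eta>" using word_exists[OF t0(2)] .
    obtain U2 h2 where 2: "extends M U1 h1 U2 h2" "\<And>u. u \<in> U1 \<Longrightarrow> \<eta> \<bullet>\<^bsub>V\<^esub> u \<in> U2 \<and> h2 (\<eta> \<bullet>\<^bsub>V\<^esub> u) = \<eta> \<bullet>\<^bsub>M\<^esub> h1 u"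
      using extend_word[OF M U1(1,2) w(1)] unfolding w(2) by blast
    have U2: "critical U2" "compat M U2 h2" "U1 \<subseteq> U2" "\<And>u. u \<in> U1 \<Longrightarrow> h2 u = h1 u" using 2(1) by (auto simp: extends_def)
    note D2 = fsubD[OF critical_fsub[OF U2(1)]]
    have add2: "additive_on V M U2 h2" using U2(2) by (simp add: compat_def)
    note h2D = additive_onD[OF add2]
    define z where "z t = (if t = t0 then \<eta> \<bullet>\<^bsub>V\<^esub> u \<oplus>\<^bsub>V\<^esub> y t else y t)" for t
    have uU1: "u \<in> U1" using add.hyps(3) U1(3) by blast
    have yU2: "y t \<in> U2" if "t \<in> T" for t using 1(2)[OF that] U2(3) by blast
    have zU2: "z t \<in> U2" if "t \<in> T" for t using 2(2)[OF uU1] yU2[OF that] D2(6) by (auto simp: z_def)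
    have \<eta>G: "\<eta> \<in> carrier G" and uV: "u \<in> carrier V" using H_G[OF t0(2)] uU1 U2(3) D2(4) by auto
    have ext: "extends M U h U2 h2" using U1 U2 unfolding extends_def by auto
    have yV: "y t \<in> carrier V" if "t \<in> T" for t using D2(4)[OF yU2[OF that]] .
    have hy: "h1 (y t) \<in> carrier M" "h2 (y t) = h1 (y t)" if "t \<in> T" for t
      using h2D(1)[OF yU2[OF that]] U2(4)[OF 1(2)[OF that]] by auto
    have huM: "h u \<in> carrier M" using h2D(1)[of u] U2(3,4) uU1 U1(4)[OF add.hyps(3)] by auto
    have "(\<Oplus>\<^bsub>V\<^esub>t\<in>T. t \<bullet>\<^bsub>V\<^esub> z t) = (\<Oplus>\<^bsub>V\<^esub>t\<in>T. if t = t0 then g \<bullet>\<^bsub>V\<^esub> u \<oplus>\<^bsub>V\<^esub> t \<bullet>\<^bsub>V\<^esub> y t else t \<bullet>\<^bsub>V\<^esub> y t)"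
      using yV uV TG[OF t0(1)] \<eta>G by (intro V.M.finsum_cong') (auto simp: z_def t0(3) V.gact_add V.gact_mult)
    also have "\<dots> = g \<bullet>\<^bsub>V\<^esub> u \<oplus>\<^bsub>V\<^esub> x"
      unfolding 1(3) using yV uV by (intro finsum_modify[OF left_module_V finT t0(1)]) auto
    finally have x: "g \<bullet>\<^bsub>V\<^esub> u \<oplus>\<^bsub>V\<^esub> x = (\<Oplus>\<^bsub>V\<^esub>t\<in>T. t \<bullet>\<^bsub>V\<^esub> z t)" by simp
    have hz: "h2 (z t) = (if t = t0 then \<eta> \<bullet>\<^bsub>M\<^esub> h u \<oplus>\<^bsub>M\<^esub> h1 (y t) else h1 (y t))" if t: "t \<in> T" for t
    proof (cases "t = t0")
      case True
      have "h2 (z t) = h2 (\<eta> \<bullet>\<^bsub>V\<^esub> u) \<oplus>\<^bsub>M\<^esub> h2 (y t)"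
        using h2D(2)[OF _ yU2[OF t]] 2(2)[OF uU1] True by (simp add: z_def)
      then show ?thesis using True 2(2)[OF uU1] hy(2)[OF t] U1(4)[OF add.hyps(3)] by simp
    next
      case False
      then show ?thesis using hy(2)[OF t] by (simp add: z_def)
    qed
    have "(\<Oplus>\<^bsub>M\<^esub>t\<in>T. t \<bullet>\<^bsub>M\<^esub> h2 (z t)) = (\<Oplus>\<^bsub>M\<^esub>t\<in>T. if t = t0 then g \<bullet>\<^bsub>M\<^esub> h u \<oplus>\<^bsub>M\<^esub> t \<bullet>\<^bsub>M\<^esub> h1 (y t) else t \<bullet>\<^bsub>M\<^esub> h1 (y t))"
      using hy(1) huM TG[OF t0(1)] \<eta>G hz by (intro M.M.finsum_cong') (auto simp: t0(3) M.gact_add M.gact_mult)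
    also have "\<dots> = g \<bullet>\<^bsub>M\<^esub> h u \<oplus>\<^bsub>M\<^esub> m"
      unfolding 1(4) using hy(1) huM by (intro finsum_modify[OF M finT t0(1)]) auto
    finally have m: "g \<bullet>\<^bsub>M\<^esub> h u \<oplus>\<^bsub>M\<^esub> m = (\<Oplus>\<^bsub>M\<^esub>t\<in>T. t \<bullet>\<^bsub>M\<^esub> h2 (z t))" by simp
    show ?case using ext zU2 x m by blast
  }
qed

lemma graph_carrier:
  assumes M: "left_module kG M" and U: "fsub U" and h: "additive_on V M U h" and xm: "(x, m) \<in> graph_closure M U h"
  shows "x \<in> carrier V \<and> m \<in> carrier M"
proof -
  interpret M: kG_module G k n M by (rule kG_moduleI[OF M])
  show ?thesis using xm
    by (induction rule: graph_closure.induct) (use fsubD(4)[OF U] additive_onD(1)[OF h] in auto)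
qed

lemma graph_add:
  assumes M: "left_module kG M" and U: "fsub U" and h: "additive_on V M U h"
    and xm: "(x, m) \<in> graph_closure M U h" and yl: "(y, l) \<in> graph_closure M U h"
  shows "(x \<oplus>\<^bsub>V\<^esub> y, m \<oplus>\<^bsub>M\<^esub> l) \<in> graph_closure M U h"
proof -
  interpret M: kG_module G k n M by (rule kG_moduleI[OF M])
  note c = graph_carrier[OF M U h]
  show ?thesis using xm
  proof (induction rule: graph_closure.induct)
    case zero
    then show ?case using yl c[OF yl] by simp
  next
    case (add x m g u)
    then have "(g \<bullet>\<^bsub>V\<^esub> u \<oplus>\<^bsub>V\<^esub> (x \<oplus>\<^bsub>V\<^esub> y), g \<bullet>\<^bsub>M\<^esub> h u \<oplus>\<^bsub>M\<^esub> (m \<oplus>\<^bsub>M\<^esub> l)) \<in> graph_closure M U h" by (intro graph_closure.add)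
    then show ?case
      using c[OF add.hyps(1)] c[OF yl] fsubD(4)[OF U add.hyps(3)] additive_onD(1)[OF h add.hyps(3)]
      by (simp add: V.M.a_assoc M.M.a_assoc)
  qed
qed

lemma graph_gact:
  assumes M: "left_module kG M" and U: "fsub U" and h: "additive_on V M U h"
    and xm: "(x, m) \<in> graph_closure M U h" and g: "g \<in> carrier G"
  shows "(g \<bullet>\<^bsub>V\<^esub> x, g \<bullet>\<^bsub>M\<^esub> m) \<in> graph_closure M U h"
proof -
  interpret M: kG_module G k n M by (rule kG_moduleI[OF M])
  note c = graph_carrier[OF M U h]
  show ?thesis using xm
  proof (induction rule: graph_closure.induct)
    case zero
    then show ?case using graph_closure.zero by simp
  next
    case (add x m g' u)
    then have "((g \<otimes> g') \<bullet>\<^bsub>V\<^esub> u \<oplus>\<^bsub>V\<^esub> g \<bullet>\<^bsub>V\<^esub> x, (g \<otimes> g') \<bullet>\<^bsub>M\<^esub> h u \<oplus>\<^bsub>M\<^esub> g \<bullet>\<^bsub>M\<^esub> m) \<in> graph_closure M U h"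
      using g by (intro graph_closure.add) auto
    then show ?case
      using c[OF add.hyps(1)] fsubD(4)[OF U add.hyps(3)] additive_onD(1)[OF h add.hyps(3)] g add.hyps(2)
      by (simp add: V.gact_add M.gact_add V.gact_mult M.gact_mult)
  qed
qed

lemma graph_neg:
  assumes M: "left_module kG M" and U: "fsub U" and h: "additive_on V M U h" and xm: "(x, m) \<in> graph_closure M U h"
  shows "(\<ominus>\<^bsub>V\<^esub> x, \<ominus>\<^bsub>M\<^esub> m) \<in> graph_closure M U h"
proof -
  interpret M: kG_module G k n M by (rule kG_moduleI[OF M])
  note c = graph_carrier[OF M U h]
  show ?thesis using xm
  proof (induction rule: graph_closure.induct)
    case zero
    have e: "\<ominus>\<^bsub>V\<^esub> \<zero>\<^bsub>V\<^esub> = \<zero>\<^bsub>V\<^esub>" "\<ominus>\<^bsub>M\<^esub> \<zero>\<^bsub>M\<^esub> = \<zero>\<^bsub>M\<^esub>"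
      by (rule V.M.minus_equality M.M.minus_equality; simp)+
    show ?case unfolding e by (rule graph_closure.zero)
  next
    case (add x m g u)
    then have "(g \<bullet>\<^bsub>V\<^esub> (\<ominus>\<^bsub>V\<^esub> u) \<oplus>\<^bsub>V\<^esub> (\<ominus>\<^bsub>V\<^esub> x), g \<bullet>\<^bsub>M\<^esub> h (\<ominus>\<^bsub>V\<^esub> u) \<oplus>\<^bsub>M\<^esub> (\<ominus>\<^bsub>M\<^esub> m)) \<in> graph_closure M U h"
      using fsubD(7)[OF U] by (intro graph_closure.add)
    then show ?case
      using c[OF add.hyps(1)] fsubD(4)[OF U add.hyps(3)] additive_onD(1)[OF h add.hyps(3)]
        additive_on_neg[OF left_module_V M h fsubD(1)[OF U] add.hyps(3)]
      by (simp add: V.gact_neg M.gact_neg V.M.minus_add M.M.minus_add)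
  qed
qed

text \<open>
  If a pair \<open>(0, m)\<close> is written as in \<open>graph_invariant\<close>, then \<open>coset_independent\<close> makes all its coset
  components vanish, hence \<open>m = 0\<close>; so the closure of the graph is single-valued.  In other words, the
  module spanned by a critical \<open>U\<close> has no relations but those visible in \<open>U\<close>.
\<close>

theorem compatible_map_extends:
  assumes M: "left_module kG M" and U: "critical U" and h: "compat M U h"
  obtains f where "additive_on V M (span U) f" "\<And>g x. g \<in> carrier G \<Longrightarrow> x \<in> span U \<Longrightarrow> f (g \<bullet>\<^bsub>V\<^esub> x) = g \<bullet>\<^bsub>M\<^esub> f x"
    "\<And>u. u \<in> U \<Longrightarrow> f u = h u"
proof -
  interpret M: kG_module G k n M by (rule kG_moduleI[OF M])
  have fU: "fsub U" using critical_fsub[OF U] .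
  have ha: "additive_on V M U h" using h by (simp add: compat_def)
  have UV: "U \<subseteq> carrier V" using fsubD(4)[OF fU] by blast
  note c = graph_carrier[OF M fU ha]
  obtain T where T: "left_transversal T" by (rule left_transversal_exists)
  have zero: "m = \<zero>\<^bsub>M\<^esub>" if zm: "(\<zero>\<^bsub>V\<^esub>, m) \<in> graph_closure M U h" for m
  proof -
    obtain U' h' y where e: "extends M U h U' h'" "\<And>t. t \<in> T \<Longrightarrow> y t \<in> U'"
      "\<zero>\<^bsub>V\<^esub> = (\<Oplus>\<^bsub>V\<^esub>t\<in>T. t \<bullet>\<^bsub>V\<^esub> y t)" "m = (\<Oplus>\<^bsub>M\<^esub>t\<in>T. t \<bullet>\<^bsub>M\<^esub> h' (y t))"
      using graph_invariant[OF M U h T zm] by blast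
    have U': "fsub U'" "additive_on V M U' h'" using e(1) critical_fsub by (auto simp: extends_def compat_def)
    have "y t = \<zero>\<^bsub>V\<^esub>" if "t \<in> T" for t
      using coset_independent[OF T _ e(3)[symmetric] that] e(2) fsubD(3)[OF U'(1)] by blast
    moreover have "h' \<zero>\<^bsub>V\<^esub> = \<zero>\<^bsub>M\<^esub>" using additive_on_zero[OF left_module_V M U'(2) fsubD(1)[OF U'(1)]] .
    ultimately show "m = \<zero>\<^bsub>M\<^esub>" unfolding e(4) by (intro M.M.add.finprod_one_eqI) simp
  qed
  have uniq: "m = l" if "(x, m) \<in> graph_closure M U h" "(x, l) \<in> graph_closure M U h" for x m l
  proof -
    have "(x \<oplus>\<^bsub>V\<^esub> (\<ominus>\<^bsub>V\<^esub> x), m \<oplus>\<^bsub>M\<^esub> (\<ominus>\<^bsub>M\<^esub> l)) \<in> graph_closure M U h"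
      by (rule graph_add[OF M fU ha that(1) graph_neg[OF M fU ha that(2)]])
    then have "m \<oplus>\<^bsub>M\<^esub> (\<ominus>\<^bsub>M\<^esub> l) = \<zero>\<^bsub>M\<^esub>" using zero c[OF that(1)] by (simp add: V.M.r_neg)
    then show ?thesis using M.M.minus_equality[of m "\<ominus>\<^bsub>M\<^esub> l"] c that by auto
  qed
  define f where "f x = (THE m. (x, m) \<in> graph_closure M U h)" for x
  have f: "f x = m" if "(x, m) \<in> graph_closure M U h" for x m
    unfolding f_def using that uniq by (intro the_equality) auto
  have fg: "(x, f x) \<in> graph_closure M U h" if "x \<in> span U" for x using graph_closure_total[OF that, of M h] f by auto
  show ?thesis
  proof (rule that[of f])
    show "additive_on V M (span U) f"
      unfolding additive_on_def using c fg f[OF graph_add[OF M fU ha fg fg]] by auto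
    show "f (g \<bullet>\<^bsub>V\<^esub> x) = g \<bullet>\<^bsub>M\<^esub> f x" if "g \<in> carrier G" "x \<in> span U" for g x
      using f[OF graph_gact[OF M fU ha fg[OF that(2)] that(1)]] .
    show "f u = h u" if u: "u \<in> U" for u
    proof -
      have "(\<one> \<bullet>\<^bsub>V\<^esub> u \<oplus>\<^bsub>V\<^esub> \<zero>\<^bsub>V\<^esub>, \<one> \<bullet>\<^bsub>M\<^esub> h u \<oplus>\<^bsub>M\<^esub> \<zero>\<^bsub>M\<^esub>) \<in> graph_closure M U h"
        by (intro graph_closure.intros u G.one_closed)
      then show ?thesis using f fsubD(4)[OF fU u] additive_onD(1)[OF ha u] by simp
    qed
  qed
qed

end

section \<open>Coboundaries on finite subgroups\<close>

lemma (in group) card_hom_fiber: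
  assumes f: "f \<in> hom G K" and K: "group K" and x: "x \<in> carrier G"
  shows "card {y \<in> carrier G. f y = f x} = card {y \<in> carrier G. f y = \<one>\<^bsub>K\<^esub>}"
proof (rule bij_betw_same_card)
  interpret K: group K by (rule K)
  interpret group_hom G K f using f by unfold_locales
  show "bij_betw (\<lambda>y. y \<otimes> inv x) {y \<in> carrier G. f y = f x} {y \<in> carrier G. f y = \<one>\<^bsub>K\<^esub>}"
    using x by (intro bij_betw_byWitness[where f' = "\<lambda>y. y \<otimes> x"]) (auto simp: m_assoc)
qed

text \<open>
  The fibres of a homomorphism over the points of its image all have the same size, which is determined by
  the order of the image.  So the fibres of \<open>f\<close> and \<open>g\<close> over a common value can be matched.
\<close>

lemma (in group) balanced_homs:
  assumes fin: "finite (carrier G)" and K: "group K" and f: "f \<in> hom G K" and g: "g \<in> hom G K"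
    and im: "f ` carrier G = g ` carrier G"
  obtains \<sigma> where "bij_betw \<sigma> (carrier G) (carrier G)" "\<And>x. x \<in> carrier G \<Longrightarrow> f (\<sigma> x) = g x"
proof -
  let ?F = "\<lambda>f v. {y \<in> carrier G. f y = v}"
  have cf: "card (carrier G) = card (?F f \<one>\<^bsub>K\<^esub>) * card (f ` carrier G)"
    by (rule card_fibers[OF fin card_hom_fiber[OF f K]])
  have cg: "card (carrier G) = card (?F g \<one>\<^bsub>K\<^esub>) * card (g ` carrier G)"
    by (rule card_fibers[OF fin card_hom_fiber[OF g K]])
  have "card (g ` carrier G) > 0" using fin by (auto simp: card_gt_0_iff)
  then have eq: "card (?F f \<one>\<^bsub>K\<^esub>) = card (?F g \<one>\<^bsub>K\<^esub>)" using cf cg im by simp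
  have "\<exists>\<beta>. bij_betw \<beta> (?F g v) (?F f v)" if v: "v \<in> g ` carrier G" for v
  proof (rule finite_same_card_bij)
    obtain x y where xy: "x \<in> carrier G" "v = g x" "y \<in> carrier G" "v = f y" using v im by (metis imageE)
    have "card (?F g v) = card (?F g \<one>\<^bsub>K\<^esub>)" unfolding xy(2) by (rule card_hom_fiber[OF g K xy(1)])
    moreover have "card (?F f v) = card (?F f \<one>\<^bsub>K\<^esub>)" unfolding xy(4) by (rule card_hom_fiber[OF f K xy(3)])
    ultimately show "card (?F g v) = card (?F f v)" using eq by simp
  qed (use fin in auto)
  then obtain \<beta> where \<beta>: "\<And>v. v \<in> g ` carrier G \<Longrightarrow> bij_betw (\<beta> v) (?F g v) (?F f v)" by metis
  define \<sigma> where "\<sigma> x = \<beta> (g x) x" for x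
  have \<sigma>: "\<sigma> x \<in> carrier G \<and> f (\<sigma> x) = g x" if x: "x \<in> carrier G" for x
    using bij_betwE[OF \<beta>[OF imageI[OF x]]] x by (auto simp: \<sigma>_def)
  have "inj_on \<sigma> (carrier G)"
  proof (rule inj_onI)
    fix x y assume xy: "x \<in> carrier G" "y \<in> carrier G" "\<sigma> x = \<sigma> y"
    then have e: "g x = g y" using \<sigma> by metis
    have "inj_on (\<beta> (g x)) (?F g (g x))" using \<beta>[OF imageI[OF xy(1)]] by (rule bij_betw_imp_inj_on)
    then show "x = y" using xy e by (auto simp: \<sigma>_def dest: inj_onD)
  qed
  moreover from this have "\<sigma> ` carrier G = carrier G" using \<sigma> fin by (intro endo_inj_surj) auto
  ultimately show ?thesis using that[of \<sigma>] \<sigma> by (auto simp: bij_betw_def)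
qed

context finite_index_free
begin

text \<open>
  On the image of \<open>L\<close> the map is forced; it is extended to \<open>U\<close> by a retraction of \<open>U\<close> onto this image.
\<close>

lemma factor_through:
  assumes M: "left_module kG M" and P: "group P" and L: "L \<in> hom P (add_monoid V)" and F: "F \<in> hom P (add_monoid M)"
    and ker: "\<And>z. z \<in> carrier P \<Longrightarrow> L z = \<zero>\<^bsub>V\<^esub> \<Longrightarrow> F z = \<zero>\<^bsub>M\<^esub>"
    and U: "fsub U" and im: "L ` carrier P \<subseteq> U"
  obtains c where "additive_on V M U c" "\<And>z. z \<in> carrier P \<Longrightarrow> c (L z) = F z"
proof -
  interpret M: kG_module G k n M by (rule kG_moduleI[OF M])
  interpret P: group P by (rule P)
  interpret L: group_hom P "add_monoid V" L using L by unfold_locales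
  interpret F: group_hom P "add_monoid M" F using F by unfold_locales
  have A: "V.asub (L ` carrier P)" using L.img_is_subgroup .
  obtain r where r: "r \<in> U \<rightarrow> L ` carrier P" "additive_on V V U r" "\<And>a. a \<in> L ` carrier P \<Longrightarrow> r a = a"
    using V.asub_retraction[OF fsubD(1,2)[OF U] A im] by blast
  have Fc: "F z \<in> carrier M" if "z \<in> carrier P" for z using F.hom_closed[OF that] by simp
  have Fadd: "F (z \<otimes>\<^bsub>P\<^esub> z') = F z \<oplus>\<^bsub>M\<^esub> F z'" "L (z \<otimes>\<^bsub>P\<^esub> z') = L z \<oplus>\<^bsub>V\<^esub> L z'"
    if "z \<in> carrier P" "z' \<in> carrier P" for z z' using F.hom_mult[OF that] L.hom_mult[OF that] by simp_all
  have wd: "F z = F z'" if z: "z \<in> carrier P" "z' \<in> carrier P" "L z = L z'" for z z'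
  proof -
    let ?d = "z \<otimes>\<^bsub>P\<^esub> inv\<^bsub>P\<^esub> z'"
    have "L ?d = \<zero>\<^bsub>V\<^esub>" using L.hom_mult[of z "inv\<^bsub>P\<^esub> z'"] L.hom_inv[OF z(2)] z V.M.r_neg[of "L z'"] L.hom_closed[OF z(2)]
      by (simp flip: a_inv_def)
    then have "F ?d = \<zero>\<^bsub>M\<^esub>" using ker z by simp
    moreover have "?d \<otimes>\<^bsub>P\<^esub> z' = z" using z by (simp add: P.m_assoc)
    ultimately show "F z = F z'" using Fadd(1)[of ?d z'] Fc[OF z(2)] z by simp
  qed
  define c where "c u = F (SOME z. z \<in> carrier P \<and> L z = r u)" for u
  have c: "c u = F z" if "z \<in> carrier P" "L z = r u" for u z
  proof -
    have "(SOME z. z \<in> carrier P \<and> L z = r u) \<in> carrier P \<and> L (SOME z. z \<in> carrier P \<and> L z = r u) = r u"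
      by (rule someI[of _ z]) (use that in simp)
    then show ?thesis unfolding c_def using wd that by metis
  qed
  have pre: "\<exists>z. z \<in> carrier P \<and> L z = r u" if "u \<in> U" for u using r(1) that by (auto simp: Pi_def image_iff) metis
  show ?thesis
  proof (rule that[of c])
    show "additive_on V M U c"
      unfolding additive_on_def
    proof (intro conjI ballI)
      show "c \<in> U \<rightarrow> carrier M" using pre c Fc by (metis Pi_I)
      fix x y assume xy: "x \<in> U" "y \<in> U"
      obtain z z' where z: "z \<in> carrier P" "L z = r x" "z' \<in> carrier P" "L z' = r y" using pre xy by metis
      have "L (z \<otimes>\<^bsub>P\<^esub> z') = r (x \<oplus>\<^bsub>V\<^esub> y)" using Fadd(2)[OF z(1,3)] z additive_onD(2)[OF r(2) xy] by simp
      then have "c (x \<oplus>\<^bsub>V\<^esub> y) = F (z \<otimes>\<^bsub>P\<^esub> z')" by (rule c[OF P.m_closed[OF z(1,3)]])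
      then show "c (x \<oplus>\<^bsub>V\<^esub> y) = c x \<oplus>\<^bsub>M\<^esub> c y" using Fadd(1)[OF z(1,3)] c[OF z(1,2)] c[OF z(3,4)] by simp
    qed
    show "c (L z) = F z" if "z \<in> carrier P" for z using c[OF that] r(3) that by simp
  qed
qed

text \<open>
  Two families \<open>x\<close>, \<open>y\<close> with \<open>x s\<close> and \<open>y s\<close> in \<open>shift_dom U s\<close> are stored in one function \<open>z\<close>, as
  \<open>x s = z (s, True)\<close> and \<open>y s = z (s, False)\<close>.
\<close>

definition pairs :: "('g set \<Rightarrow> 'g set \<Rightarrow> 'r) set \<Rightarrow> ('g \<times> bool \<Rightarrow> ('g set \<Rightarrow> 'g set \<Rightarrow> 'r)) monoid"
  where "pairs U = product_group (active U \<times> UNIV) (\<lambda>i. (add_monoid V)\<lparr>carrier := shift_dom U (fst i)\<rparr>)"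

lemma pairs_group: "fsub U \<Longrightarrow> group (pairs U)"
  unfolding pairs_def using V.M.add.subgroup_imp_group[OF fsubD(1)[OF shift_dom_fsub]] by (intro product_group)

lemma pairs_simps:
  "carrier (pairs U) = (\<Pi>\<^sub>E i\<in>active U \<times> UNIV. shift_dom U (fst i))"
  "z \<otimes>\<^bsub>pairs U\<^esub> z' = (\<lambda>i\<in>active U \<times> UNIV. z i \<oplus>\<^bsub>V\<^esub> z' i)"
  "\<one>\<^bsub>pairs U\<^esub> = (\<lambda>i\<in>active U \<times> UNIV. \<zero>\<^bsub>V\<^esub>)"
  by (simp_all add: pairs_def)

lemma pairs_finite:
  assumes U: "fsub U" shows "finite (carrier (pairs U))"
  unfolding pairs_simps using finite_active[OF U] fsubD(2)[OF shift_dom_fsub[OF U]] by (intro finite_PiE) auto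

lemma pairs_app:
  assumes U: "fsub U" and z: "z \<in> carrier (pairs U)" and s: "s \<in> active U"
  shows "z (s, b) \<in> shift_dom U s" "z (s, b) \<in> U" "z (s, b) \<in> VH" "z (s, b) \<in> carrier V" "s \<bullet>\<^bsub>V\<^esub> z (s, b) \<in> U"
proof -
  show d: "z (s, b) \<in> shift_dom U s" using z s by (force simp: pairs_simps)
  then show "z (s, b) \<in> U" "z (s, b) \<in> VH" "z (s, b) \<in> carrier V" "s \<bullet>\<^bsub>V\<^esub> z (s, b) \<in> U"
    using fsubD(3,4)[OF U] by (auto simp: shift_dom_def)
qed

lemma pairs_eval_hom:
  assumes U: "fsub U" and s: "s \<in> active U" and E: "E \<subseteq> carrier (pairs U)"
  shows "(\<lambda>z. z (s, b)) \<in> hom ((pairs U)\<lparr>carrier := E\<rparr>) (add_monoid V)"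
  using pairs_app(4)[OF U _ s] E s by (auto simp: hom_def pairs_simps(2))

text \<open>
  The sum of \<open>\<delta> s (y s) - s \<delta> s (x s)\<close> for the pair \<open>(x, y)\<close> stored in \<open>z\<close>.
\<close>

definition twisted_sum :: "('g \<Rightarrow> 'r, 'm, 'd) module_scheme \<Rightarrow> ('g set \<Rightarrow> 'g set \<Rightarrow> 'r) set \<Rightarrow> ('g \<Rightarrow> ('g set \<Rightarrow> 'g set \<Rightarrow> 'r) \<Rightarrow> 'm) \<Rightarrow>
    ('g \<times> bool \<Rightarrow> ('g set \<Rightarrow> 'g set \<Rightarrow> 'r)) \<Rightarrow> 'm"
  where "twisted_sum M U \<delta> z = (\<Oplus>\<^bsub>M\<^esub>s\<in>active U. \<delta> s (z (s, False)) \<oplus>\<^bsub>M\<^esub> (\<ominus>\<^bsub>M\<^esub> (s \<bullet>\<^bsub>M\<^esub> \<delta> s (z (s, True)))))"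

definition source_sum :: "('g \<Rightarrow> 'r, 'm, 'd) module_scheme \<Rightarrow> ('g set \<Rightarrow> 'g set \<Rightarrow> 'r) set \<Rightarrow> ('g \<Rightarrow> ('g set \<Rightarrow> 'g set \<Rightarrow> 'r) \<Rightarrow> 'm) \<Rightarrow>
    ('g \<times> bool \<Rightarrow> ('g set \<Rightarrow> 'g set \<Rightarrow> 'r)) \<Rightarrow> 'm"
  where "source_sum M U e z = (\<Oplus>\<^bsub>M\<^esub>s\<in>active U. e s (z (s, True)))"

lemma twisted_sum_hom:
  assumes M: "left_module kG M" and U: "fsub U" and \<delta>: "\<And>s. s \<in> active U \<Longrightarrow> additive_on V M (shift_dom U s) (\<delta> s)"
  shows "z \<in> carrier (pairs U) \<Longrightarrow> twisted_sum M U \<delta> z \<in> carrier M"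
    "z \<in> carrier (pairs U) \<Longrightarrow> z' \<in> carrier (pairs U) \<Longrightarrow>
      twisted_sum M U \<delta> (z \<otimes>\<^bsub>pairs U\<^esub> z') = twisted_sum M U \<delta> z \<oplus>\<^bsub>M\<^esub> twisted_sum M U \<delta> z'"
proof -
  interpret M: kG_module G k n M by (rule kG_moduleI[OF M])
  have \<delta>c: "\<delta> s (z (s, b)) \<in> carrier M" if "z \<in> carrier (pairs U)" "s \<in> active U" for z s b
    using additive_onD(1)[OF \<delta> pairs_app(1)[OF U]] that by blast
  show "z \<in> carrier (pairs U) \<Longrightarrow> twisted_sum M U \<delta> z \<in> carrier M"
    unfolding twisted_sum_def using \<delta>c by (intro M.M.finsum_closed) auto
  assume z: "z \<in> carrier (pairs U)" "z' \<in> carrier (pairs U)"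
  note c = \<delta>c[OF z(1)] \<delta>c[OF z(2)]
  have add: "\<delta> s ((z \<otimes>\<^bsub>pairs U\<^esub> z') (s, b)) = \<delta> s (z (s, b)) \<oplus>\<^bsub>M\<^esub> \<delta> s (z' (s, b))" if "s \<in> active U" for s b
    using additive_onD(2)[OF \<delta>[OF that] pairs_app(1)[OF U z(1) that] pairs_app(1)[OF U z(2) that]] that
    by (simp add: pairs_simps(2))
  have "twisted_sum M U \<delta> (z \<otimes>\<^bsub>pairs U\<^esub> z') = (\<Oplus>\<^bsub>M\<^esub>s\<in>active U.
      (\<delta> s (z (s, False)) \<oplus>\<^bsub>M\<^esub> (\<ominus>\<^bsub>M\<^esub> (s \<bullet>\<^bsub>M\<^esub> \<delta> s (z (s, True))))) \<oplus>\<^bsub>M\<^esub>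
      (\<delta> s (z' (s, False)) \<oplus>\<^bsub>M\<^esub> (\<ominus>\<^bsub>M\<^esub> (s \<bullet>\<^bsub>M\<^esub> \<delta> s (z' (s, True))))))"
    unfolding twisted_sum_def using c by (intro M.M.finsum_cong') (auto simp: add M.gact_add M.M.minus_add M.M.a_ac)
  also have "\<dots> = twisted_sum M U \<delta> z \<oplus>\<^bsub>M\<^esub> twisted_sum M U \<delta> z'"
    unfolding twisted_sum_def using c by (intro M.M.finsum_addf) auto
  finally show "twisted_sum M U \<delta> (z \<otimes>\<^bsub>pairs U\<^esub> z') = twisted_sum M U \<delta> z \<oplus>\<^bsub>M\<^esub> twisted_sum M U \<delta> z'" .
qed

lemma source_sum_hom:
  assumes M: "left_module kG M" and U: "fsub U" and e: "\<And>s. s \<in> active U \<Longrightarrow> additive_on V M (shift_dom U s) (e s)"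
  shows "z \<in> carrier (pairs U) \<Longrightarrow> source_sum M U e z \<in> carrier M"
    "z \<in> carrier (pairs U) \<Longrightarrow> z' \<in> carrier (pairs U) \<Longrightarrow>
      source_sum M U e (z \<otimes>\<^bsub>pairs U\<^esub> z') = source_sum M U e z \<oplus>\<^bsub>M\<^esub> source_sum M U e z'"
proof -
  interpret M: kG_module G k n M by (rule kG_moduleI[OF M])
  have ec: "e s (z (s, b)) \<in> carrier M" if "z \<in> carrier (pairs U)" "s \<in> active U" for z s b
    using additive_onD(1)[OF e pairs_app(1)[OF U]] that by blast
  show "z \<in> carrier (pairs U) \<Longrightarrow> source_sum M U e z \<in> carrier M"
    unfolding source_sum_def using ec by (intro M.M.finsum_closed) auto
  assume z: "z \<in> carrier (pairs U)" "z' \<in> carrier (pairs U)"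
  note c = ec[OF z(1)] ec[OF z(2)]
  have add: "e s ((z \<otimes>\<^bsub>pairs U\<^esub> z') (s, b)) = e s (z (s, b)) \<oplus>\<^bsub>M\<^esub> e s (z' (s, b))" if "s \<in> active U" for s b
    using additive_onD(2)[OF e[OF that] pairs_app(1)[OF U z(1) that] pairs_app(1)[OF U z(2) that]] that
    by (simp add: pairs_simps(2))
  have "source_sum M U e (z \<otimes>\<^bsub>pairs U\<^esub> z') = (\<Oplus>\<^bsub>M\<^esub>s\<in>active U. e s (z (s, True)) \<oplus>\<^bsub>M\<^esub> e s (z' (s, True)))"
    unfolding source_sum_def using c by (intro M.M.finsum_cong') (auto simp: add)
  also have "\<dots> = source_sum M U e z \<oplus>\<^bsub>M\<^esub> source_sum M U e z'"
    unfolding source_sum_def using c by (intro M.M.finsum_addf) auto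
  finally show "source_sum M U e (z \<otimes>\<^bsub>pairs U\<^esub> z') = source_sum M U e z \<oplus>\<^bsub>M\<^esub> source_sum M U e z'" .
qed

lemma twisted_sum_update:
  assumes M: "left_module kG M" and U: "fsub U" and \<delta>: "\<And>s. s \<in> active U \<Longrightarrow> additive_on V M (shift_dom U s) (\<delta> s)"
    and s0: "s0 \<in> active U" and \<epsilon>: "additive_on V M (shift_dom U s0) \<epsilon>" and z: "z \<in> carrier (pairs U)"
  shows "twisted_sum M U (\<delta>(s0 := \<lambda>u. \<epsilon> u \<oplus>\<^bsub>M\<^esub> \<delta> s0 u)) z =
    (\<epsilon> (z (s0, False)) \<oplus>\<^bsub>M\<^esub> (\<ominus>\<^bsub>M\<^esub> (s0 \<bullet>\<^bsub>M\<^esub> \<epsilon> (z (s0, True))))) \<oplus>\<^bsub>M\<^esub> twisted_sum M U \<delta> z"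
proof -
  interpret M: kG_module G k n M by (rule kG_moduleI[OF M])
  have \<delta>c: "\<delta> s (z (s, b)) \<in> carrier M" if "s \<in> active U" for s b
    using additive_onD(1)[OF \<delta>[OF that] pairs_app(1)[OF U z that]] .
  have \<epsilon>c: "\<epsilon> (z (s0, b)) \<in> carrier M" for b using additive_onD(1)[OF \<epsilon> pairs_app(1)[OF U z s0]] .
  let ?c = "\<epsilon> (z (s0, False)) \<oplus>\<^bsub>M\<^esub> (\<ominus>\<^bsub>M\<^esub> (s0 \<bullet>\<^bsub>M\<^esub> \<epsilon> (z (s0, True))))"
  let ?f = "\<lambda>s. \<delta> s (z (s, False)) \<oplus>\<^bsub>M\<^esub> (\<ominus>\<^bsub>M\<^esub> (s \<bullet>\<^bsub>M\<^esub> \<delta> s (z (s, True))))"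
  have "twisted_sum M U (\<delta>(s0 := \<lambda>u. \<epsilon> u \<oplus>\<^bsub>M\<^esub> \<delta> s0 u)) z = (\<Oplus>\<^bsub>M\<^esub>s\<in>active U. if s = s0 then ?c \<oplus>\<^bsub>M\<^esub> ?f s else ?f s)"
    unfolding twisted_sum_def using \<delta>c \<epsilon>c s0 by (intro M.M.finsum_cong') (auto simp: M.gact_add M.M.minus_add M.M.a_ac)
  also have "\<dots> = ?c \<oplus>\<^bsub>M\<^esub> (\<Oplus>\<^bsub>M\<^esub>s\<in>active U. ?f s)"
    using \<delta>c \<epsilon>c by (intro finsum_modify[OF M finite_active[OF U] s0]) auto
  finally show ?thesis by (simp add: twisted_sum_def)
qed

text \<open>
  The map is \<open>\<Psi>\<close> on the values of \<open>z (s, b)\<close> and zero on those of \<open>z (s, b')\<close>; the two prescriptions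
  agree where they overlap because \<open>\<Psi>\<close> vanishes there.
\<close>

lemma separating_map:
  assumes M: "left_module kG M" and U: "fsub U" and s: "s \<in> active U"
    and E: "subgroup E (pairs U)" and \<Psi>: "\<Psi> \<in> hom ((pairs U)\<lparr>carrier := E\<rparr>) (add_monoid M)"
    and van: "\<And>z. z \<in> E \<Longrightarrow> z (s, b) \<in> (\<lambda>z. z (s, b')) ` E \<Longrightarrow> \<Psi> z = \<zero>\<^bsub>M\<^esub>"
  obtains \<epsilon> where "additive_on V M (shift_dom U s) \<epsilon>" "\<And>z. z \<in> E \<Longrightarrow> \<epsilon> (z (s, b)) = \<Psi> z" "\<And>z. z \<in> E \<Longrightarrow> \<epsilon> (z (s, b')) = \<zero>\<^bsub>M\<^esub>"
proof -
  interpret M: kG_module G k n M by (rule kG_moduleI[OF M])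
  interpret P: group "pairs U" by (rule pairs_group[OF U])
  let ?E = "(pairs U)\<lparr>carrier := E\<rparr>"
  interpret E: group ?E using P.subgroup_imp_group[OF E] .
  interpret \<Psi>: group_hom ?E "add_monoid M" \<Psi> using \<Psi> by unfold_locales
  have Ec: "z \<in> carrier (pairs U)" if "z \<in> E" for z using subgroup.mem_carrier[OF E that] .
  have zero: "\<one>\<^bsub>pairs U\<^esub> \<in> E" using subgroup.one_closed[OF E] .
  have zs: "\<one>\<^bsub>pairs U\<^esub> (s, c) = \<zero>\<^bsub>V\<^esub>" for c using s by (simp add: pairs_simps)
  note app = pairs_app[OF U Ec s]
  let ?D = "?E \<times>\<times> ?E"
  let ?L = "\<lambda>(z, z'). z (s, b) \<oplus>\<^bsub>V\<^esub> z' (s, b')"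
  let ?F = "\<lambda>(z, z'). \<Psi> z"
  have \<Psi>c: "\<Psi> z \<in> carrier M" if "z \<in> E" for z using \<Psi>.hom_closed that by simp
  have D: "group ?D" by (intro DirProd_group E.group_axioms)
  have L: "?L \<in> hom ?D (add_monoid V)"
    using app(4) s by (auto simp: hom_def DirProd_def pairs_simps(2) V.M.a_ac)
  have F: "?F \<in> hom ?D (add_monoid M)"
    using \<Psi> by (auto simp: hom_def DirProd_def)
  have neg: "\<exists>y\<in>E. \<ominus>\<^bsub>V\<^esub> z (s, b') = y (s, b')" if z: "z \<in> E" for z
  proof (rule bexI)
    have i: "inv\<^bsub>pairs U\<^esub> z \<in> E" using subgroup.m_inv_closed[OF E z] .
    show "inv\<^bsub>pairs U\<^esub> z \<in> E" by (rule i)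
    have "(inv\<^bsub>pairs U\<^esub> z \<otimes>\<^bsub>pairs U\<^esub> z) (s, b') = \<zero>\<^bsub>V\<^esub>" using Ec[OF z] zs by simp
    then have "(inv\<^bsub>pairs U\<^esub> z) (s, b') \<oplus>\<^bsub>V\<^esub> z (s, b') = \<zero>\<^bsub>V\<^esub>" using s by (simp add: pairs_simps(2))
    then show "\<ominus>\<^bsub>V\<^esub> z (s, b') = (inv\<^bsub>pairs U\<^esub> z) (s, b')"
      using app(4)[OF i] app(4)[OF z] by (intro V.M.minus_equality) auto
  qed
  have "?F zz = \<zero>\<^bsub>M\<^esub>" if zz: "zz \<in> carrier ?D" "?L zz = \<zero>\<^bsub>V\<^esub>" for zz
  proof -
    obtain z z' where z: "zz = (z, z')" "z \<in> E" "z' \<in> E" using zz(1) by (auto simp: DirProd_def)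
    have "z (s, b) = \<ominus>\<^bsub>V\<^esub> z' (s, b')"
      using zz(2) z app(4)[OF z(2)] app(4)[OF z(3)] by (intro V.M.minus_equality[symmetric]) auto
    then have "z (s, b) \<in> (\<lambda>z. z (s, b')) ` E" using neg[OF z(3)] by auto
    then show ?thesis using van[OF z(2)] z(1) by simp
  qed
  moreover have "?L ` carrier ?D \<subseteq> shift_dom U s"
    using app(1) fsubD(6)[OF shift_dom_fsub[OF U]] by (auto simp: DirProd_def)
  ultimately obtain \<epsilon> where \<epsilon>: "additive_on V M (shift_dom U s) \<epsilon>" "\<And>zz. zz \<in> carrier ?D \<Longrightarrow> \<epsilon> (?L zz) = ?F zz"
    using factor_through[OF M D L F _ shift_dom_fsub[OF U]] by blast
  show ?thesis
  proof (rule that[OF \<epsilon>(1)])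
    fix z assume z: "z \<in> E"
    show "\<epsilon> (z (s, b)) = \<Psi> z" using \<epsilon>(2)[of "(z, \<one>\<^bsub>pairs U\<^esub>)"] z zero zs app(4)[OF z] by (simp add: DirProd_def)
    have "\<Psi> \<one>\<^bsub>pairs U\<^esub> = \<zero>\<^bsub>M\<^esub>" using \<Psi>.hom_one by simp
    then show "\<epsilon> (z (s, b')) = \<zero>\<^bsub>M\<^esub>" using \<epsilon>(2)[of "(\<one>\<^bsub>pairs U\<^esub>, z)"] z zero zs app(4)[OF z] by (simp add: DirProd_def)
  qed
qed

text \<open>
  For the pair \<open>(x, y)\<close> stored in \<open>z\<close> the condition reads \<open>\<Sum>\<^sub>s s x s = \<Sum>\<^sub>s y s\<close>.
\<close>

definition relations :: "('g set \<Rightarrow> 'g set \<Rightarrow> 'r) set \<Rightarrow> ('g \<times> bool \<Rightarrow> ('g set \<Rightarrow> 'g set \<Rightarrow> 'r)) set"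
  where "relations U = {z \<in> carrier (pairs U). twisted_sum V U (\<lambda>s u. u) z = \<zero>\<^bsub>V\<^esub>}"

text \<open>
  By \<open>balanced_homs\<close> there are permutations \<open>\<sigma> s\<close> of \<open>E\<close> such that the component \<open>y s\<close> of an
  element is the component \<open>x s\<close> of its image.  The elements of \<open>E\<close> then form a periodic family of relations, to which
  \<open>no_finite_relations\<close> applies.
\<close>

lemma balanced_relations_trivial:
  assumes U: "fsub U" and E: "subgroup E (pairs U)" "E \<subseteq> relations U"
    and bal: "\<And>s. s \<in> active U \<Longrightarrow> (\<lambda>z. z (s, True)) ` E = (\<lambda>z. z (s, False)) ` E"
    and z: "z \<in> E"
  shows "z = \<one>\<^bsub>pairs U\<^esub>"
proof -
  interpret P: group "pairs U" by (rule pairs_group[OF U])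
  let ?E = "(pairs U)\<lparr>carrier := E\<rparr>"
  interpret E: group ?E using P.subgroup_imp_group[OF E(1)] .
  have Ec: "E \<subseteq> carrier (pairs U)" using subgroup.subset[OF E(1)] .
  have fin: "finite E" using finite_subset[OF Ec pairs_finite[OF U]] .
  have grpV: "group (add_monoid V)" by (rule V.M.a_group)
  have "\<exists>\<sigma>. bij_betw \<sigma> E E \<and> (\<forall>z\<in>E. (\<sigma> z) (s, True) = z (s, False))" if s: "s \<in> active U" for s
    using E.balanced_homs[OF _ grpV pairs_eval_hom[OF U s Ec] pairs_eval_hom[OF U s Ec], of True False] fin bal[OF s]
    by (metis (no_types, lifting) partial_object.select_convs(1) partial_object.surjective partial_object.update_convs(1))
  then obtain \<sigma>' where \<sigma>': "\<And>s. s \<in> active U \<Longrightarrow> bij_betw (\<sigma>' s) E E"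
    "\<And>s z. s \<in> active U \<Longrightarrow> z \<in> E \<Longrightarrow> (\<sigma>' s z) (s, True) = z (s, False)" by metis
  define \<sigma> where "\<sigma> s = (if s \<in> active U then \<sigma>' s else id)" for s
  have \<sigma>: "bij_betw (\<sigma> s) E E" for s using \<sigma>'(1) by (simp add: \<sigma>_def)
  have app: "y (s, c) \<in> VH" "y (s, c) \<in> carrier V" if "s \<in> active U" "y \<in> E" for s y c
    using pairs_app(3,4)[OF U _ that(1)] that(2) Ec by auto
  have rel: "(\<Oplus>\<^bsub>V\<^esub>s\<in>active U. s \<bullet>\<^bsub>V\<^esub> y (s, True)) = (\<Oplus>\<^bsub>V\<^esub>s\<in>active U. (\<sigma> s y) (s, True))" if y: "y \<in> E" for y
  proof -
    let ?a = "\<lambda>s. s \<bullet>\<^bsub>V\<^esub> y (s, True)" and ?b = "\<lambda>s. y (s, False)"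
    have "(\<Oplus>\<^bsub>V\<^esub>s\<in>active U. ?b s) = (\<Oplus>\<^bsub>V\<^esub>s\<in>active U. (?b s \<oplus>\<^bsub>V\<^esub> (\<ominus>\<^bsub>V\<^esub> ?a s)) \<oplus>\<^bsub>V\<^esub> ?a s)"
      using app(2)[OF _ y] by (intro V.M.finsum_cong') (auto simp: V.M.a_assoc V.M.l_neg)
    also have "\<dots> = (\<Oplus>\<^bsub>V\<^esub>s\<in>active U. ?b s \<oplus>\<^bsub>V\<^esub> (\<ominus>\<^bsub>V\<^esub> ?a s)) \<oplus>\<^bsub>V\<^esub> (\<Oplus>\<^bsub>V\<^esub>s\<in>active U. ?a s)"
      using app(2)[OF _ y] by (intro V.M.finsum_addf) auto
    also have "(\<Oplus>\<^bsub>V\<^esub>s\<in>active U. ?b s \<oplus>\<^bsub>V\<^esub> (\<ominus>\<^bsub>V\<^esub> ?a s)) = \<zero>\<^bsub>V\<^esub>"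
      using y E(2) by (auto simp: relations_def twisted_sum_def)
    also have "\<zero>\<^bsub>V\<^esub> \<oplus>\<^bsub>V\<^esub> (\<Oplus>\<^bsub>V\<^esub>s\<in>active U. ?a s) = (\<Oplus>\<^bsub>V\<^esub>s\<in>active U. ?a s)"
      using app(2)[OF _ y] by (intro V.M.l_zero V.M.finsum_closed) auto
    finally have "(\<Oplus>\<^bsub>V\<^esub>s\<in>active U. ?a s) = (\<Oplus>\<^bsub>V\<^esub>s\<in>active U. ?b s)" by simp
    also have "\<dots> = (\<Oplus>\<^bsub>V\<^esub>s\<in>active U. (\<sigma> s y) (s, True))"
      using \<sigma>'(2)[OF _ y] app(2)[OF _ y] by (intro V.M.finsum_cong') (auto simp: \<sigma>_def)
    finally show ?thesis .
  qed
  have T: "y (s, True) = \<zero>\<^bsub>V\<^esub>" if "s \<in> active U" "y \<in> E" for s y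
    by (rule no_finite_relations[where Y = E and \<sigma> = \<sigma> and b = "\<lambda>s y. y (s, True)" and S' = "active U", OF fin])
      (rule \<sigma> finite_active[OF U] active_sub that rel app(1) | assumption)+
  have F: "y (s, False) = \<zero>\<^bsub>V\<^esub>" if s: "s \<in> active U" and y: "y \<in> E" for s y
    using \<sigma>'(2)[OF s y] T[OF s, of "\<sigma>' s y"] bij_betwE[OF \<sigma>'(1)[OF s]] y by auto
  have zi: "z i = \<zero>\<^bsub>V\<^esub>" if i: "i \<in> active U \<times> UNIV" for i
  proof -
    obtain s c where "i = (s, c)" "s \<in> active U" using i by auto
    then show ?thesis using T[OF _ z] F[OF _ z] by (cases c) auto
  qed
  have "z \<in> extensional (active U \<times> UNIV)" using z Ec by (auto simp: pairs_simps PiE_iff)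
  then show ?thesis using zi unfolding pairs_simps(3) by (auto simp: extensional_def fun_eq_iff)
qed

lemma pairs_inv_app:
  assumes U: "fsub U" and z: "z \<in> carrier (pairs U)" and s: "s \<in> active U"
  shows "(inv\<^bsub>pairs U\<^esub> z) (s, b) = \<ominus>\<^bsub>V\<^esub> z (s, b)"
proof -
  interpret P: group "pairs U" by (rule pairs_group[OF U])
  have "(inv\<^bsub>pairs U\<^esub> z \<otimes>\<^bsub>pairs U\<^esub> z) (s, b) = \<zero>\<^bsub>V\<^esub>" using z s by (simp add: pairs_simps(3))
  then have "(inv\<^bsub>pairs U\<^esub> z) (s, b) \<oplus>\<^bsub>V\<^esub> z (s, b) = \<zero>\<^bsub>V\<^esub>" using s by (simp add: pairs_simps(2))
  then show ?thesis
    using pairs_app(4)[OF U z s] pairs_app(4)[OF U P.inv_closed[OF z] s]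
    by (intro V.M.minus_equality[symmetric]) auto
qed

lemma overlap_subgroup:
  assumes U: "fsub U" and s: "s \<in> active U" and E: "subgroup E (pairs U)"
  shows "subgroup {z \<in> E. z (s, b) \<in> (\<lambda>z. z (s, b')) ` E} (pairs U)"
proof -
  interpret P: group "pairs U" by (rule pairs_group[OF U])
  let ?E' = "{z \<in> E. z (s, b) \<in> (\<lambda>z. z (s, b')) ` E}"
  have Ec: "z \<in> carrier (pairs U)" if "z \<in> E" for z using subgroup.mem_carrier[OF E that] .
  show ?thesis
  proof (rule P.subgroupI)
    show "?E' \<subseteq> carrier (pairs U)" using Ec by auto
    have "\<one>\<^bsub>pairs U\<^esub> (s, b) = \<one>\<^bsub>pairs U\<^esub> (s, b')" using s by (simp add: pairs_simps)
    then have "\<one>\<^bsub>pairs U\<^esub> \<in> ?E'" using subgroup.one_closed[OF E] by auto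
    then show "?E' \<noteq> {}" by blast
  next
    fix z assume "z \<in> ?E'"
    then obtain w where z: "z \<in> E" "w \<in> E" "z (s, b) = w (s, b')" by auto
    have "(inv\<^bsub>pairs U\<^esub> z) (s, b) = (inv\<^bsub>pairs U\<^esub> w) (s, b')"
      using z pairs_inv_app[OF U Ec s] by simp
    then show "inv\<^bsub>pairs U\<^esub> z \<in> ?E'" using subgroup.m_inv_closed[OF E] z by auto
    fix z' assume "z' \<in> ?E'"
    then obtain w' where z': "z' \<in> E" "w' \<in> E" "z' (s, b) = w' (s, b')" by auto
    have "(z \<otimes>\<^bsub>pairs U\<^esub> z') (s, b) = (w \<otimes>\<^bsub>pairs U\<^esub> w') (s, b')"
      using z z' s by (simp add: pairs_simps(2))
    then show "z \<otimes>\<^bsub>pairs U\<^esub> z' \<in> ?E'" using subgroup.m_closed[OF E] z z' by auto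
  qed
qed

text \<open>
  If the components \<open>x s\<close> and \<open>y s\<close> of \<open>E\<close> fill the same group for every \<open>s\<close>, then \<open>E\<close> is trivial.
  Otherwise, for some \<open>s\<close>, the elements whose component of one kind is the component of the other kind of some
  element of \<open>E\<close> form a proper subgroup.  There the functional has the required form by induction, and the remainder, which vanishes on
  this subgroup, is absorbed by changing \<open>\<delta> s\<close> alone.
\<close>

lemma relation_functionals:
  fixes M :: "('g \<Rightarrow> 'r, 'm, 'd) module_scheme"
  assumes M: "left_module kG M" and U: "fsub U"
  shows "subgroup E (pairs U) \<Longrightarrow> E \<subseteq> relations U \<Longrightarrow> \<Phi> \<in> hom ((pairs U)\<lparr>carrier := E\<rparr>) (add_monoid M) \<Longrightarrow>
    \<exists>\<delta>. (\<forall>s\<in>active U. additive_on V M (shift_dom U s) (\<delta> s)) \<and> (\<forall>z\<in>E. \<Phi> z = twisted_sum M U \<delta> z)"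
proof (induction "card E" arbitrary: E \<Phi> rule: less_induct)
  case (less E \<Phi>)
  interpret M: kG_module G k n M by (rule kG_moduleI[OF M])
  interpret P: group "pairs U" by (rule pairs_group[OF U])
  note E = less.prems(1,2) and \<Phi> = less.prems(3)
  let ?E = "(pairs U)\<lparr>carrier := E\<rparr>"
  interpret E: group ?E using P.subgroup_imp_group[OF E(1)] .
  interpret \<Phi>: group_hom ?E "add_monoid M" \<Phi> using \<Phi> by unfold_locales
  have Ec: "z \<in> carrier (pairs U)" if "z \<in> E" for z using subgroup.mem_carrier[OF E(1) that] .
  have finE: "finite E" using finite_subset[OF subgroup.subset[OF E(1)] pairs_finite[OF U]] .
  have \<Phi>c: "\<Phi> z \<in> carrier M" if "z \<in> E" for z using \<Phi>.hom_closed that by simp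
  have \<Phi>add: "\<Phi> (z \<otimes>\<^bsub>pairs U\<^esub> z') = \<Phi> z \<oplus>\<^bsub>M\<^esub> \<Phi> z'" if "z \<in> E" "z' \<in> E" for z z' using \<Phi>.hom_mult that by simp
  show ?case
  proof (cases "\<forall>s\<in>active U. (\<lambda>z. z (s, True)) ` E = (\<lambda>z. z (s, False)) ` E")
    case True
    then have triv: "z = \<one>\<^bsub>pairs U\<^esub>" if "z \<in> E" for z
      using balanced_relations_trivial[OF U E _ that] by blast
    have "\<Phi> \<one>\<^bsub>pairs U\<^esub> = \<zero>\<^bsub>M\<^esub>" using \<Phi>.hom_one by simp
    moreover have "twisted_sum M U (\<lambda>_ _. \<zero>\<^bsub>M\<^esub>) z = \<zero>\<^bsub>M\<^esub>" for z
      unfolding twisted_sum_def by (intro M.M.add.finprod_one_eqI) (simp add: M.M.r_neg)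
    ultimately have "\<Phi> z = twisted_sum M U (\<lambda>_ _. \<zero>\<^bsub>M\<^esub>) z" if "z \<in> E" for z
      unfolding triv[OF that] by simp
    moreover have "additive_on V M (shift_dom U s) (\<lambda>_. \<zero>\<^bsub>M\<^esub>)" for s by (simp add: additive_on_def)
    ultimately show ?thesis by (intro exI[of _ "\<lambda>_ _. \<zero>\<^bsub>M\<^esub>"] conjI ballI)
  next
    case False
    then obtain s where s: "s \<in> active U" "(\<lambda>z. z (s, True)) ` E \<noteq> (\<lambda>z. z (s, False)) ` E" by blast
    obtain b where b: "\<not> (\<lambda>z. z (s, b)) ` E \<subseteq> (\<lambda>z. z (s, \<not> b)) ` E"
    proof (cases "(\<lambda>z. z (s, True)) ` E \<subseteq> (\<lambda>z. z (s, False)) ` E")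
      case True
      then have "\<not> (\<lambda>z. z (s, False)) ` E \<subseteq> (\<lambda>z. z (s, \<not> False)) ` E" using s(2) by (simp add: subset_antisym)
      then show ?thesis by (rule that)
    next
      case False
      then have "\<not> (\<lambda>z. z (s, True)) ` E \<subseteq> (\<lambda>z. z (s, \<not> True)) ` E" by simp
      then show ?thesis by (rule that)
    qed
    define E' where "E' = {z \<in> E. z (s, b) \<in> (\<lambda>z. z (s, \<not> b)) ` E}"
    obtain z0 where z0: "z0 \<in> E" "z0 (s, b) \<notin> (\<lambda>z. z (s, \<not> b)) ` E"
      using b by (auto simp del: image_iff simp: image_subset_iff)
    have "E' \<subseteq> E" by (simp add: E'_def)
    moreover have "z0 \<notin> E'" using z0(2) by (simp add: E'_def)
    ultimately have sub: "E' \<subset> E" using z0(1) by (metis psubsetI)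
    have E': "subgroup E' (pairs U)" unfolding E'_def by (rule overlap_subgroup[OF U s(1) E(1)])
    have "\<Phi> \<in> hom ((pairs U)\<lparr>carrier := E'\<rparr>) (add_monoid M)" using \<Phi>c \<Phi>add sub by (auto simp: hom_def)
    moreover have "E' \<subseteq> relations U" using sub E(2) by blast
    ultimately have "\<exists>\<delta>. (\<forall>s\<in>active U. additive_on V M (shift_dom U s) (\<delta> s)) \<and> (\<forall>z\<in>E'. \<Phi> z = twisted_sum M U \<delta> z)"
      by (intro less.hyps[OF psubset_card_mono[OF finE sub] E'])
    then obtain \<delta> where \<delta>: "\<And>s. s \<in> active U \<Longrightarrow> additive_on V M (shift_dom U s) (\<delta> s)" "\<And>z. z \<in> E' \<Longrightarrow> \<Phi> z = twisted_sum M U \<delta> z"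
      by (elim exE conjE) (use that in blast)
    note rs = twisted_sum_hom[OF M U \<delta>(1)]
    define \<Psi> where "\<Psi> z = \<Phi> z \<oplus>\<^bsub>M\<^esub> (\<ominus>\<^bsub>M\<^esub> twisted_sum M U \<delta> z)" for z
    have \<Psi>c: "\<Psi> z \<in> carrier M" if "z \<in> E" for z using \<Phi>c[OF that] rs(1)[OF _ Ec[OF that]] by (simp add: \<Psi>_def)
    have \<Psi>: "\<Psi> \<in> hom ?E (add_monoid M)"
    proof -
      have "\<Psi> (z \<otimes>\<^bsub>pairs U\<^esub> z') = \<Psi> z \<oplus>\<^bsub>M\<^esub> \<Psi> z'" if z: "z \<in> E" "z' \<in> E" for z z'
        using \<Phi>add[OF z] rs(2)[OF _ Ec[OF z(1)] Ec[OF z(2)]] rs(1)[OF _ Ec[OF z(1)]] rs(1)[OF _ Ec[OF z(2)]] \<Phi>c[OF z(1)] \<Phi>c[OF z(2)]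
        by (simp add: \<Psi>_def M.M.minus_add M.M.a_ac)
      then show ?thesis using \<Psi>c by (auto simp: hom_def)
    qed
    have van: "\<Psi> z = \<zero>\<^bsub>M\<^esub>" if "z \<in> E" "z (s, b) \<in> (\<lambda>z. z (s, \<not> b)) ` E" for z
    proof -
      have "z \<in> E'" using that by (simp add: E'_def)
      then show ?thesis using \<delta>(2) rs(1)[OF _ Ec[OF that(1)]] by (simp add: \<Psi>_def M.M.r_neg)
    qed
    obtain \<epsilon> where \<epsilon>: "additive_on V M (shift_dom U s) \<epsilon>" "\<And>z. z \<in> E \<Longrightarrow> \<epsilon> (z (s, b)) = \<Psi> z"
      "\<And>z. z \<in> E \<Longrightarrow> \<epsilon> (z (s, \<not> b)) = \<zero>\<^bsub>M\<^esub>"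
      by (rule separating_map[OF M U s(1) E(1) \<Psi>, of b "\<not> b"]) (rule van, assumption+, rule that)
    note \<epsilon>D = additive_onD[OF \<epsilon>(1)]
    have sG: "s \<in> carrier G" using H_G[OF S_H] active_sub s(1) by blast
    \<comment> \<open>\<open>\<delta> s\<close> enters as \<open>\<delta> s (y s) - s \<delta> s (x s)\<close>; if the component \<open>x s\<close> is used, the factor \<open>- s\<close> has to be undone\<close>
    define \<epsilon>' where "\<epsilon>' = (if b then \<lambda>u. \<ominus>\<^bsub>M\<^esub> (inv s \<bullet>\<^bsub>M\<^esub> \<epsilon> u) else \<epsilon>)"
    have \<epsilon>': "additive_on V M (shift_dom U s) \<epsilon>'"
      using \<epsilon>(1) \<epsilon>D by (auto simp: \<epsilon>'_def additive_on_def M.gact_add M.M.minus_add M.M.a_ac)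
    have val: "\<epsilon>' (z (s, False)) \<oplus>\<^bsub>M\<^esub> (\<ominus>\<^bsub>M\<^esub> (s \<bullet>\<^bsub>M\<^esub> \<epsilon>' (z (s, True)))) = \<Psi> z" if z: "z \<in> E" for z
    proof -
      have z0: "\<ominus>\<^bsub>M\<^esub> \<zero>\<^bsub>M\<^esub> = \<zero>\<^bsub>M\<^esub>" by (rule M.M.minus_equality) auto
      show ?thesis
        using \<epsilon>(2)[OF z] \<epsilon>(3)[OF z] \<Psi>c[OF z] sG by (cases b) (simp_all add: \<epsilon>'_def z0 M.gact_neg)
    qed
    let ?\<delta> = "\<delta>(s := \<lambda>u. \<epsilon>' u \<oplus>\<^bsub>M\<^esub> \<delta> s u)"
    have "\<Phi> z = twisted_sum M U ?\<delta> z" if z: "z \<in> E" for z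
    proof -
      have "twisted_sum M U ?\<delta> z = \<Psi> z \<oplus>\<^bsub>M\<^esub> twisted_sum M U \<delta> z"
        using twisted_sum_update[OF M U \<delta>(1) s(1) \<epsilon>' Ec[OF z]] val[OF z] by simp
      also have "\<dots> = \<Phi> z"
        using \<Phi>c[OF z] rs(1)[OF _ Ec[OF z]] by (simp add: \<Psi>_def M.M.a_assoc M.M.l_neg)
      finally show ?thesis by simp
    qed
    moreover have "additive_on V M (shift_dom U r) (?\<delta> r)" if r: "r \<in> active U" for r
    proof (cases "r = s")
      case True
      have "additive_on V M (shift_dom U s) (\<lambda>u. \<epsilon>' u \<oplus>\<^bsub>M\<^esub> \<delta> s u)"
        using \<epsilon>' \<delta>(1)[OF s(1)] additive_onD[OF \<epsilon>'] additive_onD[OF \<delta>(1)[OF s(1)]]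
        by (auto simp: additive_on_def M.M.a_ac)
      then show ?thesis using True by simp
    qed (use \<delta>(1)[OF r] in simp)
    ultimately show ?thesis by (intro exI[of _ ?\<delta>] conjI ballI)
  qed
qed

lemma entry_sums:
  assumes M: "left_module kG M" and U: "fsub U" and \<delta>: "\<And>s. s \<in> active U \<Longrightarrow> additive_on V M (shift_dom U s) (\<delta> s)"
    and s: "s \<in> active U" and u: "u \<in> shift_dom U s"
  defines "entry b \<equiv> (\<lambda>i\<in>active U \<times> UNIV. if i = (s, b) then u else \<zero>\<^bsub>V\<^esub>)"
  shows "entry b \<in> carrier (pairs U)"
    "twisted_sum M U \<delta> (entry False) = \<delta> s u" "twisted_sum M U \<delta> (entry True) = \<ominus>\<^bsub>M\<^esub> (s \<bullet>\<^bsub>M\<^esub> \<delta> s u)"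
    "source_sum M U \<delta> (entry False) = \<zero>\<^bsub>M\<^esub>" "source_sum M U \<delta> (entry True) = \<delta> s u"
proof -
  interpret M: kG_module G k n M by (rule kG_moduleI[OF M])
  show "entry b \<in> carrier (pairs U)"
    using u fsubD(5)[OF shift_dom_fsub[OF U]] by (auto simp: pairs_simps entry_def)
  have d0: "\<delta> r \<zero>\<^bsub>V\<^esub> = \<zero>\<^bsub>M\<^esub>" if "r \<in> active U" for r
    using additive_on_zero[OF left_module_V M \<delta>[OF that] fsubD(1)[OF shift_dom_fsub[OF U]]] .
  have du: "\<delta> s u \<in> carrier M" using additive_onD(1)[OF \<delta>[OF s] u] .
  have z0: "\<ominus>\<^bsub>M\<^esub> \<zero>\<^bsub>M\<^esub> = \<zero>\<^bsub>M\<^esub>" by (rule M.M.minus_equality) auto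
  note fin = finite_active[OF U]
  have sing: "(\<Oplus>\<^bsub>M\<^esub>r\<in>active U. if s = r then c else \<zero>\<^bsub>M\<^esub>) = c" if "c \<in> carrier M" for c
    using s fin that by (intro M.M.finsum_singleton) auto
  have "twisted_sum M U \<delta> (entry False) = (\<Oplus>\<^bsub>M\<^esub>r\<in>active U. if s = r then \<delta> s u else \<zero>\<^bsub>M\<^esub>)"
    unfolding twisted_sum_def entry_def using d0 du z0 by (intro M.M.finsum_cong') auto
  then show "twisted_sum M U \<delta> (entry False) = \<delta> s u" using sing du by simp
  have "twisted_sum M U \<delta> (entry True) = (\<Oplus>\<^bsub>M\<^esub>r\<in>active U. if s = r then \<ominus>\<^bsub>M\<^esub> (s \<bullet>\<^bsub>M\<^esub> \<delta> s u) else \<zero>\<^bsub>M\<^esub>)"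
    unfolding twisted_sum_def entry_def using d0 du z0 by (intro M.M.finsum_cong') auto
  then show "twisted_sum M U \<delta> (entry True) = \<ominus>\<^bsub>M\<^esub> (s \<bullet>\<^bsub>M\<^esub> \<delta> s u)" using sing du by simp
  show "source_sum M U \<delta> (entry False) = \<zero>\<^bsub>M\<^esub>"
    unfolding source_sum_def entry_def using d0 by (intro M.M.add.finprod_one_eqI) simp
  have "source_sum M U \<delta> (entry True) = (\<Oplus>\<^bsub>M\<^esub>r\<in>active U. if s = r then \<delta> s u else \<zero>\<^bsub>M\<^esub>)"
    unfolding source_sum_def entry_def using d0 du by (intro M.M.finsum_cong') auto
  then show "source_sum M U \<delta> (entry True) = \<delta> s u" using sing du by simp
qed

text \<open>
  The family \<open>e\<close> defines a functional on pairs, namely \<open>\<Sum>\<^sub>s e s (x s)\<close>.  By \<open>relation_functionals\<close> it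
  agrees on relations with the functional given by some \<open>\<delta>\<close>, so the difference of the two factors
  through \<open>(x, y) \<mapsto> \<Sum>\<^sub>s (y s - s x s)\<close>, that is, through a map \<open>c\<close> on \<open>U\<close>.  Evaluation at pairs with a
  single nonzero entry shows that \<open>c\<close> extends every \<open>\<delta> s\<close> and has the required values on products.
\<close>

theorem cocycle_is_coboundary:
  assumes M: "left_module kG M" and U: "fsub U" and e: "\<And>s. s \<in> S \<Longrightarrow> additive_on V M (shift_dom U s) (e s)"
  obtains c where "additive_on V M U c"
    "\<And>s u. s \<in> S \<Longrightarrow> u \<in> shift_dom U s \<Longrightarrow> c (s \<bullet>\<^bsub>V\<^esub> u) = e s u \<oplus>\<^bsub>M\<^esub> s \<bullet>\<^bsub>M\<^esub> c u"
proof -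
  interpret M: kG_module G k n M by (rule kG_moduleI[OF M])
  interpret P: group "pairs U" by (rule pairs_group[OF U])
  have eA: "additive_on V M (shift_dom U s) (e s)" if "s \<in> active U" for s using e that active_sub by blast
  have idA: "additive_on V V (shift_dom U s) (\<lambda>u. u)" for s
    using fsubD(4)[OF shift_dom_fsub[OF U]] by (auto simp: additive_on_def)
  let ?L = "twisted_sum V U (\<lambda>s u. u)"
  note L = twisted_sum_hom[OF left_module_V U idA] and es = source_sum_hom[OF M U eA]
  have Lhom: "?L \<in> hom (pairs U) (add_monoid V)" using L by (auto simp: hom_def)
  interpret L: group_hom "pairs U" "add_monoid V" ?L using Lhom V.M.a_group by unfold_locales
  have R: "subgroup (relations U) (pairs U)"
    using L.subgroup_kernel by (simp add: kernel_def relations_def)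
  have Rc: "z \<in> carrier (pairs U)" if "z \<in> relations U" for z using that by (simp add: relations_def)
  have "source_sum M U e \<in> hom ((pairs U)\<lparr>carrier := relations U\<rparr>) (add_monoid M)"
    using es Rc by (auto simp: hom_def)
  then obtain \<delta> where \<delta>: "\<And>s. s \<in> active U \<Longrightarrow> additive_on V M (shift_dom U s) (\<delta> s)"
    "\<And>z. z \<in> relations U \<Longrightarrow> source_sum M U e z = twisted_sum M U \<delta> z"
    using relation_functionals[OF M U R subset_refl] by blast
  note rs = twisted_sum_hom[OF M U \<delta>(1)]
  define F where "F z = twisted_sum M U \<delta> z \<oplus>\<^bsub>M\<^esub> (\<ominus>\<^bsub>M\<^esub> source_sum M U e z)" for z
  have "F (z \<otimes>\<^bsub>pairs U\<^esub> z') = F z \<oplus>\<^bsub>M\<^esub> F z'" if "z \<in> carrier (pairs U)" "z' \<in> carrier (pairs U)" for z z'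
    using that rs es by (simp add: F_def M.M.minus_add M.M.a_ac)
  then have Fhom: "F \<in> hom (pairs U) (add_monoid M)" using rs(1) es(1) by (auto simp: hom_def F_def)
  have ker: "F z = \<zero>\<^bsub>M\<^esub>" if "z \<in> carrier (pairs U)" "?L z = \<zero>\<^bsub>V\<^esub>" for z
    using that \<delta>(2)[of z] rs(1) by (simp add: F_def relations_def M.M.r_neg)
  have im: "?L ` carrier (pairs U) \<subseteq> U"
  proof (rule image_subsetI)
    fix z assume z: "z \<in> carrier (pairs U)"
    show "?L z \<in> U"
      unfolding twisted_sum_def using pairs_app[OF U z] fsubD(6,7)[OF U]
      by (intro V.asub_finsum[OF fsubD(1)[OF U] finite_active[OF U]]) auto
  qed
  obtain c where c: "additive_on V M U c" "\<And>z. z \<in> carrier (pairs U) \<Longrightarrow> c (?L z) = F z"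
    using factor_through[OF M P.group_axioms Lhom Fhom ker U im] by blast
  note cD = additive_onD[OF c(1)]
  show ?thesis
  proof (rule that[OF c(1)])
    fix s u assume s: "s \<in> S" and u: "u \<in> shift_dom U s"
    have uU: "u \<in> U" "s \<bullet>\<^bsub>V\<^esub> u \<in> U" "u \<in> carrier V" using u fsubD(4)[OF U] by (auto simp: shift_dom_def)
    have z0: "\<ominus>\<^bsub>M\<^esub> \<zero>\<^bsub>M\<^esub> = \<zero>\<^bsub>M\<^esub>" by (rule M.M.minus_equality) auto
    show "c (s \<bullet>\<^bsub>V\<^esub> u) = e s u \<oplus>\<^bsub>M\<^esub> s \<bullet>\<^bsub>M\<^esub> c u"
    proof (cases "s \<in> active U")
      case False
      then have "u = \<zero>\<^bsub>V\<^esub>" using s u by (auto simp: active_def)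
      moreover have "c \<zero>\<^bsub>V\<^esub> = \<zero>\<^bsub>M\<^esub>" using additive_on_zero[OF left_module_V M c(1) fsubD(1)[OF U]] .
      moreover have "e s \<zero>\<^bsub>V\<^esub> = \<zero>\<^bsub>M\<^esub>"
        using additive_on_zero[OF left_module_V M e[OF s] fsubD(1)[OF shift_dom_fsub[OF U]]] .
      ultimately show ?thesis by simp
    next
      case True
      note ent\<delta> = entry_sums[OF M U \<delta>(1) True u]
        and ente = entry_sums[OF M U eA True u] and entL = entry_sums[OF left_module_V U idA True u]
      have \<delta>u: "\<delta> s u \<in> carrier M" "e s u \<in> carrier M"
        using additive_onD(1)[OF \<delta>(1)[OF True] u] additive_onD(1)[OF e[OF s] u] by auto
      have cu: "c u = \<delta> s u"
        using c(2)[OF entL(1), of False] \<delta>u unfolding entL(2) F_def by (simp add: ent\<delta>(2) ente(4) z0)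
      have "c (\<ominus>\<^bsub>V\<^esub> (s \<bullet>\<^bsub>V\<^esub> u)) = \<ominus>\<^bsub>M\<^esub> (s \<bullet>\<^bsub>M\<^esub> \<delta> s u) \<oplus>\<^bsub>M\<^esub> (\<ominus>\<^bsub>M\<^esub> e s u)"
        using c(2)[OF entL(1), of True] unfolding entL(3) F_def by (simp add: ent\<delta>(3) ente(5))
      then have "\<ominus>\<^bsub>M\<^esub> c (s \<bullet>\<^bsub>V\<^esub> u) = \<ominus>\<^bsub>M\<^esub> (e s u \<oplus>\<^bsub>M\<^esub> s \<bullet>\<^bsub>M\<^esub> \<delta> s u)"
        using additive_on_neg[OF left_module_V M c(1) fsubD(1)[OF U] uU(2)] \<delta>u
        by (simp add: M.M.minus_add M.M.a_ac)
      then have "c (s \<bullet>\<^bsub>V\<^esub> u) = e s u \<oplus>\<^bsub>M\<^esub> s \<bullet>\<^bsub>M\<^esub> \<delta> s u"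
        using cD(1)[OF uU(2)] \<delta>u by (metis M.M.a_closed M.M.minus_minus M.gact_closed)
      then show ?thesis unfolding cu .
    qed
  qed
qed

section \<open>Projectivity and the direct union\<close>

lemma kernel_submodule:
  assumes M: "left_module kG M" and N: "left_module kG N" and f: "f \<in> left_module_hom kG M N"
  shows "submodule {x \<in> carrier M. f x = \<zero>\<^bsub>N\<^esub>} kG M"
proof -
  interpret M: kG_module G k n M by (rule kG_moduleI[OF M])
  interpret N: kG_module G k n N by (rule kG_moduleI[OF N])
  have f0: "f \<zero>\<^bsub>M\<^esub> = \<zero>\<^bsub>N\<^esub>" using M.hom_zero[OF N f] .
  show ?thesis
    using f f0 single_closed by (intro M.submoduleI) (auto simp: left_module_hom_def)
qed

text \<open>
  The values of \<open>g\<close> are lifted one by one into a finite subgroup \<open>M1\<close>; projecting along the part of the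
  kernel of \<open>f\<close> in \<open>M1\<close>, which has a complement, makes the choice additive.
\<close>

lemma additive_lift:
  assumes M: "left_module kG M" and N: "left_module kG N" and f: "f \<in> left_module_hom kG M N"
    and onto: "f ` carrier M = carrier N" and U: "fsub U" and g: "additive_on V N U g"
  obtains h where "additive_on V M U h" "\<And>u. u \<in> U \<Longrightarrow> f (h u) = g u"
proof -
  interpret M: kG_module G k n M by (rule kG_moduleI[OF M])
  interpret N: kG_module G k n N by (rule kG_moduleI[OF N])
  have fc: "f x \<in> carrier N" if "x \<in> carrier M" for x using f that by (auto simp: left_module_hom_def)
  have fadd: "f (x \<oplus>\<^bsub>M\<^esub> y) = f x \<oplus>\<^bsub>N\<^esub> f y" if "x \<in> carrier M" "y \<in> carrier M" for x y
    using f that by (auto simp: left_module_hom_def)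
  have fA: "additive_on M N (carrier M) f" using fc fadd by (auto simp: additive_on_def)
  have fneg: "f (\<ominus>\<^bsub>M\<^esub> x) = \<ominus>\<^bsub>N\<^esub> f x" if "x \<in> carrier M" for x
    using additive_on_neg[OF M N fA _ that] M.add.subgroup_self by simp
  note gD = additive_onD[OF g]
  have "\<exists>x\<in>carrier M. f x = g u" if "u \<in> U" for u using onto gD(1)[OF that] by (metis imageE)
  then obtain m where m: "\<And>u. u \<in> U \<Longrightarrow> m u \<in> carrier M" "\<And>u. u \<in> U \<Longrightarrow> f (m u) = g u" by metis
  obtain M1 where M1: "M.asub M1" "finite M1" "m ` U \<subseteq> M1"
    using M.finite_asub_containing[of "m ` U"] fsubD(2)[OF U] m(1) by blast
  note D1 = M.asubD[OF M1(1)]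
  define K where "K = {x \<in> M1. f x = \<zero>\<^bsub>N\<^esub>}"
  have K: "M.asub K"
    using D1 fadd M.hom_zero[OF N f] by (intro M.asubI) (auto simp: K_def)
  obtain r where r: "r \<in> M1 \<rightarrow> K" "additive_on M M M1 r" "\<And>a. a \<in> K \<Longrightarrow> r a = a"
    using M.asub_retraction[OF M1(1,2) K] by (auto simp: K_def)
  have rK: "r x \<in> K" "r x \<in> carrier M" "f (r x) = \<zero>\<^bsub>N\<^esub>" if "x \<in> M1" for x
    using r(1) that D1(2) by (auto simp: K_def)
  \<comment> \<open>the projection along the kernel of \<open>f\<close> in \<open>M1\<close>\<close>
  define p where "p x = x \<oplus>\<^bsub>M\<^esub> (\<ominus>\<^bsub>M\<^esub> r x)" for x
  have padd: "p (x \<oplus>\<^bsub>M\<^esub> y) = p x \<oplus>\<^bsub>M\<^esub> p y" if "x \<in> M1" "y \<in> M1" for x y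
    using that additive_onD(2)[OF r(2) that] rK(2) D1(2) by (simp add: p_def M.M.minus_add M.M.a_ac)
  have pK: "p x = \<zero>\<^bsub>M\<^esub>" if "x \<in> K" for x
    using r(3)[OF that] that D1(2) by (simp add: p_def M.M.r_neg K_def)
  have pc: "p x \<in> carrier M" if "x \<in> M1" for x using that rK(2) D1(2) by (simp add: p_def)
  have fp: "f (p x) = f x" if "x \<in> M1" for x
  proof -
    have z: "\<ominus>\<^bsub>N\<^esub> \<zero>\<^bsub>N\<^esub> = \<zero>\<^bsub>N\<^esub>" by (rule N.M.minus_equality) auto
    have "f (p x) = f x \<oplus>\<^bsub>N\<^esub> (\<ominus>\<^bsub>N\<^esub> f (r x))"
      using that rK(2) D1(2) by (simp add: p_def fadd fneg)
    then show ?thesis using rK(3)[OF that] fc D1(2)[OF that] by (simp add: z)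
  qed
  have peq: "p x = p y" if xy: "x \<in> M1" "y \<in> M1" "f x = f y" for x y
  proof -
    let ?d = "x \<oplus>\<^bsub>M\<^esub> (\<ominus>\<^bsub>M\<^esub> y)"
    have d: "?d \<in> K" using xy D1 fadd fneg fc by (simp add: K_def N.M.r_neg)
    then have "?d \<in> M1" by (simp add: K_def)
    have "x = ?d \<oplus>\<^bsub>M\<^esub> y" using xy D1(2) by (simp add: M.M.a_assoc M.M.l_neg)
    then have "p x = p ?d \<oplus>\<^bsub>M\<^esub> p y" using padd[OF \<open>?d \<in> M1\<close> xy(2)] by simp
    then show ?thesis using pK[OF d] pc[OF xy(2)] by simp
  qed
  have mM: "m u \<in> M1" if "u \<in> U" for u using M1(3) that by blast
  show ?thesis
  proof (rule that[of "\<lambda>u. p (m u)"])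
    show "additive_on V M U (\<lambda>u. p (m u))"
      unfolding additive_on_def
    proof (intro conjI ballI)
      show "(\<lambda>u. p (m u)) \<in> U \<rightarrow> carrier M" using pc mM by auto
      fix x y assume xy: "x \<in> U" "y \<in> U"
      have xyU: "x \<oplus>\<^bsub>V\<^esub> y \<in> U" using fsubD(6)[OF U xy] .
      have "f (m (x \<oplus>\<^bsub>V\<^esub> y)) = f (m x \<oplus>\<^bsub>M\<^esub> m y)"
        using m xy xyU gD(2)[OF xy] fadd by simp
      then have "p (m (x \<oplus>\<^bsub>V\<^esub> y)) = p (m x \<oplus>\<^bsub>M\<^esub> m y)"
        using peq mM xy xyU D1(4) by blast
      then show "p (m (x \<oplus>\<^bsub>V\<^esub> y)) = p (m x) \<oplus>\<^bsub>M\<^esub> p (m y)" using padd mM xy by simp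
    qed
    show "f (p (m u)) = g u" if "u \<in> U" for u using fp[OF mM[OF that]] m(2)[OF that] by simp
  qed
qed

text \<open>
  An additive lift \<open>h0\<close> on \<open>U\<close> fails to be compatible by maps \<open>e s\<close> into the kernel of \<open>f\<close>.  This
  defect is a coboundary \<open>c\<close> with values in the kernel, and \<open>h0 - c\<close> is a compatible lift, which
  extends to the module spanned by \<open>U\<close>.
\<close>

lemma span_lifting:
  assumes U: "critical U" and M: "left_module kG M" and N: "left_module kG N"
    and f: "f \<in> left_module_hom kG M N" "f ` carrier M = carrier N"
    and g: "g \<in> left_module_hom kG (V\<lparr>carrier := span U\<rparr>) N"
  shows "\<exists>h \<in> left_module_hom kG (V\<lparr>carrier := span U\<rparr>) M. \<forall>x\<in>span U. f (h x) = g x"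
proof -
  interpret M: kG_module G k n M by (rule kG_moduleI[OF M])
  interpret N: kG_module G k n N by (rule kG_moduleI[OF N])
  have fU: "fsub U" using critical_fsub[OF U] .
  note D = fsubD[OF fU]
  have UV: "U \<subseteq> carrier V" using D(4) by blast
  have f_c: "f x \<in> carrier N" if "x \<in> carrier M" for x using f that by (auto simp: left_module_hom_def)
  have f_add: "f (x \<oplus>\<^bsub>M\<^esub> y) = f x \<oplus>\<^bsub>N\<^esub> f y" if "x \<in> carrier M" "y \<in> carrier M" for x y
    using f that by (auto simp: left_module_hom_def)
  have f_act: "f (r \<bullet>\<^bsub>M\<^esub> x) = r \<bullet>\<^bsub>N\<^esub> f x" if "x \<in> carrier M" for r x
    using f that single_closed by (auto simp: left_module_hom_def)
  have fA: "additive_on M N (carrier M) f" using f_c f_add by (auto simp: additive_on_def)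
  have f_neg: "f (\<ominus>\<^bsub>M\<^esub> x) = \<ominus>\<^bsub>N\<^esub> f x" if "x \<in> carrier M" for x
    using additive_on_neg[OF M N fA _ that] M.add.subgroup_self by simp
  have f_0: "f \<zero>\<^bsub>M\<^esub> = \<zero>\<^bsub>N\<^esub>" using M.hom_zero[OF N f(1)] .
  have g_c: "g x \<in> carrier N" if "x \<in> span U" for x using g that by (auto simp: left_module_hom_def)
  have g_add: "g (x \<oplus>\<^bsub>V\<^esub> y) = g x \<oplus>\<^bsub>N\<^esub> g y" if "x \<in> span U" "y \<in> span U" for x y
    using g that by (auto simp: left_module_hom_def)
  have g_act: "g (r \<bullet>\<^bsub>V\<^esub> x) = r \<bullet>\<^bsub>N\<^esub> g x" if "x \<in> span U" for r x
    using g that single_closed by (auto simp: left_module_hom_def)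
  have gU: "additive_on V N U g" using g_c g_add span_self[OF UV] by (auto simp: additive_on_def)
  obtain h0 where h0: "additive_on V M U h0" "\<And>u. u \<in> U \<Longrightarrow> f (h0 u) = g u"
    using additive_lift[OF M N f fU gU] by blast
  note h0D = additive_onD[OF h0(1)]
  let ?K = "{x \<in> carrier M. f x = \<zero>\<^bsub>N\<^esub>}"
  let ?MK = "M\<lparr>carrier := ?K\<rparr>"
  have K: "submodule ?K kG M" using kernel_submodule[OF M N f(1)] .
  have MK: "left_module kG ?MK" using M.submodule_left_module[OF K] .
  define e where "e s u = h0 (s \<bullet>\<^bsub>V\<^esub> u) \<oplus>\<^bsub>M\<^esub> (\<ominus>\<^bsub>M\<^esub> (s \<bullet>\<^bsub>M\<^esub> h0 u))" for s u
  have e: "additive_on V ?MK (shift_dom U s) (e s)" for s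
    unfolding additive_on_def
  proof (intro conjI ballI)
    have dU: "u \<in> U" "s \<bullet>\<^bsub>V\<^esub> u \<in> U" "u \<in> carrier V" if "u \<in> shift_dom U s" for u
      using that D(4) by (auto simp: shift_dom_def)
    have "e s u \<in> ?K" if u: "u \<in> shift_dom U s" for u
    proof -
      note c = h0D(1)[OF dU(1)[OF u]] h0D(1)[OF dU(2)[OF u]]
      have "f (e s u) = g (s \<bullet>\<^bsub>V\<^esub> u) \<oplus>\<^bsub>N\<^esub> (\<ominus>\<^bsub>N\<^esub> (s \<bullet>\<^bsub>N\<^esub> g u))"
        using c h0(2)[OF dU(1)[OF u]] h0(2)[OF dU(2)[OF u]] by (simp add: e_def f_add f_neg f_act)
      also have "\<dots> = \<zero>\<^bsub>N\<^esub>"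
        using g_act[OF span_self[OF UV dU(1)[OF u]]] g_c[OF span_self[OF UV dU(1)[OF u]]] by (simp add: N.M.r_neg)
      finally show ?thesis using c by (simp add: e_def)
    qed
    then show "e s \<in> shift_dom U s \<rightarrow> carrier ?MK" by auto
    fix x y assume xy: "x \<in> shift_dom U s" "y \<in> shift_dom U s"
    show "e s (x \<oplus>\<^bsub>V\<^esub> y) = e s x \<oplus>\<^bsub>?MK\<^esub> e s y"
      using h0D dU[OF xy(1)] dU[OF xy(2)]
      by (simp add: e_def V.gact_add M.gact_add M.M.minus_add M.M.a_ac)
  qed
  obtain c where c: "additive_on V ?MK U c"
    "\<And>s u. s \<in> S \<Longrightarrow> u \<in> shift_dom U s \<Longrightarrow> c (s \<bullet>\<^bsub>V\<^esub> u) = e s u \<oplus>\<^bsub>?MK\<^esub> s \<bullet>\<^bsub>?MK\<^esub> c u"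
    using cocycle_is_coboundary[OF MK fU e] by blast
  have cK: "c u \<in> carrier M" "f (c u) = \<zero>\<^bsub>N\<^esub>" if "u \<in> U" for u
    using additive_onD(1)[OF c(1) that] by auto
  have c_add: "c (x \<oplus>\<^bsub>V\<^esub> y) = c x \<oplus>\<^bsub>M\<^esub> c y" if "x \<in> U" "y \<in> U" for x y
    using additive_onD(2)[OF c(1) that] by simp
  define h where "h u = h0 u \<oplus>\<^bsub>M\<^esub> (\<ominus>\<^bsub>M\<^esub> c u)" for u
  have zN: "\<ominus>\<^bsub>N\<^esub> \<zero>\<^bsub>N\<^esub> = \<zero>\<^bsub>N\<^esub>" by (rule N.M.minus_equality) auto
  have h_c: "h u \<in> carrier M" "f (h u) = g u" if "u \<in> U" for u
    using h0D(1)[OF that] cK[OF that] h0(2)[OF that] g_c[OF span_self[OF UV that]]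
    by (simp_all add: h_def f_add f_neg zN)
  have "compat M U h"
    unfolding compat_def
  proof (intro conjI ballI)
    have "h (x \<oplus>\<^bsub>V\<^esub> y) = h x \<oplus>\<^bsub>M\<^esub> h y" if "x \<in> U" "y \<in> U" for x y
      using h0D(1)[OF that(1)] h0D(1)[OF that(2)] cK(1)[OF that(1)] cK(1)[OF that(2)] h0D(2)[OF that] c_add[OF that]
      by (simp add: h_def M.M.minus_add M.M.a_ac)
    then show "additive_on V M U h" using h_c by (auto simp: additive_on_def)
    fix s u assume s: "s \<in> S" and u: "u \<in> shift_dom U s"
    have uU: "u \<in> U" "s \<bullet>\<^bsub>V\<^esub> u \<in> U" using u by (auto simp: shift_dom_def)
    note cc = h0D(1)[OF uU(1)] h0D(1)[OF uU(2)] cK(1)[OF uU(1)]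
    have "c (s \<bullet>\<^bsub>V\<^esub> u) = h0 (s \<bullet>\<^bsub>V\<^esub> u) \<oplus>\<^bsub>M\<^esub> (\<ominus>\<^bsub>M\<^esub> (s \<bullet>\<^bsub>M\<^esub> h0 u)) \<oplus>\<^bsub>M\<^esub> s \<bullet>\<^bsub>M\<^esub> c u"
      using c(2)[OF s u] by (simp add: e_def)
    then show "h (s \<bullet>\<^bsub>V\<^esub> u) = s \<bullet>\<^bsub>M\<^esub> h u"
      using cc by (simp add: h_def M.M.minus_add M.gact_add M.gact_neg M.M.a_ac M.M.r_neg2 M.M.r_neg1 M.M.r_neg M.M.swap_cancel)
  qed
  then obtain F where F: "additive_on V M (span U) F"
    "\<And>r x. r \<in> carrier G \<Longrightarrow> x \<in> span U \<Longrightarrow> F (r \<bullet>\<^bsub>V\<^esub> x) = r \<bullet>\<^bsub>M\<^esub> F x" "\<And>u. u \<in> U \<Longrightarrow> F u = h u"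
    using compatible_map_extends[OF M U] by blast
  note FD = additive_onD[OF F(1)]
  have "F \<in> left_module_hom kG (V\<lparr>carrier := span U\<rparr>) M"
  proof (rule left_module_homI[OF V.submodule_left_module[OF span_submodule[OF UV]] M])
    show "additive_on (V\<lparr>carrier := span U\<rparr>) M (carrier (V\<lparr>carrier := span U\<rparr>)) F"
      using F(1) by (simp add: additive_on_def)
  qed (use F(2) in simp)
  moreover have "f (F x) = g x" if "x \<in> span U" for x
    using that
  proof (induction rule: span.induct)
    case zero
    have "F \<zero>\<^bsub>V\<^esub> = \<zero>\<^bsub>M\<^esub>"
      using additive_on_zero[OF left_module_V M F(1) submodule.axioms(1)[OF span_submodule[OF UV]]] .
    moreover have "g \<zero>\<^bsub>V\<^esub> = \<zero>\<^bsub>N\<^esub>"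
    proof -
      have "additive_on V N (span U) g" using g_c g_add by (auto simp: additive_on_def)
      then show ?thesis
        using additive_on_zero[OF left_module_V N _ submodule.axioms(1)[OF span_submodule[OF UV]]] by blast
    qed
    ultimately show ?case using f_0 by simp
  next
    case (add x r u)
    have ru: "r \<bullet>\<^bsub>V\<^esub> u \<in> span U" "u \<in> span U" using span_incl[OF UV] span_self[OF UV] add.hyps by auto
    have "f (F (r \<bullet>\<^bsub>V\<^esub> u)) = g (r \<bullet>\<^bsub>V\<^esub> u)"
      using F(2)[OF add.hyps(2) ru(2)] F(3)[OF add.hyps(3)] h_c[OF add.hyps(3)] g_act[OF ru(2)] f_act by simp
    then show ?case
      using FD(2)[OF ru(1) add.hyps(1)] FD(1)[OF ru(1)] FD(1)[OF add.hyps(1)] g_add[OF ru(1) add.hyps(1)] add.IH f_add by simp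
  qed
  ultimately show ?thesis by blast
qed

theorem span_projective:
  assumes U: "critical U"
  shows "projective_left_module kG (V\<lparr>carrier := span U\<rparr>)"
proof -
  have "U \<subseteq> carrier V" using fsubD(4)[OF critical_fsub[OF U]] by blast
  then have "left_module kG (V\<lparr>carrier := span U\<rparr>)" by (intro V.submodule_left_module span_submodule)
  then show ?thesis
    unfolding projective_left_module_def
    by (intro conjI allI impI) (simp, elim conjE, simp add: span_lifting[OF U])
qed

lemma span_mono:
  assumes "U \<subseteq> U'" shows "span U \<subseteq> span U'"
proof
  fix x assume "x \<in> span U"
  then show "x \<in> span U'" by (induction rule: span.induct) (use assms in \<open>auto intro: span.intros\<close>)
qed

theorem completed_module_direct_union:
  "direct_union_of_submodules kG V {span U |U. critical U}"
  unfolding direct_union_of_submodules_def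
proof (intro conjI ballI)
  have UV: "U \<subseteq> carrier V" if "critical U" for U using fsubD(4)[OF critical_fsub[OF that]] by blast
  show "submodule W kG V" if "W \<in> {span U |U. critical U}" for W
    using that span_submodule UV by blast
  show "{span U |U. critical U} \<noteq> {}" using critical_exists[of "{}"] by auto
  fix W W' assume "W \<in> {span U |U. critical U}" "W' \<in> {span U |U. critical U}"
  then obtain U U' where U: "critical U" "W = span U" "critical U'" "W' = span U'" by blast
  note D = fsubD[OF critical_fsub[OF U(1)]] and D' = fsubD[OF critical_fsub[OF U(3)]]
  obtain U2 where "critical U2" "U \<union> U' \<subseteq> U2" using critical_exists[of "U \<union> U'"] D(2,3) D'(2,3) by blast
  then show "\<exists>K\<in>{span U |U. critical U}. W \<subseteq> K \<and> W' \<subseteq> K" using span_mono U by (metis (mono_tags, lifting) Un_subset_iff mem_Collect_eq)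
next
  show "carrier V = \<Union> {span U |U. critical U}"
  proof (intro equalityI subsetI)
    fix v assume v: "v \<in> carrier V"
    obtain T where T: "left_transversal T" by (rule left_transversal_exists)
    obtain x where x: "\<And>t. t \<in> T \<Longrightarrow> x t \<in> VH" "v = (\<Oplus>\<^bsub>V\<^esub>t\<in>T. t \<bullet>\<^bsub>V\<^esub> x t)"
      using coset_decomposition[OF T v] by blast
    have finT: "finite T" "T \<subseteq> carrier G" using T by (auto simp: left_transversal_def)
    obtain U where U: "critical U" "x ` T \<subseteq> U" using critical_exists[of "x ` T"] finT x(1) by blast
    have UV: "U \<subseteq> carrier V" using fsubD(4)[OF critical_fsub[OF U(1)]] by blast
    have "v \<in> span U"
      unfolding x(2) using span_incl[OF UV] U(2) finT
      by (intro V.asub_finsum[OF submodule.axioms(1)[OF span_submodule[OF UV]]]) auto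
    then show "v \<in> \<Union> {span U |U. critical U}" using U(1) by blast
  next
    fix v assume "v \<in> \<Union> {span U |U. critical U}"
    then obtain U where U: "critical U" "v \<in> span U" by blast
    have "U \<subseteq> carrier V" using fsubD(4)[OF critical_fsub[OF U(1)]] by blast
    then show "v \<in> carrier V" using span_V U(2) by blast
  qed
qed

end

section \<open>Coefficients modulo a squarefree number\<close>

lemma squarefree_prod_primes:
  assumes "finite P" "\<forall>p\<in>P. Factorial_Ring.prime (p::nat)"
  shows "squarefree (\<Prod>P)"
  using assms
  by (intro squarefree_prod_coprime) (auto intro: primes_coprime squarefree_prime)

lemma ZFact_multiple:
  fixes n m :: nat
  shows "[m] \<cdot>\<^bsub>ZFact (int n)\<^esub> \<one>\<^bsub>ZFact (int n)\<^esub> = Idl\<^bsub>\<Z>\<^esub> {int n} +>\<^bsub>\<Z>\<^esub> int m"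
proof -
  interpret I: ideal "Idl\<^bsub>\<Z>\<^esub> {int n}" \<Z> by (rule int.genideal_ideal) simp
  interpret Z: cring "ZFact (int n)" by (rule ZFact_is_cring)
  show ?thesis
  proof (induction m)
    case 0
    have "[(0::nat)] \<cdot>\<^bsub>ZFact (int n)\<^esub> \<one>\<^bsub>ZFact (int n)\<^esub> = \<zero>\<^bsub>ZFact (int n)\<^esub>" by simp
    also have "\<dots> = Idl\<^bsub>\<Z>\<^esub> {int n}" by (simp add: ZFact_def FactRing_def)
    finally show ?case using I.a_rcos_const[OF I.zero_closed] by simp
  next
    case (Suc m)
    have "[Suc m] \<cdot>\<^bsub>ZFact (int n)\<^esub> \<one>\<^bsub>ZFact (int n)\<^esub> = [m] \<cdot>\<^bsub>ZFact (int n)\<^esub> \<one>\<^bsub>ZFact (int n)\<^esub> \<oplus>\<^bsub>ZFact (int n)\<^esub> \<one>\<^bsub>ZFact (int n)\<^esub>"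
      by simp
    also have "\<dots> = (Idl\<^bsub>\<Z>\<^esub> {int n} +>\<^bsub>\<Z>\<^esub> int m) <+>\<^bsub>\<Z>\<^esub> (Idl\<^bsub>\<Z>\<^esub> {int n} +>\<^bsub>\<Z>\<^esub> 1)"
      unfolding Suc by (simp add: ZFact_def FactRing_def)
    also have "\<dots> = Idl\<^bsub>\<Z>\<^esub> {int n} +>\<^bsub>\<Z>\<^esub> (int m + 1)"
      using I.a_rcos_sum[of "int m" 1] by simp
    finally show ?case by (simp add: add.commute)
  qed
qed

lemma ZFact_cyclic_group_algebra:
  assumes G: "group G" and n: "squarefree n"
  shows "cyclic_group_algebra G (ZFact (int n)) n"
proof -
  interpret I: ideal "Idl\<^bsub>\<Z>\<^esub> {int n}" \<Z> by (rule int.genideal_ideal) simp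
  have n0: "n > 0" using n by (auto intro: Nat.gr0I)
  have I: "Idl\<^bsub>\<Z>\<^esub> {int n} = {x * int n |x. True}" using int_Idl by simp
  have "[n] \<cdot>\<^bsub>ZFact (int n)\<^esub> \<one>\<^bsub>ZFact (int n)\<^esub> = \<zero>\<^bsub>ZFact (int n)\<^esub>"
  proof -
    have "int n \<in> Idl\<^bsub>\<Z>\<^esub> {int n}" unfolding I by (auto intro: exI[of _ 1])
    then have "Idl\<^bsub>\<Z>\<^esub> {int n} +>\<^bsub>\<Z>\<^esub> int n = Idl\<^bsub>\<Z>\<^esub> {int n}" by (rule I.a_rcos_const)
    then show ?thesis unfolding ZFact_multiple by (simp add: ZFact_def FactRing_def)
  qed
  moreover have "\<exists>m::nat. c = [m] \<cdot>\<^bsub>ZFact (int n)\<^esub> \<one>\<^bsub>ZFact (int n)\<^esub>" if "c \<in> carrier (ZFact (int n))" for c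
  proof -
    obtain a where a: "c = Idl\<^bsub>\<Z>\<^esub> {int n} +>\<^bsub>\<Z>\<^esub> a"
    proof -
      have "c \<in> a_rcosets\<^bsub>\<Z>\<^esub> (Idl\<^bsub>\<Z>\<^esub> {int n})" using \<open>c \<in> carrier (ZFact (int n))\<close> by (simp add: ZFact_def FactRing_def)
      then show ?thesis using that unfolding A_RCOSETS_def RCOSETS_def a_r_coset_def by blast
    qed
    have "a mod int n \<in> Idl\<^bsub>\<Z>\<^esub> {int n} +>\<^bsub>\<Z>\<^esub> a"
    proof -
      have "- (a div int n) * int n \<in> Idl\<^bsub>\<Z>\<^esub> {int n}" unfolding I by blast
      then have "- (a div int n) * int n \<oplus>\<^bsub>\<Z>\<^esub> a \<in> Idl\<^bsub>\<Z>\<^esub> {int n} +>\<^bsub>\<Z>\<^esub> a"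
        unfolding a_r_coset_def' by blast
      moreover have "- (a div int n) * int n \<oplus>\<^bsub>\<Z>\<^esub> a = a mod int n"
        by (simp add: minus_div_mult_eq_mod[symmetric])
      ultimately show ?thesis by simp
    qed
    then have "c = Idl\<^bsub>\<Z>\<^esub> {int n} +>\<^bsub>\<Z>\<^esub> (a mod int n)"
      unfolding a using I.a_subgroup by (intro int.a_repr_independence) auto
    moreover have "a mod int n = int (nat (a mod int n))" using n0 by simp
    ultimately show ?thesis using ZFact_multiple[of n "nat (a mod int n)"] by metis
  qed
  ultimately show ?thesis
    using G n by (intro cyclic_group_algebra.intro cyclic_group_algebra_axioms.intro group_algebra.intro ZFact_is_cring)
qed

theorem corollary5p7:
  fixes G :: "('g, 'b) monoid_scheme" and P :: "nat set" and n :: nat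
    and k :: "int set ring" and kG :: "('g \<Rightarrow> int set) ring"
  assumes "group G" and "finitely_generated_group G" and "virtually_free_group G"
    and "finite P" and "\<forall>p\<in>P. Factorial_Ring.prime p" and "n = \<Prod>P"
    and "k = ZFact (int n)" and "kG = group_ring k G"
  shows "\<exists>(U :: ('g \<Rightarrow> int set, 'g set \<Rightarrow> 'g set \<Rightarrow> int set) module) \<F>.
    left_module kG U \<and>
    direct_union_of_submodules kG U \<F> \<and>
    (\<forall>H\<in>\<F>. projective_left_module kG (U\<lparr>carrier := H\<rparr>)) \<and>
    left_module_isomorphic kG (completed_group_module k G) U"
proof -
  obtain H S where HS: "subgroup H G" "finite (rcosets\<^bsub>G\<^esub> H)" "free_group_on (G\<lparr>carrier := H\<rparr>) S"
    using assms(3) by (auto simp: virtually_free_group_def)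
  have "squarefree n" using squarefree_prod_primes assms(4-6) by simp
  then have "cyclic_group_algebra G k n" using ZFact_cyclic_group_algebra assms(1,7) by simp
  then interpret finite_index_free G k n H S
    using HS by (intro finite_index_free.intro finite_index_free_axioms.intro)
  have "(\<lambda>x. x) \<in> left_module_hom kG (completed_group_module k G) (completed_group_module k G)"
    by (auto simp: left_module_hom_def)
  moreover have "bij_betw (\<lambda>x. x) (carrier (completed_group_module k G)) (carrier (completed_group_module k G))"
    by (simp add: bij_betw_def)
  ultimately have "left_module_isomorphic kG (completed_group_module k G) (completed_group_module k G)"
    unfolding left_module_isomorphic_def by blast
  then show ?thesis
    unfolding assms(8)
    using left_module_V completed_module_direct_union span_projective by blast
qed

end
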